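(* Let $V$ be a $\mathcal{T}$-vertex algebra, let $A$ be an abelian group, and let $\{M_i\}_{i\in A}$ be a set of $V$-modules in $\mathcal{T}$ such that $M_0=V$. Given a one-dimensional $\mathcal{T}$-commutativity datum $\{\mathcal{I}_{i,j}^{i+j}\}_{i,j\in A}$ attached to $V$ and $\{M_i\}_{i\in A}$, and any normalized choice of nonzero elements $\{m^{i,j}_z\in\mathcal{I}_{i,j}^{i+j}\}_{i,j\in A}$ with associated pair $(F,\Omega)$, the following hold: (1) The rescaling action of the group $C^2_{ab}(A,\mathbb{C}^\times)$ on $\bigoplus\mathcal{I}_{i,j}^{i+j}$, in which $\lambda$ sends $\{m^{i,j}_z\}$ to $\{\lambda_{i,j}m^{i,j}_z\}$, induces the translation action $(\{\lambda_{i,j}\},(F,\Omega))\mapsto d\lambda\cdot(F,\Omega)$ on the group of abelian 3-cocycles by coboundaries. This action is transitive on representatives of any fixed cohomology class in $H^3_{ab}(A,\mathbb{C}^\times)$, with stabilizer given by the group of abelian 2-cocycles $\{\lambda_{i,j}\}$. (2) The function $A\to\{\pm1\}$ defined by $i\mapsto\Omega(i,i)$ is a quadratic form invariant under rescaling ($\lambda$-twist) by 2-cochains. In particular, the abelian cohomology class of $(F,\Omega)$ is canonically attached to the commutativity datum. (3) If $\{M_i\}$ is $\mathcal{T}$-compatible, then the quadratic form $i\mapsto\Omega(i,i)$ is identically one if and only if there exists a normalized 2-cochain $\lambda$ such that $\{\lambda_{i,j}m^{i,j}_z\}$ describe an $A$-graded $\mathcal{T}$-vertex algebra structure on $\bigoplus_{i\in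 A}M_i$. (4) The $A$-graded $\mathcal{T}$-vertex algebra structure on $\bigoplus_{i\in A}M_i$ (with multiplication given by nonzero elements of the spaces $\mathcal{I}_{i,j}^{i+j}$) is unique up to isomorphism if it exists.
   Context: Power series. All vector spaces are over $\mathbb{C}$; all series have integer exponents. $M((z))((w))$ means Laurent series in $w$ with coefficients in $M((z))$. The space $M[[z,w]][z^{-1},w^{-1},(z-w)^{-1}]$ consists of series landing in $M[[z,w]]$ after multiplication by a power of $zw(z-w)$; it embeds in $M((z))((w))$, $M((w))((z))$, $M((w))((z-w))$ by the binomial expansions $(z-w)^n=z^n(1-w/z)^n$, $(z-w)^n=(-1)^nw^n(1-z/w)^n$, $z^n=w^n(1+\frac{z-w}{w})^n$ respectively. Maps into the larger spaces are compared by factoring them through this common subspace. Vertex algebras. A vertex algebra is $(V,\mathbf 1,L(-1),m_z)$ with $\mathbf 1\in V$, $L(-1)\in\mathrm{End}(V)$, $m_z:V\otimes V\to V((z))$ linear, such that $m_z(\mathbf 1\otimes v)=v$, $m_z(v\otimes\mathbf 1)\in v+zV[[z]]$, $L(-1)m_z(u\otimes v)-m_z(u\otimes L(-1)v)=\frac{d}{dz}m_z(u\otimes v)$, and $m_z(u\otimes m_w(v\otimes x))$, $m_w(v\otimes m_z(u\otimes x))$ are expansions of the same element of $V[[z,w]][z^{-1},w^{-1},(z-w)^{-1}]$. It is weighted if equipped with $L(0)$ acting semisimply with integer eigenvalues ($V=\bigoplus_n V_n$), $[L(-1),L(0)]=-L(-1)$, and $L(0)m_z(u\otimes v)-m_z(u\otimes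 L(0)v)=m_z(L(0)u\otimes v)+zm_z(L(-1)u\otimes v)$. It is Möbius (resp. quasi-conformal) if weighted with an operator $L(1)$ (resp. operators $L(i)$, $i\ge-1$) satisfying $[L(i),L(j)]=(i-j)L(i+j)$, $L(i)m_z(u\otimes v)-m_z(u\otimes L(i)v)=\sum_{j=0}^{i+1}\binom{i+1}{j}z^jm_z(L(i-j)u\otimes v)$, and such that the span of the $L(i)$ with $i\ge1$ acts locally nilpotently. It is conformal of central charge $c$ if weighted with $\omega\in V_2$ such that $m_z(\omega\otimes v)=\sum_nL(n)vz^{-n-2}$ gives operators satisfying the Virasoro relations of central charge $c$. A vertex operator algebra (VOA) is a conformal vertex algebra with $L(0)$-eigenvalues bounded below and finite dimensional $L(0)$-eigenspaces. Modules. A $V$-module is a vector space $M$ with $act_z:V\otimes M\to M((z))$ and an operator $L(-1)^M$ such that $act_z(\mathbf 1\otimes x)=x$, $L(-1)^Mact_z(u\otimes x)-act_z(u\otimes L(-1)^Mx)=act_z(L(-1)u\otimes x)$, and $act_w(m_{z-w}(u\otimes v)\otimes x)\in M((w))((z-w))$, $act_z(u\otimes act_w(v\otimes x))\in M((z))((w))$ are expansions of the same element of $M[[z,w]][z^{-1},w^{-1},(z-w)^{-1}]$. If $V$ is weighted (resp. Möbius, quasi-conformal), an integral-weight module also carries the corresponding operators $L(i)^M$, with $L(0)^M$ semisimple with integer eigenvalues, $[L(i)^M,L(j)^M]=(i-j)L(i+j)^M$, $L(i)^Mact_z(u\otimes x)-act_z(u\otimes L(i)^Mx)=\sum_{j=0}^{i+1}\binom{i+1}{j}z^jact_z(L(i-j)u\otimes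 x)$, and the span of the $L(i)^M$, $i\ge1$, acting locally nilpotently. If $V$ is conformal one also requires that the coefficients of $act_z(\omega\otimes\cdot)$ give a Virasoro representation of central charge $c$; if $V$ is a VOA, also that $L(0)^M$ has spectrum bounded below and finite dimensional eigenspaces. Intertwining operators. An integral-weight intertwining operator of type $\binom{M_3}{M_1M_2}$ is a linear map $I_z:M_1\otimes M_2\to M_3((z))$ with $\frac{d}{dz}I_z(u\otimes v)=I_z(L(-1)u\otimes v)=L(-1)I_z(u\otimes v)-I_z(u\otimes L(-1)v)$, and such that $act_z(a\otimes I_w(u\otimes v))$, $I_w(act_{z-w}(a\otimes u)\otimes v)$, $I_w(u\otimes act_z(a\otimes v))$ are expansions (in $M_3((z))((w))$, $M_3((w))((z-w))$, $M_3((w))((z))$) of the same element of $M_3[[z,w]][z^{-1},w^{-1},(z-w)^{-1}]$ for $a\in V$. In the presence of operators $L(i)$ one also requires $L(i)I_z(u\otimes v)-I_z(u\otimes L(i)v)=\sum_{j=0}^{i+1}\binom{i+1}{j}z^jI_z(L(i-j)u\otimes v)$. Its skew $I^*_z:M_2\otimes M_1\to M_3((z))$ is $I^*_z(v\otimes u)=e^{zL(-1)}I_{-z}(u\otimes v)$, again an intertwining operator. Types. $\mathcal{T}$ denotes one of the following settings: (a) unrestricted: $\mathcal{T}$-vertex algebras are vertex algebras, with modules, module maps and integral-weight intertwining operators; (b) weighted, Möbius, quasi-conformal or conformal vertex algebras, with integral-weight modules of the corresponding kind and with module maps and intertwining operators compatible with all defined $L(i)$; (c) VOAs, with integral-weight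 VOA modules; (d) strictly $G$-equivariant versions of these for a group $G$ acting on $V$ by automorphisms and on modules by operators commuting with all $L(i)$ and satisfying $act_z(gv\otimes gu)=g\,act_z(v\otimes u)$, with equivariant module maps and intertwining operators ($I_z(gu\otimes gv)=gI_z(u\otimes v)$). $I_{\mathcal{T}}\binom{M_3}{M_1,M_2}$ is the space of $\mathcal{T}$-intertwining operators. A set of modules in $\mathcal{T}$ is $\mathcal{T}$-compatible if its direct sum is a module in $\mathcal{T}$. Data. A one-dimensional $\mathcal{T}$-associativity datum for $\{M_i\}_{i\in A}$ ($M_0=V$) is a set of one-dimensional subspaces $\mathcal{I}_{i,j}^{i+j}\subset I_{\mathcal{T}}\binom{M_{i+j}}{M_i,M_j}$ such that: (i) for all $i,j,k$ there is a one-dimensional space $\mathcal{I}_{i,j,k}^{i+j+k}$ of maps $M_i\otimes M_j\otimes M_k\to M_{i+j+k}[[z,w]][z^{-1},w^{-1},(z-w)^{-1}]$ such that the compositions $m^{i,j+k}_z\circ(1\otimes m^{j,k}_w)$ (into $M_{i+j+k}((z))((w))$) and $m^{i+j,k}_w\circ(m^{i,j}_{z-w}\otimes1)$ (into $M_{i+j+k}((w))((z-w))$) factor through the embeddings and induce isomorphisms $\mathcal{I}_{i,j+k}^{i+j+k}\otimes\mathcal{I}_{j,k}^{j+k}\cong\mathcal{I}_{i,j,k}^{i+j+k}$ and $\mathcal{I}_{i+j,k}^{i+j+k}\otimes\mathcal{I}_{i,j}^{i+j}\cong\mathcal{I}_{i,j,k}^{i+j+k}$; (ii) for all $i,j,k,\ell$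 there is a one-dimensional space $\mathcal{I}_{i,j,k,\ell}^{i+j+k+\ell}$ of maps $M_i\otimes M_j\otimes M_k\otimes M_\ell\to M_{i+j+k+\ell}[[z,w,t]][z^{-1},w^{-1},t^{-1},(z-w)^{-1},(z-t)^{-1},(w-t)^{-1}]$ such that composition $m_z\circ(1\otimes m_w)\circ(1\otimes1\otimes m_t)$ (into $M_{i+j+k+\ell}((z))((w))((t))$, with the analogous binomial expansions) induces an isomorphism $\mathcal{I}_{i,j+k+\ell}^{i+j+k+\ell}\otimes\mathcal{I}_{j,k+\ell}^{j+k+\ell}\otimes\mathcal{I}_{k,\ell}^{k+\ell}\cong\mathcal{I}_{i,j,k,\ell}^{i+j+k+\ell}$; (iii) $\mathcal{I}_{0,i}^i$ is spanned by the module structure map $act_z$ of $M_i$, and $\mathcal{I}_{i,0}^i$ by $act^*_z$. It is a commutativity datum if moreover for every nonzero $m^{i,j}_z\in\mathcal{I}_{i,j}^{i+j}$ one has $m^{i,j,*}_z\in\mathcal{I}_{j,i}^{j+i}$. For a choice of nonzero $m^{i,j}_z\in\mathcal{I}_{i,j}^{i+j}$, define $F:A^3\to\mathbb{C}^\times$ and $\Omega:A^2\to\mathbb{C}^\times$ by $m^{i,j+k}_z\circ(1\otimes m^{j,k}_w)=F(i,j,k)\,m^{i+j,k}_w\circ(m^{i,j}_{z-w}\otimes1)$ (as maps to the common subspace) and $m^{i,j}_z(u\otimes v)=\Omega(i,j)e^{zL(-1)}m^{j,i}_{-z}(v\otimes u)$. The choice is normalized if $m^{0,i}_z=act_z$ and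 $m^{i,0}_z=act^*_z$ for all $i$. Abelian cohomology. An abelian 2-cochain is a function $\lambda:A\times A\to\mathbb{C}^\times$; these form $C^2_{ab}(A,\mathbb{C}^\times)$. Its differential is $d\lambda=\left(\frac{\lambda(j,k)\lambda(i,j+k)}{\lambda(i+j,k)\lambda(i,j)},\frac{\lambda(\ell,m)}{\lambda(m,\ell)}\right)$; $\lambda$ is an abelian 2-cocycle if $d\lambda=1$, and normalized if $\lambda(0,i)=\lambda(i,0)=1$. An abelian 3-cocycle is a pair $(F,\Omega)$ of functions $A^3\to\mathbb{C}^\times$, $A^2\to\mathbb{C}^\times$ with $F(i,j,k)F(i,j+k,\ell)F(j,k,\ell)=F(i+j,k,\ell)F(i,j,k+\ell)$, $F(i,j,k)^{-1}\Omega(i,j+k)F(j,k,i)^{-1}=\Omega(i,j)F(j,i,k)^{-1}\Omega(i,k)$, $F(i,j,k)\Omega(i+j,k)F(k,i,j)=\Omega(j,k)F(i,k,j)\Omega(i,k)$. $H^3_{ab}(A,\mathbb{C}^\times)$ is the group of abelian 3-cocycles modulo the $d\lambda$. A quadratic form is $Q:A\to\mathbb{C}^\times$ with $Q(i)=Q(-i)$ and $\frac{Q(i+j+k)Q(i)Q(j)Q(k)}{Q(i+j)Q(i+k)Q(j+k)}=1$. *)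

theory Defs
  imports Complex_Main "HOL-Library.Poly_Mapping" "HOL-Library.Function_Algebras"
    "HOL-Algebra.Group_Action"
begin

class complex_vector = ab_group_add +
  fixes scaleC :: "complex \<Rightarrow> 'a \<Rightarrow> 'a" (infixr "*\<^sub>C" 75)
  assumes scaleC_add_right: "a *\<^sub>C (x + y) = a *\<^sub>C x + a *\<^sub>C y"
    and scaleC_add_left: "(a + b) *\<^sub>C x = a *\<^sub>C x + b *\<^sub>C x"
    and scaleC_scaleC: "a *\<^sub>C b *\<^sub>C x = (a * b) *\<^sub>C x"
    and scaleC_one: "1 *\<^sub>C x = x"

global_interpretation complex_vector: vector_space "scaleC :: complex \<Rightarrow> 'a \<Rightarrow> 'a::complex_vector"
  by unfold_locales (simp_all add: scaleC_add_right scaleC_add_left scaleC_scaleC scaleC_one)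

instantiation "fun" :: (type, complex_vector) complex_vector
begin
definition scaleC_fun :: "complex \<Rightarrow> ('a \<Rightarrow> 'b) \<Rightarrow> 'a \<Rightarrow> 'b" where
  "scaleC_fun c f = (\<lambda>x. c *\<^sub>C f x)"
instance
  by standard (simp_all add: scaleC_fun_def plus_fun_def fun_eq_iff
      scaleC_add_right scaleC_add_left scaleC_scaleC scaleC_one)
end

instantiation poly_mapping :: (type, complex_vector) complex_vector
begin
lift_definition scaleC_poly_mapping :: "complex \<Rightarrow> ('a \<Rightarrow>\<^sub>0 'b) \<Rightarrow> 'a \<Rightarrow>\<^sub>0 'b" is
  "\<lambda>c f x. c *\<^sub>C f x"
  by (rule finite_subset[rotated]) auto
instance
  by standard (transfer, simp add: fun_eq_iff
      scaleC_add_right scaleC_add_left scaleC_scaleC scaleC_one)+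
end

subsection \<open>Localization at an operator\<close>

text \<open>\<open>frac_rel D\<close> identifies \<open>(N, x)\<close> and \<open>(N', x')\<close> as fractions \<open>x / D^N\<close> and
  \<open>x' / D^N'\<close>.\<close>

definition frac_rel :: "('b \<Rightarrow> 'b) \<Rightarrow> nat \<times> 'b \<Rightarrow> nat \<times> 'b \<Rightarrow> bool" where
  "frac_rel D p q \<longleftrightarrow> (\<exists>k. (D ^^ (k + fst q)) (snd p) = (D ^^ (k + fst p)) (snd q))"

lemma frac_rel_equivp: "equivp (frac_rel D)"
proof (rule equivpI)
  show "reflp (frac_rel D)" by (auto simp: reflp_def frac_rel_def)
  show "symp (frac_rel D)" by (auto simp: symp_def frac_rel_def intro: sym)
  show "transp (frac_rel D)"
  proof (rule transpI)
    fix p q r :: "nat \<times> 'a"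
    assume "frac_rel D p q" "frac_rel D q r"
    then obtain k l where
      k: "(D ^^ (k + fst q)) (snd p) = (D ^^ (k + fst p)) (snd q)" and
      l: "(D ^^ (l + fst r)) (snd q) = (D ^^ (l + fst q)) (snd r)"
      unfolding frac_rel_def by blast
    have "(D ^^ ((k + l + fst q) + fst r)) (snd p) = (D ^^ (l + fst r)) ((D ^^ (k + fst q)) (snd p))"
      by (simp add: funpow_add[symmetric] add_ac flip: comp_apply[of "D ^^ _" "D ^^ _"])
    also have "\<dots> = (D ^^ (k + fst p)) ((D ^^ (l + fst r)) (snd q))"
      by (simp add: k funpow_add[symmetric] add_ac flip: comp_apply[of "D ^^ _" "D ^^ _"])
    also have "\<dots> = (D ^^ ((k + l + fst q) + fst p)) (snd r)"
      by (simp add: l funpow_add[symmetric] add_ac flip: comp_apply[of "D ^^ _" "D ^^ _"])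
    finally show "frac_rel D p r" unfolding frac_rel_def by blast
  qed
qed

lemma frac_rel_lift:
  assumes step: "\<And>N F. f (Suc N, D F) = f (N, F)" and "frac_rel D p q"
  shows "f p = f q"
proof -
  have it: "f (k + N, (D ^^ k) F) = f (N, F)" for k N F
    by (induction k) (simp_all add: step)
  obtain k where k: "(D ^^ (k + fst q)) (snd p) = (D ^^ (k + fst p)) (snd q)"
    using assms(2) unfolding frac_rel_def by blast
  have "f p = f (k + fst q + fst p, (D ^^ (k + fst q)) (snd p))" using it[of _ "fst p" "snd p"] by simp
  also have "\<dots> = f (k + fst p + fst q, (D ^^ (k + fst p)) (snd q))" by (simp add: k add_ac)
  also have "\<dots> = f q" using it[of _ "fst q" "snd q"] by simp
  finally show ?thesis .
qed

definition frac_add :: "('b \<Rightarrow> 'b) \<Rightarrow> nat \<times> 'b \<Rightarrow> nat \<times> 'b \<Rightarrow> nat \<times> 'b::plus" where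
  "frac_add D p q = (fst p + fst q, (D ^^ fst q) (snd p) + (D ^^ fst p) (snd q))"

definition frac_scale :: "complex \<Rightarrow> nat \<times> 'b \<Rightarrow> nat \<times> 'b::complex_vector" where
  "frac_scale c p = (fst p, c *\<^sub>C snd p)"

locale linear_endo =
  fixes D :: "'b::complex_vector \<Rightarrow> 'b"
  assumes D_add: "D (x + y) = D x + D y" and D_scale: "D (c *\<^sub>C x) = c *\<^sub>C D x"
begin

lemma pow_add: "(D ^^ n) (x + y) = (D ^^ n) x + (D ^^ n) y"
  by (induction n) (simp_all add: D_add)

lemma pow_scale: "(D ^^ n) (c *\<^sub>C x) = c *\<^sub>C (D ^^ n) x"
  by (induction n) (simp_all add: D_scale)

lemma pow_zero: "(D ^^ n) 0 = 0"
  using pow_add[of n 0 0] by simp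

lemma pow_pow: "(D ^^ m) ((D ^^ n) x) = (D ^^ (m + n)) x"
  by (simp add: funpow_add)

lemma frac_add_resp:
  assumes "frac_rel D p p'" "frac_rel D q q'"
  shows "frac_rel D (frac_add D p q) (frac_add D p' q')"
proof -
  obtain k l where
    k: "(D ^^ (k + fst p')) (snd p) = (D ^^ (k + fst p)) (snd p')" and
    l: "(D ^^ (l + fst q')) (snd q) = (D ^^ (l + fst q)) (snd q')"
    using assms unfolding frac_rel_def by blast
  have "(D ^^ (l + fst q + fst q')) ((D ^^ (k + fst p')) (snd p))
      = (D ^^ (l + fst q + fst q')) ((D ^^ (k + fst p)) (snd p'))" by (simp add: k)
  moreover have "(D ^^ (k + fst p + fst p')) ((D ^^ (l + fst q')) (snd q))
      = (D ^^ (k + fst p + fst p')) ((D ^^ (l + fst q)) (snd q'))" by (simp add: l)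
  ultimately show ?thesis
    unfolding frac_rel_def frac_add_def
    by (intro exI[of _ "k + l"]) (simp add: pow_add pow_pow add_ac)
qed

lemma frac_scale_resp: "frac_rel D p q \<Longrightarrow> frac_rel D (frac_scale c p) (frac_scale c q)"
  unfolding frac_rel_def frac_scale_def by (auto simp: pow_scale)

lemma frac_relI: "fst p = fst q \<Longrightarrow> snd p = snd q \<Longrightarrow> frac_rel D p q"
  by (auto simp: frac_rel_def)

lemma frac_add_assoc: "frac_rel D (frac_add D (frac_add D p q) r) (frac_add D p (frac_add D q r))"
  by (rule frac_relI) (simp_all add: frac_add_def pow_add pow_pow add_ac)

lemma frac_add_comm: "frac_rel D (frac_add D p q) (frac_add D q p)"
  by (rule frac_relI) (simp_all add: frac_add_def add_ac)

lemma frac_add_zero: "frac_rel D (frac_add D (0, 0) p) p"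
  by (rule frac_relI) (simp_all add: frac_add_def pow_zero)

lemma frac_add_inv: "frac_rel D (frac_add D (frac_scale (- 1) p) p) (0, 0)"
  by (simp add: frac_rel_def frac_add_def frac_scale_def pow_scale pow_zero
      flip: pow_add complex_vector.scale_left_distrib)

lemma frac_scale_add_right:
  "frac_rel D (frac_scale c (frac_add D p q)) (frac_add D (frac_scale c p) (frac_scale c q))"
  by (rule frac_relI) (simp_all add: frac_add_def frac_scale_def pow_scale scaleC_add_right)

lemma frac_scale_add_left:
  "frac_rel D (frac_scale (c + d) p) (frac_add D (frac_scale c p) (frac_scale d p))"
  unfolding frac_rel_def
  by (simp add: frac_add_def frac_scale_def pow_scale scaleC_add_left pow_add pow_pow add.assoc)

lemma frac_scale_scale: "frac_rel D (frac_scale c (frac_scale d p)) (frac_scale (c * d) p)"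
  by (rule frac_relI) (simp_all add: frac_scale_def scaleC_scaleC)

lemma frac_scale_one: "frac_rel D (frac_scale 1 p) p"
  by (rule frac_relI) (simp_all add: frac_scale_def scaleC_one)

end

subsection \<open>The space M[[z,w]][1/z, 1/w, 1/(z-w)]\<close>

text \<open>\<open>disc2\<close> is multiplication by \<open>zw(z - w)\<close> on \<open>M[[z,w]]\<close>, where \<open>F a b\<close> is the coefficient of
  \<open>z^a w^b\<close>; \<open>coef2\<close> extends the coefficients by \<open>0\<close> to integer exponents. The localization
  \<open>M[[z,w]][1/z, 1/w, 1/(z-w)]\<close> then consists of the fractions \<open>frac2 (N, F) = F / (zw(z - w))^N\<close>.\<close>

definition coef2 :: "(nat \<Rightarrow> nat \<Rightarrow> 'v::zero) \<Rightarrow> int \<Rightarrow> int \<Rightarrow> 'v" where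
  "coef2 F m n = (if 0 \<le> m \<and> 0 \<le> n then F (nat m) (nat n) else 0)"

definition disc2 :: "(nat \<Rightarrow> nat \<Rightarrow> 'v::complex_vector) \<Rightarrow> nat \<Rightarrow> nat \<Rightarrow> 'v" where
  "disc2 F a b = coef2 F (int a - 2) (int b - 1) - coef2 F (int a - 1) (int b - 2)"

interpretation disc2: linear_endo "disc2 :: _ \<Rightarrow> nat \<Rightarrow> nat \<Rightarrow> 'v::complex_vector"
  by unfold_locales
    (auto simp: disc2_def coef2_def fun_eq_iff scaleC_fun_def
      complex_vector.scale_right_diff_distrib)

quotient_type (overloaded) 'v locser2 = "nat \<times> (nat \<Rightarrow> nat \<Rightarrow> 'v::complex_vector)" / "frac_rel disc2"
  morphisms rep_locser2 frac2
  by (rule frac_rel_equivp)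

instantiation locser2 :: (complex_vector) complex_vector
begin
lift_definition zero_locser2 :: "'a locser2" is "(0, 0)" .
lift_definition plus_locser2 :: "'a locser2 \<Rightarrow> 'a locser2 \<Rightarrow> 'a locser2" is "frac_add disc2"
  by (rule disc2.frac_add_resp)
lift_definition scaleC_locser2 :: "complex \<Rightarrow> 'a locser2 \<Rightarrow> 'a locser2" is frac_scale
  by (rule disc2.frac_scale_resp)
definition uminus_locser2 :: "'a locser2 \<Rightarrow> 'a locser2" where "uminus_locser2 x = (- 1) *\<^sub>C x"
definition minus_locser2 :: "'a locser2 \<Rightarrow> 'a locser2 \<Rightarrow> 'a locser2" where "minus_locser2 x y = x + - y"
instance
proof
  fix x y z :: "'a locser2" and c d :: complex
  show "x + y + z = x + (y + z)" by transfer (rule disc2.frac_add_assoc)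
  show "x + y = y + x" by transfer (rule disc2.frac_add_comm)
  show "0 + x = x" by transfer (rule disc2.frac_add_zero)
  show "- x + x = 0" unfolding uminus_locser2_def by transfer (rule disc2.frac_add_inv)
  show "x - y = x + - y" by (rule minus_locser2_def)
  show "c *\<^sub>C (x + y) = c *\<^sub>C x + c *\<^sub>C y" by transfer (rule disc2.frac_scale_add_right)
  show "(c + d) *\<^sub>C x = c *\<^sub>C x + d *\<^sub>C x" by transfer (rule disc2.frac_scale_add_left)
  show "c *\<^sub>C d *\<^sub>C x = (c * d) *\<^sub>C x" by transfer (rule disc2.frac_scale_scale)
  show "1 *\<^sub>C x = x" by transfer (rule disc2.frac_scale_one)
qed
end

definition locser2_on :: "'v::complex_vector set \<Rightarrow> 'v locser2 set" where
  "locser2_on S = {frac2 (N, F) | N F. \<forall>a b. F a b \<in> S}"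

text \<open>Multiplication by \<open>(x - y)^e = x^e (1 - y/x)^e\<close>, expanded in nonnegative powers of \<open>y\<close>, of a
  series in which \<open>y\<close> has no negative exponents; \<open>f m n\<close> is the coefficient of \<open>x^m y^n\<close>.\<close>

definition bin_mult :: "int \<Rightarrow> (int \<Rightarrow> int \<Rightarrow> 'v::complex_vector) \<Rightarrow> int \<Rightarrow> int \<Rightarrow> 'v" where
  "bin_mult e f m n = (\<Sum>k\<le>nat n. ((- 1) ^ k * (of_int e gchoose k)) *\<^sub>C f (m - e + int k) (n - int k))"

lemma coef2_disc2: "coef2 (disc2 F) m n = coef2 F (m - 2) (n - 1) - coef2 F (m - 1) (n - 2)"
  by (auto simp: coef2_def disc2_def)

lemma bin_mult_step:
  fixes f :: "int \<Rightarrow> int \<Rightarrow> 'v::complex_vector"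
  assumes "\<And>m n. n < 0 \<Longrightarrow> f m n = 0"
  shows "bin_mult e (\<lambda>m n. f (m - 1) n - f m (n - 1)) m n = bin_mult (e + 1) f m n"
proof (cases "n < 0")
  case True
  then show ?thesis by (simp add: bin_mult_def assms)
next
  case False
  define K where "K = nat n"
  let ?b = "\<lambda>e k. (- 1) ^ k * ((of_int e :: complex) gchoose k)"
  have n: "n = int K" using False by (simp add: K_def)
  have b: "?b e (Suc k) - ?b e k = ?b (e + 1) (Suc k)" for k
    using gbinomial_Suc_Suc[of "of_int e :: complex" k] by (simp add: algebra_simps)
  have "bin_mult e (\<lambda>m n. f (m - 1) n - f m (n - 1)) m n
      = (\<Sum>k\<le>K. ?b e k *\<^sub>C f (m - (e + 1) + int k) (n - int k))
       - (\<Sum>k\<le>K. ?b e k *\<^sub>C f (m - e + int k) (n - int k - 1))"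
    by (simp add: bin_mult_def n complex_vector.scale_right_diff_distrib sum_subtractf algebra_simps)
  also have "(\<Sum>k\<le>K. ?b e k *\<^sub>C f (m - e + int k) (n - int k - 1))
      = (\<Sum>k<K. ?b e k *\<^sub>C f (m - e + int k) (n - int k - 1))"
    by (simp add: n assms flip: lessThan_Suc_atMost)
  also have "(\<Sum>k\<le>K. ?b e k *\<^sub>C f (m - (e + 1) + int k) (n - int k))
      = f (m - (e + 1)) n + (\<Sum>k<K. ?b e (Suc k) *\<^sub>C f (m - e + int k) (n - int k - 1))"
    by (simp add: sum.atMost_shift algebra_simps)
  finally have "bin_mult e (\<lambda>m n. f (m - 1) n - f m (n - 1)) m n
      = f (m - (e + 1)) n + (\<Sum>k<K. (?b e (Suc k) - ?b e k) *\<^sub>C f (m - e + int k) (n - int k - 1))"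
    by (simp add: complex_vector.scale_left_diff_distrib sum_subtractf)
  also have "\<dots> = f (m - (e + 1)) n + (\<Sum>k<K. ?b (e + 1) (Suc k) *\<^sub>C f (m - e + int k) (n - int k - 1))"
    by (simp only: b)
  also have "\<dots> = bin_mult (e + 1) f m n"
    by (simp add: bin_mult_def n sum.atMost_shift algebra_simps)
  finally show ?thesis .
qed


lemma bin_mult_bound:
  assumes "\<And>m n. n < 0 \<Longrightarrow> f m n = 0" "nat n \<le> K"
  shows "bin_mult e f m n = (\<Sum>k\<le>K. ((- 1) ^ k * (of_int e gchoose k)) *\<^sub>C f (m - e + int k) (n - int k))"
  unfolding bin_mult_def using assms by (intro sum.mono_neutral_left) auto

lemma bin_mult_shift:
  assumes "\<And>m n. n < 0 \<Longrightarrow> f m n = 0"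
  shows "bin_mult e (\<lambda>m n. f (m - 1) (n - 1)) m n = bin_mult e f (m - 1) (n - 1)"
proof -
  have "bin_mult e f (m - 1) (n - 1)
      = (\<Sum>k\<le>nat n. ((- 1) ^ k * (of_int e gchoose k)) *\<^sub>C f (m - 1 - e + int k) (n - 1 - int k))"
    by (rule bin_mult_bound) (auto simp: assms)
  then show ?thesis by (simp add: bin_mult_def algebra_simps)
qed

lemma bin_mult_neg: "bin_mult e (\<lambda>m n. - f m n) m n = - bin_mult e f m n"
  by (simp add: bin_mult_def sum_negf)

text \<open>The embeddings into \<open>M((z))((w))\<close> and \<open>M((w))((z))\<close>; both results are indexed by the exponents
  of \<open>z\<close> and \<open>w\<close> in this order.\<close>

lift_definition expand_zw :: "'v::complex_vector locser2 \<Rightarrow> int \<Rightarrow> int \<Rightarrow> 'v" is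
  "\<lambda>(N, F) m n. bin_mult (- int N) (coef2 F) (m + int N) (n + int N)"
proof (rule frac_rel_lift)
  fix N :: nat and F :: "nat \<Rightarrow> nat \<Rightarrow> 'v"
  have supp: "n < 0 \<Longrightarrow> coef2 F m n = 0" for m n by (simp add: coef2_def)
  let ?g = "\<lambda>m n. coef2 F (m - 1) (n - 1)"
  have "bin_mult (- int (Suc N)) (coef2 (disc2 F)) (m + int (Suc N)) (n + int (Suc N))
      = bin_mult (- int N) (coef2 F) (m + int N) (n + int N)" for m n
  proof -
    have "coef2 (disc2 F) = (\<lambda>m n. ?g (m - 1) n - ?g m (n - 1))"
      by (simp add: fun_eq_iff coef2_disc2)
    then show ?thesis
      using bin_mult_step[of ?g "- int (Suc N)" "m + int (Suc N)" "n + int (Suc N)"]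
        bin_mult_shift[of "coef2 F" "- int N" "m + int (Suc N)" "n + int (Suc N)"]
      by (simp add: supp)
  qed
  then show "(case (Suc N, disc2 F) of (N, F) \<Rightarrow> \<lambda>m n. bin_mult (- int N) (coef2 F) (m + int N) (n + int N))
      = (case (N, F) of (N, F) \<Rightarrow> \<lambda>m n. bin_mult (- int N) (coef2 F) (m + int N) (n + int N))"
    by (simp add: fun_eq_iff)
qed

lift_definition expand_wz :: "'v::complex_vector locser2 \<Rightarrow> int \<Rightarrow> int \<Rightarrow> 'v" is
  "\<lambda>(N, F) m n. (- 1) ^ N *\<^sub>C bin_mult (- int N) (\<lambda>b a. coef2 F a b) (n + int N) (m + int N)"
proof (rule frac_rel_lift)
  fix N :: nat and F :: "nat \<Rightarrow> nat \<Rightarrow> 'v"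
  have supp: "n < 0 \<Longrightarrow> coef2 F n m = 0" for m n by (simp add: coef2_def)
  let ?g = "\<lambda>b a. coef2 F (a - 1) (b - 1)"
  have "(- 1) ^ Suc N *\<^sub>C bin_mult (- int (Suc N)) (\<lambda>b a. coef2 (disc2 F) a b) (n + int (Suc N)) (m + int (Suc N))
      = (- 1) ^ N *\<^sub>C bin_mult (- int N) (\<lambda>b a. coef2 F a b) (n + int N) (m + int N)" for m n
  proof -
    have "(\<lambda>b a. coef2 (disc2 F) a b) = (\<lambda>b a. - (?g (b - 1) a - ?g b (a - 1)))"
      by (simp add: fun_eq_iff coef2_disc2)
    then show ?thesis
      using bin_mult_step[of ?g "- int (Suc N)" "n + int (Suc N)" "m + int (Suc N)"]
        bin_mult_shift[of "\<lambda>b a. coef2 F a b" "- int N" "n + int (Suc N)" "m + int (Suc N)"]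
      by (simp add: supp bin_mult_neg[of _ "\<lambda>b a. ?g (b - 1) a - ?g b (a - 1)", simplified])
  qed
  then show "(case (Suc N, disc2 F) of (N, F) \<Rightarrow> \<lambda>m n. (- 1) ^ N *\<^sub>C bin_mult (- int N) (\<lambda>b a. coef2 F a b) (n + int N) (m + int N))
      = (case (N, F) of (N, F) \<Rightarrow> \<lambda>m n. (- 1) ^ N *\<^sub>C bin_mult (- int N) (\<lambda>b a. coef2 F a b) (n + int N) (m + int N))"
    by (simp add: fun_eq_iff)
qed

lemma antidiagonal_disc2:
  "(\<Sum>a\<le>nat (q + 3). c a *\<^sub>C coef2 (disc2 F) (int a) (q + 3 - int a))
    = (\<Sum>a\<le>nat q. (c (Suc (Suc a)) - c (Suc a)) *\<^sub>C coef2 F (int a) (q - int a))"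
proof (cases "q < 0")
  case True
  then show ?thesis unfolding coef2_disc2 by (auto simp: coef2_def intro!: sum.neutral)
next
  case False
  then obtain Q where q: "q = int Q" by (metis nonneg_int_cases not_less)
  have n: "nat (q + 3) = Suc (Suc (Suc Q))" by (simp add: q)
  have "(\<Sum>a\<le>nat (q + 3). c a *\<^sub>C coef2 F (int a - 2) (q + 2 - int a))
      = (\<Sum>a\<le>Q. c (Suc (Suc a)) *\<^sub>C coef2 F (int a) (q - int a))"
    unfolding n sum.atMost_Suc_shift[of _ "Suc (Suc Q)"] sum.atMost_Suc_shift[of _ "Suc Q"]
    by (simp add: q coef2_def)
  moreover have "(\<Sum>a\<le>nat (q + 3). c a *\<^sub>C coef2 F (int a - 1) (q + 1 - int a))
      = (\<Sum>a\<le>Q. c (Suc a) *\<^sub>C coef2 F (int a) (q - int a))"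
    unfolding n sum.atMost_Suc_shift[of _ "Suc (Suc Q)"]
    by (simp add: q coef2_def)
  moreover have "nat q = Q" by (simp add: q)
  ultimately show ?thesis
    by (simp add: coef2_disc2 complex_vector.scale_right_diff_distrib
        complex_vector.scale_left_diff_distrib sum_subtractf algebra_simps)
qed

text \<open>The embedding into \<open>M((w))((z - w))\<close>: the result is indexed by the exponents \<open>p\<close> of \<open>z - w\<close> and
  \<open>n\<close> of \<open>w\<close>. It expands \<open>z^{a-N} = w^{a-N} (1 + (z-w)/w)^{a-N}\<close> in
  \<open>(z-w)^{-N} w^{b-N} z^{a-N}\<close>.\<close>

lift_definition expand_w_zw :: "'v::complex_vector locser2 \<Rightarrow> int \<Rightarrow> int \<Rightarrow> 'v" is
  "\<lambda>(N, F) p n. if p + int N < 0 then 0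
     else \<Sum>a\<le>nat (p + n + 3 * int N).
       (of_int (int a - int N) gchoose nat (p + int N)) *\<^sub>C coef2 F (int a) (p + n + 3 * int N - int a)"
proof (rule frac_rel_lift)
  fix N :: nat and F :: "nat \<Rightarrow> nat \<Rightarrow> 'v"
  let ?e = "\<lambda>N F p n. if p + int N < 0 then 0
     else \<Sum>a\<le>nat (p + n + 3 * int N).
       (of_int (int a - int N) gchoose nat (p + int N)) *\<^sub>C coef2 F (int a) (p + n + 3 * int N - int a)"
  have "?e (Suc N) (disc2 F) p n = ?e N F p n" for p n
  proof -
    define q where "q = p + n + 3 * int N"
    have q3: "p + n + 3 * int (Suc N) = q + 3" by (simp add: q_def)
    consider "p + int N < - 1" | "p + int N = - 1" | "0 \<le> p + int N" by linarith
    then show ?thesis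
    proof cases
      case 2
      then have "nat (p + int (Suc N)) = 0" by simp
      then show ?thesis
        unfolding q3 antidiagonal_disc2 using 2 by simp
    next
      case 3
      define k where "k = nat (p + int N)"
      have k: "nat (p + int (Suc N)) = Suc k" "nat (p + int N) = k" using 3 by (simp_all add: k_def)
      have "(of_int (int (Suc (Suc a)) - int (Suc N)) gchoose Suc k)
          - (of_int (int (Suc a) - int (Suc N)) gchoose Suc k)
          = (of_int (int a - int N) gchoose k :: complex)" for a
        using gbinomial_Suc_Suc[of "of_int (int a - int N) :: complex" k] by (simp add: algebra_simps)
      then show ?thesis
        unfolding q3 antidiagonal_disc2 k q_def[symmetric] using 3 by simp
    qed simp
  qed
  then show "(case (Suc N, disc2 F) of (N, F) \<Rightarrow> ?e N F) = (case (N, F) of (N, F) \<Rightarrow> ?e N F)"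
    by (simp add: fun_eq_iff)
qed


subsection \<open>Three variables\<close>

text \<open>As above, with \<open>disc3\<close> the multiplication by \<open>zwt(z - w)(z - t)(w - t)\<close>.\<close>

definition coef3 :: "(nat \<Rightarrow> nat \<Rightarrow> nat \<Rightarrow> 'v::zero) \<Rightarrow> int \<Rightarrow> int \<Rightarrow> int \<Rightarrow> 'v" where
  "coef3 F m n s = (if 0 \<le> m \<and> 0 \<le> n \<and> 0 \<le> s then F (nat m) (nat n) (nat s) else 0)"

definition mul_zw :: "(int \<Rightarrow> int \<Rightarrow> int \<Rightarrow> 'v::minus) \<Rightarrow> int \<Rightarrow> int \<Rightarrow> int \<Rightarrow> 'v" where
  "mul_zw g m n s = g (m - 1) n s - g m (n - 1) s"

definition mul_zt :: "(int \<Rightarrow> int \<Rightarrow> int \<Rightarrow> 'v::minus) \<Rightarrow> int \<Rightarrow> int \<Rightarrow> int \<Rightarrow> 'v" where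
  "mul_zt g m n s = g (m - 1) n s - g m n (s - 1)"

definition mul_wt :: "(int \<Rightarrow> int \<Rightarrow> int \<Rightarrow> 'v::minus) \<Rightarrow> int \<Rightarrow> int \<Rightarrow> int \<Rightarrow> 'v" where
  "mul_wt g m n s = g m (n - 1) s - g m n (s - 1)"

definition disc3 :: "(nat \<Rightarrow> nat \<Rightarrow> nat \<Rightarrow> 'v::complex_vector) \<Rightarrow> nat \<Rightarrow> nat \<Rightarrow> nat \<Rightarrow> 'v" where
  "disc3 F a b c = mul_zw (mul_zt (mul_wt (coef3 F))) (int a - 1) (int b - 1) (int c - 1)"

lemma coef3_disc3:
  "coef3 (disc3 F) m n s = mul_zw (mul_zt (mul_wt (coef3 F))) (m - 1) (n - 1) (s - 1)"
  by (simp add: coef3_def disc3_def mul_zw_def mul_zt_def mul_wt_def)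

lemma coef3_add: "coef3 (x + y) m n s = coef3 x m n s + coef3 y m n s"
  for x y :: "nat \<Rightarrow> nat \<Rightarrow> nat \<Rightarrow> 'v::complex_vector"
  by (simp add: coef3_def)

lemma coef3_scale: "coef3 (c *\<^sub>C x) m n s = c *\<^sub>C coef3 x m n s"
  by (simp add: coef3_def scaleC_fun_def)

interpretation disc3: linear_endo "disc3 :: _ \<Rightarrow> nat \<Rightarrow> nat \<Rightarrow> nat \<Rightarrow> 'v::complex_vector"
  by unfold_locales
    (simp_all add: disc3_def mul_zw_def mul_zt_def mul_wt_def coef3_add
      coef3_scale[unfolded scaleC_fun_def] fun_eq_iff
      scaleC_fun_def scaleC_add_right complex_vector.scale_right_diff_distrib)

quotient_type (overloaded) 'v locser3 =
    "nat \<times> (nat \<Rightarrow> nat \<Rightarrow> nat \<Rightarrow> 'v::complex_vector)" / "frac_rel disc3"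
  morphisms rep_locser3 frac3
  by (rule frac_rel_equivp)

instantiation locser3 :: (complex_vector) complex_vector
begin
lift_definition zero_locser3 :: "'a locser3" is "(0, 0)" .
lift_definition plus_locser3 :: "'a locser3 \<Rightarrow> 'a locser3 \<Rightarrow> 'a locser3" is "frac_add disc3"
  by (rule disc3.frac_add_resp)
lift_definition scaleC_locser3 :: "complex \<Rightarrow> 'a locser3 \<Rightarrow> 'a locser3" is frac_scale
  by (rule disc3.frac_scale_resp)
definition uminus_locser3 :: "'a locser3 \<Rightarrow> 'a locser3" where "uminus_locser3 x = (- 1) *\<^sub>C x"
definition minus_locser3 :: "'a locser3 \<Rightarrow> 'a locser3 \<Rightarrow> 'a locser3" where "minus_locser3 x y = x + - y"
instance
proof
  fix x y z :: "'a locser3" and c d :: complex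
  show "x + y + z = x + (y + z)" by transfer (rule disc3.frac_add_assoc)
  show "x + y = y + x" by transfer (rule disc3.frac_add_comm)
  show "0 + x = x" by transfer (rule disc3.frac_add_zero)
  show "- x + x = 0" unfolding uminus_locser3_def by transfer (rule disc3.frac_add_inv)
  show "x - y = x + - y" by (rule minus_locser3_def)
  show "c *\<^sub>C (x + y) = c *\<^sub>C x + c *\<^sub>C y" by transfer (rule disc3.frac_scale_add_right)
  show "(c + d) *\<^sub>C x = c *\<^sub>C x + d *\<^sub>C x" by transfer (rule disc3.frac_scale_add_left)
  show "c *\<^sub>C d *\<^sub>C x = (c * d) *\<^sub>C x" by transfer (rule disc3.frac_scale_scale)
  show "1 *\<^sub>C x = x" by transfer (rule disc3.frac_scale_one)
qed
end

definition locser3_on :: "'v::complex_vector set \<Rightarrow> 'v locser3 set" where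
  "locser3_on S = {frac3 (N, F) | N F. \<forall>a b c. F a b c \<in> S}"

definition bin_zw :: "int \<Rightarrow> (int \<Rightarrow> int \<Rightarrow> int \<Rightarrow> 'v::complex_vector) \<Rightarrow> int \<Rightarrow> int \<Rightarrow> int \<Rightarrow> 'v" where
  "bin_zw e g m n s = bin_mult e (\<lambda>m n. g m n s) m n"

definition bin_zt :: "int \<Rightarrow> (int \<Rightarrow> int \<Rightarrow> int \<Rightarrow> 'v::complex_vector) \<Rightarrow> int \<Rightarrow> int \<Rightarrow> int \<Rightarrow> 'v" where
  "bin_zt e g m n s = bin_mult e (\<lambda>m s. g m n s) m s"

definition bin_wt :: "int \<Rightarrow> (int \<Rightarrow> int \<Rightarrow> int \<Rightarrow> 'v::complex_vector) \<Rightarrow> int \<Rightarrow> int \<Rightarrow> int \<Rightarrow> 'v" where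
  "bin_wt e g m n s = bin_mult e (\<lambda>n s. g m n s) n s"

definition supp_w :: "(int \<Rightarrow> int \<Rightarrow> int \<Rightarrow> 'v::zero) \<Rightarrow> bool" where
  "supp_w g \<longleftrightarrow> (\<forall>m n s. n < 0 \<longrightarrow> g m n s = 0)"

definition supp_t :: "(int \<Rightarrow> int \<Rightarrow> int \<Rightarrow> 'v::zero) \<Rightarrow> bool" where
  "supp_t g \<longleftrightarrow> (\<forall>m n s. s < 0 \<longrightarrow> g m n s = 0)"

lemma bin_zw_step: "supp_w g \<Longrightarrow> bin_zw e (mul_zw g) = bin_zw (e + 1) g"
  unfolding fun_eq_iff
proof (intro allI)
  fix m n s
  assume "supp_w g"
  then show "bin_zw e (mul_zw g) m n s = bin_zw (e + 1) g m n s"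
    using bin_mult_step[of "\<lambda>m n. g m n s" e m n] by (simp add: bin_zw_def mul_zw_def supp_w_def)
qed

lemma bin_zt_step: "supp_t g \<Longrightarrow> bin_zt e (mul_zt g) = bin_zt (e + 1) g"
  unfolding fun_eq_iff
proof (intro allI)
  fix m n s
  assume "supp_t g"
  then show "bin_zt e (mul_zt g) m n s = bin_zt (e + 1) g m n s"
    using bin_mult_step[of "\<lambda>m s. g m n s" e m s] by (simp add: bin_zt_def mul_zt_def supp_t_def)
qed

lemma bin_wt_step: "supp_t g \<Longrightarrow> bin_wt e (mul_wt g) = bin_wt (e + 1) g"
  unfolding fun_eq_iff
proof (intro allI)
  fix m n s
  assume "supp_t g"
  then show "bin_wt e (mul_wt g) m n s = bin_wt (e + 1) g m n s"
    using bin_mult_step[of "\<lambda>n s. g m n s" e n s] by (simp add: bin_wt_def mul_wt_def supp_t_def)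
qed

lemma bin_mult_diff: "bin_mult e (\<lambda>m n. f m n - g m n) m n = bin_mult e f m n - bin_mult e g m n"
  by (simp add: bin_mult_def complex_vector.scale_right_diff_distrib sum_subtractf)

lemma bin_mult_shift1: "bin_mult e (\<lambda>m n. f (m - 1) n) m n = bin_mult e f (m - 1) n"
  by (simp add: bin_mult_def algebra_simps)

lemma bin_mult_shift2:
  assumes "\<And>m n. n < 0 \<Longrightarrow> f m n = 0"
  shows "bin_mult e (\<lambda>m n. f m (n - 1)) m n = bin_mult e f m (n - 1)"
  using bin_mult_shift[of f e "m + 1" n] bin_mult_shift1[of e "\<lambda>m n. f m (n - 1)" "m + 1" n] assms
  by simp

lemma bin_zw_mul_zt: "bin_zw e (mul_zt g) = mul_zt (bin_zw e g)"
  by (intro ext) (simp add: bin_zw_def mul_zt_def bin_mult_diff bin_mult_shift1 [of e "\<lambda>m n. g m n _"])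

lemma bin_zw_mul_wt: "supp_w g \<Longrightarrow> bin_zw e (mul_wt g) = mul_wt (bin_zw e g)"
  by (intro ext) (simp add: bin_zw_def mul_wt_def bin_mult_diff supp_w_def bin_mult_shift2 [of "\<lambda>m n. g m n _"])

lemma bin_zt_mul_wt: "supp_t g \<Longrightarrow> bin_zt e (mul_wt g) = mul_wt (bin_zt e g)"
  by (intro ext) (simp add: bin_zt_def mul_wt_def bin_mult_diff supp_t_def bin_mult_shift2 [of "\<lambda>m s. g m _ s"])

lemma supp_simps:
  "supp_w g \<Longrightarrow> supp_w (mul_zt g)" "supp_w g \<Longrightarrow> supp_w (mul_wt g)"
  "supp_t g \<Longrightarrow> supp_t (mul_wt g)"
  "supp_t g \<Longrightarrow> supp_t (bin_zw e g)" "supp_t g \<Longrightarrow> supp_t (bin_zt e g)"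
  by (auto simp: supp_w_def supp_t_def mul_zt_def mul_wt_def bin_zw_def bin_zt_def bin_mult_def)

lemma bin3_step:
  assumes "supp_w g" "supp_t g"
  shows "bin_wt e (bin_zt e (bin_zw e (mul_zw (mul_zt (mul_wt g)))))
    = bin_wt (e + 1) (bin_zt (e + 1) (bin_zw (e + 1) g))"
  by (simp add: assms supp_simps bin_zw_step bin_zw_mul_zt bin_zw_mul_wt bin_zt_step bin_zt_mul_wt
      bin_wt_step)

definition shift3 :: "int \<Rightarrow> (int \<Rightarrow> int \<Rightarrow> int \<Rightarrow> 'v) \<Rightarrow> int \<Rightarrow> int \<Rightarrow> int \<Rightarrow> 'v" where
  "shift3 r g m n s = g (m + r) (n + r) (s + r)"

lemma bin_zw_shift3: "supp_w g \<Longrightarrow> bin_zw e (shift3 (- 1) g) = shift3 (- 1) (bin_zw e g)"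
  by (intro ext) (simp add: bin_zw_def shift3_def supp_w_def bin_mult_shift[of "\<lambda>m n. g m n _"])

lemma bin_zt_shift3: "supp_t g \<Longrightarrow> bin_zt e (shift3 (- 1) g) = shift3 (- 1) (bin_zt e g)"
  by (intro ext) (simp add: bin_zt_def shift3_def supp_t_def bin_mult_shift[of "\<lambda>m s. g m _ s"])

lemma bin_wt_shift3: "supp_t g \<Longrightarrow> bin_wt e (shift3 (- 1) g) = shift3 (- 1) (bin_wt e g)"
  by (intro ext) (simp add: bin_wt_def shift3_def supp_t_def bin_mult_shift[of "\<lambda>n s. g _ n s"])

text \<open>The embedding into \<open>M((z))((w))((t))\<close>, expanding \<open>z - w\<close> and \<open>z - t\<close> at large \<open>z\<close> and \<open>w - t\<close> at
  large \<open>w\<close>.\<close>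

lift_definition expand_zwt :: "'v::complex_vector locser3 \<Rightarrow> int \<Rightarrow> int \<Rightarrow> int \<Rightarrow> 'v" is
  "\<lambda>(N, F). shift3 (int N) (bin_wt (- int N) (bin_zt (- int N) (bin_zw (- int N) (coef3 F))))"
proof (rule frac_rel_lift)
  fix N :: nat and F :: "nat \<Rightarrow> nat \<Rightarrow> nat \<Rightarrow> 'v"
  let ?g = "mul_zw (mul_zt (mul_wt (coef3 F)))" and ?e = "- int (Suc N)"
  have s: "supp_w (coef3 F)" "supp_t (coef3 F)" "supp_w ?g" "supp_t ?g"
    by (auto simp: supp_w_def supp_t_def mul_zw_def mul_zt_def mul_wt_def coef3_def)
  have "coef3 (disc3 F) = shift3 (- 1) ?g"
    by (intro ext) (simp add: coef3_disc3 shift3_def)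
  then have "bin_wt ?e (bin_zt ?e (bin_zw ?e (coef3 (disc3 F))))
      = shift3 (- 1) (bin_wt ?e (bin_zt ?e (bin_zw ?e ?g)))"
    using s by (simp add: bin_zw_shift3 bin_zt_shift3 bin_wt_shift3 supp_simps)
  also have "\<dots> = shift3 (- 1) (bin_wt (- int N) (bin_zt (- int N) (bin_zw (- int N) (coef3 F))))"
    using bin3_step[OF s(1,2), of ?e] by simp
  finally show "(case (Suc N, disc3 F) of (N, F) \<Rightarrow>
        shift3 (int N) (bin_wt (- int N) (bin_zt (- int N) (bin_zw (- int N) (coef3 F)))))
      = (case (N, F) of (N, F) \<Rightarrow>
        shift3 (int N) (bin_wt (- int N) (bin_zt (- int N) (bin_zw (- int N) (coef3 F)))))"
    by (simp add: shift3_def fun_eq_iff algebra_simps)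
qed
subsection \<open>Multilinear maps\<close>

definition lin_map :: "'u::complex_vector set \<Rightarrow> 'w::complex_vector set \<Rightarrow> ('u \<Rightarrow> 'w) \<Rightarrow> bool" where
  "lin_map U W f \<longleftrightarrow> (\<forall>x\<in>U. f x \<in> W) \<and> (\<forall>x\<in>U. \<forall>y\<in>U. f (x + y) = f x + f y)
    \<and> (\<forall>c. \<forall>x\<in>U. f (c *\<^sub>C x) = c *\<^sub>C f x)"

text \<open>All vector spaces below are subspaces of ambient types. A linear map out of a tensor product
  of subspaces is a multilinear function, extended by \<open>0\<close> outside the subspaces; with this
  convention a map is determined by its restriction, and the spaces of such maps are honest
  subspaces of function types.\<close>

definition bilin_maps :: "'u::complex_vector set \<Rightarrow> 'v::complex_vector set
    \<Rightarrow> 'w::complex_vector set \<Rightarrow> ('u \<Rightarrow> 'v \<Rightarrow> 'w) set" where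
  "bilin_maps U V W = {B. (\<forall>u\<in>U. lin_map V W (B u)) \<and> (\<forall>v\<in>V. lin_map U W (\<lambda>u. B u v))
    \<and> (\<forall>u v. u \<notin> U \<or> v \<notin> V \<longrightarrow> B u v = 0)}"

definition trilin_maps :: "'u::complex_vector set \<Rightarrow> 'v::complex_vector set
    \<Rightarrow> 'x::complex_vector set \<Rightarrow> 'w::complex_vector set \<Rightarrow> ('u \<Rightarrow> 'v \<Rightarrow> 'x \<Rightarrow> 'w) set" where
  "trilin_maps U V X W = {B. (\<forall>u\<in>U. B u \<in> bilin_maps V X W)
    \<and> (\<forall>v\<in>V. \<forall>x\<in>X. lin_map U W (\<lambda>u. B u v x)) \<and> (\<forall>u. u \<notin> U \<longrightarrow> B u = 0)}"

definition quadrilin_maps :: "'u::complex_vector set \<Rightarrow> 'v::complex_vector set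
    \<Rightarrow> 'x::complex_vector set \<Rightarrow> 'y::complex_vector set \<Rightarrow> 'w::complex_vector set
    \<Rightarrow> ('u \<Rightarrow> 'v \<Rightarrow> 'x \<Rightarrow> 'y \<Rightarrow> 'w) set" where
  "quadrilin_maps U V X Y W = {B. (\<forall>u\<in>U. B u \<in> trilin_maps V X Y W)
    \<and> (\<forall>v\<in>V. \<forall>x\<in>X. \<forall>y\<in>Y. lin_map U W (\<lambda>u. B u v x y)) \<and> (\<forall>u. u \<notin> U \<longrightarrow> B u = 0)}"

definition one_dimensional :: "'v::complex_vector set \<Rightarrow> bool" where
  "one_dimensional S \<longleftrightarrow> complex_vector.subspace S \<and> complex_vector.dim S = 1"

definition is_basis :: "'v::complex_vector set \<Rightarrow> 'v set \<Rightarrow> bool" where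
  "is_basis B S \<longleftrightarrow> complex_vector.independent B \<and> complex_vector.span B = S"

text \<open>A bilinear map \<open>\<beta>\<close> on \<open>P \<times> Q\<close> induces an isomorphism from the tensor product of
  \<open>P\<close> and \<open>Q\<close> onto \<open>S\<close>: it carries a basis \<open>b \<otimes> c\<close> of the tensor product
  injectively onto a basis of \<open>S\<close>. Similarly for three factors.\<close>

definition tensor_iso2 :: "('p::complex_vector \<Rightarrow> 'q::complex_vector \<Rightarrow> 's::complex_vector)
    \<Rightarrow> 'p set \<Rightarrow> 'q set \<Rightarrow> 's set \<Rightarrow> bool" where
  "tensor_iso2 \<beta> P Q S \<longleftrightarrow>
    (\<forall>p\<in>P. lin_map Q S (\<beta> p)) \<and> (\<forall>q\<in>Q. lin_map P S (\<lambda>p. \<beta> p q))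
    \<and> (\<exists>B C. is_basis B P \<and> is_basis C Q \<and> inj_on (\<lambda>(b, c). \<beta> b c) (B \<times> C)
        \<and> is_basis ((\<lambda>(b, c). \<beta> b c) ` (B \<times> C)) S)"

definition tensor_iso3 :: "('p::complex_vector \<Rightarrow> 'q::complex_vector \<Rightarrow> 'r::complex_vector
    \<Rightarrow> 's::complex_vector) \<Rightarrow> 'p set \<Rightarrow> 'q set \<Rightarrow> 'r set \<Rightarrow> 's set \<Rightarrow> bool" where
  "tensor_iso3 \<beta> P Q R S \<longleftrightarrow>
    (\<forall>p\<in>P. \<forall>q\<in>Q. lin_map R S (\<beta> p q)) \<and> (\<forall>p\<in>P. \<forall>r\<in>R. lin_map Q S (\<lambda>q. \<beta> p q r))
    \<and> (\<forall>q\<in>Q. \<forall>r\<in>R. lin_map P S (\<lambda>p. \<beta> p q r))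
    \<and> (\<exists>B C D. is_basis B P \<and> is_basis C Q \<and> is_basis D R
        \<and> inj_on (\<lambda>(b, c, d). \<beta> b c d) (B \<times> C \<times> D)
        \<and> is_basis ((\<lambda>(b, c, d). \<beta> b c d) ` (B \<times> C \<times> D)) S)"

subsection \<open>Operations on series\<close>

text \<open>A series-valued map \<open>I\<close> is given by its coefficients: \<open>I u v n\<close> is the coefficient
  of \<open>z^n\<close> (plain exponents, not mode numbering).\<close>

definition laurent :: "'v::complex_vector set \<Rightarrow> (int \<Rightarrow> 'v) set" where
  "laurent S = {f. (\<forall>n. f n \<in> S) \<and> (\<exists>N. \<forall>n<N. f n = 0)}"

definition ddz :: "(int \<Rightarrow> 'v::complex_vector) \<Rightarrow> int \<Rightarrow> 'v" where
  "ddz f n = of_int (n + 1) *\<^sub>C f (n + 1)"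

text \<open>\<open>nested I J\<close> is \<open>I_z(u \<otimes> J_w(v \<otimes> x))\<close>, indexed by the exponents of \<open>z\<close>, \<open>w\<close>;
  \<open>iterated I J\<close> is \<open>I_w(J_{z-w}(u \<otimes> v) \<otimes> x)\<close>, indexed by the exponents of \<open>z - w\<close>, \<open>w\<close>.\<close>

definition nested :: "('u \<Rightarrow> 'y \<Rightarrow> int \<Rightarrow> 's) \<Rightarrow> ('v \<Rightarrow> 'x \<Rightarrow> int \<Rightarrow> 'y)
    \<Rightarrow> 'u \<Rightarrow> 'v \<Rightarrow> 'x \<Rightarrow> int \<Rightarrow> int \<Rightarrow> 's" where
  "nested I J u v x = (\<lambda>m n. I u (J v x n) m)"

definition iterated :: "('y \<Rightarrow> 'x \<Rightarrow> int \<Rightarrow> 's) \<Rightarrow> ('u \<Rightarrow> 'v \<Rightarrow> int \<Rightarrow> 'y)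
    \<Rightarrow> 'u \<Rightarrow> 'v \<Rightarrow> 'x \<Rightarrow> int \<Rightarrow> int \<Rightarrow> 's" where
  "iterated I J u v x = (\<lambda>p n. I (J u v p) x n)"

text \<open>\<open>skew L I\<close> is \<open>I*_z(v \<otimes> u) = e^{z L(-1)} I_{-z}(u \<otimes> v)\<close>.\<close>

definition skew :: "(int \<Rightarrow> 'w \<Rightarrow> 'w) \<Rightarrow> ('u \<Rightarrow> 'v \<Rightarrow> int \<Rightarrow> 'w::complex_vector)
    \<Rightarrow> 'v \<Rightarrow> 'u \<Rightarrow> int \<Rightarrow> 'w" where
  "skew L I v u n = Sum_any (\<lambda>k::nat.
    ((- 1) powi (n - int k) / fact k) *\<^sub>C (L (- 1) ^^ k) (I u v (n - int k)))"

subsection \<open>Vertex algebras, modules and intertwining operators\<close>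

datatype kind = Unrestricted | Weighted | Moebius | Quasi_conformal | Conformal | Vertex_operator

text \<open>The settings: a kind of vertex algebra, possibly with a group acting strictly equivariantly.\<close>

datatype 'g setting = Plain kind | Equivariant kind "'g monoid"

primrec kind_of :: "'g setting \<Rightarrow> kind" where
  "kind_of (Plain K) = K"
| "kind_of (Equivariant K G) = K"

definition has_conformal_vector :: "kind \<Rightarrow> bool" where
  "has_conformal_vector K \<longleftrightarrow> K = Conformal \<or> K = Vertex_operator"

primrec L_index :: "kind \<Rightarrow> int set" where
  "L_index Unrestricted = {- 1}"
| "L_index Weighted = {- 1, 0}"
| "L_index Moebius = {- 1, 0, 1}"
| "L_index Quasi_conformal = {- 1..}"
| "L_index Conformal = UNIV"
| "L_index Vertex_operator = UNIV"

text \<open>Fields that are not part of the structure for a given setting (the operators \<open>L i\<close> with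
  \<open>i\<close> outside \<^const>\<open>L_index\<close>, the conformal vector, the central charge, the group action) are
  left unconstrained and ignored.\<close>

record ('v, 'g) valg =
  vspace :: "'v set"
  vac :: 'v
  vmul :: "'v \<Rightarrow> 'v \<Rightarrow> int \<Rightarrow> 'v"
  vL :: "int \<Rightarrow> 'v \<Rightarrow> 'v"
  vomega :: 'v
  vcharge :: complex
  vgrp :: "'g \<Rightarrow> 'v \<Rightarrow> 'v"

record ('u, 'v, 'g) vmodule =
  mspace :: "'v set"
  mact :: "'u \<Rightarrow> 'v \<Rightarrow> int \<Rightarrow> 'v"
  mL :: "int \<Rightarrow> 'v \<Rightarrow> 'v"
  mgrp :: "'g \<Rightarrow> 'v \<Rightarrow> 'v"

definition adjoint_module :: "('v, 'g) valg \<Rightarrow> ('v, 'v, 'g) vmodule" where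
  "adjoint_module V = \<lparr>mspace = vspace V, mact = vmul V, mL = vL V, mgrp = vgrp V\<rparr>"

definition L_covariant :: "int \<Rightarrow> (int \<Rightarrow> 'u \<Rightarrow> 'u) \<Rightarrow> (int \<Rightarrow> 'v \<Rightarrow> 'v) \<Rightarrow> (int \<Rightarrow> 'w \<Rightarrow> 'w)
    \<Rightarrow> 'u set \<Rightarrow> 'v set \<Rightarrow> ('u \<Rightarrow> 'v \<Rightarrow> int \<Rightarrow> 'w::complex_vector) \<Rightarrow> bool" where
  "L_covariant i L1 L2 L3 U V B \<longleftrightarrow> (\<forall>u\<in>U. \<forall>v\<in>V. \<forall>n.
    L3 i (B u v n) - B u (L2 i v) n
      = (\<Sum>j\<le>nat (i + 1). of_nat (nat (i + 1) choose j) *\<^sub>C B (L1 (i - int j) u) v (n - int j)))"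

definition witt :: "int set \<Rightarrow> 'v::complex_vector set \<Rightarrow> (int \<Rightarrow> 'v \<Rightarrow> 'v) \<Rightarrow> bool" where
  "witt J S L \<longleftrightarrow> (\<forall>i\<in>J. \<forall>j\<in>J. \<forall>x\<in>S.
    L i (L j x) - L j (L i x) = of_int (i - j) *\<^sub>C L (i + j) x)"

definition virasoro :: "complex \<Rightarrow> 'v::complex_vector set \<Rightarrow> (int \<Rightarrow> 'v \<Rightarrow> 'v) \<Rightarrow> bool" where
  "virasoro c S L \<longleftrightarrow> (\<forall>i j. \<forall>x\<in>S.
    L i (L j x) - L j (L i x) = of_int (i - j) *\<^sub>C L (i + j) x
      + (if i + j = 0 then of_int (i ^ 3 - i) / 12 * c else 0) *\<^sub>C x)"

definition eigenspace :: "'v::complex_vector set \<Rightarrow> ('v \<Rightarrow> 'v) \<Rightarrow> complex \<Rightarrow> 'v set" where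
  "eigenspace S f c = {x \<in> S. f x = c *\<^sub>C x}"

definition integral_semisimple :: "'v::complex_vector set \<Rightarrow> ('v \<Rightarrow> 'v) \<Rightarrow> bool" where
  "integral_semisimple S f \<longleftrightarrow> S \<subseteq> complex_vector.span (\<Union>n::int. eigenspace S f (of_int n))"

definition voa_grading :: "'v::complex_vector set \<Rightarrow> ('v \<Rightarrow> 'v) \<Rightarrow> bool" where
  "voa_grading S f \<longleftrightarrow> (\<exists>N::int. \<forall>n<N. eigenspace S f (of_int n) = {0})
    \<and> (\<forall>c. \<exists>B. finite B \<and> eigenspace S f c \<subseteq> complex_vector.span B)"

text \<open>Every vector is annihilated by all sufficiently long products of operators \<open>L i\<close> with
  \<open>i \<in> J\<close>; by multilinearity, equivalently by all such products of elements of their span.\<close>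

definition locally_nilpotent :: "int set \<Rightarrow> 'v::complex_vector set \<Rightarrow> (int \<Rightarrow> 'v \<Rightarrow> 'v) \<Rightarrow> bool" where
  "locally_nilpotent J S L \<longleftrightarrow>
    (\<forall>x\<in>S. \<exists>N. \<forall>is. length is = N \<and> set is \<subseteq> J \<longrightarrow> foldr L is x = 0)"

definition L_structure :: "kind \<Rightarrow> complex \<Rightarrow> 'v::complex_vector set \<Rightarrow> (int \<Rightarrow> 'v \<Rightarrow> 'v) \<Rightarrow> bool" where
  "L_structure K c S L \<longleftrightarrow> (\<forall>i\<in>L_index K. lin_map S S (L i))
    \<and> (if has_conformal_vector K then virasoro c S L else witt (L_index K) S L)
    \<and> (K \<noteq> Unrestricted \<longrightarrow> integral_semisimple S (L 0))
    \<and> (K = Moebius \<or> K = Quasi_conformal \<longrightarrow> locally_nilpotent {i \<in> L_index K. 1 \<le> i} S L)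
    \<and> (K = Vertex_operator \<longrightarrow> voa_grading S (L 0))"

definition action_covariant :: "kind \<Rightarrow> (int \<Rightarrow> 'u \<Rightarrow> 'u) \<Rightarrow> (int \<Rightarrow> 'v \<Rightarrow> 'v)
    \<Rightarrow> 'u set \<Rightarrow> 'v set \<Rightarrow> ('u \<Rightarrow> 'v \<Rightarrow> int \<Rightarrow> 'v::complex_vector) \<Rightarrow> bool" where
  "action_covariant K LV L U S B \<longleftrightarrow> (K \<noteq> Unrestricted \<longrightarrow> L_covariant 0 LV L L U S B)
    \<and> (K = Moebius \<or> K = Quasi_conformal \<longrightarrow> (\<forall>i\<in>L_index K. L_covariant i LV L L U S B))"

definition group_rep :: "'g monoid \<Rightarrow> 'v::complex_vector set \<Rightarrow> ('g \<Rightarrow> 'v \<Rightarrow> 'v) \<Rightarrow> bool" where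
  "group_rep G S \<rho> \<longleftrightarrow> group G \<and> (\<forall>g\<in>carrier G. lin_map S S (\<rho> g)) \<and> (\<forall>x\<in>S. \<rho> \<one>\<^bsub>G\<^esub> x = x)
    \<and> (\<forall>g\<in>carrier G. \<forall>h\<in>carrier G. \<forall>x\<in>S. \<rho> (g \<otimes>\<^bsub>G\<^esub> h) x = \<rho> g (\<rho> h x))"

definition commutes_with_L :: "'g monoid \<Rightarrow> kind \<Rightarrow> 'v set \<Rightarrow> (int \<Rightarrow> 'v \<Rightarrow> 'v) \<Rightarrow> ('g \<Rightarrow> 'v \<Rightarrow> 'v) \<Rightarrow> bool" where
  "commutes_with_L G K S L \<rho> \<longleftrightarrow> (\<forall>g\<in>carrier G. \<forall>i\<in>L_index K. \<forall>x\<in>S. \<rho> g (L i x) = L i (\<rho> g x))"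

definition equivariant_op :: "'g monoid \<Rightarrow> 'u set \<Rightarrow> 'v set \<Rightarrow> ('g \<Rightarrow> 'u \<Rightarrow> 'u) \<Rightarrow> ('g \<Rightarrow> 'v \<Rightarrow> 'v)
    \<Rightarrow> ('g \<Rightarrow> 'w \<Rightarrow> 'w) \<Rightarrow> ('u \<Rightarrow> 'v \<Rightarrow> int \<Rightarrow> 'w) \<Rightarrow> bool" where
  "equivariant_op G U V \<rho>1 \<rho>2 \<rho>3 B \<longleftrightarrow>
    (\<forall>g\<in>carrier G. \<forall>u\<in>U. \<forall>v\<in>V. \<forall>n. B (\<rho>1 g u) (\<rho>2 g v) n = \<rho>3 g (B u v n))"

definition vertex_algebra :: "('v::complex_vector, 'g) valg \<Rightarrow> bool" where
  "vertex_algebra V \<longleftrightarrow> complex_vector.subspace (vspace V) \<and> vac V \<in> vspace V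
    \<and> lin_map (vspace V) (vspace V) (vL V (- 1))
    \<and> vmul V \<in> bilin_maps (vspace V) (vspace V) (laurent (vspace V))
    \<and> (\<forall>v\<in>vspace V. \<forall>n. vmul V (vac V) v n = (if n = 0 then v else 0))
    \<and> (\<forall>v\<in>vspace V. vmul V v (vac V) 0 = v \<and> (\<forall>n<0. vmul V v (vac V) n = 0))
    \<and> (\<forall>u\<in>vspace V. \<forall>v\<in>vspace V. \<forall>n.
        vL V (- 1) (vmul V u v n) - vmul V u (vL V (- 1) v) n = ddz (vmul V u v) n)
    \<and> (\<forall>u\<in>vspace V. \<forall>v\<in>vspace V. \<forall>x\<in>vspace V. \<exists>\<phi>\<in>locser2_on (vspace V).
        expand_zw \<phi> = nested (vmul V) (vmul V) u v x
        \<and> expand_wz \<phi> = (\<lambda>m n. nested (vmul V) (vmul V) v u x n m))"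

definition T_vertex_algebra :: "'g setting \<Rightarrow> ('v::complex_vector, 'g) valg \<Rightarrow> bool" where
  "T_vertex_algebra T V \<longleftrightarrow> vertex_algebra V
    \<and> L_structure (kind_of T) (vcharge V) (vspace V) (vL V)
    \<and> action_covariant (kind_of T) (vL V) (vL V) (vspace V) (vspace V) (vmul V)
    \<and> (has_conformal_vector (kind_of T) \<longrightarrow> vomega V \<in> eigenspace (vspace V) (vL V 0) 2
        \<and> (\<forall>v\<in>vspace V. \<forall>n. vmul V (vomega V) v (- n - 2) = vL V n v))
    \<and> (case T of Plain K \<Rightarrow> True
        | Equivariant K G \<Rightarrow> group_rep G (vspace V) (vgrp V)
            \<and> commutes_with_L G K (vspace V) (vL V) (vgrp V)
            \<and> (\<forall>g\<in>carrier G. vgrp V g (vac V) = vac V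
                \<and> (has_conformal_vector K \<longrightarrow> vgrp V g (vomega V) = vomega V))
            \<and> equivariant_op G (vspace V) (vspace V) (vgrp V) (vgrp V) (vgrp V) (vmul V))"

definition T_module :: "'g setting \<Rightarrow> ('u::complex_vector, 'g) valg
    \<Rightarrow> ('u, 'v::complex_vector, 'g) vmodule \<Rightarrow> bool" where
  "T_module T V X \<longleftrightarrow> complex_vector.subspace (mspace X)
    \<and> mact X \<in> bilin_maps (vspace V) (mspace X) (laurent (mspace X))
    \<and> (\<forall>x\<in>mspace X. \<forall>n. mact X (vac V) x n = (if n = 0 then x else 0))
    \<and> (\<forall>u\<in>vspace V. \<forall>x\<in>mspace X. \<forall>n.
        mL X (- 1) (mact X u x n) - mact X u (mL X (- 1) x) n = mact X (vL V (- 1) u) x n)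
    \<and> (\<forall>u\<in>vspace V. \<forall>v\<in>vspace V. \<forall>x\<in>mspace X. \<exists>\<phi>\<in>locser2_on (mspace X).
        expand_w_zw \<phi> = iterated (mact X) (vmul V) u v x
        \<and> expand_zw \<phi> = nested (mact X) (mact X) u v x)
    \<and> L_structure (kind_of T) (vcharge V) (mspace X) (mL X)
    \<and> action_covariant (kind_of T) (vL V) (mL X) (vspace V) (mspace X) (mact X)
    \<and> (has_conformal_vector (kind_of T) \<longrightarrow>
        (\<forall>x\<in>mspace X. \<forall>n. mact X (vomega V) x (- n - 2) = mL X n x))
    \<and> (case T of Plain K \<Rightarrow> True
        | Equivariant K G \<Rightarrow> group_rep G (mspace X) (mgrp X)
            \<and> commutes_with_L G K (mspace X) (mL X) (mgrp X)
            \<and> equivariant_op G (vspace V) (mspace X) (vgrp V) (mgrp X) (mgrp X) (mact X))"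

definition intertwiners :: "'g setting \<Rightarrow> ('u::complex_vector, 'g) valg
    \<Rightarrow> ('u, 'v1::complex_vector, 'g) vmodule \<Rightarrow> ('u, 'v2::complex_vector, 'g) vmodule
    \<Rightarrow> ('u, 'v3::complex_vector, 'g) vmodule \<Rightarrow> ('v1 \<Rightarrow> 'v2 \<Rightarrow> int \<Rightarrow> 'v3) set" where
  "intertwiners T V M1 M2 M3 = {I \<in> bilin_maps (mspace M1) (mspace M2) (laurent (mspace M3)).
    (\<forall>u\<in>mspace M1. \<forall>v\<in>mspace M2. \<forall>n. ddz (I u v) n = I (mL M1 (- 1) u) v n
        \<and> ddz (I u v) n = mL M3 (- 1) (I u v n) - I u (mL M2 (- 1) v) n)
    \<and> (\<forall>a\<in>vspace V. \<forall>u\<in>mspace M1. \<forall>v\<in>mspace M2. \<exists>\<phi>\<in>locser2_on (mspace M3).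
        expand_zw \<phi> = nested (mact M3) I a u v
        \<and> expand_w_zw \<phi> = iterated I (mact M1) a u v
        \<and> expand_wz \<phi> = (\<lambda>m n. nested I (mact M2) u a v n m))
    \<and> (\<forall>i\<in>L_index (kind_of T). - 1 \<le> i \<longrightarrow>
        L_covariant i (mL M1) (mL M2) (mL M3) (mspace M1) (mspace M2) I)
    \<and> (case T of Plain K \<Rightarrow> True
        | Equivariant K G \<Rightarrow>
            equivariant_op G (mspace M1) (mspace M2) (mgrp M1) (mgrp M2) (mgrp M3) I)}"

subsection \<open>Direct sums and graded vertex algebras\<close>

definition dsum_space :: "('i \<Rightarrow> ('u, 'v::complex_vector, 'g) vmodule) \<Rightarrow> ('i \<Rightarrow>\<^sub>0 'v) set" where
  "dsum_space M = {f. \<forall>i. Poly_Mapping.lookup f i \<in> mspace (M i)}"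

definition component :: "('i \<Rightarrow> ('u, 'v::complex_vector, 'g) vmodule) \<Rightarrow> 'i \<Rightarrow> ('i \<Rightarrow>\<^sub>0 'v) set" where
  "component M i = Poly_Mapping.single i ` mspace (M i)"

definition dsum_op :: "('i \<Rightarrow> 'v \<Rightarrow> 'v) \<Rightarrow> ('i \<Rightarrow>\<^sub>0 'v::complex_vector) \<Rightarrow> 'i \<Rightarrow>\<^sub>0 'v" where
  "dsum_op h f = (\<Sum>i\<in>Poly_Mapping.keys f. Poly_Mapping.single i (h i (Poly_Mapping.lookup f i)))"

definition dsum_module :: "('u, 'g) valg \<Rightarrow> ('i \<Rightarrow> ('u, 'v::complex_vector, 'g) vmodule)
    \<Rightarrow> ('u, 'i \<Rightarrow>\<^sub>0 'v, 'g) vmodule" where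
  "dsum_module V M = \<lparr>mspace = dsum_space M,
    mact = (\<lambda>u f n. if u \<in> vspace V \<and> f \<in> dsum_space M
      then dsum_op (\<lambda>i x. mact (M i) u x n) f else 0),
    mL = (\<lambda>n. dsum_op (\<lambda>i. mL (M i) n)),
    mgrp = (\<lambda>g. dsum_op (\<lambda>i. mgrp (M i) g))\<rparr>"

definition T_compatible :: "'g setting \<Rightarrow> ('u::complex_vector, 'g) valg
    \<Rightarrow> ('i \<Rightarrow> ('u, 'v::complex_vector, 'g) vmodule) \<Rightarrow> bool" where
  "T_compatible T V M \<longleftrightarrow> T_module T V (dsum_module V M)"

definition dsum_mul :: "('i::ab_group_add \<Rightarrow> ('u, 'v::complex_vector, 'g) vmodule)
    \<Rightarrow> ('i \<Rightarrow> 'i \<Rightarrow> 'v \<Rightarrow> 'v \<Rightarrow> int \<Rightarrow> 'v)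
    \<Rightarrow> ('i \<Rightarrow>\<^sub>0 'v) \<Rightarrow> ('i \<Rightarrow>\<^sub>0 'v) \<Rightarrow> int \<Rightarrow> 'i \<Rightarrow>\<^sub>0 'v" where
  "dsum_mul M m f g n = (if f \<in> dsum_space M \<and> g \<in> dsum_space M
    then \<Sum>i\<in>Poly_Mapping.keys f. \<Sum>j\<in>Poly_Mapping.keys g.
      Poly_Mapping.single (i + j) (m i j (Poly_Mapping.lookup f i) (Poly_Mapping.lookup g j) n)
    else 0)"

text \<open>The structure on the direct sum described by a family \<open>m\<close>, with unit and conformal vector
  those of \<open>V = M 0\<close>.\<close>

definition dsum_valg :: "('v, 'g) valg \<Rightarrow> ('i::ab_group_add \<Rightarrow> ('v, 'v::complex_vector, 'g) vmodule)
    \<Rightarrow> ('i \<Rightarrow> 'i \<Rightarrow> 'v \<Rightarrow> 'v \<Rightarrow> int \<Rightarrow> 'v) \<Rightarrow> ('i \<Rightarrow>\<^sub>0 'v, 'g) valg" where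
  "dsum_valg V M m = \<lparr>vspace = dsum_space M,
    vac = Poly_Mapping.single 0 (vac V),
    vmul = dsum_mul M m,
    vL = (\<lambda>n. dsum_op (\<lambda>i. mL (M i) n)),
    vomega = Poly_Mapping.single 0 (vomega V),
    vcharge = vcharge V,
    vgrp = (\<lambda>g. dsum_op (\<lambda>i. mgrp (M i) g))\<rparr>"

definition graded_T_vertex_algebra :: "'g setting \<Rightarrow> ('w::complex_vector, 'g) valg
    \<Rightarrow> ('i::ab_group_add \<Rightarrow> 'w set) \<Rightarrow> bool" where
  "graded_T_vertex_algebra T W C \<longleftrightarrow> T_vertex_algebra T W
    \<and> (\<forall>i. complex_vector.subspace (C i) \<and> C i \<subseteq> vspace W)
    \<and> (\<forall>x\<in>vspace W. \<exists>!f. (\<forall>i. Poly_Mapping.lookup f i \<in> C i)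
        \<and> x = (\<Sum>i\<in>Poly_Mapping.keys f. Poly_Mapping.lookup f i))
    \<and> vac W \<in> C 0
    \<and> (\<forall>i j. \<forall>u\<in>C i. \<forall>v\<in>C j. \<forall>n. vmul W u v n \<in> C (i + j))
    \<and> (\<forall>k\<in>L_index (kind_of T). \<forall>i. vL W k ` C i \<subseteq> C i)
    \<and> (has_conformal_vector (kind_of T) \<longrightarrow> vomega W \<in> C 0)
    \<and> (case T of Plain K \<Rightarrow> True
        | Equivariant K G \<Rightarrow> \<forall>g\<in>carrier G. \<forall>i. vgrp W g ` C i \<subseteq> C i)"

text \<open>A graded structure on the direct sum of the \<open>M i\<close> whose multiplication is given by \<open>m\<close> and
  which restricts to the given operators on the \<open>M i\<close>; unit and conformal vector are
  not prescribed.\<close>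

definition graded_structure :: "'g setting \<Rightarrow> ('i::ab_group_add \<Rightarrow> ('v, 'v::complex_vector, 'g) vmodule)
    \<Rightarrow> ('i \<Rightarrow> 'i \<Rightarrow> 'v \<Rightarrow> 'v \<Rightarrow> int \<Rightarrow> 'v) \<Rightarrow> ('i \<Rightarrow>\<^sub>0 'v, 'g) valg \<Rightarrow> bool" where
  "graded_structure T M m W \<longleftrightarrow> vspace W = dsum_space M \<and> vmul W = dsum_mul M m
    \<and> (\<forall>k\<in>L_index (kind_of T). \<forall>f\<in>dsum_space M. vL W k f = dsum_op (\<lambda>i. mL (M i) k) f)
    \<and> (case T of Plain K \<Rightarrow> True
        | Equivariant K G \<Rightarrow> \<forall>g\<in>carrier G. \<forall>f\<in>dsum_space M.
            vgrp W g f = dsum_op (\<lambda>i. mgrp (M i) g) f)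
    \<and> graded_T_vertex_algebra T W (component M)"

definition graded_isomorphic :: "'g setting \<Rightarrow> ('w::complex_vector, 'g) valg \<Rightarrow> ('i \<Rightarrow> 'w set)
    \<Rightarrow> ('x::complex_vector, 'g) valg \<Rightarrow> ('i \<Rightarrow> 'x set) \<Rightarrow> bool" where
  "graded_isomorphic T W C X D \<longleftrightarrow> (\<exists>\<phi>. lin_map (vspace W) (vspace X) \<phi>
    \<and> bij_betw \<phi> (vspace W) (vspace X) \<and> (\<forall>i. \<phi> ` C i = D i)
    \<and> \<phi> (vac W) = vac X
    \<and> (\<forall>u\<in>vspace W. \<forall>v\<in>vspace W. \<forall>n. \<phi> (vmul W u v n) = vmul X (\<phi> u) (\<phi> v) n)
    \<and> (\<forall>k\<in>L_index (kind_of T). \<forall>x\<in>vspace W. \<phi> (vL W k x) = vL X k (\<phi> x))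
    \<and> (has_conformal_vector (kind_of T) \<longrightarrow> \<phi> (vomega W) = vomega X)
    \<and> (case T of Plain K \<Rightarrow> True
        | Equivariant K G \<Rightarrow> \<forall>g\<in>carrier G. \<forall>x\<in>vspace W. \<phi> (vgrp W g x) = vgrp X g (\<phi> x)))"

subsection \<open>One-dimensional associativity and commutativity data\<close>

text \<open>\<open>I i j\<close> is the space of intertwining operators from \<open>M i\<close> and \<open>M j\<close> to \<open>M (i + j)\<close>.\<close>

definition associativity_datum :: "'g setting \<Rightarrow> ('v::complex_vector, 'g) valg
    \<Rightarrow> ('a::ab_group_add \<Rightarrow> ('v, 'v, 'g) vmodule)
    \<Rightarrow> ('a \<Rightarrow> 'a \<Rightarrow> ('v \<Rightarrow> 'v \<Rightarrow> int \<Rightarrow> 'v) set) \<Rightarrow> bool" where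
  "associativity_datum T V M I \<longleftrightarrow>
    (\<forall>i j. one_dimensional (I i j) \<and> I i j \<subseteq> intertwiners T V (M i) (M j) (M (i + j)))
    \<and> (\<forall>i j k. \<exists>S. one_dimensional S
        \<and> S \<subseteq> trilin_maps (mspace (M i)) (mspace (M j)) (mspace (M k))
            (locser2_on (mspace (M (i + j + k))))
        \<and> (\<exists>\<beta>. (\<forall>p\<in>I i (j + k). \<forall>q\<in>I j k. \<forall>u\<in>mspace (M i). \<forall>v\<in>mspace (M j). \<forall>x\<in>mspace (M k).
              expand_zw (\<beta> p q u v x) = nested p q u v x)
            \<and> tensor_iso2 \<beta> (I i (j + k)) (I j k) S)
        \<and> (\<exists>\<gamma>. (\<forall>p\<in>I (i + j) k. \<forall>q\<in>I i j. \<forall>u\<in>mspace (M i). \<forall>v\<in>mspace (M j). \<forall>x\<in>mspace (M k).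
              expand_w_zw (\<gamma> p q u v x) = iterated p q u v x)
            \<and> tensor_iso2 \<gamma> (I (i + j) k) (I i j) S))
    \<and> (\<forall>i j k l. \<exists>S. one_dimensional S
        \<and> S \<subseteq> quadrilin_maps (mspace (M i)) (mspace (M j)) (mspace (M k)) (mspace (M l))
            (locser3_on (mspace (M (i + j + k + l))))
        \<and> (\<exists>\<beta>. (\<forall>p\<in>I i (j + k + l). \<forall>q\<in>I j (k + l). \<forall>r\<in>I k l.
              \<forall>u\<in>mspace (M i). \<forall>v\<in>mspace (M j). \<forall>x\<in>mspace (M k). \<forall>y\<in>mspace (M l).
                expand_zwt (\<beta> p q r u v x y) = (\<lambda>m n s. p u (q v (r x y s) n) m))
            \<and> tensor_iso3 \<beta> (I i (j + k + l)) (I j (k + l)) (I k l) S))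
    \<and> (\<forall>i. I 0 i = complex_vector.span {mact (M i)}
        \<and> I i 0 = complex_vector.span {skew (mL (M i)) (mact (M i))})"

definition commutativity_datum :: "'g setting \<Rightarrow> ('v::complex_vector, 'g) valg
    \<Rightarrow> ('a::ab_group_add \<Rightarrow> ('v, 'v, 'g) vmodule)
    \<Rightarrow> ('a \<Rightarrow> 'a \<Rightarrow> ('v \<Rightarrow> 'v \<Rightarrow> int \<Rightarrow> 'v) set) \<Rightarrow> bool" where
  "commutativity_datum T V M I \<longleftrightarrow> associativity_datum T V M I
    \<and> (\<forall>i j. \<forall>p\<in>I i j. p \<noteq> 0 \<longrightarrow> skew (mL (M (i + j))) p \<in> I j i)"

definition families :: "('a \<Rightarrow> 'a \<Rightarrow> 'p set) \<Rightarrow> ('a \<Rightarrow> 'a \<Rightarrow> 'p) set" where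
  "families I = {m. \<forall>i j. m i j \<in> I i j}"

definition choices :: "('a \<Rightarrow> 'a \<Rightarrow> 'p::zero set) \<Rightarrow> ('a \<Rightarrow> 'a \<Rightarrow> 'p) set" where
  "choices I = {m \<in> families I. \<forall>i j. m i j \<noteq> 0}"

definition normalized_choice :: "('a::ab_group_add \<Rightarrow> ('v, 'v::complex_vector, 'g) vmodule)
    \<Rightarrow> ('a \<Rightarrow> 'a \<Rightarrow> 'v \<Rightarrow> 'v \<Rightarrow> int \<Rightarrow> 'v) \<Rightarrow> bool" where
  "normalized_choice M m \<longleftrightarrow>
    (\<forall>i. m 0 i = mact (M i) \<and> m i 0 = skew (mL (M i)) (mact (M i)))"

definition associated :: "('a::ab_group_add \<Rightarrow> ('v, 'v::complex_vector, 'g) vmodule)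
    \<Rightarrow> ('a \<Rightarrow> 'a \<Rightarrow> 'v \<Rightarrow> 'v \<Rightarrow> int \<Rightarrow> 'v)
    \<Rightarrow> ('a \<Rightarrow> 'a \<Rightarrow> 'a \<Rightarrow> complex) \<Rightarrow> ('a \<Rightarrow> 'a \<Rightarrow> complex) \<Rightarrow> bool" where
  "associated M m F \<Omega> \<longleftrightarrow>
    (\<forall>i j k. F i j k \<noteq> 0 \<and>
      (\<forall>u\<in>mspace (M i). \<forall>v\<in>mspace (M j). \<forall>x\<in>mspace (M k).
        \<exists>\<phi>\<in>locser2_on (mspace (M (i + j + k))). \<exists>\<psi>\<in>locser2_on (mspace (M (i + j + k))).
          expand_zw \<phi> = nested (m i (j + k)) (m j k) u v x
          \<and> expand_w_zw \<psi> = iterated (m (i + j) k) (m i j) u v x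
          \<and> \<phi> = F i j k *\<^sub>C \<psi>))
    \<and> (\<forall>i j. \<Omega> i j \<noteq> 0 \<and> m i j = \<Omega> i j *\<^sub>C skew (mL (M (i + j))) (m j i))"

type_synonym 'a ab3cochain = "('a \<Rightarrow> 'a \<Rightarrow> 'a \<Rightarrow> complex) \<times> ('a \<Rightarrow> 'a \<Rightarrow> complex)"

definition associated_pair :: "('a::ab_group_add \<Rightarrow> ('v, 'v::complex_vector, 'g) vmodule)
    \<Rightarrow> ('a \<Rightarrow> 'a \<Rightarrow> 'v \<Rightarrow> 'v \<Rightarrow> int \<Rightarrow> 'v)
    \<Rightarrow> 'a ab3cochain" where
  "associated_pair M m = (THE p. associated M m (fst p) (snd p))"

subsection \<open>Abelian cohomology\<close>

definition C2ab :: "('a::ab_group_add \<Rightarrow> 'a \<Rightarrow> complex) monoid" where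
  "C2ab = \<lparr>carrier = {l. \<forall>i j. l i j \<noteq> 0}, mult = (\<lambda>l l' i j. l i j * l' i j), one = (\<lambda>i j. 1)\<rparr>"

definition abelian_3cocycle :: "'a::ab_group_add ab3cochain \<Rightarrow> bool" where
  "abelian_3cocycle p \<longleftrightarrow> (case p of (F, \<Omega>) \<Rightarrow>
    (\<forall>i j k. F i j k \<noteq> 0) \<and> (\<forall>i j. \<Omega> i j \<noteq> 0)
    \<and> (\<forall>i j k l. F i j k * F i (j + k) l * F j k l = F (i + j) k l * F i j (k + l))
    \<and> (\<forall>i j k. inverse (F i j k) * \<Omega> i (j + k) * inverse (F j k i)
        = \<Omega> i j * inverse (F j i k) * \<Omega> i k)
    \<and> (\<forall>i j k. F i j k * \<Omega> (i + j) k * F k i j = \<Omega> j k * F i k j * \<Omega> i k))"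

definition Z3ab :: "'a::ab_group_add ab3cochain monoid" where
  "Z3ab = \<lparr>carrier = {p. abelian_3cocycle p},
    mult = (\<lambda>p q. (\<lambda>i j k. fst p i j k * fst q i j k, \<lambda>i j. snd p i j * snd q i j)),
    one = (\<lambda>i j k. 1, \<lambda>i j. 1)\<rparr>"

definition ab_diff :: "('a::ab_group_add \<Rightarrow> 'a \<Rightarrow> complex)
    \<Rightarrow> 'a ab3cochain" where
  "ab_diff l = (\<lambda>i j k. l j k * l i (j + k) / (l (i + j) k * l i j), \<lambda>i j. l i j / l j i)"

definition Z2ab :: "('a::ab_group_add \<Rightarrow> 'a \<Rightarrow> complex) set" where
  "Z2ab = {l \<in> carrier C2ab. ab_diff l = \<one>\<^bsub>Z3ab\<^esub>}"

definition B3ab :: "'a::ab_group_add ab3cochain set" where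
  "B3ab = ab_diff ` carrier C2ab"

definition H3ab :: "'a::ab_group_add ab3cochain set monoid" where
  "H3ab = Z3ab Mod B3ab"

definition cohomology_class :: "'a::ab_group_add ab3cochain
    \<Rightarrow> 'a ab3cochain set" where
  "cohomology_class p = B3ab #>\<^bsub>Z3ab\<^esub> p"

definition normalized_cochain :: "('a::ab_group_add \<Rightarrow> 'a \<Rightarrow> complex) \<Rightarrow> bool" where
  "normalized_cochain l \<longleftrightarrow> (\<forall>i. l 0 i = 1 \<and> l i 0 = 1)"

definition quadratic_form :: "('a::ab_group_add \<Rightarrow> complex) \<Rightarrow> bool" where
  "quadratic_form Q \<longleftrightarrow> (\<forall>i. Q i \<noteq> 0) \<and> (\<forall>i. Q i = Q (- i))
    \<and> (\<forall>i j k. Q (i + j + k) * Q i * Q j * Q k / (Q (i + j) * Q (i + k) * Q (j + k)) = 1)"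

definition rescale :: "('a \<Rightarrow> 'a \<Rightarrow> complex) \<Rightarrow> ('a \<Rightarrow> 'a \<Rightarrow> 'p::complex_vector) \<Rightarrow> 'a \<Rightarrow> 'a \<Rightarrow> 'p" where
  "rescale l m = (\<lambda>i j. l i j *\<^sub>C m i j)"

definition translate :: "('a::ab_group_add \<Rightarrow> 'a \<Rightarrow> complex)
    \<Rightarrow> 'a ab3cochain
    \<Rightarrow> 'a ab3cochain" where
  "translate l p = ab_diff l \<otimes>\<^bsub>Z3ab\<^esub> p"

end

theory Submission
  imports Defs "HOL-Library.Multiset" "HOL-Computational_Algebra.Formal_Power_Series"
begin

text \<open>Let \<open>\<tau>(i, j, k) = F(i, j, k) \<Omega>(i, j) / F(j, i, k)\<close>, the scalar by which \<open>x(yz)\<close> and \<open>y(xz)\<close> differ for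
  \<open>x, y, z\<close> in \<open>M i\<close>, \<open>M j\<close>, \<open>M k\<close>. A four-fold product becomes a power series after multiplication by enough
  linear forms, and this power series can be transported between the expansion regions. Comparing two ways of
  reassociating it gives the pentagon; comparing two ways of moving the first factor past the
  next two gives \<open>F(j, k, l) \<tau>(i, j + k, l) = F(j, k, i + l) \<tau>(i, j, k + l) \<tau>(i, k, l)\<close>, which for \<open>l = 0\<close> is a
  hexagon. As skew-symmetry is an involution, \<open>\<Omega>(i, j) \<Omega>(j, i) = 1\<close>, and the other hexagon follows.

  If \<open>\<Omega>(i, i) = 1\<close> for all \<open>i\<close>, then \<open>\<tau>\<close> defines a consistent scalar for sorting words in \<open>A\<close>, so \<open>(F, \<Omega>)\<close>
  becomes a coboundary on the free commutative monoid on \<open>A\<close>; since \<open>\<complex>\<^sup>\<times>\<close> is divisible, the coboundary descends to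
  \<open>A\<close>. The rescaled maps satisfy locality, because \<open>\<tau> = 1\<close> for them. Conversely locality forces
  \<open>\<tau> = 1\<close>, hence \<open>F = 1\<close> and \<open>\<Omega> = 1\<close>. Two graded structures therefore differ by a symmetric 2-cocycle, which is a
  coboundary, again by divisibility.\<close>

subsection \<open>Symmetric two-cocycles with values in the nonzero complex numbers\<close>

text \<open>The datum embeds a four-fold product in one expansion region only. Every reassociation
  or exchange is therefore a relation between series in two variables, imposed on two exponents
  while the third is held fixed. Such a relation is a partial function and respects multiplication
  by linear forms. So the forms that clear the denominator at the start of a path clear it, after
  substitution, all along the path, and two paths end in the same nonzero power series up to the
  scalars to be compared. One-dimensionality of the given spaces of products supplies the
  nonvanishing.

  On the algebraic side, sorting is consistent only if exchanging two equal letters costs nothing,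
  and this is where the diagonal of \<Omega> enters. What keeps the resulting trivialization on
  multisets from depending on sums alone is a symmetric cocycle on the multisets of sum 0. These
  form a monoid without inverses, which is why characters are extended over cancellative commutative
  monoids and not over groups.\<close>

lemma complex_root_exists:
  fixes z :: complex
  assumes "n > 0"
  shows "\<exists>c. c ^ n = z"
proof -
  obtain r a where z: "z = rcis r a" and r: "0 \<le> r"
    using rcis_cmod_Arg norm_ge_zero by metis
  have "rcis (root n r) (a / real n) ^ n = z"
    using assms r by (simp add: DeMoivre2 z)
  then show ?thesis by blast
qed

text \<open>A multiplicative function on a multiplicatively closed subset, encoded as its graph:
  extension becomes inclusion, and the union of a chain is again of this kind.\<close>

definition partial_character :: "('e, 'x) monoid_scheme \<Rightarrow> ('e \<times> complex) set \<Rightarrow> bool" where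
  "partial_character G \<Gamma> \<longleftrightarrow> \<Gamma> \<subseteq> carrier G \<times> (- {0}) \<and> single_valued \<Gamma>
    \<and> (\<forall>x c y d. (x, c) \<in> \<Gamma> \<longrightarrow> (y, d) \<in> \<Gamma> \<longrightarrow> (x \<otimes>\<^bsub>G\<^esub> y, c * d) \<in> \<Gamma>)"

lemma partial_character_Union:
  assumes "\<And>\<Gamma>. \<Gamma> \<in> \<C> \<Longrightarrow> partial_character G \<Gamma>" "\<And>\<Gamma> \<Delta>. \<Gamma> \<in> \<C> \<Longrightarrow> \<Delta> \<in> \<C> \<Longrightarrow> \<Gamma> \<subseteq> \<Delta> \<or> \<Delta> \<subseteq> \<Gamma>"
  shows "partial_character G (\<Union>\<C>)"
proof -
  have both: "\<exists>\<Gamma>\<in>\<C>. p \<in> \<Gamma> \<and> q \<in> \<Gamma>" if "p \<in> \<Union>\<C>" "q \<in> \<Union>\<C>" for p q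
    using that assms(2) by blast
  show ?thesis
    unfolding partial_character_def
  proof (intro conjI allI impI)
    show "\<Union>\<C> \<subseteq> carrier G \<times> - {0}" using assms(1) unfolding partial_character_def by blast
    show "single_valued (\<Union>\<C>)"
    proof (rule single_valuedI)
      fix x c d assume "(x, c) \<in> \<Union>\<C>" "(x, d) \<in> \<Union>\<C>"
      then show "c = d" using both assms(1) unfolding partial_character_def
        by (meson single_valuedD)
    qed
    fix x c y d assume "(x, c) \<in> \<Union>\<C>" "(y, d) \<in> \<Union>\<C>"
    then show "(x \<otimes>\<^bsub>G\<^esub> y, c * d) \<in> \<Union>\<C>" using both assms(1) unfolding partial_character_def
      by (metis UnionI)
  qed
qed

context comm_monoid
begin

text \<open>Adjoining \<open>x\<close> constrains the value \<open>c\<close> only through equations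
  \<open>h x^n = k\<close> with \<open>h\<close> and \<open>k\<close> already in the domain. The
  smallest positive exponent \<open>d\<close> that occurs determines \<open>c\<close> up to a
  \<open>d\<close>-th root of unity, and every such root satisfies the remaining equations by
  descent on the exponent. If there is no such equation, \<open>c = 1\<close> works.\<close>

lemma partial_character_extend:
  assumes cancel: "\<forall>z\<in>carrier G. inj_on (\<lambda>x. x \<otimes> z) (carrier G)"
    and \<Gamma>: "partial_character G \<Gamma>" and one: "(\<one>, 1) \<in> \<Gamma>" and x: "x \<in> carrier G"
  shows "\<exists>\<Delta> c. partial_character G \<Delta> \<and> \<Gamma> \<subseteq> \<Delta> \<and> (x, c) \<in> \<Delta>"
proof -
  have carr: "h \<in> carrier G" "a \<noteq> 0" if "(h, a) \<in> \<Gamma>" for h a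
    using \<Gamma> that unfolding partial_character_def by auto
  have mult: "(h \<otimes> k, a * b) \<in> \<Gamma>" if "(h, a) \<in> \<Gamma>" "(k, b) \<in> \<Gamma>" for h k a b
    using \<Gamma> that unfolding partial_character_def by blast
  have sv: "a = b" if "(h, a) \<in> \<Gamma>" "(h, b) \<in> \<Gamma>" for h a b
    using \<Gamma> that unfolding partial_character_def by (meson single_valuedD)
  let ?D = "\<lambda>n::nat. n > 0 \<and> (\<exists>h a k b. (h, a) \<in> \<Gamma> \<and> (k, b) \<in> \<Gamma> \<and> h \<otimes> x [^] n = k)"
  obtain c where c: "c \<noteq> 0"
    and key: "\<And>n h a k b. (h, a) \<in> \<Gamma> \<Longrightarrow> (k, b) \<in> \<Gamma> \<Longrightarrow> h \<otimes> x [^] n = k \<Longrightarrow> b = a * c ^ (n::nat)"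
  proof (cases "\<exists>n. ?D n")
    case False
    have "b = a * 1 ^ n" if "(h, a) \<in> \<Gamma>" "(k, b) \<in> \<Gamma>" "h \<otimes> x [^] n = k" for n :: nat and h a k b
    proof -
      have "\<not> ?D n" using False by blast
      then have "\<not> n > 0" using that by metis
      then show ?thesis using that carr sv by simp
    qed
    then show ?thesis using that[of 1] by simp
  next
    case True
    define d where "d = (LEAST n. ?D n)"
    have "?D d" unfolding d_def using True by (rule LeastI_ex)
    then obtain h0 a0 k0 b0 where d: "d > 0" and 0: "(h0, a0) \<in> \<Gamma>" "(k0, b0) \<in> \<Gamma>" "h0 \<otimes> x [^] d = k0"
      by metis
    obtain c where c: "c ^ d = b0 / a0" using complex_root_exists[OF d] by blast
    have c0: "c \<noteq> 0" using c d carr(2)[OF 0(1)] carr(2)[OF 0(2)] by (auto simp: power_0_left)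
    have "b = a * c ^ n" if "(h, a) \<in> \<Gamma>" "(k, b) \<in> \<Gamma>" "h \<otimes> x [^] n = k" for n :: nat and h a k b
      using that
    proof (induction n arbitrary: h a k b rule: less_induct)
      case (less n)
      show ?case
      proof (cases "n < d")
        case True
        then have "\<not> ?D n" unfolding d_def by (rule not_less_Least)
        then have "\<not> n > 0" using less.prems by metis
        then show ?thesis using less.prems carr sv by simp
      next
        case False
        then obtain r where r: "n = d + r" using le_Suc_ex not_less by blast
        note C = carr(1)[OF 0(1)] carr(1)[OF 0(2)] carr(1)[OF less.prems(1)] carr(1)[OF less.prems(2)] x
        have "(h \<otimes> k0) \<otimes> x [^] r = (h \<otimes> (h0 \<otimes> x [^] d)) \<otimes> x [^] r" using 0 by simp
        also have "\<dots> = h0 \<otimes> (h \<otimes> (x [^] d \<otimes> x [^] r))" using C by (simp add: m_ac)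
        also have "\<dots> = h0 \<otimes> k" using C less.prems(3) r by (simp add: nat_pow_mult)
        finally have "a0 * b = a * b0 * c ^ r"
          using less.IH[of r, OF _ mult[OF less.prems(1) 0(2)] mult[OF 0(1) less.prems(2)]] r d by simp
        moreover have "b0 = a0 * c ^ d" using c carr(2)[OF 0(1)] by simp
        ultimately show ?thesis using carr(2)[OF 0(1)] by (simp add: r power_add mult_ac)
      qed
    qed
    then show ?thesis by (rule that[OF c0])
  qed
  define \<Delta> where "\<Delta> = {(h \<otimes> x [^] n, a * c ^ n) | h a n. (h, a) \<in> \<Gamma> \<and> n \<in> (UNIV :: nat set)}"
  \<comment> \<open>Cancelling \<open>x^l\<close> reduces the equality of two presentations of one
    element to an equation of the kind settled by \<open>key\<close>.\<close>
  have le: "a * c ^ n = b * c ^ l" if "(h, a) \<in> \<Gamma>" "(k, b) \<in> \<Gamma>" "l \<le> n" "h \<otimes> x [^] n = k \<otimes> x [^] l"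
    for h a k b and n l :: nat
  proof -
    have "\<exists>r. n = l + r" using that(3) le_Suc_ex by blast
    then obtain r where r: "n = l + r" ..
    note C = carr(1)[OF that(1)] carr(1)[OF that(2)] x
    have "h \<otimes> x [^] r \<otimes> x [^] l = h \<otimes> x [^] (r + l)" using C by (simp add: m_assoc nat_pow_mult)
    also have "\<dots> = k \<otimes> x [^] l" using that(4) by (simp add: r add.commute)
    finally have "h \<otimes> x [^] r = k"
      using inj_onD[OF bspec[OF cancel, of "x [^] l"], of "h \<otimes> x [^] r" k] C by simp
    then show ?thesis using key[OF that(1,2)] by (simp add: r power_add)
  qed
  have eq: "a * c ^ n = b * c ^ l" if "(h, a) \<in> \<Gamma>" "(k, b) \<in> \<Gamma>" "h \<otimes> x [^] n = k \<otimes> x [^] l"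
    for h a k b and n l :: nat
    using le[OF that(1,2) _ that(3)] le[OF that(2,1) _ that(3)[symmetric]] by (cases "l \<le> n") simp_all
  have "single_valued \<Delta>"
  proof (rule single_valuedI)
    fix p s t assume "(p, s) \<in> \<Delta>" "(p, t) \<in> \<Delta>"
    then obtain h a n k b l where "(h, a) \<in> \<Gamma>" "(k, b) \<in> \<Gamma>" "p = h \<otimes> x [^] (n::nat)" "s = a * c ^ n"
      "p = k \<otimes> x [^] (l::nat)" "t = b * c ^ l" unfolding \<Delta>_def by blast
    then show "s = t" using eq[of h a k b n l] by simp
  qed
  moreover have "\<Delta> \<subseteq> carrier G \<times> - {0}" using carr x c unfolding \<Delta>_def by auto
  moreover have "(p \<otimes> q, s * t) \<in> \<Delta>" if pq: "(p, s) \<in> \<Delta>" "(q, t) \<in> \<Delta>" for p s q t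
  proof -
    obtain h a n where 1: "p = h \<otimes> x [^] (n::nat)" "s = a * c ^ n" "(h, a) \<in> \<Gamma>"
      using pq(1) unfolding \<Delta>_def by blast
    obtain k b l where 2: "q = k \<otimes> x [^] (l::nat)" "t = b * c ^ l" "(k, b) \<in> \<Gamma>"
      using pq(2) unfolding \<Delta>_def by blast
    have "p \<otimes> q = h \<otimes> k \<otimes> x [^] (n + l)"
      using carr(1)[OF 1(3)] carr(1)[OF 2(3)] x by (simp add: 1 2 m_ac flip: nat_pow_mult)
    moreover have "s * t = a * b * c ^ (n + l)" by (simp add: 1 2 power_add)
    ultimately show ?thesis using mult[OF 1(3) 2(3)] unfolding \<Delta>_def by blast
  qed
  ultimately have "partial_character G \<Delta>" unfolding partial_character_def by blast
  moreover have "\<Gamma> \<subseteq> \<Delta>"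
  proof
    fix p assume "p \<in> \<Gamma>"
    then obtain h a where "p = (h, a)" "(h, a) \<in> \<Gamma>" by (cases p) auto
    then show "p \<in> \<Delta>" unfolding \<Delta>_def using carr by (force intro: exI[of _ "0::nat"])
  qed
  moreover have "(x, c) \<in> \<Delta>" unfolding \<Delta>_def using one x by (force intro: exI[of _ "1::nat"])
  ultimately show ?thesis by (intro exI conjI)
qed

text \<open>By Zorn's lemma there is a maximal extension, and the one-element step shows that it is
  defined everywhere.\<close>

lemma character_extension:
  assumes cancel: "\<forall>z\<in>carrier G. inj_on (\<lambda>x. x \<otimes> z) (carrier G)"
    and \<Gamma>: "partial_character G \<Gamma>" and one: "(\<one>, 1) \<in> \<Gamma>"
  shows "\<exists>\<chi>. (\<forall>x\<in>carrier G. \<chi> x \<noteq> 0) \<and> (\<forall>(x, c)\<in>\<Gamma>. \<chi> x = c)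
    \<and> (\<forall>x\<in>carrier G. \<forall>y\<in>carrier G. \<chi> (x \<otimes> y) = \<chi> x * \<chi> y)"
proof -
  let ?A = "{\<Delta>. \<Gamma> \<subseteq> \<Delta> \<and> partial_character G \<Delta>}"
  have "\<exists>\<Delta>\<in>?A. \<forall>X\<in>?A. \<Delta> \<subseteq> X \<longrightarrow> X = \<Delta>"
  proof (rule subset_Zorn_nonempty)
    show "?A \<noteq> {}" using \<Gamma> by blast
    fix \<C> assume ne: "\<C> \<noteq> {}" and ch: "subset.chain ?A \<C>"
    from ch have "partial_character G (\<Union>\<C>)"
      by (intro partial_character_Union) (auto simp: subset_chain_def)
    moreover have "\<Gamma> \<subseteq> \<Union>\<C>" using ne ch by (fastforce simp: subset_chain_def)
    ultimately show "\<Union>\<C> \<in> ?A" by simp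
  qed
  then obtain \<Delta> where "\<Delta> \<in> ?A" and mx: "\<forall>X\<in>?A. \<Delta> \<subseteq> X \<longrightarrow> X = \<Delta>" by (rule bexE)
  then have \<Delta>: "\<Gamma> \<subseteq> \<Delta>" "partial_character G \<Delta>" by simp_all
  have dom: "\<exists>c. (x, c) \<in> \<Delta>" if x: "x \<in> carrier G" for x
  proof -
    have "(\<one>, 1) \<in> \<Delta>" using \<Delta>(1) one by (rule subsetD)
    obtain \<Delta>' c where \<Delta>': "partial_character G \<Delta>'" "\<Delta> \<subseteq> \<Delta>'" "(x, c) \<in> \<Delta>'"
      using partial_character_extend[OF cancel \<Delta>(2) \<open>(\<one>, 1) \<in> \<Delta>\<close> x] by blast
    have "\<Delta>' = \<Delta>" using mx \<Delta>'(1,2) subset_trans[OF \<Delta>(1) \<Delta>'(2)] by simp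
    then show ?thesis using \<Delta>'(3) by blast
  qed
  define \<chi> where "\<chi> x = (THE c. (x, c) \<in> \<Delta>)" for x
  have \<chi>: "\<chi> x = c" if "(x, c) \<in> \<Delta>" for x c
    unfolding \<chi>_def using that \<Delta>(2) unfolding partial_character_def
    by (auto dest: single_valuedD)
  show ?thesis
  proof (intro exI[of _ \<chi>] conjI ballI)
    show "case p of (x, c) \<Rightarrow> \<chi> x = c" if "p \<in> \<Gamma>" for p using that \<chi> \<Delta>(1) by auto
    fix x assume x: "x \<in> carrier G"
    then obtain c where "(x, c) \<in> \<Delta>" using dom by blast
    then show "\<chi> x \<noteq> 0" using \<chi> \<Delta>(2) unfolding partial_character_def by auto
    fix y assume "y \<in> carrier G"
    with x obtain c d where "(x, c) \<in> \<Delta>" "(y, d) \<in> \<Delta>" using dom by blast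
    moreover have "(x \<otimes> y, c * d) \<in> \<Delta>" using calculation \<Delta>(2) unfolding partial_character_def by blast
    ultimately show "\<chi> (x \<otimes> y) = \<chi> x * \<chi> y" using \<chi> by simp
  qed
qed

end

text \<open>A symmetric 2-cocycle is a coboundary: the commutative extension by \<open>\<complex>\<^sup>\<times>\<close> it defines splits,
  because the identity of \<open>\<complex>\<^sup>\<times>\<close> extends to a character of the extension.\<close>

lemma symmetric_cocycle_coboundary:
  fixes K :: "'p::cancel_comm_monoid_add set" and f :: "'p \<Rightarrow> 'p \<Rightarrow> complex"
  assumes K0: "0 \<in> K" and K: "\<And>s t. s \<in> K \<Longrightarrow> t \<in> K \<Longrightarrow> s + t \<in> K"
    and nz: "\<And>s t. s \<in> K \<Longrightarrow> t \<in> K \<Longrightarrow> f s t \<noteq> 0"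
    and sym: "\<And>s t. s \<in> K \<Longrightarrow> t \<in> K \<Longrightarrow> f s t = f t s"
    and norm: "\<And>s. s \<in> K \<Longrightarrow> f 0 s = 1"
    and coc: "\<And>s t r. s \<in> K \<Longrightarrow> t \<in> K \<Longrightarrow> r \<in> K \<Longrightarrow> f s t * f (s + t) r = f t r * f s (t + r)"
  shows "\<exists>\<mu>. (\<forall>s\<in>K. \<mu> s \<noteq> 0) \<and> (\<forall>s\<in>K. \<forall>t\<in>K. f s t * \<mu> (s + t) = \<mu> s * \<mu> t)"
proof -
  define E :: "(complex \<times> 'p) monoid" where "E = \<lparr>carrier = (- {0}) \<times> K,
    monoid.mult = (\<lambda>p q. (fst p * fst q * f (snd p) (snd q), snd p + snd q)), one = (1, 0)\<rparr>"
  have E: "comm_monoid E"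
  proof (rule comm_monoidI)
    fix x y z assume "x \<in> carrier E" "y \<in> carrier E" "z \<in> carrier E"
    then show "x \<otimes>\<^bsub>E\<^esub> y \<otimes>\<^bsub>E\<^esub> z = x \<otimes>\<^bsub>E\<^esub> (y \<otimes>\<^bsub>E\<^esub> z)"
      using coc[of "snd x" "snd y" "snd z"] by (auto simp: E_def add.assoc)
    show "x \<otimes>\<^bsub>E\<^esub> y = y \<otimes>\<^bsub>E\<^esub> x" using \<open>x \<in> carrier E\<close> \<open>y \<in> carrier E\<close> sym by (auto simp: E_def add.commute)
  qed (auto simp: E_def K0 K nz norm)
  interpret comm_monoid E by (rule E)
  \<comment> \<open>The copy of the nonzero complex numbers inside \<open>E\<close>, with its
    identity character.\<close>
  let ?\<Gamma> = "{((c, 0 :: 'p), c) | c. c \<noteq> (0::complex)}"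
  have pc: "partial_character E ?\<Gamma>"
    by (auto simp: partial_character_def E_def K0 norm single_valued_def)
  have cancel: "\<forall>z\<in>carrier E. inj_on (\<lambda>x. x \<otimes>\<^bsub>E\<^esub> z) (carrier E)"
    using nz by (auto simp: E_def inj_on_def)
  have one: "(\<one>\<^bsub>E\<^esub>, 1) \<in> ?\<Gamma>" by (simp add: E_def)
  obtain \<chi> where \<chi>: "\<forall>x\<in>carrier E. \<chi> x \<noteq> 0" "\<forall>(x, c)\<in>?\<Gamma>. \<chi> x = c"
      "\<forall>x\<in>carrier E. \<forall>y\<in>carrier E. \<chi> (x \<otimes>\<^bsub>E\<^esub> y) = \<chi> x * \<chi> y"
    using character_extension[OF cancel pc one] by blast
  have in_E: "(c, s) \<in> carrier E" if "c \<noteq> 0" "s \<in> K" for c s using that by (simp add: E_def)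
  \<comment> \<open>In \<open>E\<close> the product of \<open>(1, s)\<close> and
    \<open>(1, t)\<close> is \<open>(f s t, 0)\<close> times \<open>(1, s + t)\<close>. A character
    that is the identity on the first factor turns this into the coboundary equation.\<close>
  have "f s t * \<chi> (1, s + t) = \<chi> (1, s) * \<chi> (1, t)" if st: "s \<in> K" "t \<in> K" for s t
  proof -
    have "\<chi> (f s t, s + t) = \<chi> (f s t, 0) * \<chi> (1, s + t)"
      using bspec[OF bspec[OF \<chi>(3)], of "(f s t, 0)" "(1, s + t)"] in_E K0 K[OF st] nz[OF st] norm[OF K[OF st]] by (simp add: E_def)
    moreover have "\<chi> (f s t, s + t) = \<chi> (1, s) * \<chi> (1, t)"
      using bspec[OF bspec[OF \<chi>(3)], of "(1, s)" "(1, t)"] in_E st by (simp add: E_def)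
    moreover have "\<chi> (f s t, 0) = f s t" using bspec[OF \<chi>(2), of "((f s t, 0), f s t)"] nz[OF st] by simp
    ultimately show ?thesis by simp
  qed
  then show ?thesis using \<chi>(1) in_E by (intro exI[of _ "\<lambda>s. \<chi> (1, s)"]) simp
qed

subsection \<open>Abelian three-cocycles with trivial quadratic form\<close>

text \<open>Adjacent transpositions generate all rearrangements. The prefix \<open>p\<close> is
  generalized so that a first letter, once it agrees, can be absorbed into it.\<close>

lemma swap_invariant_mset:
  assumes swap: "\<And>u x y v. f (u @ x # y # v) = f (u @ y # x # v)" and "mset w = mset w'"
  shows "f w = f w'"
proof -
  have move: "f (p @ a @ x # b) = f (p @ x # a @ b)" for p a x b
  proof (induction a arbitrary: p)
    case (Cons c a)
    then have "f (p @ (c # a) @ x # b) = f ((p @ [c]) @ x # a @ b)"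
      using Cons.IH[of "p @ [c]"] by simp
    then show ?case using swap[of p c x "a @ b"] by simp
  qed simp
  have "f (p @ w) = f (p @ w')" if "mset w = mset w'" for p w w'
    using that
  proof (induction w arbitrary: p w')
    case (Cons x w)
    then have "x \<in> set w'" using mset_eq_setD by fastforce
    then obtain a b where w': "w' = a @ x # b" using split_list by metis
    then have "f ((p @ [x]) @ w) = f ((p @ [x]) @ (a @ b))"
      using Cons.prems by (intro Cons.IH) simp
    then show ?case using move[of p a x b] w' by simp
  qed simp
  from this[of w w' "[]"] assms(2) show ?thesis by simp
qed

text \<open>The scalar of the exchange \<open>x(yz) \<rightarrow> y(xz)\<close>.\<close>

definition exchange_scalar :: "('a \<Rightarrow> 'a \<Rightarrow> 'a \<Rightarrow> complex) \<Rightarrow> ('a \<Rightarrow> 'a \<Rightarrow> complex) \<Rightarrow> 'a \<Rightarrow> 'a \<Rightarrow> 'a \<Rightarrow> complex" where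
  "exchange_scalar F \<Omega> x y z = F x y z * \<Omega> x y / F y x z"

text \<open>These are the constraints that exchanges of operators yield most directly: symmetry of
  \<open>\<Omega>\<close> stands in for the second hexagon, and the normalization of
  \<open>F\<close> reflects that index \<open>0\<close> acts by the module structure.\<close>

locale normalized_cocycle =
  fixes F :: "'a::ab_group_add \<Rightarrow> 'a \<Rightarrow> 'a \<Rightarrow> complex" and \<Omega> :: "'a \<Rightarrow> 'a \<Rightarrow> complex"
  assumes F_nz: "F i j k \<noteq> 0" and \<Omega>_nz: "\<Omega> i j \<noteq> 0"
    and pentagon: "F i j k * F i (j + k) l * F j k l = F (i + j) k l * F i j (k + l)"
    and hexagon: "\<Omega> i (j + k) * F j i k = F j k i * F i j k * \<Omega> i j * \<Omega> i k"
    and \<Omega>_sym: "\<Omega> i j * \<Omega> j i = 1"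
    and F_norm: "F 0 j k = 1" "F i 0 k = 1" "F i j 0 = 1"
begin

lemma \<Omega>_0: "\<Omega> i 0 = 1" "\<Omega> 0 i = 1"
  using hexagon[of i 0 0] \<Omega>_nz[of i 0] \<Omega>_sym[of i 0] by (simp_all add: F_norm)

lemma hexagon': "F i j k * \<Omega> (i + j) k * F k i j = \<Omega> j k * F i k j * \<Omega> i k"
proof -
  have inv: "\<Omega> j i = 1 / \<Omega> i j" for i j using \<Omega>_sym[of i j] \<Omega>_nz[of i j] by (simp add: field_simps)
  show ?thesis using hexagon[of k i j] F_nz \<Omega>_nz
    by (simp add: inv[of k i] inv[of k j] inv[of k "i + j"] field_simps)
qed

lemma abelian_3cocycle: "abelian_3cocycle (F, \<Omega>)"
proof -
  have "inverse (F i j k) * \<Omega> i (j + k) * inverse (F j k i) = \<Omega> i j * inverse (F j i k) * \<Omega> i k" for i j k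
    using hexagon[of i j k] F_nz by (simp add: field_simps)
  then show ?thesis by (simp add: abelian_3cocycle_def F_nz \<Omega>_nz pentagon hexagon')
qed

text \<open>The polarization of the diagonal is \<open>\<Omega> x y * \<Omega> y x = 1\<close>, so
  the quadratic form is even a homomorphism. Three hexagons split the arguments, and the associators
  that appear are the two sides of one pentagon.\<close>

lemma trace_add: "\<Omega> (x + y) (x + y) = \<Omega> x x * \<Omega> y y"
proof -
  have x: "\<Omega> x (x + y) = F x y x * \<Omega> x x * \<Omega> x y"
    using hexagon[of x x y] F_nz by simp
  have y: "\<Omega> y (x + y) = F y x y * \<Omega> y x * \<Omega> y y"
    using hexagon[of y x y] F_nz by simp
  let ?c = "F x y (x + y) * F (x + y) x y"
  have "?c * \<Omega> (x + y) (x + y) = \<Omega> y (x + y) * F x (x + y) y * \<Omega> x (x + y)"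
    using hexagon'[of x y "x + y"] by (simp add: mult_ac)
  also have "\<dots> = (F x y x * F x (y + x) y * F y x y) * (\<Omega> x y * \<Omega> y x) * (\<Omega> x x * \<Omega> y y)"
    unfolding x y add.commute[of y x] by (simp only: mult_ac)
  also have "\<dots> = ?c * (\<Omega> x x * \<Omega> y y)"
    unfolding pentagon \<Omega>_sym by (simp add: mult_ac)
  finally show ?thesis using F_nz by simp
qed

lemma trace_sign: "\<Omega> i i \<in> {1, - 1}"
  using \<Omega>_sym[of i i] by (simp add: square_eq_1_iff)

lemma quadratic_form_trace: "quadratic_form (\<lambda>i. \<Omega> i i)"
proof -
  have "\<Omega> i i * \<Omega> (- i) (- i) = 1" for i using trace_add[of i "- i"] by (simp add: \<Omega>_0)
  then have "\<Omega> i i = \<Omega> (- i) (- i)" for i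
    using \<Omega>_sym[of i i] \<Omega>_nz[of i i] by (metis mult_cancel_left)
  moreover have "\<Omega> (i + j + k) (i + j + k) * \<Omega> i i * \<Omega> j j * \<Omega> k k
      / (\<Omega> (i + j) (i + j) * \<Omega> (i + k) (i + k) * \<Omega> (j + k) (j + k)) = 1" for i j k
    by (simp add: trace_add \<Omega>_nz)
  ultimately show ?thesis unfolding quadratic_form_def using \<Omega>_nz by simp
qed

text \<open>The hypothesis is what locality of the direct sum provides. Index \<open>0\<close> in
  the last place isolates \<open>\<Omega>\<close>; then \<open>F\<close> is symmetric in its first
  two arguments, and the hexagon leaves a single associator.\<close>

lemma trivial_exchange:
  assumes "\<And>i j k. F i j k * \<Omega> i j = F j i k"
  shows "F i j k = 1" "\<Omega> i j = 1"
proof -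
  have \<Omega>: "\<Omega> i j = 1" for i j using assms[of i j 0] by (simp add: F_norm)
  then have "F j i k = F i j k" for i j k using assms[of i j k] by simp
  then have "F j k i = 1" for i j k using hexagon[of i j k] F_nz by (simp add: \<Omega>)
  then show "F i j k = 1" "\<Omega> i j = 1" using \<Omega> by simp_all
qed

abbreviation \<tau> :: "'a \<Rightarrow> 'a \<Rightarrow> 'a \<Rightarrow> complex" where
  "\<tau> \<equiv> exchange_scalar F \<Omega>"

lemma \<tau>_nz: "\<tau> x y z \<noteq> 0"
  by (simp add: exchange_scalar_def F_nz \<Omega>_nz)

end

locale strict_cocycle = normalized_cocycle +
  assumes \<Omega>_diag: "\<Omega> i i = 1"
begin

lemma \<tau>_diag: "\<tau> x x z = 1"
  by (simp add: exchange_scalar_def F_nz \<Omega>_diag)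

lemma \<tau>_0: "\<tau> x y 0 = \<Omega> x y"
  by (simp add: exchange_scalar_def F_norm)

lemma \<tau>_sym: "\<tau> x y z * \<tau> y x z = 1"
  using \<Omega>_sym[of x y] F_nz by (simp add: exchange_scalar_def)

text \<open>Moving \<open>i\<close> past \<open>j\<close> and \<open>k\<close> jointly or one after
  the other. The pentagon is used for the three positions of \<open>i\<close>, namely
  \<open>(i, j, k, l)\<close>, \<open>(j, i, k, l)\<close> and \<open>(j, k, i, l)\<close>, and the
  hexagon for \<open>(i, j, k)\<close>.\<close>

lemma \<tau>_fusion: "F j k l * \<tau> i (j + k) l = F j k (i + l) * \<tau> i j (k + l) * \<tau> i k l"
proof -
  let ?lhs = "F j k l * F i (j + k) l * \<Omega> i (j + k) * F j i (k + l) * F k i l"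
  let ?rhs = "F j k (i + l) * F i j (k + l) * \<Omega> i j * F i k l * \<Omega> i k * F (j + k) i l"
  \<comment> \<open>These two factors complete the first pentagon and the hexagon to full left-hand
    sides; they cancel at the end.\<close>
  let ?s = "F i j k * F j i k"
  have "?s * ?lhs = (F i j k * F i (j + k) l * F j k l) * (\<Omega> i (j + k) * F j i k) * F j i (k + l) * F k i l"
    by simp
  also have "\<dots> = F i j (k + l) * F j k i * F i j k * \<Omega> i j * \<Omega> i k * F k i l * (F (i + j) k l * F j i (k + l))"
    unfolding pentagon[of i j k l] hexagon[of i j k] by (simp only: mult_ac)
  also have "F (i + j) k l * F j i (k + l) = F j i k * F j (i + k) l * F i k l"
    using pentagon[of j i k l] by (simp add: add.commute)
  also have "F i j (k + l) * F j k i * F i j k * \<Omega> i j * \<Omega> i k * F k i l * (F j i k * F j (i + k) l * F i k l)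
    = ?s * (F i j (k + l) * \<Omega> i j * \<Omega> i k * F i k l * (F j k i * F j (k + i) l * F k i l))"
    by (simp add: add.commute)
  also have "\<dots> = ?s * ?rhs" unfolding pentagon[of j k i l] by (simp only: mult_ac add.commute[of k i])
  finally have "?lhs = ?rhs" using F_nz by simp
  then show ?thesis using F_nz unfolding exchange_scalar_def by (simp add: field_simps)
qed

text \<open>By fusion both sides move \<open>x\<close> past the product of \<open>y\<close> and
  \<open>z\<close> as a whole; they differ only in whether \<open>y\<close> and \<open>z\<close> are
  interchanged before or after.\<close>

lemma yang_baxter:
  "\<tau> x y (z + w) * \<tau> x z w * \<tau> y z (x + w) = \<tau> y z w * \<tau> x z (y + w) * \<tau> x y w"
proof -
  have A: "\<tau> x y (z + w) * \<tau> x z w = F y z w * \<tau> x (y + z) w / F y z (x + w)"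
    using \<tau>_fusion[of y z w x] F_nz by (simp add: field_simps)
  have B: "\<tau> x z (y + w) * \<tau> x y w = F z y w * \<tau> x (y + z) w / F z y (x + w)"
    using \<tau>_fusion[of z y w x] F_nz by (simp add: field_simps)
  have "\<tau> x y (z + w) * \<tau> x z w * \<tau> y z (x + w) = F y z w * \<tau> x (y + z) w * \<Omega> y z / F z y (x + w)"
    unfolding A using F_nz by (simp add: exchange_scalar_def[of F \<Omega> y z])
  also have "\<dots> = \<tau> y z w * (\<tau> x z (y + w) * \<tau> x y w)"
    unfolding B using F_nz by (simp add: exchange_scalar_def[of F \<Omega> y z])
  finally show ?thesis by simp
qed

text \<open>The scalar relating \<open>(w c)\<close> bracketed as \<open>(x\<^sub>1 \<dots> x\<^sub>n) c\<close> and as \<open>x\<^sub>1 (\<dots> (x\<^sub>n c))\<close>.\<close>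

primrec reassoc :: "'a list \<Rightarrow> 'a \<Rightarrow> complex" where
  "reassoc [] c = 1"
| "reassoc (x # w) c = F x (sum_list w) c * reassoc w c"

lemma reassoc_nz: "reassoc w c \<noteq> 0"
  by (induction w) (simp_all add: F_nz)

lemma reassoc_0: "reassoc w 0 = 1"
  by (induction w) (simp_all add: F_norm)

text \<open>Each letter of \<open>w\<close> contributes one pentagon. This is what makes
  \<open>\<kappa>\<close> a cocycle up to \<open>F\<close>.\<close>

lemma reassoc_append:
  "reassoc v c * reassoc w (sum_list v + c) * F (sum_list w) (sum_list v) c
    = reassoc (w @ v) c * reassoc w (sum_list v)"
proof (induction w)
  case (Cons x w)
  let ?V = "sum_list v" and ?W = "sum_list w"
  have "reassoc v c * reassoc (x # w) (?V + c) * F (x + ?W) ?V c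
      = reassoc v c * reassoc w (?V + c) * (F (x + ?W) ?V c * F x ?W (?V + c))" by simp
  also have "\<dots> = (reassoc v c * reassoc w (?V + c) * F ?W ?V c) * F x ?W ?V * F x (?W + ?V) c"
    unfolding pentagon[of x ?W ?V c, symmetric] by (simp only: mult_ac)
  also have "\<dots> = reassoc ((x # w) @ v) c * reassoc (x # w) ?V" by (simp add: Cons.IH)
  finally show ?case by simp
qed (simp add: F_norm)

text \<open>A transposition costs \<tau> evaluated at whatever stands to the right of the two
  letters: \<open>v\<close> alone inside the bracket, \<open>v\<close> and \<open>c\<close> once the
  bracket is opened.\<close>

lemma reassoc_swap:
  "reassoc (u @ x # y # v) c * \<tau> x y (sum_list v) = reassoc (u @ y # x # v) c * \<tau> x y (sum_list v + c)"
proof (induction u)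
  case Nil
  let ?v = "sum_list v"
  have *: "F x (y + ?v) c * F y ?v c = F (x + y) ?v c * F x y (?v + c) / F x y ?v" for x y
    using pentagon[of x y ?v c] F_nz by (simp add: field_simps)
  have "F x (y + ?v) c * F y ?v c * \<tau> x y ?v = F y (x + ?v) c * F x ?v c * \<tau> x y (?v + c)"
    unfolding * exchange_scalar_def using F_nz by (simp add: field_simps add.commute[of y x])
  then show ?case by (simp only: append_Nil reassoc.simps sum_list.Cons mult_ac)
qed (simp add: add.left_commute)

end

section \<open>Sorting words and a trivialization on multisets\<close>

locale ordered_strict_cocycle = strict_cocycle F \<Omega>
  for F :: "'a::ab_group_add \<Rightarrow> 'a \<Rightarrow> 'a \<Rightarrow> complex" and \<Omega> :: "'a \<Rightarrow> 'a \<Rightarrow> complex" +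
  fixes lt :: "'a \<Rightarrow> 'a \<Rightarrow> bool"
  assumes lt_irrefl: "\<not> lt x x" and lt_trans: "lt x y \<Longrightarrow> lt y z \<Longrightarrow> lt x z"
    and lt_total: "x = y \<or> lt x y \<or> lt y x"
begin

primrec ins :: "'a \<Rightarrow> 'a list \<Rightarrow> 'a list" where
  "ins x [] = [x]"
| "ins x (y # ys) = (if lt y x then y # ins x ys else x # y # ys)"

primrec ins_scalar :: "'a \<Rightarrow> 'a list \<Rightarrow> complex" where
  "ins_scalar x [] = 1"
| "ins_scalar x (y # ys) = (if lt y x then \<tau> x y (sum_list ys) * ins_scalar x ys else 1)"

definition sorted_word :: "'a list \<Rightarrow> 'a list" where
  "sorted_word w = foldr ins w []"

text \<open>The scalar relating a right-bracketed word to its insertion sort.\<close>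

primrec sort_scalar :: "'a list \<Rightarrow> complex" where
  "sort_scalar [] = 1"
| "sort_scalar (x # w) = ins_scalar x (sorted_word w) * sort_scalar w"

lemma sum_list_ins [simp]: "sum_list (ins x w) = x + sum_list w"
  by (induction w) (simp_all add: add.left_commute)

lemma sum_list_sorted_word [simp]: "sum_list (sorted_word w) = sum_list w"
  by (induction w) (simp_all add: sorted_word_def)

lemma ins_commute: "ins x (ins y w) = ins y (ins x w)"
proof -
  have "ins x (ins y w) = ins y (ins x w)" if "lt y x" for x y
  proof -
    have "\<not> lt x y" "lt z x" if "lt z y" for z using that \<open>lt y x\<close> lt_trans lt_irrefl by blast+
    moreover have "\<not> lt x y" using \<open>lt y x\<close> lt_trans lt_irrefl by blast
    ultimately show ?thesis using \<open>lt y x\<close> by (induction w) auto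
  qed
  then show ?thesis using lt_total[of x y] by metis
qed

lemma sorted_word_swap: "sorted_word (u @ x # y # v) = sorted_word (u @ y # x # v)"
  by (simp add: sorted_word_def ins_commute)

text \<open>The braid relation for insertion. If both letters pass \<open>z\<close>, it is the
  Yang-Baxter identity. If \<open>x = y\<close>, the two sides agree only because
  \<open>\<tau> x x\<close> is \<open>1\<close>; here the trivial diagonal of
  \<open>\<Omega>\<close> is used.\<close>

lemma ins_scalar_swap:
  "ins_scalar x (ins y w) * ins_scalar y w = \<tau> x y (sum_list w) * (ins_scalar y (ins x w) * ins_scalar x w)"
proof -
  have less: "ins_scalar x (ins y w) * ins_scalar y w = \<tau> x y (sum_list w) * (ins_scalar y (ins x w) * ins_scalar x w)"
    if "lt y x" for x y
  proof (induction w)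
    case Nil
    have "\<not> lt x y" using that lt_trans lt_irrefl by blast
    then show ?case using that by simp
  next
    case (Cons z w)
    show ?case
    proof (cases "lt z y")
      case True
      then have "lt z x" using that lt_trans by blast
      let ?W = "sum_list w"
      have "ins_scalar x (ins y (z # w)) * ins_scalar y (z # w)
          = \<tau> x z (y + ?W) * \<tau> y z ?W * (ins_scalar x (ins y w) * ins_scalar y w)"
        using True \<open>lt z x\<close> by simp
      also have "\<dots> = (\<tau> y z ?W * \<tau> x z (y + ?W) * \<tau> x y ?W) * (ins_scalar y (ins x w) * ins_scalar x w)"
        by (simp add: Cons.IH)
      also have "\<dots> = \<tau> x y (z + ?W) * \<tau> x z ?W * \<tau> y z (x + ?W) * (ins_scalar y (ins x w) * ins_scalar x w)"
        by (simp only: yang_baxter)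
      finally show ?thesis using True \<open>lt z x\<close> by simp
    next
      case False
      have "\<not> lt x y" using that lt_trans lt_irrefl by blast
      then show ?thesis using False that by simp
    qed
  qed
  consider "x = y" | "lt y x" | "lt x y" using lt_total by blast
  then show ?thesis
  proof cases
    case 3
    then show ?thesis using less[OF 3] \<tau>_sym[of x y "sum_list w"] by (simp flip: mult.assoc)
  qed (simp_all add: \<tau>_diag less)
qed

lemma sort_scalar_nz: "sort_scalar w \<noteq> 0"
proof -
  have "ins_scalar x w \<noteq> 0" for x w by (induction w) (simp_all add: \<tau>_nz)
  then show ?thesis by (induction w) simp_all
qed

lemma sort_scalar_swap:
  "sort_scalar (u @ x # y # v) = \<tau> x y (sum_list v) * sort_scalar (u @ y # x # v)"
proof (induction u)
  case Nil
  have "sorted_word (a # v) = ins a (sorted_word v)" for a by (simp add: sorted_word_def)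
  then show ?case using ins_scalar_swap[of x y "sorted_word v"] by (simp flip: mult.assoc)
qed (simp add: sorted_word_swap)

text \<open>With each sorted, right-bracketed word taken as a basis vector, this is the factor by
  which the product of the vectors of \<open>w\<close> and \<open>v\<close> must be rescaled to
  become the vector of \<open>w @ v\<close>.\<close>

definition word_mult :: "'a list \<Rightarrow> 'a list \<Rightarrow> complex" where
  "word_mult w v = reassoc w (sum_list v) * sort_scalar w * sort_scalar v / sort_scalar (w @ v)"

text \<open>A transposition in \<open>w\<close> changes \<open>reassoc\<close> and two sort scalars
  by exchange scalars with tails \<open>r\<close> and \<open>r @ v\<close>, and these cancel. In
  \<open>v\<close> two sort scalars change, by the same factor.\<close>

lemma word_mult_mset:
  assumes "mset w = mset w'" "mset v = mset v'"
  shows "word_mult w v = word_mult w' v'"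
proof -
  have "word_mult (u @ x # y # r) v = word_mult (u @ y # x # r) v" for u x y r
    using reassoc_swap[of u x y r "sum_list v"] sort_scalar_swap[of u x y r]
      sort_scalar_swap[of u x y "r @ v"] \<tau>_nz sort_scalar_nz
    by (simp add: word_mult_def field_simps)
  then have "word_mult w v = word_mult w' v" using assms(1) by (rule swap_invariant_mset)
  moreover have "word_mult w' (u @ x # y # r) = word_mult w' (u @ y # x # r)" for u x y r
    using sort_scalar_swap[of u x y r] sort_scalar_swap[of "w' @ u" x y r] \<tau>_nz sort_scalar_nz
    by (simp add: word_mult_def field_simps add.left_commute)
  then have "word_mult w' v = word_mult w' v'" using assms(2) by (rule swap_invariant_mset)
  ultimately show ?thesis by simp
qed

definition \<kappa> :: "'a multiset \<Rightarrow> 'a multiset \<Rightarrow> complex" where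
  "\<kappa> s t = word_mult (SOME w. mset w = s) (SOME w. mset w = t)"

lemma \<kappa>_mset: "\<kappa> (mset w) (mset v) = word_mult w v"
  unfolding \<kappa>_def by (intro word_mult_mset someI[of "\<lambda>w'. mset w' = mset _"]) (rule refl)+

lemma \<kappa>_nz: "\<kappa> s t \<noteq> 0"
  by (simp add: \<kappa>_def word_mult_def reassoc_nz sort_scalar_nz)

lemma \<kappa>_0: "\<kappa> {#} s = 1" "\<kappa> s {#} = 1"
proof -
  obtain w where "s = mset w" using ex_mset by metis
  then show "\<kappa> {#} s = 1" "\<kappa> s {#} = 1"
    using \<kappa>_mset[of "[]" w] \<kappa>_mset[of w "[]"] sort_scalar_nz[of w] by (simp_all add: word_mult_def reassoc_0)
qed

lemma \<kappa>_cocycle: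
  "\<kappa> t r * \<kappa> s (t + r) * F (sum_mset s) (sum_mset t) (sum_mset r) = \<kappa> (s + t) r * \<kappa> s t"
proof -
  obtain w v u where "s = mset w" "t = mset v" "r = mset u" using ex_mset by metis
  moreover have "word_mult v u * word_mult w (v @ u) * F (sum_list w) (sum_list v) (sum_list u)
      = word_mult (w @ v) u * word_mult w v"
    using reassoc_append[of v "sum_list u" w] sort_scalar_nz by (simp add: word_mult_def field_simps)
  ultimately show ?thesis
    by (simp add: sum_mset_sum_list \<kappa>_mset flip: mset_append)
qed

text \<open>The quotient \<open>B\<close> of the two sides is a bicharacter: writing
  \<open>F\<close> as a coboundary of \<open>\<kappa>\<close> turns the hexagon into
  multiplicativity in the second argument, and symmetry gives the first. On two letters
  \<open>B\<close> is \<open>1\<close>, since swapping a word of length two costs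
  \<open>\<tau> x y 0 = \<Omega> x y\<close>.\<close>

lemma \<kappa>_commute: "\<kappa> s t * \<Omega> (sum_mset s) (sum_mset t) = \<kappa> t s"
proof -
  define B where "B s t = \<kappa> s t * \<Omega> (sum_mset s) (sum_mset t) / \<kappa> t s" for s t
  have B_mult: "B s (t + r) = B s t * B s r" for s t r
  proof -
    let ?s = "sum_mset s" and ?t = "sum_mset t" and ?r = "sum_mset r"
    have F: "F (sum_mset s) (sum_mset t) (sum_mset r) = \<kappa> (s + t) r * \<kappa> s t / (\<kappa> t r * \<kappa> s (t + r))" for s t r
      using \<kappa>_cocycle[of t r s] \<kappa>_nz by (simp add: field_simps)
    have "\<Omega> ?s (?t + ?r) = F ?t ?r ?s * F ?s ?t ?r * \<Omega> ?s ?t * \<Omega> ?s ?r / F ?t ?s ?r"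
      using hexagon[of ?s ?t ?r] F_nz by (simp add: field_simps)
    then show ?thesis unfolding F B_def using \<kappa>_nz \<Omega>_nz by (simp add: field_simps add.commute add.left_commute)
  qed
  have B_0: "B s {#} = 1" for s by (simp add: B_def \<kappa>_0 \<Omega>_0)
  have B_sym: "B s t * B t s = 1" for s t
    using \<Omega>_sym[of "sum_mset s" "sum_mset t"] \<kappa>_nz by (simp add: B_def)
  have "\<kappa> {#x#} {#y#} * sort_scalar [x, y] = 1" for x y
    using \<kappa>_mset[of "[x]" "[y]"] sort_scalar_nz[of "[x, y]"] by (simp add: word_mult_def F_norm sorted_word_def)
  then have \<kappa>_single: "\<kappa> {#x#} {#y#} = 1 / sort_scalar [x, y]" for x y
    using sort_scalar_nz[of "[x, y]"] by (simp add: field_simps)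
  have B_single: "B {#x#} {#y#} = 1" for x y
    using sort_scalar_swap[of "[]" x y "[]"] \<Omega>_nz[of x y] sort_scalar_nz[of "[y, x]"]
    by (simp add: B_def \<kappa>_single \<tau>_0 del: sort_scalar.simps)
  have "B {#x#} t = 1" for x t
  proof (induction t)
    case (add y t)
    then show ?case using B_mult[of "{#x#}" "{#y#}" t] B_single[of x y] by simp
  qed (simp add: B_0)
  then have "B t {#x#} = 1" for x t using B_sym[of t "{#x#}"] by simp
  then have "B s t = 1"
  proof (induction t)
    case (add y t)
    then show ?case using B_mult[of s "{#y#}" t] by simp
  qed (simp add: B_0)
  then show ?thesis using \<kappa>_nz by (simp add: B_def field_simps)
qed

text \<open>On multisets of sum \<open>0\<close> the associator is trivial, so there \<open>\<kappa>\<close> is an honest symmetric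
  2-cocycle. Trivializing it, and extending the trivialization along the translation action of these
  multisets, makes \<open>\<kappa>\<close> depend only on the sums of its arguments.\<close>

lemma coboundary_aux:
  "\<exists>l. (\<forall>i j. l i j \<noteq> 0) \<and> (\<forall>i. l 0 i = 1 \<and> l i 0 = 1)
    \<and> (\<forall>i j k. l j k * l i (j + k) * F i j k = l (i + j) k * l i j) \<and> (\<forall>i j. l i j * \<Omega> i j = l j i)"
proof -
  define K :: "'a multiset set" where "K = {s. sum_mset s = 0}"
  have K_add: "s + t \<in> K" if "s \<in> K" "t \<in> K" for s t using that by (simp add: K_def)
  have sym: "\<kappa> s t = \<kappa> t s" if "s \<in> K" for s t
    using that \<kappa>_commute[of s t] by (simp add: K_def \<Omega>_0)
  have coc: "\<kappa> t r * \<kappa> s (t + r) = \<kappa> (s + t) r * \<kappa> s t" if "s \<in> K \<or> t \<in> K" for s t r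
    using that \<kappa>_cocycle[of t r s] by (auto simp: K_def F_norm)
  have "\<exists>\<mu>. (\<forall>s\<in>K. \<mu> s \<noteq> 0) \<and> (\<forall>s\<in>K. \<forall>t\<in>K. \<kappa> s t * \<mu> (s + t) = \<mu> s * \<mu> t)"
  proof (rule symmetric_cocycle_coboundary)
    fix s t r assume "s \<in> K" "t \<in> K" "r \<in> K"
    then show "\<kappa> s t * \<kappa> (s + t) r = \<kappa> t r * \<kappa> s (t + r)" using coc[of s t r] by simp
  qed (simp_all add: K_add \<kappa>_nz sym \<kappa>_0, simp_all add: K_def)
  then obtain \<mu> where \<mu>_nz: "\<And>s. s \<in> K \<Longrightarrow> \<mu> s \<noteq> 0"
    and \<mu>: "\<And>s t. s \<in> K \<Longrightarrow> t \<in> K \<Longrightarrow> \<kappa> s t * \<mu> (s + t) = \<mu> s * \<mu> t" by metis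
  \<comment> \<open>Multisets have no inverses, so \<open>s\<close> is linked to the singleton of
    its sum by two multisets of sum 0 with \<open>q s + s = r s + {#sum_mset s#}\<close>.\<close>
  define q where "q s = {#- sum_mset s#} + {#sum_mset s#}" for s :: "'a multiset"
  define r where "r s = s + {#- sum_mset s#}" for s :: "'a multiset"
  have qr: "q s \<in> K" "r s \<in> K" for s by (simp_all add: K_def q_def r_def)
  \<comment> \<open>The value forced on \<open>s\<close> by the requirements of being
    \<open>1\<close> on singletons and compatible with translation by \<open>q s\<close> and by
    \<open>r s\<close>.\<close>
  define \<nu>0 where "\<nu>0 s = \<kappa> (q s) s * \<mu> (r s) / (\<kappa> (r s) {#sum_mset s#} * \<mu> (q s))" for s
  have \<nu>0_nz: "\<nu>0 s \<noteq> 0" for s by (simp add: \<nu>0_def \<kappa>_nz \<mu>_nz qr)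
  have \<nu>0: "\<kappa> t s * \<nu>0 (t + s) = \<mu> t * \<nu>0 s" if t: "t \<in> K" for s t
  proof -
    let ?e = "{#sum_mset s#}"
    have sum: "sum_mset (t + s) = sum_mset s" using t by (simp add: K_def)
    have q: "q (t + s) = q s" and r: "r (t + s) = t + r s" using sum by (simp_all add: q_def r_def)
    have 1: "\<kappa> t (r s) * \<mu> (t + r s) = \<mu> t * \<mu> (r s)" using \<mu> t qr by blast
    have "r s + ?e = q s + s" by (simp add: q_def r_def)
    then have 2: "\<kappa> (r s) ?e * \<kappa> t (q s + s) = \<kappa> (t + r s) ?e * \<kappa> t (r s)"
      using coc[of t "r s" ?e] t by simp
    have 3: "\<kappa> t s * \<kappa> (q s) (t + s) = \<kappa> (q s + t) s * \<kappa> (q s) t" using coc[of "q s" t s] t by simp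
    have 4: "\<kappa> (q s) s * \<kappa> t (q s + s) = \<kappa> (t + q s) s * \<kappa> t (q s)" using coc[of t "q s" s] t by simp
    have 5: "\<kappa> t s * \<kappa> (q s) (t + s) = \<kappa> (q s) s * \<kappa> t (q s + s)"
      using 3 4 sym[OF t, of "q s"] by (simp add: add.commute)
    let ?d = "\<kappa> (r s) ?e * \<kappa> (t + r s) ?e * \<kappa> t (r s)"
    have "?d * (\<kappa> t s * \<kappa> (q s) (t + s) * \<mu> (t + r s) * \<kappa> (r s) ?e)
        = (\<kappa> t s * \<kappa> (q s) (t + s)) * (\<kappa> t (r s) * \<mu> (t + r s)) * \<kappa> (r s) ?e * \<kappa> (r s) ?e * \<kappa> (t + r s) ?e"
      by (simp only: mult_ac)
    also have "\<dots> = \<kappa> (q s) s * (\<kappa> (r s) ?e * \<kappa> t (q s + s)) * \<mu> t * \<mu> (r s) * \<kappa> (r s) ?e * \<kappa> (t + r s) ?e"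
      unfolding 5 1 by (simp only: mult_ac)
    also have "\<dots> = ?d * (\<mu> t * \<kappa> (q s) s * \<mu> (r s) * \<kappa> (t + r s) ?e)"
      unfolding 2 by (simp only: mult_ac)
    finally have "\<kappa> t s * \<kappa> (q s) (t + s) * \<mu> (t + r s) * \<kappa> (r s) ?e
        = \<mu> t * \<kappa> (q s) s * \<mu> (r s) * \<kappa> (t + r s) ?e" using \<kappa>_nz by simp
    then show ?thesis unfolding \<nu>0_def sum q r using \<kappa>_nz \<mu>_nz qr
      by (simp add: frac_eq_eq mult_ac)
  qed
  \<comment> \<open>\<open>\<nu>0\<close> is normalized on singletons instead of the empty multiset;
    the constant factor makes \<open>\<nu>\<close> extend \<open>\<mu>\<close>.\<close>
  define \<nu> where "\<nu> s = \<nu>0 s / \<nu>0 {#}" for s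
  have \<nu>_nz: "\<nu> s \<noteq> 0" for s by (simp add: \<nu>_def \<nu>0_nz)
  have \<nu>_K: "\<nu> t = \<mu> t" if "t \<in> K" for t
    using \<nu>0[OF that, of "{#}"] \<nu>0_nz by (simp add: \<nu>_def \<kappa>_0 field_simps)
  have \<nu>: "\<kappa> t s * \<nu> (t + s) = \<nu> t * \<nu> s" if "t \<in> K" for s t
    using \<nu>0[OF that, of s] \<nu>0_nz \<nu>_K[OF that] by (simp add: \<nu>_def field_simps)
  define \<rho> where "\<rho> s t = \<kappa> s t * \<nu> (s + t) / (\<nu> s * \<nu> t)" for s t
  have \<rho>_nz: "\<rho> s t \<noteq> 0" for s t by (simp add: \<rho>_def \<kappa>_nz \<nu>_nz)
  have \<rho>_K: "\<rho> t s = 1" if "t \<in> K" for s t using \<nu>[OF that] \<nu>_nz by (simp add: \<rho>_def)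
  have \<rho>_cocycle: "\<rho> t r * \<rho> s (t + r) * F (sum_mset s) (sum_mset t) (sum_mset r) = \<rho> (s + t) r * \<rho> s t" for s t r
    using \<kappa>_cocycle[of t r s] \<nu>_nz by (simp add: \<rho>_def field_simps add.assoc)
  have \<rho>_commute: "\<rho> s t * \<Omega> (sum_mset s) (sum_mset t) = \<rho> t s" for s t
    using \<kappa>_commute[of s t] by (simp add: \<rho>_def add.commute mult.commute field_simps)
  \<comment> \<open>A multiset of sum 0 has trivial \<open>\<rho>\<close> and trivial associators,
    so the cocycle identity drops it from the first argument. Hence only sums matter, and
    \<open>l\<close> may be read off from singletons.\<close>
  have \<rho>_absorb: "\<rho> (t + s) u = \<rho> s u" if "t \<in> K" for s t u
    using that \<rho>_cocycle[of s u t] \<rho>_K[OF that] by (simp add: K_def F_norm)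
  have \<rho>_left: "\<rho> s u = \<rho> s' u" if "sum_mset s = sum_mset s'" for s s' u
  proof -
    have "r s + s' = r s' + s" using that by (simp add: r_def)
    then show ?thesis using \<rho>_absorb[OF qr(2), of s s' u] \<rho>_absorb[OF qr(2), of s' s u] by simp
  qed
  have \<rho>_right: "\<rho> u s = \<rho> u s'" if "sum_mset s = sum_mset s'" for s s' u
    using \<rho>_commute[of s u] \<rho>_commute[of s' u] \<rho>_left[OF that, of u] that by simp
  define l where "l i j = \<rho> {#i#} {#j#}" for i j
  have "l 0 i = 1" for i by (simp add: l_def \<rho>_K K_def)
  moreover have comm: "l i j * \<Omega> i j = l j i" for i j
    using \<rho>_commute[of "{#i#}" "{#j#}"] by (simp add: l_def)
  moreover have "l i 0 = 1" for i using comm[of 0 i] calculation(1)[of i] by (simp add: \<Omega>_0)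
  moreover have "l j k * l i (j + k) * F i j k = l (i + j) k * l i j" for i j k
    using \<rho>_cocycle[of "{#j#}" "{#k#}" "{#i#}"] \<rho>_left[of "{#i#} + {#j#}" "{#i + j#}" "{#k#}"]
      \<rho>_right[of "{#j#} + {#k#}" "{#j + k#}" "{#i#}"] by (simp add: l_def)
  moreover have "l i j \<noteq> 0" for i j by (simp add: l_def \<rho>_nz)
  ultimately show ?thesis by (intro exI[of _ l]) simp
qed

end

lemma (in strict_cocycle) coboundary:
  "\<exists>l. (\<forall>i j. l i j \<noteq> 0) \<and> (\<forall>i. l 0 i = 1 \<and> l i 0 = 1)
    \<and> (\<forall>i j k. l j k * l i (j + k) * F i j k = l (i + j) k * l i j) \<and> (\<forall>i j. l i j * \<Omega> i j = l j i)"
proof -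
  \<comment> \<open>Any total order will do: it only selects the sorted representative of each
    multiset.\<close>
  obtain r :: "'a rel" where "well_order_on UNIV r" using well_order_on ..
  then have lin: "total r" "antisym r" "trans r"
    unfolding well_order_on_def linear_order_on_def partial_order_on_def preorder_on_def by simp_all
  interpret ordered_strict_cocycle F \<Omega> "\<lambda>x y. (x, y) \<in> r \<and> x \<noteq> y"
  proof
    fix x y z
    show "x = y \<or> (x, y) \<in> r \<and> x \<noteq> y \<or> (y, x) \<in> r \<and> y \<noteq> x"
      using lin(1) by (auto simp: total_on_def)
    assume "(x, y) \<in> r \<and> x \<noteq> y" "(y, z) \<in> r \<and> y \<noteq> z"
    then show "(x, z) \<in> r \<and> x \<noteq> z"
      using lin(2,3) antisymD[of r x y] transD[of r x y z] by auto
  qed simp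
  show ?thesis by (rule coboundary_aux)
qed

subsection \<open>Linear maps\<close>

lemma scaleC_apply: "(c *\<^sub>C f) x = c *\<^sub>C f x"
  by (simp add: scaleC_fun_def)

lemma lin_mapI:
  assumes "\<And>x. x \<in> U \<Longrightarrow> f x \<in> W" "\<And>x y. x \<in> U \<Longrightarrow> y \<in> U \<Longrightarrow> f (x + y) = f x + f y"
    "\<And>c x. x \<in> U \<Longrightarrow> f (c *\<^sub>C x) = c *\<^sub>C f x"
  shows "lin_map U W f"
  using assms by (simp add: lin_map_def)

lemma lin_map_in: "lin_map U W f \<Longrightarrow> x \<in> U \<Longrightarrow> f x \<in> W"
  and lin_map_add: "lin_map U W f \<Longrightarrow> x \<in> U \<Longrightarrow> y \<in> U \<Longrightarrow> f (x + y) = f x + f y"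
  and lin_map_scale: "lin_map U W f \<Longrightarrow> x \<in> U \<Longrightarrow> f (c *\<^sub>C x) = c *\<^sub>C f x"
  by (simp_all add: lin_map_def)

lemma lin_map_zero:
  assumes "lin_map U W f" "complex_vector.subspace U"
  shows "f 0 = 0"
  using lin_map_scale[OF assms(1) complex_vector.subspace_0[OF assms(2)], of 0] by simp

lemma lin_map_sum:
  assumes f: "lin_map U W f" and U: "complex_vector.subspace U" and "\<And>i. i \<in> A \<Longrightarrow> x i \<in> U"
  shows "f (\<Sum>i\<in>A. x i) = (\<Sum>i\<in>A. f (x i))"
  using assms(3)
proof (induction A rule: infinite_finite_induct)
  case (insert i A)
  then have "(\<Sum>i\<in>A. x i) \<in> U" by (intro complex_vector.subspace_sum[OF U]) simp
  then show ?case using insert lin_map_add[OF f] by simp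
qed (simp_all add: lin_map_zero[OF f U])

lemma lin_map_funpow:
  assumes "lin_map S S f"
  shows "lin_map S S (f ^^ k)"
proof (induction k)
  case (Suc k)
  then show ?case using assms by (simp add: lin_map_def)
qed (simp add: lin_map_def)

subsection \<open>Fractions in two variables\<close>

definition mul1 :: "(int \<Rightarrow> int \<Rightarrow> 'v) \<Rightarrow> int \<Rightarrow> int \<Rightarrow> 'v" where
  "mul1 f m n = f (m - 1) n"

definition mul2 :: "(int \<Rightarrow> int \<Rightarrow> 'v) \<Rightarrow> int \<Rightarrow> int \<Rightarrow> 'v" where
  "mul2 f m n = f m (n - 1)"

lemma frac2_eq: "frac2 p = frac2 q \<longleftrightarrow> frac_rel disc2 p q"
  by (rule locser2.abs_eq_iff)

lemma frac2_disc2: "frac2 (N + k, (disc2 ^^ k) F) = frac2 (N, F)"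
  unfolding frac2_eq frac_rel_def by (intro exI[of _ 0]) (simp add: disc2.pow_pow)

lemma frac2_add: "frac2 (N, F) + frac2 (N, G) = frac2 (N, F + G)"
  by (simp add: plus_locser2.abs_eq frac2_eq frac_rel_def frac_add_def disc2.pow_add disc2.pow_pow add_ac)

lemma frac2_scale: "c *\<^sub>C frac2 (N, F) = frac2 (N, c *\<^sub>C F)"
  by (simp add: scaleC_locser2.abs_eq frac_scale_def)

lemma frac2_0: "frac2 (N, 0) = 0"
  by (simp add: zero_locser2.abs_eq frac2_eq frac_rel_def disc2.pow_zero)

lemma disc2_on:
  assumes "complex_vector.subspace S" "\<And>a b. F a b \<in> S"
  shows "disc2 F a b \<in> S"
proof -
  have "coef2 F m n \<in> S" for m n
    using assms(2) complex_vector.subspace_0[OF assms(1)] by (simp add: coef2_def)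
  then show ?thesis unfolding disc2_def by (intro complex_vector.subspace_diff assms(1))
qed

lemma disc2_pow_on:
  assumes "complex_vector.subspace S" "\<And>a b. F a b \<in> S"
  shows "(disc2 ^^ k) F a b \<in> S"
  by (induction k arbitrary: a b) (simp_all add: assms disc2_on)

lemma locser2_onI: "(\<And>a b. F a b \<in> S) \<Longrightarrow> frac2 (N, F) \<in> locser2_on S"
  by (simp only: locser2_on_def mem_Collect_eq) metis

lemma locser2_onE:
  assumes "x \<in> locser2_on S"
  obtains N F where "x = frac2 (N, F)" "\<forall>a b. F a b \<in> S"
  using assms by (simp only: locser2_on_def mem_Collect_eq) metis

lemma common_denominator:
  assumes S: "complex_vector.subspace S" and "x \<in> locser2_on S" "y \<in> locser2_on S"
  obtains N F G where "x = frac2 (N, F)" "y = frac2 (N, G)" "\<forall>a b. F a b \<in> S" "\<forall>a b. G a b \<in> S"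
proof -
  obtain N1 F1 where 1: "x = frac2 (N1, F1)" "\<forall>a b. F1 a b \<in> S"
    using assms(2) by (rule locser2_onE)
  obtain N2 F2 where 2: "y = frac2 (N2, F2)" "\<forall>a b. F2 a b \<in> S"
    using assms(3) by (rule locser2_onE)
  show ?thesis
  proof (rule that)
    show "x = frac2 (N1 + N2, (disc2 ^^ N2) F1)" by (simp add: 1 frac2_disc2)
    show "y = frac2 (N1 + N2, (disc2 ^^ N1) F2)" using frac2_disc2[of N2 N1 F2] by (simp add: 2 add.commute)
  qed (simp_all add: disc2_pow_on S 1 2)
qed

lemma locser2_on_UNIV: "x \<in> locser2_on UNIV"
proof -
  have "\<exists>p. x = frac2 p" by (induction x rule: locser2.abs_induct) (rule exI, rule refl)
  then obtain N F where "x = frac2 (N, F)" by (metis surj_pair)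
  then show ?thesis using locser2_onI[of F UNIV N] by simp
qed

lemma locser2_cases:
  obtains N F where "x = frac2 (N, F)"
  using locser2_on_UNIV by (rule locser2_onE)

lemma subspace_locser2_on:
  assumes S: "complex_vector.subspace S"
  shows "complex_vector.subspace (locser2_on S)"
proof (rule complex_vector.subspaceI)
  show "0 \<in> locser2_on S"
    using locser2_onI[of 0 S 0] complex_vector.subspace_0[OF S] by (simp add: frac2_0)
next
  fix x y assume "x \<in> locser2_on S" "y \<in> locser2_on S"
  then obtain N F G where "x = frac2 (N, F)" "y = frac2 (N, G)" "\<forall>a b. F a b \<in> S" "\<forall>a b. G a b \<in> S"
    by (rule common_denominator[OF S])
  then show "x + y \<in> locser2_on S"
    using complex_vector.subspace_add[OF S] by (simp add: frac2_add locser2_onI)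
next
  fix c x assume "x \<in> locser2_on S"
  then obtain N F where "x = frac2 (N, F)" "\<forall>a b. F a b \<in> S" by (rule locser2_onE)
  then show "c *\<^sub>C x \<in> locser2_on S"
    using complex_vector.subspace_scale[OF S] by (simp add: frac2_scale locser2_onI scaleC_apply)
qed

lemma expand_zw_frac2:
  "expand_zw (frac2 (N, F)) m n = bin_mult (- int N) (coef2 F) (m + int N) (n + int N)"
  by (simp add: expand_zw.abs_eq)

lemma expand_wz_frac2:
  "expand_wz (frac2 (N, F)) m n
    = (- 1) ^ N *\<^sub>C bin_mult (- int N) (\<lambda>b a. coef2 F a b) (n + int N) (m + int N)"
  by (simp add: expand_wz.abs_eq)

lemma expand_w_zw_frac2:
  "expand_w_zw (frac2 (N, F)) p n = (if p + int N < 0 then 0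
    else \<Sum>a\<le>nat (p + n + 3 * int N).
      (of_int (int a - int N) gchoose nat (p + int N)) *\<^sub>C coef2 F (int a) (p + n + 3 * int N - int a))"
  by (simp add: expand_w_zw.abs_eq)

lemma coef2_add: "coef2 (F + G) m n = coef2 F m n + coef2 G m n" for F :: "nat \<Rightarrow> nat \<Rightarrow> 'v::complex_vector"
  by (simp add: coef2_def)

lemma coef2_scale: "coef2 (c *\<^sub>C F) m n = c *\<^sub>C coef2 F m n"
  by (simp add: coef2_def scaleC_apply)

lemma bin_mult_add: "bin_mult e (\<lambda>m n. f m n + g m n) m n = bin_mult e f m n + bin_mult e g m n"
  by (simp add: bin_mult_def scaleC_add_right sum.distrib)

lemma bin_mult_scale: "bin_mult e (\<lambda>m n. c *\<^sub>C f m n) m n = c *\<^sub>C bin_mult e f m n"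
  by (simp add: bin_mult_def complex_vector.scale_sum_right mult_ac)

lemma bin_mult_0: "0 \<le> n \<or> f m n = 0 \<Longrightarrow> bin_mult 0 f m n = f m n"
  by (cases "0 \<le> n") (auto simp: bin_mult_def sum.atMost_shift gbinomial_0_left)

lemma expand_add:
  "expand_zw (x + y) = expand_zw x + expand_zw y"
  "expand_wz (x + y) = expand_wz x + expand_wz y"
  "expand_w_zw (x + y) = expand_w_zw x + expand_w_zw y"
proof -
  obtain N F G where [simp]: "x = frac2 (N, F)" "y = frac2 (N, G)"
    using common_denominator[OF complex_vector.subspace_UNIV locser2_on_UNIV locser2_on_UNIV] by metis
  show "expand_zw (x + y) = expand_zw x + expand_zw y"
    "expand_wz (x + y) = expand_wz x + expand_wz y"
    "expand_w_zw (x + y) = expand_w_zw x + expand_w_zw y"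
    by (simp_all add: fun_eq_iff frac2_add expand_zw_frac2 expand_wz_frac2 expand_w_zw_frac2 coef2_add[abs_def]
        bin_mult_add scaleC_add_right sum.distrib)
qed

lemma expand_scale:
  "expand_zw (c *\<^sub>C x) = c *\<^sub>C expand_zw x"
  "expand_wz (c *\<^sub>C x) = c *\<^sub>C expand_wz x"
  "expand_w_zw (c *\<^sub>C x) = c *\<^sub>C expand_w_zw x"
proof -
  obtain N F where [simp]: "x = frac2 (N, F)" by (rule locser2_cases)
  show "expand_zw (c *\<^sub>C x) = c *\<^sub>C expand_zw x" "expand_wz (c *\<^sub>C x) = c *\<^sub>C expand_wz x"
    "expand_w_zw (c *\<^sub>C x) = c *\<^sub>C expand_w_zw x"
    by (simp_all add: fun_eq_iff frac2_scale expand_zw_frac2 expand_wz_frac2 expand_w_zw_frac2 coef2_scale[abs_def]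
        bin_mult_scale scaleC_apply complex_vector.scale_sum_right mult_ac)
qed

lemma expand_zero: "expand_zw 0 = 0" "expand_wz 0 = 0" "expand_w_zw 0 = 0"
  using expand_scale[of 0 0] by simp_all

text \<open>The binomial series has leading term \<open>1\<close>, so the coefficients are recovered
  by induction on the exponent of the second variable.\<close>

lemma bin_mult_inj:
  assumes supp: "\<And>m n. n < 0 \<Longrightarrow> f m n = 0" and zero: "\<And>m n. bin_mult e f m n = 0"
  shows "f m n = 0"
proof -
  have "f m (int k) = 0" for m k
  proof (induction k arbitrary: m rule: less_induct)
    case (less k)
    have "bin_mult e f (m + e) (int k)
        = (\<Sum>i\<in>{0}. ((- 1) ^ i * (of_int e gchoose i)) *\<^sub>C f (m + e - e + int i) (int k - int i))"
      unfolding bin_mult_def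
    proof (rule sum.mono_neutral_right)
      show "\<forall>i\<in>{..nat (int k)} - {0}. ((- 1) ^ i * (of_int e gchoose i)) *\<^sub>C f (m + e - e + int i) (int k - int i) = 0"
      proof
        fix i assume "i \<in> {..nat (int k)} - {0}"
        then have eq: "int k - int i = int (k - i)" and lt: "k - i < k" by auto
        show "((- 1) ^ i * (of_int e gchoose i)) *\<^sub>C f (m + e - e + int i) (int k - int i) = 0"
          by (simp only: eq less.IH[OF lt] complex_vector.scale_zero_right)
      qed
    qed auto
    then show ?case using zero[of "m + e" "int k"] by simp
  qed
  then show ?thesis using supp[of n m] by (cases "n < 0") (auto simp: not_less dest: zero_le_imp_eq_int)
qed

lemma coef2_eq_0: "(\<And>m n. coef2 F m n = 0) \<Longrightarrow> F = 0"
proof (intro ext)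
  fix a b assume "\<And>m n. coef2 F m n = 0"
  from this[of "int a" "int b"] show "F a b = 0 a b" by (simp add: coef2_def)
qed

text \<open>Passing from exponents \<open>a - N\<close> to \<open>a\<close> by Vandermonde makes the system triangular.\<close>

lemma gchoose_system_inj:
  fixes x :: "nat \<Rightarrow> 'v::complex_vector"
  assumes "\<And>k. (\<Sum>a\<le>q. (of_int (int a - int N) gchoose k) *\<^sub>C x a) = 0" and "b \<le> q"
  shows "x b = 0"
proof -
  have shifted: "(\<Sum>a\<le>q. (of_nat a gchoose k :: complex) *\<^sub>C x a) = 0" for k
  proof -
    have "(of_nat a gchoose k :: complex)
        = (\<Sum>i\<le>k. (of_int (int a - int N) gchoose i) * (of_nat N gchoose (k - i)))" for a
      using gbinomial_Vandermonde[of "of_int (int a - int N) :: complex" "of_nat N" k] by (simp add: atLeast0AtMost)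
    then have "(\<Sum>a\<le>q. (of_nat a gchoose k :: complex) *\<^sub>C x a)
        = (\<Sum>a\<le>q. \<Sum>i\<le>k. (of_nat N gchoose (k - i)) *\<^sub>C ((of_int (int a - int N) gchoose i) *\<^sub>C x a))"
      by (simp add: complex_vector.scale_sum_left scaleC_scaleC mult.commute)
    also have "\<dots> = (\<Sum>i\<le>k. (of_nat N gchoose (k - i)) *\<^sub>C (\<Sum>a\<le>q. (of_int (int a - int N) gchoose i) *\<^sub>C x a))"
      by (subst sum.swap) (simp add: complex_vector.scale_sum_right)
    finally show ?thesis by (simp only: assms(1) complex_vector.scale_zero_right sum.neutral_const)
  qed
  show ?thesis using assms(2)
  proof (induction "q - b" arbitrary: b rule: less_induct)
    case less
    have "(\<Sum>a\<le>q. (of_nat a gchoose b :: complex) *\<^sub>C x a) = (\<Sum>a\<in>{b}. (of_nat a gchoose b :: complex) *\<^sub>C x a)"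
    proof (rule sum.mono_neutral_right)
      show "\<forall>a\<in>{..q} - {b}. (of_nat a gchoose b :: complex) *\<^sub>C x a = 0"
      proof
        fix a assume "a \<in> {..q} - {b}"
        then consider "a < b" | "b < a" "a \<le> q" by fastforce
        then show "(of_nat a gchoose b :: complex) *\<^sub>C x a = 0"
        proof cases
          case 1
          then show ?thesis by (simp add: binomial_gbinomial[symmetric] binomial_eq_0)
        next
          case 2
          then show ?thesis using less.hyps[of a] by simp
        qed
      qed
    qed (use less.prems in auto)
    then show ?case using shifted[of b] by (simp add: binomial_gbinomial[symmetric] scaleC_one)
  qed
qed

lemma expand_zw_eq_0: assumes "expand_zw x = 0" shows "x = 0"
proof -
  obtain N F where x: "x = frac2 (N, F)" by (rule locser2_cases)
  have "bin_mult (- int N) (coef2 F) m n = 0" for m n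
    using fun_cong[OF fun_cong[OF assms], of "m - int N" "n - int N"] by (simp add: x expand_zw_frac2)
  then have "coef2 F m n = 0" for m n
    by (rule bin_mult_inj[of "coef2 F" "- int N", rotated]) (simp add: coef2_def)
  then have "F = 0" by (rule coef2_eq_0)
  then show ?thesis by (simp add: x frac2_0)
qed

lemma expand_w_zw_eq_0: assumes "expand_w_zw x = 0" shows "x = 0"
proof -
  obtain N F where x: "x = frac2 (N, F)" by (rule locser2_cases)
  have "F b (q - b) = 0" if "b \<le> q" for q b
  proof -
    have "(\<Sum>a\<le>q. (of_int (int a - int N) gchoose k) *\<^sub>C F a (q - a)) = 0" for k
    proof -
      \<comment> \<open>The exponents are chosen so that only the antidiagonal of degree
        \<open>q\<close> of \<open>F\<close> enters; varying \<open>k\<close> gives one equation for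
        each exponent of \<open>z - w\<close>.\<close>
      have "expand_w_zw x (int k - int N) (int q - int k - 2 * int N) = 0" by (simp add: assms)
      moreover have "(\<Sum>a\<le>q. (of_int (int a - int N) gchoose k) *\<^sub>C coef2 F (int a) (int q - int a))
          = (\<Sum>a\<le>q. (of_int (int a - int N) gchoose k) *\<^sub>C F a (q - a))"
        by (intro sum.cong refl) (simp add: coef2_def nat_diff_distrib')
      ultimately show ?thesis by (simp add: x expand_w_zw_frac2 algebra_simps)
    qed
    then show ?thesis by (rule gchoose_system_inj) (rule that)
  qed
  then have "F b a = 0" for a b by (metis add_diff_cancel_left' le_add1)
  then have "F = 0" by (simp add: fun_eq_iff)
  then show ?thesis by (simp add: x frac2_0)
qed

lemma additive_inj:
  fixes f :: "'x::complex_vector \<Rightarrow> 'y::complex_vector"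
  assumes "\<And>x y. f (x + y) = f x + f y" "\<And>c x. f (c *\<^sub>C x) = c *\<^sub>C f x" "\<And>x. f x = 0 \<Longrightarrow> x = 0"
    and "f x = f y"
  shows "x = y"
proof -
  have "f (x + (- 1) *\<^sub>C y) = 0" by (simp only: assms(1,2,4)) simp
  then have "x + (- 1) *\<^sub>C y = 0" by (rule assms(3))
  then show ?thesis by simp
qed

lemma expand_zw_inj: "expand_zw x = expand_zw y \<Longrightarrow> x = y"
  by (rule additive_inj[of expand_zw, OF expand_add(1) expand_scale(1) expand_zw_eq_0])

lemma expand_w_zw_inj: "expand_w_zw x = expand_w_zw y \<Longrightarrow> x = y"
  by (rule additive_inj[of expand_w_zw, OF expand_add(3) expand_scale(3) expand_w_zw_eq_0])

text \<open>The coefficient identity behind interchanging \<open>z\<close> and \<open>w\<close> in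
  the region of small \<open>z - w\<close>. Negating the upper index makes the sum a Vandermonde
  convolution, and a second negation produces the exponent of the other variable.\<close>

lemma gbinomial_swap:
  fixes p n :: int and N a P q :: nat
  assumes "p + int N = int P" "int q = p + n + 3 * int N"
  shows "(\<Sum>k\<le>P. (- 1) powi (p - int k) * (of_int (n + int k) gchoose k) * (of_int (int a - int N) gchoose (P - k)))
    = (- 1) ^ N * (of_int (int q - int a - int N) gchoose P :: complex)"
proof -
  have "(- 1) powi (p - int k) * (of_int (n + int k) gchoose k) = (- 1) powi p * (of_int (- n - 1) gchoose k :: complex)" for k
  proof -
    have "(of_int (n + int k) gchoose k :: complex) = (- 1) ^ k * (of_int (- n - 1) gchoose k)"
      using gbinomial_negated_upper[of "of_int (n + int k) :: complex" k] by (simp add: algebra_simps)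
    then show ?thesis by (simp add: power_int_diff)
  qed
  then have "(\<Sum>k\<le>P. (- 1) powi (p - int k) * (of_int (n + int k) gchoose k) * (of_int (int a - int N) gchoose (P - k)))
      = (- 1) powi p * (\<Sum>k\<le>P. (of_int (- n - 1) gchoose k) * (of_int (int a - int N) gchoose (P - k) :: complex))"
    by (simp add: sum_distrib_left mult.assoc)
  also have "\<dots> = (- 1) powi p * (of_int (int a - int N - n - 1) gchoose P)"
    using gbinomial_Vandermonde[of "of_int (- n - 1) :: complex" "of_int (int a - int N)" P]
    by (simp add: atLeast0AtMost algebra_simps)
  also have "(of_int (int a - int N - n - 1) gchoose P :: complex) = (- 1) ^ P * (of_int (int q - int a - int N) gchoose P)"
  proof -
    have "of_nat P - of_int (int a - int N - n - 1) - 1 = (of_int (int q - int a - int N) :: complex)"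
    proof -
      have "int P - (int a - int N - n - 1) - 1 = int q - int a - int N" using assms by simp
      then show ?thesis by (metis of_int_1 of_int_diff of_int_of_nat_eq)
    qed
    then show ?thesis by (subst gbinomial_negated_upper) (simp only:)
  qed
  also have "(- 1) powi p * ((- 1) ^ P * (of_int (int q - int a - int N) gchoose P))
      = (- 1) ^ N * (of_int (int q - int a - int N) gchoose P :: complex)"
  proof -
    have "(- 1) powi p * (- 1) ^ P = (- 1 :: complex) powi (p + int P)" by (simp add: power_int_add)
    also have "p + int P = 2 * p + int N" using assms(1) by simp
    also have "(- 1 :: complex) powi (2 * p + int N) = (- 1) ^ N" by (simp add: power_int_add power_int_mult)
    finally show ?thesis by simp
  qed
  finally show ?thesis .
qed

text \<open>The interchange of \<open>z\<close> and \<open>w\<close>: the sign comes from the factor \<open>z - w\<close> of the denominator.\<close>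

definition swap_frac :: "nat \<Rightarrow> (nat \<Rightarrow> nat \<Rightarrow> 'v::complex_vector) \<Rightarrow> 'v locser2" where
  "swap_frac N F = frac2 (N, (- 1) ^ N *\<^sub>C (\<lambda>a b. F b a))"

lemma expand_wz_swap: "expand_wz (swap_frac N F) m n = expand_zw (frac2 (N, F)) n m"
proof -
  have "(\<lambda>b a. coef2 ((- 1) ^ N *\<^sub>C (\<lambda>a b. F b a)) a b) = (\<lambda>b a. (- 1) ^ N *\<^sub>C coef2 F b a)"
    by (intro ext) (simp add: coef2_def scaleC_apply)
  then show ?thesis
    by (simp add: swap_frac_def expand_wz_frac2 expand_zw_frac2 bin_mult_scale scaleC_scaleC scaleC_one
        flip: power_mult_distrib)
qed

text \<open>Interchanging the variables replaces \<open>y = z - w\<close> by \<open>-y\<close> and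
  \<open>w\<close> by \<open>w + y\<close>; the sum expands \<open>(-y)^(p-k) (w+y)^(n+k)\<close>.
  The pole order \<open>N\<close> in \<open>y\<close> bounds \<open>k\<close>, and \<open>K\<close>
  is left free so that the same range can also suit the truncation of an operator.\<close>

lemma expand_w_zw_swap:
  assumes "p + int N \<le> int K"
  shows "expand_w_zw (swap_frac N F) p n
    = (\<Sum>k\<le>K. ((- 1) powi (p - int k) * (of_int (n + int k) gchoose k)) *\<^sub>C expand_w_zw (frac2 (N, F)) (p - int k) (n + int k))"
proof (cases "p + int N < 0 \<or> p + n + 3 * int N < 0")
  case True
  then have "expand_w_zw (frac2 (N, F)) (p - int k) (n + int k) = 0" for k
    by (auto simp: expand_w_zw_frac2 coef2_def)
  moreover have "expand_w_zw (swap_frac N F) p n = 0"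
    using True by (auto simp: swap_frac_def expand_w_zw_frac2 coef2_def)
  ultimately show ?thesis by simp
next
  case False
  then obtain P q where P: "p + int N = int P" and q: "int q = p + n + 3 * int N"
    by (metis not_less zero_le_imp_eq_int)
  have sw: "coef2 ((- 1) ^ N *\<^sub>C (\<lambda>a b. F b a)) (int a) (int q - int a) = (- 1) ^ N *\<^sub>C coef2 F (int q - int a) (int a)" for a
    by (simp add: coef2_def scaleC_apply)
  have "expand_w_zw (swap_frac N F) p n
      = (\<Sum>a\<le>q. ((- 1) ^ N * (of_int (int a - int N) gchoose P)) *\<^sub>C coef2 F (int q - int a) (int a))"
    unfolding swap_frac_def expand_w_zw_frac2 P q[symmetric] sw by (simp add: scaleC_scaleC mult.commute)
  also have "\<dots> = (\<Sum>a\<le>q. ((- 1) ^ N * (of_int (int q - int a - int N) gchoose P)) *\<^sub>C coef2 F (int a) (int q - int a))"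
    by (rule sum.reindex_bij_witness[of _ "\<lambda>a. q - a" "\<lambda>a. q - a"]) (auto simp: of_nat_diff)
  also have "\<dots> = (\<Sum>a\<le>q. (\<Sum>k\<le>P. (- 1) powi (p - int k) * (of_int (n + int k) gchoose k)
      * (of_int (int a - int N) gchoose (P - k))) *\<^sub>C coef2 F (int a) (int q - int a))"
    by (simp only: gbinomial_swap[OF P q])
  also have "\<dots> = (\<Sum>k\<le>P. ((- 1) powi (p - int k) * (of_int (n + int k) gchoose k)) *\<^sub>C
      (\<Sum>a\<le>q. (of_int (int a - int N) gchoose (P - k)) *\<^sub>C coef2 F (int a) (int q - int a)))"
    unfolding complex_vector.scale_sum_left complex_vector.scale_sum_right
    by (subst sum.swap) (simp only: scaleC_scaleC)
  also have "\<dots> = (\<Sum>k\<le>P. ((- 1) powi (p - int k) * (of_int (n + int k) gchoose k)) *\<^sub>C expand_w_zw (frac2 (N, F)) (p - int k) (n + int k))"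
  proof (intro sum.cong refl arg_cong[where f = "scaleC _"])
    fix k assume "k \<in> {..P}"
    then have 1: "p - int k + int N = int (P - k)" using P by simp
    have 2: "p - int k + (n + int k) + 3 * int N = int q" using q by simp
    show "(\<Sum>a\<le>q. (of_int (int a - int N) gchoose (P - k)) *\<^sub>C coef2 F (int a) (int q - int a))
        = expand_w_zw (frac2 (N, F)) (p - int k) (n + int k)"
      unfolding expand_w_zw_frac2 1 2 by simp
  qed
  also have "\<dots> = (\<Sum>k\<le>K. ((- 1) powi (p - int k) * (of_int (n + int k) gchoose k)) *\<^sub>C expand_w_zw (frac2 (N, F)) (p - int k) (n + int k))"
    using assms P by (intro sum.mono_neutral_left) (auto simp: expand_w_zw_frac2)
  finally show ?thesis .
qed

subsection \<open>Skew-symmetry\<close>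

lemma laurent_bound:
  assumes "f \<in> laurent S"
  obtains N where "\<forall>n<N. f n = 0"
  using assms by (auto simp: laurent_def)

lemma sum_fun_apply: "(\<Sum>i\<in>A. f i) x = (\<Sum>i\<in>A. f i x)" for f :: "'i \<Rightarrow> 'x \<Rightarrow> 'y::comm_monoid_add"
  by (induction A rule: infinite_finite_induct) simp_all

lemma minus_one_powi_diff: "(- 1) powi m * (- 1) powi (m - int l) = ((- 1) ^ l :: complex)"
proof -
  have "(- 1 :: complex) powi m * (- 1) powi m = 1"
    by (simp flip: power_int_mult_distrib)
  moreover have "(- 1 :: complex) ^ l * (- 1) ^ l = 1" by (simp flip: power_mult_distrib)
  ultimately show ?thesis by (simp add: power_int_diff field_simps)
qed

text \<open>Truncation of \<open>I u v\<close> makes the exponential a finite sum. Its upper limit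
  is any large enough \<open>K\<close>, so that several such sums can share a range.\<close>

lemma skew_sum:
  assumes L: "lin_map S S (L (- 1))" and S: "complex_vector.subspace S"
    and N: "\<forall>r<N. I u v r = 0" and K: "n - N \<le> int K"
  shows "skew L I v u n = (\<Sum>k\<le>K. ((- 1) powi (n - int k) / fact k) *\<^sub>C (L (- 1) ^^ k) (I u v (n - int k)))"
  unfolding skew_def
proof (rule Sum_any.expand_superset)
  show "{k. ((- 1) powi (n - int k) / fact k) *\<^sub>C (L (- 1) ^^ k) (I u v (n - int k)) \<noteq> 0} \<subseteq> {..K}"
  proof (rule subsetI, rule ccontr)
    fix k assume k: "k \<in> {k. ((- 1) powi (n - int k) / fact k) *\<^sub>C (L (- 1) ^^ k) (I u v (n - int k)) \<noteq> 0}"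
      and "k \<notin> {..K}"
    then have "I u v (n - int k) = 0" using N K by auto
    then show False using k lin_map_zero[OF lin_map_funpow[OF L] S, of k] by simp
  qed
qed simp

lemma skew_scale:
  assumes L: "lin_map S S (L (- 1))" and S: "complex_vector.subspace S"
    and I: "I u v \<in> laurent S"
  shows "skew L (c *\<^sub>C I) v u = c *\<^sub>C skew L I v u"
proof
  fix n
  obtain N where N: "\<forall>r<N. I u v r = 0" using I by (rule laurent_bound)
  have in_S: "I u v r \<in> S" for r using I by (simp add: laurent_def)
  have "skew L (c *\<^sub>C I) v u n
      = (\<Sum>k\<le>nat (n - N). ((- 1) powi (n - int k) / fact k) *\<^sub>C (L (- 1) ^^ k) (c *\<^sub>C I u v (n - int k)))"
    using skew_sum[where L = L and I = "c *\<^sub>C I" and S = S and u = u and v = v and n = n and N = N and K = "nat (n - N)"]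
      L S N by (simp add: scaleC_apply)
  also have "\<dots> = c *\<^sub>C skew L I v u n"
    using skew_sum[where L = L and I = I and S = S and u = u and v = v and n = n and N = N and K = "nat (n - N)"] L S N
    by (simp add: lin_map_scale[OF lin_map_funpow[OF L] in_S] complex_vector.scale_sum_right mult.commute)
  finally show "skew L (c *\<^sub>C I) v u n = (c *\<^sub>C skew L I v u) n" by (simp add: scaleC_apply)
qed

lemma skew_laurent:
  assumes L: "lin_map S S (L (- 1))" and S: "complex_vector.subspace S" and I: "I u v \<in> laurent S"
  shows "skew L I v u \<in> laurent S"
proof -
  obtain N where N: "\<forall>r<N. I u v r = 0" using I by (rule laurent_bound)
  have in_S: "I u v r \<in> S" for r using I by (simp add: laurent_def)
  have "(\<Sum>k\<le>K. ((- 1) powi (n - int k) / fact k) *\<^sub>C (L (- 1) ^^ k) (I u v (n - int k))) \<in> S" for n K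
    by (intro complex_vector.subspace_sum[OF S] complex_vector.subspace_scale[OF S]
        lin_map_in[OF lin_map_funpow[OF L]] in_S)
  moreover have "skew L I v u n = (\<Sum>k\<le>nat (n - N). ((- 1) powi (n - int k) / fact k) *\<^sub>C (L (- 1) ^^ k) (I u v (n - int k)))" for n
    by (rule skew_sum[where S = S and N = N]) (simp_all add: L S N)
  ultimately have "skew L I v u n \<in> S" for n by simp
  moreover have "skew L I v u n = 0" if "n < N" for n
    using skew_sum[where L = L and I = I and S = S and u = u and v = v and n = n and N = N and K = 0] L S N that by simp
  ultimately show ?thesis by (auto simp: laurent_def)
qed

lemma sum_antidiagonals:
  fixes g :: "nat \<Rightarrow> nat \<Rightarrow> 'b::comm_monoid_add"
  shows "(\<Sum>k\<le>K. \<Sum>l\<le>K - k. g k l) = (\<Sum>r\<le>K. \<Sum>l\<le>r. g (r - l) l)"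
  unfolding sum.Sigma[OF finite_atMost ballI[OF finite_atMost]]
  by (rule sum.reindex_bij_witness[of _ "\<lambda>(r, l). (r - l, l)" "\<lambda>(k, l). (k + l, l)"]) auto

lemma alternating_sum_fact: "(\<Sum>l\<le>r. (- 1) ^ l / (fact (r - l) * fact l)) = (if r = 0 then 1 else 0 :: complex)"
proof -
  have "(\<Sum>l\<le>r. (- 1) ^ l / (fact (r - l) * fact l)) = (\<Sum>l\<le>r. (- 1) ^ l * of_nat (r choose l)) / (fact r :: complex)"
    by (simp add: sum_divide_distrib binomial_fact mult.commute)
  also have "\<dots> = (if r = 0 then 1 else 0)" using choose_alternating_sum[of r, where 'a = complex] by auto
  finally show ?thesis .
qed

text \<open>This is \<open>e^{zL(-1)} e^{-zL(-1)} = 1\<close> coefficientwise: the terms with a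
  fixed total power of \<open>L(-1)\<close> carry an alternating sum of binomial coefficients, which
  vanishes for positive powers.\<close>

lemma skew_skew:
  assumes L: "lin_map S S (L (- 1))" and S: "complex_vector.subspace S" and I: "I u v \<in> laurent S"
  shows "skew L (skew L I) u v = I u v"
proof
  fix n
  obtain N where N: "\<forall>r<N. I u v r = 0" using I by (rule laurent_bound)
  have in_S: "I u v r \<in> S" for r using I by (simp add: laurent_def)
  have N': "\<forall>r<N. skew L I v u r = 0"
    using skew_sum[where L = L and I = I and S = S and u = u and v = v and N = N and K = 0] L S N by simp
  define K where "K = nat (n - N)"
  let ?T = "\<lambda>k. (L (- 1) ^^ k)"
  have "skew L (skew L I) u v n = (\<Sum>k\<le>K. ((- 1) powi (n - int k) / fact k) *\<^sub>C ?T k (skew L I v u (n - int k)))"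
    by (rule skew_sum[where L = L and I = "skew L I" and S = S and N = N]) (simp_all add: L S N' K_def)
  also have "\<dots> = (\<Sum>k\<le>K. \<Sum>l\<le>K - k. ((- 1) ^ l / (fact k * fact l)) *\<^sub>C ?T (k + l) (I u v (n - int (k + l))))"
  proof (rule sum.cong[OF refl])
    fix k assume "k \<in> {..K}"
    then have "n - int k - N \<le> int (K - k)" by (auto simp: K_def)
    then have "skew L I v u (n - int k) = (\<Sum>l\<le>K - k. ((- 1) powi (n - int k - int l) / fact l) *\<^sub>C ?T l (I u v (n - int k - int l)))"
      by (intro skew_sum[where L = L and I = I and S = S and N = N] L S N)
    then have "?T k (skew L I v u (n - int k))
        = (\<Sum>l\<le>K - k. ((- 1) powi (n - int k - int l) / fact l) *\<^sub>C ?T (k + l) (I u v (n - int k - int l)))"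
      by (simp add: lin_map_sum[OF lin_map_funpow[OF L] S] lin_map_scale[OF lin_map_funpow[OF L]]
          complex_vector.subspace_scale[OF S] lin_map_in[OF lin_map_funpow[OF L]] in_S funpow_add)
    moreover have "(- 1) powi (n - int k) / fact k * ((- 1) powi (n - int k - int l) / fact l) = ((- 1) ^ l / (fact k * fact l) :: complex)" for l
      using minus_one_powi_diff[of "n - int k" l] by (simp only: times_divide_times_eq)
    ultimately show "((- 1) powi (n - int k) / fact k) *\<^sub>C ?T k (skew L I v u (n - int k))
        = (\<Sum>l\<le>K - k. ((- 1) ^ l / (fact k * fact l)) *\<^sub>C ?T (k + l) (I u v (n - int (k + l))))"
      by (simp only: complex_vector.scale_sum_right scaleC_scaleC of_nat_add diff_diff_eq)
  qed
  also have "\<dots> = (\<Sum>r\<le>K. \<Sum>l\<le>r. ((- 1) ^ l / (fact (r - l) * fact l)) *\<^sub>C ?T r (I u v (n - int r)))"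
    unfolding sum_antidiagonals by (intro sum.cong refl) simp
  also have "\<dots> = (\<Sum>r\<le>K. (if r = 0 then 1 else 0) *\<^sub>C ?T r (I u v (n - int r)))"
    by (simp only: alternating_sum_fact flip: complex_vector.scale_sum_left)
  also have "\<dots> = I u v n" by (simp add: if_distrib[of "\<lambda>c. c *\<^sub>C _"] scaleC_one sum.delta cong: if_cong)
  finally show "skew L (skew L I) u v n = I u v n" .
qed

text \<open>Iterated differentiation gives a falling factorial, written as \<open>k!\<close> times a
  binomial coefficient because the \<open>k!\<close> will cancel against the exponential in
  \<open>skew\<close>.\<close>

lemma derivative_pow:
  assumes S: "\<And>q. q \<in> S \<Longrightarrow> D q \<in> S" and D: "\<And>q n. q \<in> S \<Longrightarrow> J (D q) n = ddz (J q) n" and q: "q \<in> S"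
  shows "J ((D ^^ k) q) n = (fact k * (of_int (n + int k) gchoose k)) *\<^sub>C J q (n + int k)"
proof (induction k arbitrary: n)
  case (Suc k)
  have "(D ^^ k) q \<in> S" by (induction k) (simp_all add: q S)
  then have "J ((D ^^ Suc k) q) n = of_int (n + 1) *\<^sub>C J ((D ^^ k) q) (n + 1)" by (simp add: D ddz_def)
  also have "\<dots> = (of_int (n + 1) * (fact k * (of_int (n + int (Suc k)) gchoose k))) *\<^sub>C J q (n + int (Suc k))"
    by (simp add: Suc.IH scaleC_scaleC add_ac)
  also have "of_int (n + 1) * (of_int (n + int (Suc k)) gchoose k) = of_nat (Suc k) * (of_int (n + int (Suc k)) gchoose Suc k :: complex)"
    using gbinomial_absorption[of k "of_int (n + int (Suc k)) :: complex"]
      gbinomial_absorb_comp[of "of_int (n + int (Suc k)) :: complex" k] by simp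
  then have "of_int (n + 1) * (fact k * (of_int (n + int (Suc k)) gchoose k)) = fact (Suc k) * (of_int (n + int (Suc k)) gchoose Suc k :: complex)"
    by (simp add: mult_ac)
  finally show ?case .
qed (simp add: scaleC_one)

text \<open>By \<open>J(L(-1)q) = d/dz J(q)\<close>, replacing \<open>I\<close> by its skew in the iterate translates \<open>w\<close> by \<open>z - w\<close>.\<close>

lemma iterated_skew:
  assumes L: "lin_map S S (L (- 1))" and S: "complex_vector.subspace S" and I: "I u v \<in> laurent S"
    and J: "lin_map S W (\<lambda>q. J q x)" and D: "\<And>q n. q \<in> S \<Longrightarrow> J (L (- 1) q) x n = ddz (J q x) n"
    and N: "\<forall>r<N. I u v r = 0" and K: "p - N \<le> int K"
  shows "iterated J (skew L I) v u x p n
    = (\<Sum>k\<le>K. ((- 1) powi (p - int k) * (of_int (n + int k) gchoose k)) *\<^sub>C iterated J I u v x (p - int k) (n + int k))"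
proof -
  let ?T = "\<lambda>k. (L (- 1) ^^ k)"
  have in_S: "I u v r \<in> S" for r using I by (simp add: laurent_def)
  have T: "?T k q \<in> S" if "q \<in> S" for k q by (rule lin_map_in[OF lin_map_funpow[OF L] that])
  have "J (skew L I v u p) x = J (\<Sum>k\<le>K. ((- 1) powi (p - int k) / fact k) *\<^sub>C ?T k (I u v (p - int k))) x"
    using skew_sum[where L = L and I = I and S = S and u = u and v = v and N = N and n = p and K = K] L S N K by simp
  also have "\<dots> = (\<Sum>k\<le>K. ((- 1) powi (p - int k) / fact k) *\<^sub>C J (?T k (I u v (p - int k))) x)"
    by (simp add: lin_map_sum[OF J S] lin_map_scale[OF J] complex_vector.subspace_scale[OF S] T in_S)
  finally have "iterated J (skew L I) v u x p n
      = (\<Sum>k\<le>K. ((- 1) powi (p - int k) / fact k) *\<^sub>C J (?T k (I u v (p - int k))) x n)"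
    by (simp add: iterated_def sum_fun_apply scaleC_apply)
  also have "\<dots> = (\<Sum>k\<le>K. ((- 1) powi (p - int k) * (of_int (n + int k) gchoose k)) *\<^sub>C J (I u v (p - int k)) x (n + int k))"
    using derivative_pow[where J = "\<lambda>q. J q x" and S = S and D = "L (- 1)", OF lin_map_in[OF L] D in_S]
    by (simp add: scaleC_scaleC)
  finally show ?thesis by (simp add: iterated_def)
qed

subsection \<open>Expansions of a common fraction\<close>

text \<open>A relation between coefficient families, not a map on fractions, so that it can be
  imposed on slices of series in three variables. Injectivity of the expansions makes it a partial
  function in both directions.\<close>

definition assoc_rel :: "'v::complex_vector set \<Rightarrow> (int \<Rightarrow> int \<Rightarrow> 'v) \<Rightarrow> (int \<Rightarrow> int \<Rightarrow> 'v) \<Rightarrow> bool" where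
  "assoc_rel S f g \<longleftrightarrow> (\<exists>\<phi>\<in>locser2_on S. expand_zw \<phi> = f \<and> expand_w_zw \<phi> = g)"

definition exch_rel :: "'v::complex_vector set \<Rightarrow> (int \<Rightarrow> int \<Rightarrow> 'v) \<Rightarrow> (int \<Rightarrow> int \<Rightarrow> 'v) \<Rightarrow> bool" where
  "exch_rel S f g \<longleftrightarrow> (\<exists>\<phi>\<in>locser2_on S. expand_zw \<phi> = f \<and> expand_wz \<phi> = g)"

lemma assoc_relI: "\<phi> \<in> locser2_on S \<Longrightarrow> expand_zw \<phi> = f \<Longrightarrow> expand_w_zw \<phi> = g \<Longrightarrow> assoc_rel S f g"
  unfolding assoc_rel_def by (rule bexI) (rule conjI)

lemma exch_relI: "\<phi> \<in> locser2_on S \<Longrightarrow> expand_zw \<phi> = f \<Longrightarrow> expand_wz \<phi> = g \<Longrightarrow> exch_rel S f g"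
  unfolding exch_rel_def by (rule bexI) (rule conjI)

lemma assoc_relE:
  assumes "assoc_rel S f g"
  obtains \<phi> where "\<phi> \<in> locser2_on S" "f = expand_zw \<phi>" "g = expand_w_zw \<phi>"
  using assms unfolding assoc_rel_def by metis

lemma exch_relE:
  assumes "exch_rel S f g"
  obtains \<phi> where "\<phi> \<in> locser2_on S" "f = expand_zw \<phi>" "g = expand_wz \<phi>"
  using assms unfolding exch_rel_def by metis

lemma assoc_rel_fun: "assoc_rel S f g \<Longrightarrow> assoc_rel S' f g' \<Longrightarrow> g = g'"
  and assoc_rel_inj: "assoc_rel S f g \<Longrightarrow> assoc_rel S' f' g \<Longrightarrow> f = f'"
  and exch_rel_fun: "exch_rel S f g \<Longrightarrow> exch_rel S' f g' \<Longrightarrow> g = g'"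
  unfolding assoc_rel_def exch_rel_def by (metis expand_zw_inj expand_w_zw_inj)+

lemma assoc_rel_add:
  assumes "complex_vector.subspace S" "assoc_rel S f g" "assoc_rel S f' g'"
  shows "assoc_rel S (f + f') (g + g')"
proof -
  obtain \<phi> \<psi> where "\<phi> \<in> locser2_on S" "f = expand_zw \<phi>" "g = expand_w_zw \<phi>"
    "\<psi> \<in> locser2_on S" "f' = expand_zw \<psi>" "g' = expand_w_zw \<psi>" using assms(2,3) by (metis assoc_relE)
  then show ?thesis
    using complex_vector.subspace_add[OF subspace_locser2_on[OF assms(1)]]
    by (intro assoc_relI[of "\<phi> + \<psi>"]) (simp_all add: expand_add)
qed

lemma exch_rel_add:
  assumes "complex_vector.subspace S" "exch_rel S f g" "exch_rel S f' g'"
  shows "exch_rel S (f + f') (g + g')"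
proof -
  obtain \<phi> \<psi> where "\<phi> \<in> locser2_on S" "f = expand_zw \<phi>" "g = expand_wz \<phi>"
    "\<psi> \<in> locser2_on S" "f' = expand_zw \<psi>" "g' = expand_wz \<psi>" using assms(2,3) by (metis exch_relE)
  then show ?thesis
    using complex_vector.subspace_add[OF subspace_locser2_on[OF assms(1)]]
    by (intro exch_relI[of "\<phi> + \<psi>"]) (simp_all add: expand_add)
qed

lemma assoc_rel_scale:
  assumes "complex_vector.subspace S" "assoc_rel S f g"
  shows "assoc_rel S (c *\<^sub>C f) (c *\<^sub>C g)"
proof -
  obtain \<phi> where "\<phi> \<in> locser2_on S" "f = expand_zw \<phi>" "g = expand_w_zw \<phi>"
    using assms(2) by (rule assoc_relE)
  then show ?thesis
    using complex_vector.subspace_scale[OF subspace_locser2_on[OF assms(1)]]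
    by (intro assoc_relI[of "c *\<^sub>C \<phi>"]) (simp_all add: expand_scale)
qed

lemma exch_rel_scale:
  assumes "complex_vector.subspace S" "exch_rel S f g"
  shows "exch_rel S (c *\<^sub>C f) (c *\<^sub>C g)"
proof -
  obtain \<phi> where "\<phi> \<in> locser2_on S" "f = expand_zw \<phi>" "g = expand_wz \<phi>"
    using assms(2) by (rule exch_relE)
  then show ?thesis
    using complex_vector.subspace_scale[OF subspace_locser2_on[OF assms(1)]]
    by (intro exch_relI[of "c *\<^sub>C \<phi>"]) (simp_all add: expand_scale)
qed

lemma assoc_rel_0: "assoc_rel UNIV 0 0"
  by (rule assoc_relI[of 0]) (simp_all add: expand_zero locser2_on_UNIV)

lemma exch_rel_0: "exch_rel UNIV 0 0"
  by (rule exch_relI[of 0]) (simp_all add: expand_zero locser2_on_UNIV)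

lemma bin_mult_map:
  assumes "lin_map S W h" "complex_vector.subspace S" "\<And>m n. f m n \<in> S"
  shows "bin_mult e (\<lambda>m n. h (f m n)) m n = h (bin_mult e f m n)"
  unfolding bin_mult_def
  by (simp add: lin_map_sum[OF assms(1,2)] lin_map_scale[OF assms(1)] complex_vector.subspace_scale[OF assms(2)] assms(3))

lemma expand_map:
  assumes h: "lin_map S W h" and S: "complex_vector.subspace S" and F: "\<forall>a b. F a b \<in> S"
  shows "expand_zw (frac2 (N, \<lambda>a b. h (F a b))) m n = h (expand_zw (frac2 (N, F)) m n)"
    and "expand_wz (frac2 (N, \<lambda>a b. h (F a b))) m n = h (expand_wz (frac2 (N, F)) m n)"
    and "expand_w_zw (frac2 (N, \<lambda>a b. h (F a b))) m n = h (expand_w_zw (frac2 (N, F)) m n)"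
proof -
  have in_S: "coef2 F m n \<in> S" for m n using F complex_vector.subspace_0[OF S] by (simp add: coef2_def)
  have c: "coef2 (\<lambda>a b. h (F a b)) m n = h (coef2 F m n)" for m n
    by (simp add: coef2_def lin_map_zero[OF h S])
  have c': "coef2 (\<lambda>a b. h (F a b)) = (\<lambda>m n. h (coef2 F m n))" by (intro ext) (rule c)
  have B: "bin_mult e (\<lambda>b a. coef2 F a b) m n \<in> S" for e m n
    unfolding bin_mult_def by (intro complex_vector.subspace_sum[OF S] complex_vector.subspace_scale[OF S] in_S)
  show "expand_zw (frac2 (N, \<lambda>a b. h (F a b))) m n = h (expand_zw (frac2 (N, F)) m n)"
    by (simp add: expand_zw_frac2 c' bin_mult_map[OF h S in_S])
  show "expand_wz (frac2 (N, \<lambda>a b. h (F a b))) m n = h (expand_wz (frac2 (N, F)) m n)"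
    by (simp add: expand_wz_frac2 c' bin_mult_map[OF h S, of "\<lambda>b a. coef2 F a b"] in_S lin_map_scale[OF h B])
  show "expand_w_zw (frac2 (N, \<lambda>a b. h (F a b))) m n = h (expand_w_zw (frac2 (N, F)) m n)"
    by (simp add: expand_w_zw_frac2 c lin_map_zero[OF h S] lin_map_sum[OF h S] lin_map_scale[OF h]
        complex_vector.subspace_scale[OF S] in_S)
qed

lemma assoc_rel_map:
  assumes h: "lin_map S W h" and S: "complex_vector.subspace S" and "assoc_rel S f g"
  shows "assoc_rel W (\<lambda>m n. h (f m n)) (\<lambda>m n. h (g m n))"
proof -
  obtain \<phi> where \<phi>: "\<phi> \<in> locser2_on S" "f = expand_zw \<phi>" "g = expand_w_zw \<phi>"
    using assms(3) by (rule assoc_relE)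
  from \<phi>(1) obtain N F where F: "\<phi> = frac2 (N, F)" "\<forall>a b. F a b \<in> S" by (rule locser2_onE)
  show ?thesis
  proof (rule assoc_relI)
    show "frac2 (N, \<lambda>a b. h (F a b)) \<in> locser2_on W" using F(2) lin_map_in[OF h] by (intro locser2_onI) simp
  qed (intro ext, simp add: \<phi> F(1) expand_map[OF h S F(2)])+
qed

lemma exch_rel_map:
  assumes h: "lin_map S W h" and S: "complex_vector.subspace S" and "exch_rel S f g"
  shows "exch_rel W (\<lambda>m n. h (f m n)) (\<lambda>m n. h (g m n))"
proof -
  obtain \<phi> where \<phi>: "\<phi> \<in> locser2_on S" "f = expand_zw \<phi>" "g = expand_wz \<phi>"
    using assms(3) by (rule exch_relE)
  from \<phi>(1) obtain N F where F: "\<phi> = frac2 (N, F)" "\<forall>a b. F a b \<in> S" by (rule locser2_onE)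
  show ?thesis
  proof (rule exch_relI)
    show "frac2 (N, \<lambda>a b. h (F a b)) \<in> locser2_on W" using F(2) lin_map_in[OF h] by (intro locser2_onI) simp
  qed (intro ext, simp add: \<phi> F(1) expand_map[OF h S F(2)])+
qed

lemma assoc_rel_UNIV: "assoc_rel S f g \<Longrightarrow> assoc_rel UNIV f g"
  and exch_rel_UNIV: "exch_rel S f g \<Longrightarrow> exch_rel UNIV f g"
  unfolding assoc_rel_def exch_rel_def by (metis locser2_on_UNIV)+

text \<open>In the region of small \<open>z - w\<close>, multiplication by \<open>z\<close> is
  multiplication by \<open>(z - w) + w\<close>; on the binomial coefficients this is Pascal's
  rule.\<close>

lemma expand_mul1:
  "expand_zw (frac2 (N, \<lambda>a b. if a = 0 then 0 else F (a - 1) b)) = mul1 (expand_zw (frac2 (N, F)))"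
  "expand_wz (frac2 (N, \<lambda>a b. if a = 0 then 0 else F (a - 1) b)) = mul1 (expand_wz (frac2 (N, F)))"
  "expand_w_zw (frac2 (N, \<lambda>a b. if a = 0 then 0 else F (a - 1) b))
    = mul1 (expand_w_zw (frac2 (N, F))) + mul2 (expand_w_zw (frac2 (N, F)))"
proof -
  let ?F = "\<lambda>a b. if a = 0 then 0 else F (a - 1) b"
  have c: "coef2 ?F = (\<lambda>m n. coef2 F (m - 1) n)"
    by (intro ext) (auto simp: coef2_def nat_diff_distrib)
  show "expand_zw (frac2 (N, ?F)) = mul1 (expand_zw (frac2 (N, F)))"
    by (intro ext) (simp add: expand_zw_frac2 mul1_def c bin_mult_shift1 algebra_simps)
  show "expand_wz (frac2 (N, ?F)) = mul1 (expand_wz (frac2 (N, F)))"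
  proof (intro ext)
    fix m n
    have "bin_mult (- int N) (\<lambda>b a. coef2 F (a - 1) b) (n + int N) (m + int N)
        = bin_mult (- int N) (\<lambda>b a. coef2 F a b) (n + int N) (m + int N - 1)"
      by (rule bin_mult_shift2[of "\<lambda>b a. coef2 F a b"]) (simp add: coef2_def)
    then show "expand_wz (frac2 (N, ?F)) m n = mul1 (expand_wz (frac2 (N, F))) m n"
      by (simp add: expand_wz_frac2 mul1_def c algebra_simps)
  qed
  show "expand_w_zw (frac2 (N, ?F)) = mul1 (expand_w_zw (frac2 (N, F))) + mul2 (expand_w_zw (frac2 (N, F)))"
  proof (intro ext)
    fix p n
    define q where "q = p + n + 3 * int N"
    have q: "p - 1 + n + 3 * int N = q - 1" "p + (n - 1) + 3 * int N = q - 1" by (simp_all add: q_def)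
    show "expand_w_zw (frac2 (N, ?F)) p n = (mul1 (expand_w_zw (frac2 (N, F))) + mul2 (expand_w_zw (frac2 (N, F)))) p n"
    proof (cases "p + int N < 0 \<or> q \<le> 0")
      case True
      have "coef2 F (int a) (q - 1 - int a) = 0" "coef2 F (int a - 1) (q - int a) = 0" if "q \<le> 0" for a
        using that by (auto simp: coef2_def)
      moreover have "coef2 F (- 1) q = 0" "q \<le> 0 \<Longrightarrow> coef2 F 0 (q - 1) = 0" by (simp_all add: coef2_def)
      ultimately show ?thesis using True
        unfolding plus_fun_def mul1_def mul2_def expand_w_zw_frac2 q q_def[symmetric] c by auto
    next
      case False
      then obtain P Q where P: "p + int N = int P" and Q: "q = int (Suc Q)"
        by (metis not_less not_le zero_le_imp_eq_int pos_int_cases Suc_pred' int_ops(4) )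
      have "(\<Sum>a\<le>Suc Q. (of_int (int a - int N) gchoose P) *\<^sub>C coef2 F (int a - 1) (q - int a))
          = (\<Sum>a\<le>Q. (of_int (int a - int N) + 1 gchoose P) *\<^sub>C coef2 F (int a) (q - 1 - int a))"
        unfolding sum.atMost_Suc_shift by (simp add: coef2_def algebra_simps)
      \<comment> \<open>For \<open>P = 0\<close>, the lowest power of \<open>z - w\<close>, Pascal's
        rule has no first term.\<close>
      also have "\<dots> = (\<Sum>a\<le>Q. ((if P = 0 then 0 else of_int (int a - int N) gchoose (P - 1))
            + (of_int (int a - int N) gchoose P)) *\<^sub>C coef2 F (int a) (q - 1 - int a))"
      proof (intro sum.cong refl arg_cong[where f = "\<lambda>c. c *\<^sub>C _"])
        fix a show "(of_int (int a - int N) + 1 gchoose P :: complex)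
          = (if P = 0 then 0 else of_int (int a - int N) gchoose (P - 1)) + (of_int (int a - int N) gchoose P)"
          by (cases P) (simp_all only: gbinomial_Suc_Suc, simp_all)
      qed
      also have "\<dots> = mul1 (expand_w_zw (frac2 (N, F))) p n + mul2 (expand_w_zw (frac2 (N, F))) p n"
      proof -
        have "mul1 (expand_w_zw (frac2 (N, F))) p n = (\<Sum>a\<le>Q. (if P = 0 then 0 else of_int (int a - int N) gchoose (P - 1)) *\<^sub>C coef2 F (int a) (q - 1 - int a))"
        proof -
          have "p - 1 + int N < 0 \<longleftrightarrow> P = 0" "nat (p - 1 + int N) = P - 1" using P by auto
          then show ?thesis unfolding mul1_def expand_w_zw_frac2 q by (simp add: Q)
        qed
        moreover have "mul2 (expand_w_zw (frac2 (N, F))) p n = (\<Sum>a\<le>Q. (of_int (int a - int N) gchoose P) *\<^sub>C coef2 F (int a) (q - 1 - int a))"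
          unfolding mul2_def expand_w_zw_frac2 q P by (simp add: Q)
        ultimately show ?thesis by (simp only: scaleC_add_left sum.distrib)
      qed
      finally have "(\<Sum>a\<le>Suc Q. (of_int (int a - int N) gchoose P) *\<^sub>C coef2 F (int a - 1) (q - int a))
          = mul1 (expand_w_zw (frac2 (N, F))) p n + mul2 (expand_w_zw (frac2 (N, F))) p n" .
      moreover have "expand_w_zw (frac2 (N, ?F)) p n
          = (\<Sum>a\<le>Suc Q. (of_int (int a - int N) gchoose P) *\<^sub>C coef2 F (int a - 1) (q - int a))"
      proof -
        have "\<not> int P < 0" "nat q = Suc Q" "nat (int P) = P" using Q by simp_all
        then show ?thesis unfolding expand_w_zw_frac2 q_def[symmetric] P c by (simp only: if_False)
      qed
      ultimately show ?thesis by (simp only: plus_fun_apply)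
    qed
  qed
qed

lemma expand_mul2:
  "expand_zw (frac2 (N, \<lambda>a b. if b = 0 then 0 else F a (b - 1))) = mul2 (expand_zw (frac2 (N, F)))"
  "expand_wz (frac2 (N, \<lambda>a b. if b = 0 then 0 else F a (b - 1))) = mul2 (expand_wz (frac2 (N, F)))"
  "expand_w_zw (frac2 (N, \<lambda>a b. if b = 0 then 0 else F a (b - 1))) = mul2 (expand_w_zw (frac2 (N, F)))"
proof -
  let ?F = "\<lambda>a b. if b = 0 then 0 else F a (b - 1)"
  have c: "coef2 ?F = (\<lambda>m n. coef2 F m (n - 1))"
    by (intro ext) (auto simp: coef2_def nat_diff_distrib)
  show "expand_zw (frac2 (N, ?F)) = mul2 (expand_zw (frac2 (N, F)))"
  proof (intro ext)
    fix m n
    have "bin_mult (- int N) (\<lambda>m n. coef2 F m (n - 1)) (m + int N) (n + int N)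
        = bin_mult (- int N) (coef2 F) (m + int N) (n + int N - 1)"
      by (rule bin_mult_shift2[of "coef2 F"]) (simp add: coef2_def)
    then show "expand_zw (frac2 (N, ?F)) m n = mul2 (expand_zw (frac2 (N, F))) m n"
      by (simp add: expand_zw_frac2 mul2_def c algebra_simps)
  qed
  show "expand_wz (frac2 (N, ?F)) = mul2 (expand_wz (frac2 (N, F)))"
    by (intro ext) (simp add: expand_wz_frac2 mul2_def c bin_mult_shift1[of _ "\<lambda>b a. coef2 F a b"] algebra_simps)
  show "expand_w_zw (frac2 (N, ?F)) = mul2 (expand_w_zw (frac2 (N, F)))"
  proof (intro ext)
    fix p n
    define q where "q = p + n + 3 * int N"
    have q: "p + (n - 1) + 3 * int N = q - 1" by (simp add: q_def)
    have "(\<Sum>a\<le>nat q. (of_int (int a - int N) gchoose k) *\<^sub>C coef2 F (int a) (q - int a - 1))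
        = (\<Sum>a\<le>nat (q - 1). (of_int (int a - int N) gchoose k) *\<^sub>C coef2 F (int a) (q - 1 - int a))" for k
      by (rule sum.mono_neutral_cong_right) (auto simp: coef2_def algebra_simps)
    then show "expand_w_zw (frac2 (N, ?F)) p n = mul2 (expand_w_zw (frac2 (N, F))) p n"
      unfolding mul2_def expand_w_zw_frac2 q q_def[symmetric] c by simp
  qed
qed

lemma assoc_rel_mul:
  assumes "assoc_rel UNIV f g"
  shows "assoc_rel UNIV (mul1 f) (mul1 g + mul2 g)" "assoc_rel UNIV (mul2 f) (mul2 g)"
proof -
  obtain \<phi> where \<phi>: "f = expand_zw \<phi>" "g = expand_w_zw \<phi>" using assms by (rule assoc_relE)
  obtain N F where F: "\<phi> = frac2 (N, F)" by (rule locser2_cases)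
  show "assoc_rel UNIV (mul1 f) (mul1 g + mul2 g)" "assoc_rel UNIV (mul2 f) (mul2 g)"
    unfolding \<phi> F by (rule assoc_relI[OF locser2_on_UNIV expand_mul1(1,3)], rule assoc_relI[OF locser2_on_UNIV expand_mul2(1,3)])
qed

lemma exch_rel_mul:
  assumes "exch_rel UNIV f g"
  shows "exch_rel UNIV (mul1 f) (mul1 g)" "exch_rel UNIV (mul2 f) (mul2 g)"
proof -
  obtain \<phi> where \<phi>: "f = expand_zw \<phi>" "g = expand_wz \<phi>" using assms by (rule exch_relE)
  obtain N F where F: "\<phi> = frac2 (N, F)" by (rule locser2_cases)
  show "exch_rel UNIV (mul1 f) (mul1 g)" "exch_rel UNIV (mul2 f) (mul2 g)"
    unfolding \<phi> F by (rule exch_relI[OF locser2_on_UNIV expand_mul1(1,2)], rule exch_relI[OF locser2_on_UNIV expand_mul2(1,2)])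
qed

text \<open>The substitution \<open>z = y + w\<close> in power series.\<close>

definition subst2 :: "(nat \<Rightarrow> nat \<Rightarrow> 'v::complex_vector) \<Rightarrow> nat \<Rightarrow> nat \<Rightarrow> 'v" where
  "subst2 F p n = (\<Sum>a\<le>p + n. of_nat (a choose p) *\<^sub>C F a (p + n - a))"

lemma assoc_rel_power_series: "assoc_rel UNIV (coef2 F) (coef2 (subst2 F))"
proof (rule assoc_relI[of "frac2 (0, F)"])
  show "expand_zw (frac2 (0, F)) = coef2 F"
    by (intro ext) (simp add: expand_zw_frac2 bin_mult_0 coef2_def)
  show "expand_w_zw (frac2 (0, F)) = coef2 (subst2 F)"
  proof (intro ext)
    fix p n :: int
    show "expand_w_zw (frac2 (0, F)) p n = coef2 (subst2 F) p n"
    proof (cases "0 \<le> p \<and> 0 \<le> n")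
      case True
      then obtain P M where [simp]: "p = int P" "n = int M" by (metis zero_le_imp_eq_int)
      have "(\<Sum>a\<le>P + M. (of_nat a gchoose P) *\<^sub>C coef2 F (int a) (int P + int M - int a))
          = (\<Sum>a\<le>P + M. of_nat (a choose P) *\<^sub>C F a (P + M - a))"
        by (intro sum.cong refl) (simp add: coef2_def binomial_gbinomial nat_diff_distrib flip: of_nat_add)
      then show ?thesis by (simp add: expand_w_zw_frac2 coef2_def[of "subst2 F"] subst2_def flip: of_nat_add)
    next
      case False
      \<comment> \<open>No negative power of \<open>w\<close> arises: either \<open>a < p\<close>
        and the binomial vanishes, or the second exponent is negative.\<close>
      have "(of_nat a gchoose nat p) *\<^sub>C coef2 F (int a) (p + n - int a) = 0" if "0 \<le> p" "n < 0" for a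
      proof (cases "int a < p")
        case True
        then show ?thesis using that by (simp add: binomial_gbinomial[symmetric] binomial_eq_0)
      qed (use that in \<open>simp add: coef2_def\<close>)
      then show ?thesis using False
        by (auto simp: expand_w_zw_frac2 coef2_def[of "subst2 F"] intro!: sum.neutral)
    qed
  qed
qed (rule locser2_on_UNIV)

lemma exch_rel_power_series: "exch_rel UNIV (coef2 F) (coef2 F)"
proof (rule exch_relI[of "frac2 (0, F)"])
  show "expand_zw (frac2 (0, F)) = coef2 F"
    by (intro ext) (simp add: expand_zw_frac2 bin_mult_0 coef2_def)
  show "expand_wz (frac2 (0, F)) = coef2 F"
  proof (intro ext)
    fix m n
    have "bin_mult 0 (\<lambda>b a. coef2 F a b) n m = coef2 F m n" by (rule bin_mult_0) (auto simp: coef2_def)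
    then show "expand_wz (frac2 (0, F)) m n = coef2 F m n" by (simp add: expand_wz_frac2 scaleC_one)
  qed
qed (rule locser2_on_UNIV)

subsection \<open>Fractions in three variables\<close>

text \<open>Multiplication by the linear form \<open>\<alpha> v\<^sub>1 + \<beta> v\<^sub>2 + \<gamma> v\<^sub>3\<close>.\<close>

definition mulf :: "complex \<times> complex \<times> complex \<Rightarrow> (int \<Rightarrow> int \<Rightarrow> int \<Rightarrow> 'v::complex_vector) \<Rightarrow> int \<Rightarrow> int \<Rightarrow> int \<Rightarrow> 'v" where
  "mulf l X m n s = fst l *\<^sub>C X (m - 1) n s + fst (snd l) *\<^sub>C X m (n - 1) s + snd (snd l) *\<^sub>C X m n (s - 1)"

primrec mulfs :: "(complex \<times> complex \<times> complex) list \<Rightarrow> (int \<Rightarrow> int \<Rightarrow> int \<Rightarrow> 'v::complex_vector) \<Rightarrow> int \<Rightarrow> int \<Rightarrow> int \<Rightarrow> 'v" where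
  "mulfs [] X = X"
| "mulfs (l # ls) X = mulf l (mulfs ls X)"

lemma mulf_scale: "mulf l (c *\<^sub>C X) = c *\<^sub>C mulf l X"
  by (intro ext) (simp add: mulf_def scaleC_apply scaleC_add_right scaleC_scaleC mult.commute)

lemma mulfs_scale: "mulfs ls (c *\<^sub>C X) = c *\<^sub>C mulfs ls X"
  by (induction ls) (simp_all add: mulf_scale)

lemma mulfs_append: "mulfs (ls @ ls') X = mulfs ls (mulfs ls' X)"
  by (induction ls) simp_all

text \<open>The third exponent is a parameter: a change of region in two variables acts separately
  on each coefficient in the remaining one, so the theory of fractions in two variables
  suffices.\<close>

definition rel12 :: "((int \<Rightarrow> int \<Rightarrow> 'v) \<Rightarrow> (int \<Rightarrow> int \<Rightarrow> 'v) \<Rightarrow> bool) \<Rightarrow>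
    (int \<Rightarrow> int \<Rightarrow> int \<Rightarrow> 'v) \<Rightarrow> (int \<Rightarrow> int \<Rightarrow> int \<Rightarrow> 'v) \<Rightarrow> bool" where
  "rel12 R X Y \<longleftrightarrow> (\<forall>s. R (\<lambda>m n. X m n s) (\<lambda>m n. Y m n s))"

definition rel13 :: "((int \<Rightarrow> int \<Rightarrow> 'v) \<Rightarrow> (int \<Rightarrow> int \<Rightarrow> 'v) \<Rightarrow> bool) \<Rightarrow>
    (int \<Rightarrow> int \<Rightarrow> int \<Rightarrow> 'v) \<Rightarrow> (int \<Rightarrow> int \<Rightarrow> int \<Rightarrow> 'v) \<Rightarrow> bool" where
  "rel13 R X Y \<longleftrightarrow> (\<forall>n. R (\<lambda>m s. X m n s) (\<lambda>m s. Y m n s))"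

definition rel23 :: "((int \<Rightarrow> int \<Rightarrow> 'v) \<Rightarrow> (int \<Rightarrow> int \<Rightarrow> 'v) \<Rightarrow> bool) \<Rightarrow>
    (int \<Rightarrow> int \<Rightarrow> int \<Rightarrow> 'v) \<Rightarrow> (int \<Rightarrow> int \<Rightarrow> int \<Rightarrow> 'v) \<Rightarrow> bool" where
  "rel23 R X Y \<longleftrightarrow> (\<forall>m. R (X m) (Y m))"

lemmas rel_defs = rel12_def rel13_def rel23_def

abbreviation assoc where "assoc \<equiv> assoc_rel UNIV"
abbreviation exch where "exch \<equiv> exch_rel UNIV"

text \<open>Shaped for \<open>mulf\<close> on one slice: \<open>f'\<close> is the neighbouring
  slice, reached by the fixed variable, and \<open>b + c\<close> arises from
  \<open>z = (z - w) + w\<close>.\<close>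

lemma assoc_comb:
  assumes "assoc f g" "assoc f' g'"
  shows "assoc (\<lambda>m n. a *\<^sub>C f' m n + (b *\<^sub>C f (m - 1) n + c *\<^sub>C f m (n - 1)))
    (\<lambda>m n. a *\<^sub>C g' m n + (b *\<^sub>C g (m - 1) n + (b + c) *\<^sub>C g m (n - 1)))"
proof -
  have "assoc (a *\<^sub>C f' + (b *\<^sub>C mul1 f + c *\<^sub>C mul2 f)) (a *\<^sub>C g' + (b *\<^sub>C (mul1 g + mul2 g) + c *\<^sub>C mul2 g))"
    by (intro assoc_rel_add assoc_rel_scale assoc_rel_mul complex_vector.subspace_UNIV assms)
  moreover have "a *\<^sub>C f' + (b *\<^sub>C mul1 f + c *\<^sub>C mul2 f) = (\<lambda>m n. a *\<^sub>C f' m n + (b *\<^sub>C f (m - 1) n + c *\<^sub>C f m (n - 1)))"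
    by (intro ext) (simp add: scaleC_apply mul1_def mul2_def)
  moreover have "a *\<^sub>C g' + (b *\<^sub>C (mul1 g + mul2 g) + c *\<^sub>C mul2 g)
      = (\<lambda>m n. a *\<^sub>C g' m n + (b *\<^sub>C g (m - 1) n + (b + c) *\<^sub>C g m (n - 1)))"
    by (intro ext) (simp add: scaleC_apply mul1_def mul2_def scaleC_add_right scaleC_add_left add.assoc)
  ultimately show ?thesis by simp
qed

lemma exch_comb:
  assumes "exch f g" "exch f' g'"
  shows "exch (\<lambda>m n. a *\<^sub>C f' m n + (b *\<^sub>C f (m - 1) n + c *\<^sub>C f m (n - 1)))
    (\<lambda>m n. a *\<^sub>C g' m n + (b *\<^sub>C g (m - 1) n + c *\<^sub>C g m (n - 1)))"
proof -
  have "exch (a *\<^sub>C f' + (b *\<^sub>C mul1 f + c *\<^sub>C mul2 f)) (a *\<^sub>C g' + (b *\<^sub>C mul1 g + c *\<^sub>C mul2 g))"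
    by (intro exch_rel_add exch_rel_scale exch_rel_mul complex_vector.subspace_UNIV assms)
  moreover have "a *\<^sub>C f' + (b *\<^sub>C mul1 f + c *\<^sub>C mul2 f) = (\<lambda>m n. a *\<^sub>C f' m n + (b *\<^sub>C f (m - 1) n + c *\<^sub>C f m (n - 1)))"
    "a *\<^sub>C g' + (b *\<^sub>C mul1 g + c *\<^sub>C mul2 g) = (\<lambda>m n. a *\<^sub>C g' m n + (b *\<^sub>C g (m - 1) n + c *\<^sub>C g m (n - 1)))"
    by (intro ext; simp add: scaleC_apply mul1_def mul2_def)+
  ultimately show ?thesis by simp
qed

text \<open>The effect of the substitutions \<open>v\<^sub>1 \<mapsto> v\<^sub>1 + v\<^sub>2\<close>, \<open>v\<^sub>1 \<mapsto> v\<^sub>1 + v\<^sub>3\<close>, \<open>v\<^sub>2 \<mapsto> v\<^sub>2 + v\<^sub>3\<close> on linear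
  forms and on power series.\<close>

definition lin12 :: "complex \<times> complex \<times> complex \<Rightarrow> complex \<times> complex \<times> complex" where
  "lin12 l = (fst l, fst l + fst (snd l), snd (snd l))"
definition lin13 :: "complex \<times> complex \<times> complex \<Rightarrow> complex \<times> complex \<times> complex" where
  "lin13 l = (fst l, fst (snd l), fst l + snd (snd l))"
definition lin23 :: "complex \<times> complex \<times> complex \<Rightarrow> complex \<times> complex \<times> complex" where
  "lin23 l = (fst l, fst (snd l), fst (snd l) + snd (snd l))"

definition subst12 :: "(nat \<Rightarrow> nat \<Rightarrow> nat \<Rightarrow> 'v::complex_vector) \<Rightarrow> nat \<Rightarrow> nat \<Rightarrow> nat \<Rightarrow> 'v" where
  "subst12 F a b c = subst2 (\<lambda>a b. F a b c) a b"
definition subst13 :: "(nat \<Rightarrow> nat \<Rightarrow> nat \<Rightarrow> 'v::complex_vector) \<Rightarrow> nat \<Rightarrow> nat \<Rightarrow> nat \<Rightarrow> 'v" where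
  "subst13 F a b c = subst2 (\<lambda>a c. F a b c) a c"
definition subst23 :: "(nat \<Rightarrow> nat \<Rightarrow> nat \<Rightarrow> 'v::complex_vector) \<Rightarrow> nat \<Rightarrow> nat \<Rightarrow> nat \<Rightarrow> 'v" where
  "subst23 F a b c = subst2 (F a) b c"

lemma mulf_rel_assoc:
  "rel12 assoc X Y \<Longrightarrow> rel12 assoc (mulf l X) (mulf (lin12 l) Y)"
  "rel13 assoc X Y \<Longrightarrow> rel13 assoc (mulf l X) (mulf (lin13 l) Y)"
  "rel23 assoc X Y \<Longrightarrow> rel23 assoc (mulf l X) (mulf (lin23 l) Y)"
proof -
  assume "rel12 assoc X Y"
  then show "rel12 assoc (mulf l X) (mulf (lin12 l) Y)"
    using assoc_comb[of "\<lambda>m n. X m n s" "\<lambda>m n. Y m n s" "\<lambda>m n. X m n (s - 1)" "\<lambda>m n. Y m n (s - 1)"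
        "snd (snd l)" "fst l" "fst (snd l)" for s]
    unfolding rel12_def mulf_def lin12_def by (simp add: add_ac)
next
  assume "rel13 assoc X Y"
  then show "rel13 assoc (mulf l X) (mulf (lin13 l) Y)"
    using assoc_comb[of "\<lambda>m s. X m n s" "\<lambda>m s. Y m n s" "\<lambda>m s. X m (n - 1) s" "\<lambda>m s. Y m (n - 1) s"
        "fst (snd l)" "fst l" "snd (snd l)" for n]
    unfolding rel13_def mulf_def lin13_def by (simp add: add_ac)
next
  assume "rel23 assoc X Y"
  then show "rel23 assoc (mulf l X) (mulf (lin23 l) Y)"
    using assoc_comb[of "X m" "Y m" "X (m - 1)" "Y (m - 1)" "fst l" "fst (snd l)" "snd (snd l)" for m]
    unfolding rel23_def mulf_def[abs_def] lin23_def by (simp add: add_ac)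
qed

lemma mulf_rel_exch:
  "rel12 exch X Y \<Longrightarrow> rel12 exch (mulf l X) (mulf l Y)"
  "rel13 exch X Y \<Longrightarrow> rel13 exch (mulf l X) (mulf l Y)"
proof -
  assume "rel12 exch X Y"
  then show "rel12 exch (mulf l X) (mulf l Y)"
    using exch_comb[of "\<lambda>m n. X m n s" "\<lambda>m n. Y m n s" "\<lambda>m n. X m n (s - 1)" "\<lambda>m n. Y m n (s - 1)"
        "snd (snd l)" "fst l" "fst (snd l)" for s]
    unfolding rel12_def mulf_def by (simp add: add_ac)
next
  assume "rel13 exch X Y"
  then show "rel13 exch (mulf l X) (mulf l Y)"
    using exch_comb[of "\<lambda>m s. X m n s" "\<lambda>m s. Y m n s" "\<lambda>m s. X m (n - 1) s" "\<lambda>m s. Y m (n - 1) s"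
        "fst (snd l)" "fst l" "snd (snd l)" for n]
    unfolding rel13_def mulf_def by (simp add: add_ac)
qed

lemma mulfs_rel:
  "rel12 assoc X Y \<Longrightarrow> rel12 assoc (mulfs ls X) (mulfs (map lin12 ls) Y)"
  "rel13 assoc X Y \<Longrightarrow> rel13 assoc (mulfs ls X) (mulfs (map lin13 ls) Y)"
  "rel23 assoc X Y \<Longrightarrow> rel23 assoc (mulfs ls X) (mulfs (map lin23 ls) Y)"
  "rel12 exch X Y \<Longrightarrow> rel12 exch (mulfs ls X) (mulfs ls Y)"
  "rel13 exch X Y \<Longrightarrow> rel13 exch (mulfs ls X) (mulfs ls Y)"
  by (induction ls) (simp_all add: mulf_rel_assoc mulf_rel_exch)

lemma coef3_slices:
  "(\<lambda>m n. coef3 G m n s) = (if 0 \<le> s then coef2 (\<lambda>a b. G a b (nat s)) else 0)"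
  "(\<lambda>m s. coef3 G m n s) = (if 0 \<le> n then coef2 (\<lambda>a c. G a (nat n) c) else 0)"
  "coef3 G m = (if 0 \<le> m then coef2 (G (nat m)) else 0)"
  by (auto simp: fun_eq_iff coef3_def coef2_def)

lemma coef3_rel:
  "rel12 assoc (coef3 G) (coef3 (subst12 G))"
  "rel13 assoc (coef3 G) (coef3 (subst13 G))"
  "rel23 assoc (coef3 G) (coef3 (subst23 G))"
  "rel12 exch (coef3 G) (coef3 G)"
  "rel13 exch (coef3 G) (coef3 G)"
proof -
  note R = assoc_rel_0 exch_rel_0 assoc_rel_power_series exch_rel_power_series
  show "rel12 assoc (coef3 G) (coef3 (subst12 G))" "rel12 exch (coef3 G) (coef3 G)"
    unfolding rel12_def coef3_slices(1) by (simp_all add: subst12_def[abs_def] R)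
  show "rel13 assoc (coef3 G) (coef3 (subst13 G))" "rel13 exch (coef3 G) (coef3 G)"
    unfolding rel13_def coef3_slices(2) by (simp_all add: subst13_def[abs_def] R)
  show "rel23 assoc (coef3 G) (coef3 (subst23 G))"
    unfolding rel23_def coef3_slices(3) by (simp add: subst23_def[abs_def] R)
qed

lemma rel_fun:
  "rel12 assoc X Y \<Longrightarrow> rel12 assoc X Y' \<Longrightarrow> Y = Y'"
  "rel13 assoc X Y \<Longrightarrow> rel13 assoc X Y' \<Longrightarrow> Y = Y'"
  "rel23 assoc X Y \<Longrightarrow> rel23 assoc X Y' \<Longrightarrow> Y = Y'"
  "rel12 exch X Y \<Longrightarrow> rel12 exch X Y' \<Longrightarrow> Y = Y'"
  "rel13 exch X Y \<Longrightarrow> rel13 exch X Y' \<Longrightarrow> Y = Y'"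
  unfolding rel_defs by (intro ext, metis assoc_rel_fun exch_rel_fun)+

lemma rel_inj:
  "rel12 assoc X Y \<Longrightarrow> rel12 assoc X' Y \<Longrightarrow> X = X'"
  "rel13 assoc X Y \<Longrightarrow> rel13 assoc X' Y \<Longrightarrow> X = X'"
  "rel23 assoc X Y \<Longrightarrow> rel23 assoc X' Y \<Longrightarrow> X = X'"
  unfolding rel_defs by (intro ext, metis assoc_rel_inj)+

lemma rel_scale:
  "rel12 assoc X Y \<Longrightarrow> rel12 assoc (c *\<^sub>C X) (c *\<^sub>C Y)"
  "rel13 assoc X Y \<Longrightarrow> rel13 assoc (c *\<^sub>C X) (c *\<^sub>C Y)"
  "rel23 assoc X Y \<Longrightarrow> rel23 assoc (c *\<^sub>C X) (c *\<^sub>C Y)"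
  "rel12 exch X Y \<Longrightarrow> rel12 exch (c *\<^sub>C X) (c *\<^sub>C Y)"
  "rel13 exch X Y \<Longrightarrow> rel13 exch (c *\<^sub>C X) (c *\<^sub>C Y)"
proof -
  have "(\<lambda>m n. (c *\<^sub>C X) m n s) = c *\<^sub>C (\<lambda>m n. X m n s)" "(\<lambda>m s. (c *\<^sub>C X) m n s) = c *\<^sub>C (\<lambda>m s. X m n s)"
    "(c *\<^sub>C X) m = c *\<^sub>C X m" for X :: "int \<Rightarrow> int \<Rightarrow> int \<Rightarrow> 'a" and m n s
    by (simp_all add: scaleC_fun_def)
  note slices = this and scale = assoc_rel_scale[OF complex_vector.subspace_UNIV]
    exch_rel_scale[OF complex_vector.subspace_UNIV]
  show "rel12 assoc X Y \<Longrightarrow> rel12 assoc (c *\<^sub>C X) (c *\<^sub>C Y)" "rel12 exch X Y \<Longrightarrow> rel12 exch (c *\<^sub>C X) (c *\<^sub>C Y)"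
    unfolding rel12_def slices(1) by (simp_all only: scale simp_thms)
  show "rel13 assoc X Y \<Longrightarrow> rel13 assoc (c *\<^sub>C X) (c *\<^sub>C Y)" "rel13 exch X Y \<Longrightarrow> rel13 exch (c *\<^sub>C X) (c *\<^sub>C Y)"
    unfolding rel13_def slices(2) by (simp_all only: scale simp_thms)
  show "rel23 assoc X Y \<Longrightarrow> rel23 assoc (c *\<^sub>C X) (c *\<^sub>C Y)"
    unfolding rel23_def slices(3) by (simp only: scale simp_thms)
qed

lemma rel_0: "rel12 assoc 0 0" "rel13 assoc 0 0" "rel23 assoc 0 0"
  unfolding rel_defs using assoc_rel_0 by (simp_all add: zero_fun_def)

text \<open>A series that becomes a power series after multiplication by linear forms is transported by a
  change of expansion region to one that becomes the substituted power series.\<close>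

lemma transport:
  "rel12 assoc X Y \<Longrightarrow> mulfs ls X = coef3 G \<Longrightarrow> mulfs (map lin12 ls) Y = coef3 (subst12 G)"
  "rel13 assoc X Y \<Longrightarrow> mulfs ls X = coef3 G \<Longrightarrow> mulfs (map lin13 ls) Y = coef3 (subst13 G)"
  "rel23 assoc X Y \<Longrightarrow> mulfs ls X = coef3 G \<Longrightarrow> mulfs (map lin23 ls) Y = coef3 (subst23 G)"
  "rel12 exch X Y \<Longrightarrow> mulfs ls X = coef3 G \<Longrightarrow> mulfs ls Y = coef3 G"
  "rel13 exch X Y \<Longrightarrow> mulfs ls X = coef3 G \<Longrightarrow> mulfs ls Y = coef3 G"
  using mulfs_rel[of X Y ls] coef3_rel[of G] rel_fun by metis+

lemma coef3_eq_0: "coef3 G = 0 \<longleftrightarrow> G = 0"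
proof
  assume "coef3 G = 0"
  then have "coef3 G (int a) (int b) (int c) = 0" for a b c by simp
  then show "G = 0" by (simp add: coef3_def fun_eq_iff)
qed (simp add: coef3_def fun_eq_iff)

text \<open>Zero is a transport of zero, and transport is injective.\<close>

lemma subst_eq_0: "subst12 G = 0 \<Longrightarrow> G = 0" "subst13 G = 0 \<Longrightarrow> G = 0" "subst23 G = 0 \<Longrightarrow> G = 0"
  using coef3_rel[of G] rel_0 rel_inj coef3_eq_0 by metis+

text \<open>Both sides of \<open>subst_commute\<close> are the substitution \<open>v\<^sub>1 \<mapsto> v\<^sub>1 + v\<^sub>2 + v\<^sub>3\<close>, \<open>v\<^sub>2 \<mapsto> v\<^sub>2 + v\<^sub>3\<close>; we compare
  them on \<open>G = const + v\<^sub>1 A + v\<^sub>2 B + v\<^sub>3 C\<close> by induction on the total degree.\<close>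

definition shift_in :: "complex \<times> complex \<times> complex \<Rightarrow> (nat \<Rightarrow> nat \<Rightarrow> nat \<Rightarrow> 'v::complex_vector) \<Rightarrow> nat \<Rightarrow> nat \<Rightarrow> nat \<Rightarrow> 'v" where
  "shift_in l G a b c = mulf l (coef3 G) (int a) (int b) (int c)"

lemma coef3_shift_in: "coef3 (shift_in l G) = mulf l (coef3 G)"
  by (intro ext) (auto simp: coef3_def shift_in_def mulf_def)

lemma coef3_inj:
  assumes "coef3 G = coef3 G'"
  shows "G = G'"
proof (intro ext)
  fix a b c
  have "coef3 G (int a) (int b) (int c) = coef3 G' (int a) (int b) (int c)" using assms by simp
  then show "G a b c = G' a b c" by (simp add: coef3_def)
qed

text \<open>Both sides are transports of \<open>mulf l (coef3 G)\<close>, and transport is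
  single-valued; no coefficients need to be compared.\<close>

lemma subst_shift_in:
  "subst12 (shift_in l G) = shift_in (lin12 l) (subst12 G)"
  "subst13 (shift_in l G) = shift_in (lin13 l) (subst13 G)"
  "subst23 (shift_in l G) = shift_in (lin23 l) (subst23 G)"
proof -
  show "subst12 (shift_in l G) = shift_in (lin12 l) (subst12 G)"
    using coef3_rel(1)[of "shift_in l G"] mulf_rel_assoc(1)[OF coef3_rel(1), of l G]
    by (intro coef3_inj) (simp add: coef3_shift_in rel_fun(1))
  show "subst13 (shift_in l G) = shift_in (lin13 l) (subst13 G)"
    using coef3_rel(2)[of "shift_in l G"] mulf_rel_assoc(2)[OF coef3_rel(2), of l G]
    by (intro coef3_inj) (simp add: coef3_shift_in rel_fun(2))
  show "subst23 (shift_in l G) = shift_in (lin23 l) (subst23 G)"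
    using coef3_rel(3)[of "shift_in l G"] mulf_rel_assoc(3)[OF coef3_rel(3), of l G]
    by (intro coef3_inj) (simp add: coef3_shift_in rel_fun(3))
qed

lemma subst2_add: "subst2 (\<lambda>a b. F a b + G a b) p n = subst2 F p n + subst2 G p n"
  by (simp add: subst2_def scaleC_add_right sum.distrib)

lemma subst_add:
  "subst12 (F + G) = subst12 F + subst12 G" "subst13 (F + G) = subst13 F + subst13 G"
  "subst23 (F + G) = subst23 F + subst23 G"
  by (intro ext, simp add: subst12_def subst13_def subst23_def plus_fun_def subst2_add)+

definition const3 :: "'v::zero \<Rightarrow> nat \<Rightarrow> nat \<Rightarrow> nat \<Rightarrow> 'v" where
  "const3 x a b c = (if a = 0 \<and> b = 0 \<and> c = 0 then x else 0)"

lemma subst2_const: "subst2 (\<lambda>a b. if a = 0 \<and> b = 0 then x else 0) p n = (if p = 0 \<and> n = 0 then x else 0)"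
proof -
  have "subst2 (\<lambda>a b. if a = 0 \<and> b = 0 then x else 0) p n
      = (\<Sum>a\<le>p + n. if a = 0 then if p = 0 \<and> n = 0 then x else 0 else 0)"
    unfolding subst2_def
  proof (rule sum.cong)
    fix a assume "a \<in> {..p + n}"
    then show "of_nat (a choose p) *\<^sub>C (if a = 0 \<and> p + n - a = 0 then x else 0)
        = (if a = 0 then if p = 0 \<and> n = 0 then x else 0 else 0)"
      by (cases "p = 0") (auto simp: scaleC_one)
  qed simp
  then show ?thesis by (simp add: sum.delta)
qed

lemma subst_const: "subst12 (const3 x) = const3 x" "subst13 (const3 x) = const3 x" "subst23 (const3 x) = const3 x"
proof -
  have 0: "subst2 (\<lambda>a b. 0) p n = (0 :: 'a)" for p n by (simp add: subst2_def)
  have slices: "(\<lambda>a b. const3 x a b c) = (if c = 0 then (\<lambda>a b. if a = 0 \<and> b = 0 then x else 0) else (\<lambda>a b. 0))"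
    "(\<lambda>a b. const3 x a c b) = (if c = 0 then (\<lambda>a b. if a = 0 \<and> b = 0 then x else 0) else (\<lambda>a b. 0))"
    "const3 x c = (if c = 0 then (\<lambda>a b. if a = 0 \<and> b = 0 then x else 0) else (\<lambda>a b. 0))" for c
    by (auto simp: const3_def fun_eq_iff)
  have s: "subst2 (if c = 0 then (\<lambda>a b. if a = 0 \<and> b = 0 then x else 0) else (\<lambda>a b. 0)) p n
      = (if c = 0 \<and> p = 0 \<and> n = 0 then x else 0)" for c p n :: nat
    by (simp add: 0 subst2_const)
  show "subst12 (const3 x) = const3 x"
    by (intro ext) (unfold subst12_def slices(1) s, simp add: const3_def)
  show "subst13 (const3 x) = const3 x"
    by (intro ext) (unfold subst13_def slices(2) s, simp add: const3_def)
  show "subst23 (const3 x) = const3 x"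
    by (intro ext) (unfold subst23_def slices(3) s, simp add: const3_def)
qed

text \<open>Each nonconstant monomial is divided by the first variable occurring in it, which makes
  the decomposition unambiguous.\<close>

lemma power_series_split:
  fixes G :: "nat \<Rightarrow> nat \<Rightarrow> nat \<Rightarrow> 'v::complex_vector"
  shows "G = const3 (G 0 0 0) + (shift_in (1, 0, 0) (\<lambda>a b c. G (Suc a) b c)
    + (shift_in (0, 1, 0) (\<lambda>a b c. if a = 0 then G a (Suc b) c else 0)
    + shift_in (0, 0, 1) (\<lambda>a b c. if a = 0 \<and> b = 0 then G a b (Suc c) else 0)))"
proof (intro ext)
  fix a b c
  show "G a b c = (const3 (G 0 0 0) + (shift_in (1, 0, 0) (\<lambda>a b c. G (Suc a) b c)
    + (shift_in (0, 1, 0) (\<lambda>a b c. if a = 0 then G a (Suc b) c else 0)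
    + shift_in (0, 0, 1) (\<lambda>a b c. if a = 0 \<and> b = 0 then G a b (Suc c) else 0)))) a b c"
    by (cases a; cases b; cases c)
      (simp_all add: const3_def shift_in_def mulf_def coef3_def scaleC_one nat_add_distrib)
qed

lemma subst_commute: "subst12 (subst13 (subst23 G)) = subst23 (subst12 G)"
proof -
  define P where "P G = subst12 (subst13 (subst23 G))" for G :: "nat \<Rightarrow> nat \<Rightarrow> nat \<Rightarrow> 'a"
  define Q where "Q G = subst23 (subst12 G)" for G :: "nat \<Rightarrow> nat \<Rightarrow> nat \<Rightarrow> 'a"
  have add: "P (F + G) = P F + P G" "Q (F + G) = Q F + Q G" for F G
    by (simp_all add: P_def Q_def subst_add)
  have const: "P (const3 x) = const3 x" "Q (const3 x) = const3 x" for x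
    by (simp_all add: P_def Q_def subst_const)
  \<comment> \<open>Both composites induce the same map on linear forms, so multiplication by a form
    passes through them in the same way.\<close>
  have shift: "P (shift_in l G) = shift_in (lin23 (lin12 l)) (P G)"
    "Q (shift_in l G) = shift_in (lin23 (lin12 l)) (Q G)" for l G
    by (simp_all add: P_def Q_def subst_shift_in lin12_def lin13_def lin23_def add_ac)
  have "P G a b c = Q G a b c" if "a + b + c < d" for G a b c d
    using that
  proof (induction d arbitrary: G a b c)
    case (Suc d)
    have coef: "coef3 (P G) m n s = coef3 (Q G) m n s" if "m + n + s < int d" for G m n s
      using that Suc.IH[of "nat m" "nat n" "nat s" G] by (auto simp: coef3_def)
    \<comment> \<open>A linear form raises the degree by one, so only coefficients of
      \<open>P G\<close> and \<open>Q G\<close> of smaller degree enter.\<close>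
    have "shift_in l (P G) a b c = shift_in l (Q G) a b c" for l G
      unfolding shift_in_def mulf_def using Suc.prems by (simp add: coef)
    then show ?case
      by (subst (1 2) power_series_split[of G]) (simp only: add const shift plus_fun_apply)
  qed simp
  then show ?thesis unfolding P_def Q_def by (intro ext) (metis lessI)
qed

section \<open>Clearing denominators in three variables\<close>

lemma mulf_eq:
  "mulf (1, - 1, 0) X = mul_zw X" "mulf (1, 0, - 1) X = mul_zt X" "mulf (0, 1, - 1) X = mul_wt X"
  by (intro ext, simp add: mulf_def mul_zw_def mul_zt_def mul_wt_def scaleC_one)+

lemma mulf_shift3: "mulf (1, 0, 0) (mulf (0, 1, 0) (mulf (0, 0, 1) X)) = shift3 (- 1) X"
  by (intro ext) (simp add: mulf_def shift3_def scaleC_one)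

lemma mul_shift3:
  "mul_zw (shift3 r X) = shift3 r (mul_zw X)" "mul_zt (shift3 r X) = shift3 r (mul_zt X)"
  "mul_wt (shift3 r X) = shift3 r (mul_wt X)"
  by (intro ext, simp add: mul_zw_def mul_zt_def mul_wt_def shift3_def algebra_simps)+

lemma bin_mul_commute:
  "supp_w g \<Longrightarrow> bin_zw e (mul_zw g) = mul_zw (bin_zw e g)"
  "bin_zt e (mul_zw g) = mul_zw (bin_zt e g)"
  "bin_wt e (mul_zw g) = mul_zw (bin_wt e g)"
  "supp_t g \<Longrightarrow> bin_zt e (mul_zt g) = mul_zt (bin_zt e g)"
  "supp_t g \<Longrightarrow> bin_wt e (mul_zt g) = mul_zt (bin_wt e g)"
  "supp_t g \<Longrightarrow> bin_wt e (mul_wt g) = mul_wt (bin_wt e g)"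
proof -
  show "bin_zw e (mul_zw g) = mul_zw (bin_zw e g)" if "supp_w g"
    using that by (intro ext) (simp add: bin_zw_def mul_zw_def bin_mult_diff supp_w_def
        bin_mult_shift1[of e "\<lambda>m n. g m n _"] bin_mult_shift2[of "\<lambda>m n. g m n _"])
  show "bin_zt e (mul_zw g) = mul_zw (bin_zt e g)"
    by (intro ext) (simp add: bin_zt_def mul_zw_def bin_mult_diff bin_mult_shift1[of e "\<lambda>m s. g m _ s"])
  show "bin_wt e (mul_zw g) = mul_zw (bin_wt e g)"
    by (intro ext) (simp add: bin_wt_def mul_zw_def bin_mult_diff bin_mult_shift1[of e "\<lambda>n s. g _ n s"])
  show "bin_zt e (mul_zt g) = mul_zt (bin_zt e g)" if "supp_t g"
    using that by (intro ext) (simp add: bin_zt_def mul_zt_def bin_mult_diff supp_t_def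
        bin_mult_shift1[of e "\<lambda>m s. g m _ s"] bin_mult_shift2[of "\<lambda>m s. g m _ s"])
  show "bin_wt e (mul_zt g) = mul_zt (bin_wt e g)" if "supp_t g"
    using that by (intro ext) (simp add: bin_wt_def mul_zt_def bin_mult_diff supp_t_def
        bin_mult_shift2[of "\<lambda>n s. g _ n s"])
  show "bin_wt e (mul_wt g) = mul_wt (bin_wt e g)" if "supp_t g"
    using that by (intro ext) (simp add: bin_wt_def mul_wt_def bin_mult_diff supp_t_def
        bin_mult_shift1[of e "\<lambda>n s. g _ n s"] bin_mult_shift2[of "\<lambda>n s. g _ n s"])
qed

text \<open>In \<open>bin3_step\<close> the factors stand inside the expansion. To clear
  denominators they must multiply the expanded series, and the support conditions let them pass
  through the three binomial series.\<close>

lemma bin3_mul: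
  assumes "supp_w g" "supp_t g"
  shows "mul_zw (mul_zt (mul_wt (bin_wt e (bin_zt e (bin_zw e g)))))
    = bin_wt (e + 1) (bin_zt (e + 1) (bin_zw (e + 1) g))"
proof -
  have "supp_t (mul_zt g)" "supp_t (mul_zt (mul_wt g))" "supp_t (mul_wt g)" "supp_w (mul_zt (mul_wt g))"
    using assms by (auto simp: supp_t_def supp_w_def mul_zt_def mul_wt_def)
  then have "bin_wt e (bin_zt e (bin_zw e (mul_zw (mul_zt (mul_wt g)))))
      = mul_zw (mul_zt (mul_wt (bin_wt e (bin_zt e (bin_zw e g)))))"
    using assms by (simp add: bin_mul_commute bin_zw_mul_zt bin_zw_mul_wt bin_zt_mul_wt supp_simps)
  then show ?thesis using bin3_step[OF assms] by simp
qed

text \<open>Multiplying by the six linear factors of the denominator lowers its exponent by one,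
  until the numerator remains. The last clause hands nonvanishing of the fraction on to the power
  series.\<close>

lemma expand_zwt_clear:
  obtains ls G where "mulfs ls (expand_zwt \<phi>) = coef3 G" "G = 0 \<longrightarrow> \<phi> = 0"
proof -
  have "\<exists>p. \<phi> = frac3 p" by (induction \<phi> rule: locser3.abs_induct) (rule exI, rule refl)
  then obtain N F where \<phi>: "\<phi> = frac3 (N, F)" by (metis surj_pair)
  have s: "supp_w (coef3 F)" "supp_t (coef3 F)" by (auto simp: supp_w_def supp_t_def coef3_def)
  define E where "E N = shift3 (int N) (bin_wt (- int N) (bin_zt (- int N) (bin_zw (- int N) (coef3 F))))" for N
  let ?D = "[(1, 0, 0), (0, 1, 0), (0, 0, 1), (1, - 1, 0), (1, 0, - 1), (0, 1, - 1)] :: (complex \<times> complex \<times> complex) list"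
  have "shift3 (- 1) (shift3 (1 + int N) X) = shift3 (int N) X" for N and X :: "int \<Rightarrow> int \<Rightarrow> int \<Rightarrow> 'a"
    by (intro ext) (simp add: shift3_def)
  then have step: "mulfs ?D (E (Suc N)) = E N" for N
    using bin3_mul[OF s, of "- int (Suc N)"]
    by (simp add: mulf_eq mulf_shift3 mul_shift3 E_def)
  have "\<exists>ls. mulfs ls (E N) = E 0"
  proof (induction N)
    case 0
    show ?case by (rule exI[of _ "[]"]) simp
  next
    case (Suc N)
    then obtain ls where "mulfs ls (E N) = E 0" ..
    then have "mulfs (ls @ ?D) (E (Suc N)) = E 0" by (simp only: mulfs_append step)
    then show ?case ..
  qed
  then obtain ls where ls: "mulfs ls (E N) = E 0" ..
  have "bin_mult 0 (\<lambda>m n. coef3 F m n s) m n = coef3 F m n s" "bin_mult 0 (\<lambda>m s. coef3 F m n s) m s = coef3 F m n s"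
    "bin_mult 0 (\<lambda>n s. coef3 F m n s) n s = coef3 F m n s" for m n s
    by (rule bin_mult_0; auto simp: coef3_def)+
  then have "bin_zw 0 (coef3 F) = coef3 F" "bin_zt 0 (coef3 F) = coef3 F" "bin_wt 0 (coef3 F) = coef3 F"
    by (intro ext; simp add: bin_zw_def bin_zt_def bin_wt_def)+
  then have "E 0 = coef3 F" by (simp add: E_def shift3_def[abs_def])
  moreover have "expand_zwt \<phi> = E N" by (simp add: \<phi> E_def expand_zwt.abs_eq)
  ultimately have "mulfs ls (expand_zwt \<phi>) = coef3 F" using ls by simp
  moreover have "F = 0 \<longrightarrow> \<phi> = 0"
    by (simp add: \<phi> zero_locser3.abs_eq locser3.abs_eq_iff frac_rel_def disc3.pow_zero)
  ultimately show ?thesis by (rule that)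
qed

subsection \<open>Multilinear maps and one-dimensional spaces\<close>

lemma bilin_maps_facts:
  assumes "B \<in> bilin_maps U V (laurent S)"
  shows "u \<in> U \<Longrightarrow> v \<in> V \<Longrightarrow> B u v \<in> laurent S"
    and "u \<in> U \<Longrightarrow> v \<in> V \<Longrightarrow> B u v n \<in> S"
    and "u \<in> U \<Longrightarrow> lin_map V S (\<lambda>v. B u v n)"
    and "v \<in> V \<Longrightarrow> lin_map U S (\<lambda>u. B u v n)"
    and "u \<notin> U \<or> v \<notin> V \<Longrightarrow> B u v = 0"
proof -
  have 1: "u \<in> U \<Longrightarrow> lin_map V (laurent S) (B u)" and 2: "v \<in> V \<Longrightarrow> lin_map U (laurent S) (\<lambda>u. B u v)" for u v
    using assms by (simp_all add: bilin_maps_def)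
  show "u \<notin> U \<or> v \<notin> V \<Longrightarrow> B u v = 0" using assms by (simp add: bilin_maps_def)
  show 3: "B u v \<in> laurent S" if "u \<in> U" "v \<in> V" for u v using 1[OF that(1)] that(2) by (rule lin_map_in)
  then show 4: "B u v n \<in> S" if "u \<in> U" "v \<in> V" for u v n using that by (simp add: laurent_def)
  show "u \<in> U \<Longrightarrow> lin_map V S (\<lambda>v. B u v n)"
    using 1[of u] 4 by (simp add: lin_map_def scaleC_apply)
  show "v \<in> V \<Longrightarrow> lin_map U S (\<lambda>u. B u v n)"
    using 2[of v] 4 by (simp add: lin_map_def scaleC_apply)
qed

lemma one_dimensional_scalar:
  assumes S: "one_dimensional S" and "x \<in> S" "y \<in> S" "x \<noteq> 0" "y \<noteq> 0"
  shows "\<exists>c. c \<noteq> 0 \<and> x = c *\<^sub>C y"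
proof -
  obtain B where "B \<subseteq> S" "complex_vector.independent B" "S \<subseteq> complex_vector.span B" "card B = complex_vector.dim S"
    using complex_vector.basis_exists by metis
  moreover from this obtain b where "B = {b}" using S by (auto simp: one_dimensional_def card_1_singleton_iff)
  ultimately have "x \<in> range (\<lambda>k. k *\<^sub>C b)" "y \<in> range (\<lambda>k. k *\<^sub>C b)"
    using assms(2,3) by (auto simp: complex_vector.span_singleton)
  then obtain c d where *: "x = c *\<^sub>C b" "y = d *\<^sub>C b" by (metis imageE)
  then have "c \<noteq> 0" "d \<noteq> 0" using assms(4,5) by auto
  then show ?thesis using * by (intro exI[of _ "c / d"]) (simp add: scaleC_scaleC)
qed

lemma is_basis_nonzero:
  assumes "is_basis B S" "b \<in> B"
  shows "b \<noteq> 0"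
proof
  assume "b = 0"
  then have "complex_vector.dependent B" using assms(2) complex_vector.dependent_zero by simp
  then show False using assms(1) by (simp add: is_basis_def)
qed

lemma one_dimensional_basis:
  assumes "one_dimensional P" "is_basis B P" "p \<in> P" "p \<noteq> 0"
  shows "\<exists>b\<in>B. \<exists>c. c \<noteq> 0 \<and> b \<in> P \<and> p = c *\<^sub>C b"
proof -
  have "B \<noteq> {}"
  proof
    assume "B = {}"
    then have "P = {0}" using assms(2) by (simp add: is_basis_def complex_vector.span_empty)
    then show False using assms(3,4) by simp
  qed
  then obtain b where b: "b \<in> B" by blast
  have "b \<noteq> 0" by (rule is_basis_nonzero[OF assms(2) b])
  moreover have "b \<in> P" using assms(2) b complex_vector.span_base[of b B] by (simp add: is_basis_def)
  ultimately show ?thesis using one_dimensional_scalar[OF assms(1,3)] assms(4) b by metis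
qed

text \<open>In dimension one, nonzero vectors are nonzero multiples of basis vectors, and the
  product of the latter belongs to a basis, hence is nonzero.\<close>

lemma tensor_iso2_nonzero:
  assumes \<beta>: "tensor_iso2 \<beta> P Q S" and P: "one_dimensional P" and Q: "one_dimensional Q"
    and "p \<in> P" "p \<noteq> 0" "q \<in> Q" "q \<noteq> 0"
  shows "\<beta> p q \<in> S" "\<beta> p q \<noteq> 0"
proof -
  have lin: "\<forall>p\<in>P. lin_map Q S (\<beta> p)" "\<forall>q\<in>Q. lin_map P S (\<lambda>p. \<beta> p q)"
    using \<beta> by (simp_all add: tensor_iso2_def)
  obtain B C where BC: "is_basis B P" "is_basis C Q" "is_basis ((\<lambda>(b, c). \<beta> b c) ` (B \<times> C)) S"
    using \<beta> unfolding tensor_iso2_def by metis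
  obtain b x where b: "b \<in> B" "x \<noteq> 0" "b \<in> P" "p = x *\<^sub>C b" using one_dimensional_basis[OF P BC(1) assms(4,5)] by metis
  obtain c y where c: "c \<in> C" "y \<noteq> 0" "c \<in> Q" "q = y *\<^sub>C c" using one_dimensional_basis[OF Q BC(2) assms(6,7)] by metis
  show "\<beta> p q \<in> S" by (rule lin_map_in[OF bspec[OF lin(1) assms(4)] assms(6)])
  have "\<beta> b c \<in> (\<lambda>(b, c). \<beta> b c) ` (B \<times> C)" using b(1) c(1) by (simp add: rev_image_eqI[of "(b, c)"])
  then have "\<beta> b c \<noteq> 0" by (rule is_basis_nonzero[OF BC(3)])
  moreover have "\<beta> p q = (x * y) *\<^sub>C \<beta> b c"
    using lin_map_scale[OF bspec[OF lin(2) assms(6)] b(3)] lin_map_scale[OF bspec[OF lin(1) b(3)] c(3)]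
    by (simp add: b c scaleC_scaleC)
  ultimately show "\<beta> p q \<noteq> 0" using b c by simp
qed

lemma tensor_iso3_nonzero:
  assumes \<beta>: "tensor_iso3 \<beta> P Q R S" and P: "one_dimensional P" and Q: "one_dimensional Q" and R: "one_dimensional R"
    and "p \<in> P" "p \<noteq> 0" "q \<in> Q" "q \<noteq> 0" "r \<in> R" "r \<noteq> 0"
  shows "\<beta> p q r \<in> S" "\<beta> p q r \<noteq> 0"
proof -
  have lin: "\<forall>p\<in>P. \<forall>q\<in>Q. lin_map R S (\<beta> p q)" "\<forall>p\<in>P. \<forall>r\<in>R. lin_map Q S (\<lambda>q. \<beta> p q r)"
    "\<forall>q\<in>Q. \<forall>r\<in>R. lin_map P S (\<lambda>p. \<beta> p q r)"
    using \<beta> by (simp_all add: tensor_iso3_def)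
  obtain B C D where BC: "is_basis B P" "is_basis C Q" "is_basis D R" "is_basis ((\<lambda>(b, c, d). \<beta> b c d) ` (B \<times> C \<times> D)) S"
    using \<beta> unfolding tensor_iso3_def by metis
  obtain b x where b: "b \<in> B" "x \<noteq> 0" "b \<in> P" "p = x *\<^sub>C b" using one_dimensional_basis[OF P BC(1) assms(5,6)] by metis
  obtain c y where c: "c \<in> C" "y \<noteq> 0" "c \<in> Q" "q = y *\<^sub>C c" using one_dimensional_basis[OF Q BC(2) assms(7,8)] by metis
  obtain d z where d: "d \<in> D" "z \<noteq> 0" "d \<in> R" "r = z *\<^sub>C d" using one_dimensional_basis[OF R BC(3) assms(9,10)] by metis
  show "\<beta> p q r \<in> S" by (rule lin_map_in[OF bspec[OF bspec[OF lin(1) assms(5)] assms(7)] assms(9)])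
  have "\<beta> b c d \<in> (\<lambda>(b, c, d). \<beta> b c d) ` (B \<times> C \<times> D)"
    using b(1) c(1) d(1) by (simp add: rev_image_eqI[of "(b, c, d)"])
  then have "\<beta> b c d \<noteq> 0" by (rule is_basis_nonzero[OF BC(4)])
  moreover have "\<beta> p q r = (x * y * z) *\<^sub>C \<beta> b c d"
    using lin_map_scale[OF bspec[OF bspec[OF lin(3) assms(7)] assms(9)] b(3)]
      lin_map_scale[OF bspec[OF bspec[OF lin(2) b(3)] assms(9)] c(3)]
      lin_map_scale[OF bspec[OF bspec[OF lin(1) b(3)] c(3)] d(3)]
    by (simp add: b(4) c(4) d(4) scaleC_scaleC)
  ultimately show "\<beta> p q r \<noteq> 0" using b c d by simp
qed

subsection \<open>The cocycle of a commutativity datum\<close>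

locale commutativity =
  fixes T :: "'g setting"
    and V :: "('v::complex_vector, 'g) valg"
    and M :: "'a::ab_group_add \<Rightarrow> ('v, 'v, 'g) vmodule"
    and I :: "'a \<Rightarrow> 'a \<Rightarrow> ('v \<Rightarrow> 'v \<Rightarrow> int \<Rightarrow> 'v) set"
  assumes V: "T_vertex_algebra T V" and M: "\<And>i. T_module T V (M i)" and M0: "M 0 = adjoint_module V"
    and datum: "commutativity_datum T V M I"
begin

abbreviation S :: "'a \<Rightarrow> 'v set" where "S i \<equiv> mspace (M i)"

lemma S_subspace: "complex_vector.subspace (S i)"
  using M[of i] by (simp add: T_module_def)

lemma L_lin: "k \<in> L_index (kind_of T) \<Longrightarrow> lin_map (S i) (S i) (mL (M i) k)"
  using M[of i] by (simp add: T_module_def L_structure_def)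

lemma minus_one_L_index: "- 1 \<in> L_index K"
  by (cases K) simp_all

lemma L1_lin: "lin_map (S i) (S i) (mL (M i) (- 1))"
  by (rule L_lin[OF minus_one_L_index])

lemma S_0: "S 0 = vspace V"
  by (simp add: M0 adjoint_module_def)

lemma assoc_datum: "associativity_datum T V M I"
  using datum by (simp add: commutativity_datum_def)

lemma I_one_dim: "one_dimensional (I i j)" and I_intertwiner: "p \<in> I i j \<Longrightarrow> p \<in> intertwiners T V (M i) (M j) (M (i + j))"
  using conjunct1[OF assoc_datum[unfolded associativity_datum_def]] by (simp_all add: subset_iff)

lemma I_bilin: "p \<in> I i j \<Longrightarrow> p \<in> bilin_maps (S i) (S j) (laurent (S (i + j)))"
  using I_intertwiner[of p i j] by (simp add: intertwiners_def)

lemma I_laurent: "p \<in> I i j \<Longrightarrow> p u v \<in> laurent (S (i + j))"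
proof -
  assume p: "p \<in> I i j"
  have "(0 :: int \<Rightarrow> 'v) \<in> laurent (S (i + j))"
    using complex_vector.subspace_0[OF S_subspace] by (simp add: laurent_def)
  then show ?thesis using bilin_maps_facts(1,5)[OF I_bilin[OF p], of u v] by metis
qed

lemma skew_in_I: "p \<in> I i j \<Longrightarrow> p \<noteq> 0 \<Longrightarrow> skew (mL (M (i + j))) p \<in> I j i"
  using datum by (simp add: commutativity_datum_def)

lemma skew_involution: "p \<in> I i j \<Longrightarrow> skew (mL (M (i + j))) (skew (mL (M (i + j))) p) = p"
  by (rule ext, rule ext, rule skew_skew[where S = "S (i + j)"]) (simp_all add: L1_lin S_subspace I_laurent)

lemma skew_linear: "p \<in> I i j \<Longrightarrow> skew (mL (M (i + j))) (c *\<^sub>C p) = c *\<^sub>C skew (mL (M (i + j))) p"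
proof (rule ext, rule ext)
  fix v u assume "p \<in> I i j"
  then show "skew (mL (M (i + j))) (c *\<^sub>C p) v u = (c *\<^sub>C skew (mL (M (i + j))) p) v u"
    using skew_scale[where S = "S (i + j)" and L = "mL (M (i + j))" and I = p and v = v and u = u and c = c]
    by (simp add: scaleC_apply L1_lin S_subspace I_laurent)
qed

lemma skew_nonzero: assumes "p \<in> I i j" "p \<noteq> 0" shows "skew (mL (M (i + j))) p \<noteq> 0"
proof
  assume 0: "skew (mL (M (i + j))) p = 0"
  have p: "skew (mL (M (i + j))) p \<in> I j i" by (rule skew_in_I[OF assms])
  have "skew (mL (M (j + i))) (0 *\<^sub>C skew (mL (M (i + j))) p) = 0" by (simp only: skew_linear[OF p]) simp
  then have "skew (mL (M (i + j))) (skew (mL (M (i + j))) p) = 0" using 0 by (simp add: add.commute)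
  then show False using skew_involution[OF assms(1)] assms(2) by simp
qed

lemma choices_in: "n \<in> choices I \<Longrightarrow> n i j \<in> I i j" and choices_nz: "n \<in> choices I \<Longrightarrow> n i j \<noteq> 0"
  by (simp_all add: choices_def families_def)

section \<open>Associators and braidings from one-dimensional spaces\<close>

lemma triple_datum:
  obtains S' \<beta> \<gamma> where "one_dimensional S'"
    "S' \<subseteq> trilin_maps (S i) (S j) (S k) (locser2_on (S (i + j + k)))"
    "\<forall>p\<in>I i (j + k). \<forall>q\<in>I j k. \<forall>u\<in>S i. \<forall>v\<in>S j. \<forall>x\<in>S k. expand_zw (\<beta> p q u v x) = nested p q u v x"
    "tensor_iso2 \<beta> (I i (j + k)) (I j k) S'"
    "\<forall>p\<in>I (i + j) k. \<forall>q\<in>I i j. \<forall>u\<in>S i. \<forall>v\<in>S j. \<forall>x\<in>S k. expand_w_zw (\<gamma> p q u v x) = iterated p q u v x"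
    "tensor_iso2 \<gamma> (I (i + j) k) (I i j) S'"
proof -
  have "\<forall>i j k. \<exists>S'. one_dimensional S'
        \<and> S' \<subseteq> trilin_maps (S i) (S j) (S k) (locser2_on (S (i + j + k)))
        \<and> (\<exists>\<beta>. (\<forall>p\<in>I i (j + k). \<forall>q\<in>I j k. \<forall>u\<in>S i. \<forall>v\<in>S j. \<forall>x\<in>S k. expand_zw (\<beta> p q u v x) = nested p q u v x)
            \<and> tensor_iso2 \<beta> (I i (j + k)) (I j k) S')
        \<and> (\<exists>\<gamma>. (\<forall>p\<in>I (i + j) k. \<forall>q\<in>I i j. \<forall>u\<in>S i. \<forall>v\<in>S j. \<forall>x\<in>S k. expand_w_zw (\<gamma> p q u v x) = iterated p q u v x)
            \<and> tensor_iso2 \<gamma> (I (i + j) k) (I i j) S')"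
    using assoc_datum unfolding associativity_datum_def by (elim conjE)
  from this[rule_format, of i j k] show ?thesis using that by (elim exE conjE) metis
qed

lemma trilin_maps_in: "B \<in> trilin_maps U W X Y \<Longrightarrow> u \<in> U \<Longrightarrow> v \<in> W \<Longrightarrow> x \<in> X \<Longrightarrow> B u v x \<in> Y"
  by (auto simp: trilin_maps_def lin_map_def)

lemma trilin_maps_support: "B \<in> trilin_maps U W X Y \<Longrightarrow> B u v x \<noteq> 0 \<Longrightarrow> u \<in> U \<and> v \<in> W \<and> x \<in> X"
  by (cases "u \<in> U") (auto simp: trilin_maps_def bilin_maps_def)

text \<open>The composition is a nonzero element of a space of maps that vanish outside the modules,
  so it is nonzero at vectors of the modules, and expansion is injective.\<close>

lemma nested_nonzero:
  assumes "n \<in> choices I"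
  shows "\<exists>u\<in>S i. \<exists>v\<in>S j. \<exists>x\<in>S k. nested (n i (j + k)) (n j k) u v x \<noteq> 0"
proof -
  obtain S' \<beta> \<gamma> where d: "S' \<subseteq> trilin_maps (S i) (S j) (S k) (locser2_on (S (i + j + k)))"
    "\<forall>p\<in>I i (j + k). \<forall>q\<in>I j k. \<forall>u\<in>S i. \<forall>v\<in>S j. \<forall>x\<in>S k. expand_zw (\<beta> p q u v x) = nested p q u v x"
    "tensor_iso2 \<beta> (I i (j + k)) (I j k) S'"
    using triple_datum[of i j k] by metis
  let ?\<beta> = "\<beta> (n i (j + k)) (n j k)"
  have \<beta>: "?\<beta> \<in> S'" "?\<beta> \<noteq> 0"
    using tensor_iso2_nonzero[OF d(3) I_one_dim I_one_dim] choices_in[OF assms] choices_nz[OF assms] by simp_all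
  have "\<exists>u v x. ?\<beta> u v x \<noteq> 0" using \<beta>(2) by (simp add: fun_eq_iff)
  then obtain u v x where nz: "?\<beta> u v x \<noteq> 0" by (elim exE)
  then have in_S: "u \<in> S i" "v \<in> S j" "x \<in> S k" using trilin_maps_support[OF subsetD[OF d(1) \<beta>(1)] nz] by simp_all
  then have "expand_zw (?\<beta> u v x) = nested (n i (j + k)) (n j k) u v x"
    using d(2) choices_in[OF assms] by simp
  then have "nested (n i (j + k)) (n j k) u v x \<noteq> 0" using nz expand_zw_eq_0 by metis
  then show ?thesis using in_S by blast
qed

text \<open>Both compositions are nonzero in the same one-dimensional space of maps, so a single
  scalar serves all vectors.\<close>

lemma associator_exists:
  assumes "n \<in> choices I"
  shows "\<exists>c. c \<noteq> 0 \<and> (\<forall>u\<in>S i. \<forall>v\<in>S j. \<forall>x\<in>S k.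
    \<exists>\<phi>\<in>locser2_on (S (i + j + k)). \<exists>\<psi>\<in>locser2_on (S (i + j + k)).
      expand_zw \<phi> = nested (n i (j + k)) (n j k) u v x
      \<and> expand_w_zw \<psi> = iterated (n (i + j) k) (n i j) u v x \<and> \<phi> = c *\<^sub>C \<psi>)"
proof -
  obtain S' \<beta> \<gamma> where d: "one_dimensional S'"
    "S' \<subseteq> trilin_maps (S i) (S j) (S k) (locser2_on (S (i + j + k)))"
    "\<forall>p\<in>I i (j + k). \<forall>q\<in>I j k. \<forall>u\<in>S i. \<forall>v\<in>S j. \<forall>x\<in>S k. expand_zw (\<beta> p q u v x) = nested p q u v x"
    "tensor_iso2 \<beta> (I i (j + k)) (I j k) S'"
    "\<forall>p\<in>I (i + j) k. \<forall>q\<in>I i j. \<forall>u\<in>S i. \<forall>v\<in>S j. \<forall>x\<in>S k. expand_w_zw (\<gamma> p q u v x) = iterated p q u v x"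
    "tensor_iso2 \<gamma> (I (i + j) k) (I i j) S'"
    by (rule triple_datum[of i j k])
  let ?\<beta> = "\<beta> (n i (j + k)) (n j k)" and ?\<gamma> = "\<gamma> (n (i + j) k) (n i j)"
  have \<beta>: "?\<beta> \<in> S'" "?\<beta> \<noteq> 0"
    using tensor_iso2_nonzero[OF d(4) I_one_dim I_one_dim] choices_in[OF assms] choices_nz[OF assms] by simp_all
  have \<gamma>: "?\<gamma> \<in> S'" "?\<gamma> \<noteq> 0"
    using tensor_iso2_nonzero[OF d(6) I_one_dim I_one_dim] choices_in[OF assms] choices_nz[OF assms] by simp_all
  obtain c where c: "c \<noteq> 0" "?\<beta> = c *\<^sub>C ?\<gamma>" using one_dimensional_scalar[OF d(1) \<beta>(1) \<gamma>(1) \<beta>(2) \<gamma>(2)] by metis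
  show ?thesis
  proof (intro exI[of _ c] conjI ballI)
    fix u v x assume uvx: "u \<in> S i" "v \<in> S j" "x \<in> S k"
    show "\<exists>\<phi>\<in>locser2_on (S (i + j + k)). \<exists>\<psi>\<in>locser2_on (S (i + j + k)).
      expand_zw \<phi> = nested (n i (j + k)) (n j k) u v x
      \<and> expand_w_zw \<psi> = iterated (n (i + j) k) (n i j) u v x \<and> \<phi> = c *\<^sub>C \<psi>"
    proof (rule bexI[of _ "?\<beta> u v x"], rule bexI[of _ "?\<gamma> u v x"], intro conjI)
      show "?\<beta> u v x = c *\<^sub>C ?\<gamma> u v x" by (simp add: c(2) scaleC_apply)
      show "?\<beta> u v x \<in> locser2_on (S (i + j + k))" "?\<gamma> u v x \<in> locser2_on (S (i + j + k))"
        using trilin_maps_in[OF subsetD[OF d(2)] uvx] \<beta>(1) \<gamma>(1) by blast+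
    qed (use d(3,5) uvx choices_in[OF assms] in simp_all)
  qed (rule c(1))
qed

lemma braiding_exists:
  assumes "n \<in> choices I"
  shows "\<exists>c. c \<noteq> 0 \<and> n i j = c *\<^sub>C skew (mL (M (i + j))) (n j i)"
proof -
  have n: "n j i \<in> I j i" "n j i \<noteq> 0" using choices_in[OF assms] choices_nz[OF assms] by simp_all
  then have "skew (mL (M (i + j))) (n j i) \<in> I i j" "skew (mL (M (i + j))) (n j i) \<noteq> 0"
    using skew_in_I[OF n] skew_nonzero[OF n] by (simp_all add: add.commute)
  then show ?thesis
    by (intro one_dimensional_scalar[OF I_one_dim choices_in[OF assms]] choices_nz[OF assms])
qed

lemma associated_exists:
  assumes "n \<in> choices I"
  shows "\<exists>F \<Omega>. associated M n F \<Omega>"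
proof -
  obtain F where "\<forall>i j k. F i j k \<noteq> 0 \<and> (\<forall>u\<in>S i. \<forall>v\<in>S j. \<forall>x\<in>S k.
    \<exists>\<phi>\<in>locser2_on (S (i + j + k)). \<exists>\<psi>\<in>locser2_on (S (i + j + k)).
      expand_zw \<phi> = nested (n i (j + k)) (n j k) u v x
      \<and> expand_w_zw \<psi> = iterated (n (i + j) k) (n i j) u v x \<and> \<phi> = F i j k *\<^sub>C \<psi>)"
    using associator_exists[OF assms] by metis
  moreover obtain \<Omega> where "\<forall>i j. \<Omega> i j \<noteq> 0 \<and> n i j = \<Omega> i j *\<^sub>C skew (mL (M (i + j))) (n j i)"
    using braiding_exists[OF assms] by metis
  ultimately show ?thesis unfolding associated_def by metis
qed

lemma associated_rel:
  assumes "associated M n F \<Omega>" "u \<in> S i" "v \<in> S j" "x \<in> S k"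
  shows "assoc_rel (S (i + j + k)) (nested (n i (j + k)) (n j k) u v x) (F i j k *\<^sub>C iterated (n (i + j) k) (n i j) u v x)"
proof -
  have "\<exists>\<phi>\<in>locser2_on (S (i + j + k)). \<exists>\<psi>\<in>locser2_on (S (i + j + k)).
      expand_zw \<phi> = nested (n i (j + k)) (n j k) u v x
      \<and> expand_w_zw \<psi> = iterated (n (i + j) k) (n i j) u v x \<and> \<phi> = F i j k *\<^sub>C \<psi>"
    by (rule conjunct2[OF spec[OF spec[OF spec[OF conjunct1[OF assms(1)[unfolded associated_def]]]]],
          THEN bspec, OF assms(2), THEN bspec, OF assms(3), THEN bspec, OF assms(4)])
  then obtain \<phi> \<psi> where "\<phi> \<in> locser2_on (S (i + j + k))" "expand_zw \<phi> = nested (n i (j + k)) (n j k) u v x"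
    "expand_w_zw \<psi> = iterated (n (i + j) k) (n i j) u v x" "\<phi> = F i j k *\<^sub>C \<psi>" by metis
  then show ?thesis by (intro assoc_relI[of \<phi>]) (simp_all add: expand_scale)
qed

lemma associated_nz: "associated M n F \<Omega> \<Longrightarrow> F i j k \<noteq> 0" "associated M n F \<Omega> \<Longrightarrow> \<Omega> i j \<noteq> 0"
  and associated_braiding: "associated M n F \<Omega> \<Longrightarrow> n i j = \<Omega> i j *\<^sub>C skew (mL (M (i + j))) (n j i)"
proof -
  assume a: "associated M n F \<Omega>"
  note 1 = spec[OF spec[OF spec[OF conjunct1[OF a[unfolded associated_def]]]]]
    and 2 = spec[OF spec[OF conjunct2[OF a[unfolded associated_def]]]]
  show "F i j k \<noteq> 0" by (rule conjunct1[OF 1])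
  show "\<Omega> i j \<noteq> 0" by (rule conjunct1[OF 2])
  show "n i j = \<Omega> i j *\<^sub>C skew (mL (M (i + j))) (n j i)" by (rule conjunct2[OF 2])
qed

lemma scaleC_cancel: "c *\<^sub>C x = d *\<^sub>C x \<Longrightarrow> x \<noteq> 0 \<Longrightarrow> c = d" for x :: "'x::complex_vector"
  by simp

lemma iterated_nonzero:
  assumes "n \<in> choices I"
  shows "\<exists>u\<in>S i. \<exists>v\<in>S j. \<exists>x\<in>S k. iterated (n (i + j) k) (n i j) u v x \<noteq> 0"
proof -
  obtain F \<Omega> where a: "associated M n F \<Omega>" using associated_exists[OF assms] by metis
  obtain u v x where uvx: "u \<in> S i" "v \<in> S j" "x \<in> S k" and nz: "nested (n i (j + k)) (n j k) u v x \<noteq> 0"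
    using nested_nonzero[OF assms] by metis
  have "iterated (n (i + j) k) (n i j) u v x \<noteq> 0"
  proof
    assume "iterated (n (i + j) k) (n i j) u v x = 0"
    then have "assoc_rel (S (i + j + k)) (nested (n i (j + k)) (n j k) u v x) 0"
      using associated_rel[OF a uvx] by simp
    then show False using assoc_rel_inj[OF _ assoc_rel_0] nz by metis
  qed
  then show ?thesis using uvx by blast
qed

text \<open>A triple on which the iterate does not vanish determines the associator, and a
  nonvanishing skew determines the braiding. This makes the description in
  \<open>associated_pair\<close> meaningful.\<close>

lemma associated_unique:
  assumes n: "n \<in> choices I" and "associated M n F \<Omega>" "associated M n F' \<Omega>'"
  shows "F = F'" "\<Omega> = \<Omega>'"
proof -
  show "F = F'"
  proof (intro ext)
    fix i j k
    obtain u v x where uvx: "u \<in> S i" "v \<in> S j" "x \<in> S k" and nz: "iterated (n (i + j) k) (n i j) u v x \<noteq> 0"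
      using iterated_nonzero[OF n] by metis
    show "F i j k = F' i j k"
      using assoc_rel_fun[OF associated_rel[OF assms(2) uvx] associated_rel[OF assms(3) uvx]] nz
      by (rule scaleC_cancel)
  qed
  show "\<Omega> = \<Omega>'"
  proof (intro ext)
    fix i j
    have "skew (mL (M (i + j))) (n j i) \<noteq> 0"
      using skew_nonzero[OF choices_in[OF n] choices_nz[OF n], of j i] by (simp add: add.commute)
    then show "\<Omega> i j = \<Omega>' i j"
      using associated_braiding[OF assms(2), of i j] associated_braiding[OF assms(3), of i j] scaleC_cancel by metis
  qed
qed

lemma associated_pair_eq:
  assumes "n \<in> choices I"
  shows "associated_pair M n = (F, \<Omega>) \<longleftrightarrow> associated M n F \<Omega>"
proof -
  obtain F' \<Omega>' where a: "associated M n F' \<Omega>'" using associated_exists[OF assms] by metis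
  have "associated_pair M n = (F', \<Omega>')"
    unfolding associated_pair_def
    by (rule the_equality) (use a associated_unique[OF assms] in \<open>auto simp: prod_eq_iff\<close>)
  then show ?thesis using a associated_unique[OF assms, of F \<Omega> F' \<Omega>'] by auto
qed

text \<open>Associate \<open>u(vx)\<close> to \<open>(uv)x\<close>, apply skew-symmetry to \<open>uv\<close>, and associate back.\<close>

lemma exchange:
  assumes n: "n \<in> choices I" and a: "associated M n F \<Omega>" and uvx: "u \<in> S i" "v \<in> S j" "x \<in> S k"
  shows "exch_rel (S (i + j + k)) (nested (n i (j + k)) (n j k) u v x)
    (exchange_scalar F \<Omega> i j k *\<^sub>C (\<lambda>b c. nested (n j (i + k)) (n i k) v u x c b))"
proof -
  have ji: "j + i = i + j" by (rule add.commute)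
  obtain \<phi> where \<phi>: "\<phi> \<in> locser2_on (S (i + j + k))" "nested (n i (j + k)) (n j k) u v x = expand_zw \<phi>"
    "F i j k *\<^sub>C iterated (n (i + j) k) (n i j) u v x = expand_w_zw \<phi>"
    using associated_rel[OF a uvx] by (rule assoc_relE)
  obtain \<psi> where \<psi>: "\<psi> \<in> locser2_on (S (j + i + k))" "nested (n j (i + k)) (n i k) v u x = expand_zw \<psi>"
    "F j i k *\<^sub>C iterated (n (j + i) k) (n j i) v u x = expand_w_zw \<psi>"
    using associated_rel[OF a uvx(2,1,3)] by (rule assoc_relE)
  obtain N G where G: "\<psi> = frac2 (N, G)" by (rule locser2_cases)
  let ?L = "mL (M (i + j))" and ?J = "n (i + j) k"
  have nji: "n j i \<in> I j i" and J: "?J \<in> I (i + j) k" using choices_in[OF n] by simp_all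
  have lau: "n j i v u \<in> laurent (S (i + j))" using I_laurent[OF nji] by (simp add: ji)
  obtain B where B: "\<forall>r<B. n j i v u r = 0" using lau by (rule laurent_bound)
  have D: "?J (?L (- 1) q) x r = ddz (?J q x) r" if "q \<in> S (i + j)" for q r
    using I_intertwiner[OF J] that uvx(3) by (simp add: intertwiners_def)
  have J_lin: "lin_map (S (i + j)) (laurent (S (i + j + k))) (\<lambda>q. ?J q x)"
    using I_bilin[OF J] uvx(3) by (simp add: bilin_maps_def)
  have sw: "expand_w_zw (swap_frac N G) = F j i k *\<^sub>C iterated ?J (skew ?L (n j i)) u v x"
  proof (intro ext)
    fix p r
    \<comment> \<open>One range for two finite sums: the pole order \<open>N\<close> bounds the
      first, the truncation \<open>B\<close> of \<open>n j i v u\<close> the second.\<close>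
    define K where "K = nat (max (p + int N) (p - B))"
    have K: "p + int N \<le> int K" "p - B \<le> int K" unfolding K_def by linarith+
    have "expand_w_zw (swap_frac N G) p r = (\<Sum>t\<le>K. ((- 1) powi (p - int t) * (of_int (r + int t) gchoose t))
        *\<^sub>C expand_w_zw \<psi> (p - int t) (r + int t))"
      unfolding G by (rule expand_w_zw_swap[OF K(1)])
    also have "\<dots> = F j i k *\<^sub>C (\<Sum>t\<le>K. ((- 1) powi (p - int t) * (of_int (r + int t) gchoose t))
        *\<^sub>C iterated ?J (n j i) v u x (p - int t) (r + int t))"
      by (simp add: \<psi>(3)[symmetric] ji scaleC_apply complex_vector.scale_sum_right mult.commute)
    also have "\<dots> = F j i k *\<^sub>C iterated ?J (skew ?L (n j i)) u v x p r"
      using iterated_skew[where L = ?L and S = "S (i + j)" and W = "laurent (S (i + j + k))" and I = "n j i"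
          and J = ?J and u = v and v = u and x = x and N = B and p = p and K = K and n = r]
        L1_lin S_subspace lau J_lin D B K(2) by simp
    finally show "expand_w_zw (swap_frac N G) p r = (F j i k *\<^sub>C iterated ?J (skew ?L (n j i)) u v x) p r"
      by (simp add: scaleC_apply)
  qed
  have "iterated ?J (n i j) u v x = \<Omega> i j *\<^sub>C iterated ?J (skew ?L (n j i)) u v x"
  proof (intro ext)
    fix p r
    have "skew ?L (n j i) u v p \<in> S (i + j)"
      using skew_laurent[where S = "S (i + j)" and L = ?L and I = "n j i" and u = v and v = u]
        L1_lin S_subspace lau by (simp add: laurent_def)
    then show "iterated ?J (n i j) u v x p r = (\<Omega> i j *\<^sub>C iterated ?J (skew ?L (n j i)) u v x) p r"
      by (simp add: iterated_def associated_braiding[OF a, of i j] scaleC_apply lin_map_scale[OF J_lin])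
  qed
  \<comment> \<open>The two fractions are compared in the region of small \<open>z - w\<close>,
    where skew-symmetry of the inner operator is visible; injectivity carries the equality to the
    other regions.\<close>
  then have "expand_w_zw \<phi> = expand_w_zw (exchange_scalar F \<Omega> i j k *\<^sub>C swap_frac N G)"
    using associated_nz(1)[OF a] by (simp add: \<phi>(3)[symmetric] expand_scale sw scaleC_scaleC exchange_scalar_def)
  then have "\<phi> = exchange_scalar F \<Omega> i j k *\<^sub>C swap_frac N G" by (rule expand_w_zw_inj)
  then have "expand_wz \<phi> = exchange_scalar F \<Omega> i j k *\<^sub>C (\<lambda>b c. nested (n j (i + k)) (n i k) v u x c b)"
    by (intro ext) (simp add: expand_scale scaleC_apply expand_wz_swap \<psi>(2) G)
  then show ?thesis using \<phi> by (intro exch_relI) simp_all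
qed

text \<open>The only entry of the condition on four modules. It retains what is needed later: one
  quadruple of vectors with nonvanishing product, and linear forms that clear the denominator of
  this product.\<close>

lemma quad_fraction:
  assumes "n \<in> choices I"
  shows "\<exists>u\<in>S i. \<exists>v\<in>S j. \<exists>x\<in>S k. \<exists>y\<in>S l. \<exists>ls G. G \<noteq> 0
    \<and> mulfs ls (\<lambda>a b c. n i (j + k + l) u (n j (k + l) v (n k l x y c) b) a) = coef3 G"
proof -
  have "\<forall>i j k l. \<exists>S'. one_dimensional S'
        \<and> S' \<subseteq> quadrilin_maps (S i) (S j) (S k) (S l) (locser3_on (S (i + j + k + l)))
        \<and> (\<exists>\<beta>. (\<forall>p\<in>I i (j + k + l). \<forall>q\<in>I j (k + l). \<forall>r\<in>I k l.
              \<forall>u\<in>S i. \<forall>v\<in>S j. \<forall>x\<in>S k. \<forall>y\<in>S l.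
                expand_zwt (\<beta> p q r u v x y) = (\<lambda>m n s. p u (q v (r x y s) n) m))
            \<and> tensor_iso3 \<beta> (I i (j + k + l)) (I j (k + l)) (I k l) S')"
    using assoc_datum unfolding associativity_datum_def by (elim conjE)
  from this[rule_format, of i j k l] obtain S' \<beta> where
    d: "S' \<subseteq> quadrilin_maps (S i) (S j) (S k) (S l) (locser3_on (S (i + j + k + l)))"
    "\<forall>p\<in>I i (j + k + l). \<forall>q\<in>I j (k + l). \<forall>r\<in>I k l. \<forall>u\<in>S i. \<forall>v\<in>S j. \<forall>x\<in>S k. \<forall>y\<in>S l.
      expand_zwt (\<beta> p q r u v x y) = (\<lambda>m n s. p u (q v (r x y s) n) m)"
    "tensor_iso3 \<beta> (I i (j + k + l)) (I j (k + l)) (I k l) S'"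
    by (elim exE conjE) (rule that)
  let ?\<beta> = "\<beta> (n i (j + k + l)) (n j (k + l)) (n k l)"
  have \<beta>: "?\<beta> \<in> S'" "?\<beta> \<noteq> 0"
    using tensor_iso3_nonzero[OF d(3) I_one_dim I_one_dim I_one_dim] choices_in[OF assms] choices_nz[OF assms]
    by simp_all
  have "\<exists>u v x y. ?\<beta> u v x y \<noteq> 0" using \<beta>(2) by (simp add: fun_eq_iff)
  then obtain u v x y where nz: "?\<beta> u v x y \<noteq> 0" by (elim exE)
  have q: "?\<beta> \<in> quadrilin_maps (S i) (S j) (S k) (S l) (locser3_on (S (i + j + k + l)))"
    by (rule subsetD[OF d(1) \<beta>(1)])
  have u: "u \<in> S i" using q nz by (cases "u \<in> S i") (auto simp: quadrilin_maps_def)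
  then have "?\<beta> u \<in> trilin_maps (S j) (S k) (S l) (locser3_on (S (i + j + k + l)))"
    using q by (simp add: quadrilin_maps_def)
  from trilin_maps_support[OF this nz] have vxy: "v \<in> S j" "x \<in> S k" "y \<in> S l" by simp_all
  obtain ls G where G: "mulfs ls (expand_zwt (?\<beta> u v x y)) = coef3 G" "G = 0 \<longrightarrow> ?\<beta> u v x y = 0"
    by (rule expand_zwt_clear)
  have "expand_zwt (?\<beta> u v x y) = (\<lambda>a b c. n i (j + k + l) u (n j (k + l) v (n k l x y c) b) a)"
    using d(2) u vxy choices_in[OF assms] by simp
  then have "mulfs ls (\<lambda>a b c. n i (j + k + l) u (n j (k + l) v (n k l x y c) b) a) = coef3 G" "G \<noteq> 0"
    using G nz by simp_all
  then show ?thesis using u vxy by (intro bexI exI conjI)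
qed

lemma choice_maps:
  assumes "n \<in> choices I"
  shows "u \<in> S i \<Longrightarrow> v \<in> S j \<Longrightarrow> n i j u v r \<in> S (i + j)"
    and "u \<in> S i \<Longrightarrow> lin_map (S j) (S (i + j)) (\<lambda>v. n i j u v r)"
    and "v \<in> S j \<Longrightarrow> lin_map (S i) (S (i + j)) (\<lambda>u. n i j u v r)"
  using bilin_maps_facts(2,3,4)[OF I_bilin[OF choices_in[OF assms]]] by simp_all

text \<open>The five bracketings of a product of four vectors, as series in the appropriate differences of
  the variables, are transported from the common fraction in three variables along both sides of the
  pentagon.\<close>

lemma pentagon:
  assumes n: "n \<in> choices I" and a: "associated M n F \<Omega>"
  shows "F i j k * F i (j + k) l * F j k l = F (i + j) k l * F i j (k + l)"
proof -
  obtain u v x y ls G where uvxy: "u \<in> S i" "v \<in> S j" "x \<in> S k" "y \<in> S l" and G: "G \<noteq> 0"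
    "mulfs ls (\<lambda>a b c. n i (j + k + l) u (n j (k + l) v (n k l x y c) b) a) = coef3 G"
    using quad_fraction[OF n, of i j k l] by metis
  note mem = choice_maps(1)[OF n] and rmap = choice_maps(2)[OF n] and lmap = choice_maps(3)[OF n]
  \<comment> \<open>The bracketings are \<open>u(v(xy))\<close>, \<open>u((vx)y)\<close>,
    \<open>(u(vx))y\<close>, \<open>((uv)x)y\<close> and \<open>(uv)(xy)\<close>. The exponents
    \<open>a\<close>, \<open>b\<close>, \<open>c\<close> stay attached to \<open>u\<close>,
    \<open>v\<close>, \<open>x\<close>. Only the point from which a variable is measured changes,
    and this tells on which pair of slots each step acts.\<close>
  define X1 where "X1 = (\<lambda>a b c. n i (j + k + l) u (n j (k + l) v (n k l x y c) b) a)"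
  define X2 where "X2 = (\<lambda>a b c. n i (j + k + l) u (n (j + k) l (n j k v x b) y c) a)"
  define X3 where "X3 = (\<lambda>a b c. n (i + j + k) l (n i (j + k) u (n j k v x b) a) y c)"
  define X4 where "X4 = (\<lambda>a b c. n (i + j + k) l (n (i + j) k (n i j u v a) x b) y c)"
  define X5 where "X5 = (\<lambda>a b c. n (i + j) (k + l) (n i j u v a) (n k l x y c) b)"
  have R12: "rel23 assoc X1 (F j k l *\<^sub>C X2)"
    unfolding rel23_def
  proof
    fix a
    have "assoc_rel (S (i + (j + k + l))) (\<lambda>b c. n i (j + k + l) u (nested (n j (k + l)) (n k l) v x y b c) a)
      (\<lambda>b c. n i (j + k + l) u ((F j k l *\<^sub>C iterated (n (j + k) l) (n j k) v x y) b c) a)"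
      by (rule assoc_rel_map[OF rmap[OF uvxy(1)] S_subspace associated_rel[OF \<open>associated M n F \<Omega>\<close> uvxy(2-4)]])
    moreover have "n i (j + k + l) u ((F j k l *\<^sub>C iterated (n (j + k) l) (n j k) v x y) b c) a
        = (F j k l *\<^sub>C X2) a b c" for b c
      using lin_map_scale[OF rmap[OF uvxy(1)] mem[OF mem[OF uvxy(2,3)] uvxy(4)], of "F j k l"]
      by (simp add: scaleC_apply iterated_def X2_def)
    ultimately show "assoc (X1 a) ((F j k l *\<^sub>C X2) a)"
      by (simp add: X1_def nested_def assoc_rel_UNIV)
  qed
  have R23: "rel13 assoc X2 (F i (j + k) l *\<^sub>C X3)"
    unfolding rel13_def
  proof
    fix b
    have "assoc_rel (S (i + (j + k) + l)) (nested (n i (j + k + l)) (n (j + k) l) u (n j k v x b) y)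
        (F i (j + k) l *\<^sub>C iterated (n (i + (j + k)) l) (n i (j + k)) u (n j k v x b) y)"
      by (rule associated_rel[OF a uvxy(1) mem[OF uvxy(2,3)] uvxy(4)])
    moreover have "nested (n i (j + k + l)) (n (j + k) l) u (n j k v x b) y = (\<lambda>m s. X2 m b s)"
      by (simp add: nested_def X2_def)
    moreover have "F i (j + k) l *\<^sub>C iterated (n (i + (j + k)) l) (n i (j + k)) u (n j k v x b) y
        = (\<lambda>m s. (F i (j + k) l *\<^sub>C X3) m b s)"
      by (simp add: iterated_def X3_def scaleC_fun_def add.assoc)
    ultimately show "assoc (\<lambda>m s. X2 m b s) (\<lambda>m s. (F i (j + k) l *\<^sub>C X3) m b s)"
      by (metis assoc_rel_UNIV)
  qed
  have R34: "rel12 assoc X3 (F i j k *\<^sub>C X4)"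
    unfolding rel12_def
  proof
    fix c
    have "assoc_rel (S (i + j + k + l)) (\<lambda>m p. n (i + j + k) l (nested (n i (j + k)) (n j k) u v x m p) y c)
      (\<lambda>m p. n (i + j + k) l ((F i j k *\<^sub>C iterated (n (i + j) k) (n i j) u v x) m p) y c)"
      by (rule assoc_rel_map[OF lmap[OF uvxy(4)] S_subspace associated_rel[OF a uvxy(1-3)]])
    moreover have "n (i + j + k) l ((F i j k *\<^sub>C iterated (n (i + j) k) (n i j) u v x) m p) y c
        = (F i j k *\<^sub>C X4) m p c" for m p
      using lin_map_scale[OF lmap[OF uvxy(4)] mem[OF mem[OF uvxy(1,2)] uvxy(3)], of "F i j k"]
      by (simp add: scaleC_apply iterated_def X4_def)
    ultimately show "assoc (\<lambda>m p. X3 m p c) (\<lambda>m p. (F i j k *\<^sub>C X4) m p c)"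
      by (simp add: X3_def nested_def assoc_rel_UNIV)
  qed
  have R15: "rel12 assoc X1 (F i j (k + l) *\<^sub>C X5)"
    unfolding rel12_def
  proof
    fix c
    have "assoc_rel (S (i + j + (k + l))) (nested (n i (j + (k + l))) (n j (k + l)) u v (n k l x y c))
        (F i j (k + l) *\<^sub>C iterated (n (i + j) (k + l)) (n i j) u v (n k l x y c))"
      by (rule associated_rel[OF a uvxy(1,2) mem[OF uvxy(3,4)]])
    moreover have "nested (n i (j + (k + l))) (n j (k + l)) u v (n k l x y c) = (\<lambda>m s. X1 m s c)"
      by (simp add: nested_def X1_def add.assoc)
    moreover have "F i j (k + l) *\<^sub>C iterated (n (i + j) (k + l)) (n i j) u v (n k l x y c)
        = (\<lambda>m s. (F i j (k + l) *\<^sub>C X5) m s c)"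
      by (simp add: iterated_def X5_def scaleC_fun_def)
    ultimately show "assoc (\<lambda>m s. X1 m s c) (\<lambda>m s. (F i j (k + l) *\<^sub>C X5) m s c)"
      by (metis assoc_rel_UNIV)
  qed
  have R54: "rel23 assoc X5 (F (i + j) k l *\<^sub>C X4)"
    unfolding rel23_def
  proof
    fix b
    have "assoc_rel (S (i + j + k + l)) (nested (n (i + j) (k + l)) (n k l) (n i j u v b) x y)
        (F (i + j) k l *\<^sub>C iterated (n (i + j + k) l) (n (i + j) k) (n i j u v b) x y)"
      by (rule associated_rel[OF a mem[OF uvxy(1,2)] uvxy(3,4)])
    moreover have "nested (n (i + j) (k + l)) (n k l) (n i j u v b) x y = X5 b"
      by (simp add: nested_def X5_def)
    moreover have "F (i + j) k l *\<^sub>C iterated (n (i + j + k) l) (n (i + j) k) (n i j u v b) x y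
        = (F (i + j) k l *\<^sub>C X4) b"
      by (simp add: iterated_def X4_def scaleC_fun_def)
    ultimately show "assoc (X5 b) ((F (i + j) k l *\<^sub>C X4) b)"
      by (metis assoc_rel_UNIV)
  qed
  have 1: "mulfs ls X1 = coef3 G" using G(2) by (simp add: X1_def)
  have 2: "mulfs (map lin23 ls) (F j k l *\<^sub>C X2) = coef3 (subst23 G)" by (rule transport(3)[OF R12 1])
  have 3: "mulfs (map lin13 (map lin23 ls)) (F j k l *\<^sub>C F i (j + k) l *\<^sub>C X3) = coef3 (subst13 (subst23 G))"
    by (rule transport(2)[OF rel_scale(2)[OF R23] 2])
  have 4: "mulfs (map lin12 (map lin13 (map lin23 ls))) (F j k l *\<^sub>C F i (j + k) l *\<^sub>C F i j k *\<^sub>C X4)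
      = coef3 (subst12 (subst13 (subst23 G)))"
    by (rule transport(1)[OF rel_scale(1)[OF rel_scale(1)[OF R34]] 3])
  have 5: "mulfs (map lin12 ls) (F i j (k + l) *\<^sub>C X5) = coef3 (subst12 G)" by (rule transport(1)[OF R15 1])
  have 6: "mulfs (map lin23 (map lin12 ls)) (F i j (k + l) *\<^sub>C F (i + j) k l *\<^sub>C X4) = coef3 (subst23 (subst12 G))"
    by (rule transport(3)[OF rel_scale(3)[OF R54] 5])
  \<comment> \<open>Both paths perform the same total change of variables, so the forms and the
    power series agree, and only the scalars could differ.\<close>
  have "map lin12 (map lin13 (map lin23 ls)) = map lin23 (map lin12 ls)"
    by (simp add: lin12_def lin13_def lin23_def add_ac)
  then have "(F j k l * (F i (j + k) l * F i j k)) *\<^sub>C mulfs (map lin23 (map lin12 ls)) X4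
      = (F i j (k + l) * F (i + j) k l) *\<^sub>C mulfs (map lin23 (map lin12 ls)) X4"
    using 4 6 by (simp only: mulfs_scale scaleC_scaleC subst_commute)
  \<comment> \<open>Substitution is injective on power series, so nonvanishing of \<open>G\<close>
    survives to the end of the path.\<close>
  moreover have "mulfs (map lin23 (map lin12 ls)) X4 \<noteq> 0"
  proof
    assume "mulfs (map lin23 (map lin12 ls)) X4 = 0"
    then have "coef3 (subst23 (subst12 G)) = 0" using 6 by (simp add: mulfs_scale)
    then show False using G(1) subst_eq_0 coef3_eq_0 by metis
  qed
  ultimately have "F j k l * (F i (j + k) l * F i j k) = F i j (k + l) * F (i + j) k l"
    by (rule scaleC_cancel)
  then show ?thesis by (simp add: mult_ac)
qed

text \<open>Moving \<open>u\<close> past \<open>v\<close> and \<open>x\<close> in \<open>u(v(xy))\<close> one after the other, or past the product \<open>vx\<close>.\<close>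

lemma fusion:
  assumes n: "n \<in> choices I" and a: "associated M n F \<Omega>"
  shows "F j k l * exchange_scalar F \<Omega> i (j + k) l = F j k (i + l) * exchange_scalar F \<Omega> i j (k + l) * exchange_scalar F \<Omega> i k l"
proof -
  obtain u v x y ls G where uvxy: "u \<in> S i" "v \<in> S j" "x \<in> S k" "y \<in> S l" and G: "G \<noteq> 0"
    "mulfs ls (\<lambda>a b c. n i (j + k + l) u (n j (k + l) v (n k l x y c) b) a) = coef3 G"
    using quad_fraction[OF n, of i j k l] by metis
  note mem = choice_maps(1)[OF n] and rmap = choice_maps(2)[OF n] and lmap = choice_maps(3)[OF n]
  \<comment> \<open>The products are \<open>u(v(xy))\<close>, \<open>u((vx)y)\<close>,
    \<open>v(u(xy))\<close>, \<open>v(x(uy))\<close> and \<open>(vx)(uy)\<close>. Exchanges leave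
    the variables alone, so on both paths the forms undergo \<open>lin23\<close> exactly
    once.\<close>
  define X1 where "X1 = (\<lambda>a b c. n i (j + k + l) u (n j (k + l) v (n k l x y c) b) a)"
  define X2 where "X2 = (\<lambda>a b c. n i (j + k + l) u (n (j + k) l (n j k v x b) y c) a)"
  define Y1 where "Y1 = (\<lambda>a b c. n j (i + k + l) v (n i (k + l) u (n k l x y c) a) b)"
  define Y2 where "Y2 = (\<lambda>a b c. n j (i + k + l) v (n k (i + l) x (n i l u y a) c) b)"
  define Z where "Z = (\<lambda>a b c. n (j + k) (i + l) (n j k v x b) (n i l u y a) c)"
  have R12: "rel23 assoc X1 (F j k l *\<^sub>C X2)"
    unfolding rel23_def
  proof
    fix a
    have "assoc_rel (S (i + (j + k + l))) (\<lambda>b c. n i (j + k + l) u (nested (n j (k + l)) (n k l) v x y b c) a)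
      (\<lambda>b c. n i (j + k + l) u ((F j k l *\<^sub>C iterated (n (j + k) l) (n j k) v x y) b c) a)"
      by (rule assoc_rel_map[OF rmap[OF uvxy(1)] S_subspace associated_rel[OF \<open>associated M n F \<Omega>\<close> uvxy(2-4)]])
    moreover have "n i (j + k + l) u ((F j k l *\<^sub>C iterated (n (j + k) l) (n j k) v x y) b c) a
        = (F j k l *\<^sub>C X2) a b c" for b c
      using lin_map_scale[OF rmap[OF uvxy(1)] mem[OF mem[OF uvxy(2,3)] uvxy(4)], of "F j k l"]
      by (simp add: scaleC_apply iterated_def X2_def)
    ultimately show "assoc (X1 a) ((F j k l *\<^sub>C X2) a)"
      by (simp add: X1_def nested_def assoc_rel_UNIV)
  qed
  have E1: "rel12 exch X1 (exchange_scalar F \<Omega> i j (k + l) *\<^sub>C Y1)"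
    unfolding rel12_def
  proof
    fix c
    have "exch_rel (S (i + j + (k + l))) (nested (n i (j + (k + l))) (n j (k + l)) u v (n k l x y c))
        (exchange_scalar F \<Omega> i j (k + l) *\<^sub>C (\<lambda>m s. nested (n j (i + (k + l))) (n i (k + l)) v u (n k l x y c) s m))"
      by (rule exchange[OF n a uvxy(1,2) mem[OF uvxy(3,4)]])
    moreover have "nested (n i (j + (k + l))) (n j (k + l)) u v (n k l x y c) = (\<lambda>m s. X1 m s c)"
      by (simp add: nested_def X1_def add.assoc)
    moreover have "exchange_scalar F \<Omega> i j (k + l) *\<^sub>C (\<lambda>m s. nested (n j (i + (k + l))) (n i (k + l)) v u (n k l x y c) s m)
        = (\<lambda>m s. (exchange_scalar F \<Omega> i j (k + l) *\<^sub>C Y1) m s c)"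
      by (simp add: nested_def Y1_def scaleC_fun_def add.assoc)
    ultimately show "exch (\<lambda>m s. X1 m s c) (\<lambda>m s. (exchange_scalar F \<Omega> i j (k + l) *\<^sub>C Y1) m s c)"
      by (metis exch_rel_UNIV)
  qed
  have E2: "rel13 exch Y1 (exchange_scalar F \<Omega> i k l *\<^sub>C Y2)"
    unfolding rel13_def
  proof
    fix b
    let ?N = "\<lambda>m s. nested (n k (i + l)) (n i l) x u y s m"
    have "exch_rel (S (j + (i + k + l))) (\<lambda>m s. n j (i + k + l) v (nested (n i (k + l)) (n k l) u x y m s) b)
      (\<lambda>m s. n j (i + k + l) v ((exchange_scalar F \<Omega> i k l *\<^sub>C ?N) m s) b)"
      by (rule exch_rel_map[OF rmap[OF uvxy(2)] S_subspace exchange[OF n a uvxy(1,3,4)]])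
    moreover have "?N m s \<in> S (i + k + l)" for m s
      using mem[OF uvxy(3) mem[OF uvxy(1,4)]] by (simp add: nested_def add_ac)
    then have "n j (i + k + l) v ((exchange_scalar F \<Omega> i k l *\<^sub>C ?N) m s) b = (exchange_scalar F \<Omega> i k l *\<^sub>C Y2) m b s" for m s
      using lin_map_scale[OF rmap[OF uvxy(2)], of _ "i + k + l" "exchange_scalar F \<Omega> i k l"]
      by (simp add: scaleC_apply nested_def Y2_def)
    ultimately show "exch (\<lambda>m s. Y1 m b s) (\<lambda>m s. (exchange_scalar F \<Omega> i k l *\<^sub>C Y2) m b s)"
      by (simp add: Y1_def nested_def exch_rel_UNIV)
  qed
  have E3: "rel13 exch X2 (exchange_scalar F \<Omega> i (j + k) l *\<^sub>C Z)"
    unfolding rel13_def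
  proof
    fix b
    have "exch_rel (S (i + (j + k) + l)) (nested (n i (j + k + l)) (n (j + k) l) u (n j k v x b) y)
        (exchange_scalar F \<Omega> i (j + k) l *\<^sub>C (\<lambda>m s. nested (n (j + k) (i + l)) (n i l) (n j k v x b) u y s m))"
      by (rule exchange[OF n a uvxy(1) mem[OF uvxy(2,3)] uvxy(4)])
    moreover have "nested (n i (j + k + l)) (n (j + k) l) u (n j k v x b) y = (\<lambda>m s. X2 m b s)"
      by (simp add: nested_def X2_def)
    moreover have "exchange_scalar F \<Omega> i (j + k) l *\<^sub>C (\<lambda>m s. nested (n (j + k) (i + l)) (n i l) (n j k v x b) u y s m)
        = (\<lambda>m s. (exchange_scalar F \<Omega> i (j + k) l *\<^sub>C Z) m b s)"
      by (simp add: nested_def Z_def scaleC_fun_def)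
    ultimately show "exch (\<lambda>m s. X2 m b s) (\<lambda>m s. (exchange_scalar F \<Omega> i (j + k) l *\<^sub>C Z) m b s)"
      by (metis exch_rel_UNIV)
  qed
  have R: "rel23 assoc Y2 (F j k (i + l) *\<^sub>C Z)"
    unfolding rel23_def
  proof
    fix c
    have "assoc_rel (S (j + k + (i + l))) (nested (n j (k + (i + l))) (n k (i + l)) v x (n i l u y c))
        (F j k (i + l) *\<^sub>C iterated (n (j + k) (i + l)) (n j k) v x (n i l u y c))"
      by (rule associated_rel[OF a uvxy(2,3) mem[OF uvxy(1,4)]])
    moreover have "nested (n j (k + (i + l))) (n k (i + l)) v x (n i l u y c) = Y2 c"
      by (simp add: nested_def Y2_def add_ac)
    moreover have "F j k (i + l) *\<^sub>C iterated (n (j + k) (i + l)) (n j k) v x (n i l u y c)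
        = (F j k (i + l) *\<^sub>C Z) c"
      by (simp add: iterated_def Z_def scaleC_fun_def)
    ultimately show "assoc (Y2 c) ((F j k (i + l) *\<^sub>C Z) c)"
      by (metis assoc_rel_UNIV)
  qed
  have 1: "mulfs ls X1 = coef3 G" using G(2) by (simp add: X1_def)
  have 2: "mulfs ls (exchange_scalar F \<Omega> i j (k + l) *\<^sub>C Y1) = coef3 G" by (rule transport(4)[OF E1 1])
  have 3: "mulfs ls (exchange_scalar F \<Omega> i j (k + l) *\<^sub>C exchange_scalar F \<Omega> i k l *\<^sub>C Y2) = coef3 G"
    by (rule transport(5)[OF rel_scale(5)[OF E2] 2])
  have 4: "mulfs (map lin23 ls) (exchange_scalar F \<Omega> i j (k + l) *\<^sub>C exchange_scalar F \<Omega> i k l *\<^sub>C F j k (i + l) *\<^sub>C Z) = coef3 (subst23 G)"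
    by (rule transport(3)[OF rel_scale(3)[OF rel_scale(3)[OF R]] 3])
  have 5: "mulfs (map lin23 ls) (F j k l *\<^sub>C X2) = coef3 (subst23 G)" by (rule transport(3)[OF R12 1])
  have 6: "mulfs (map lin23 ls) (F j k l *\<^sub>C exchange_scalar F \<Omega> i (j + k) l *\<^sub>C Z) = coef3 (subst23 G)"
    by (rule transport(5)[OF rel_scale(5)[OF E3] 5])
  have "(F j k l * exchange_scalar F \<Omega> i (j + k) l) *\<^sub>C mulfs (map lin23 ls) Z
      = (exchange_scalar F \<Omega> i j (k + l) * (exchange_scalar F \<Omega> i k l * F j k (i + l))) *\<^sub>C mulfs (map lin23 ls) Z"
    using 4 6 by (simp only: mulfs_scale scaleC_scaleC)
  moreover have "mulfs (map lin23 ls) Z \<noteq> 0"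
  proof
    assume "mulfs (map lin23 ls) Z = 0"
    then have "coef3 (subst23 G) = 0" using 6 by (simp add: mulfs_scale)
    then show False using G(1) subst_eq_0 coef3_eq_0 by metis
  qed
  ultimately have "F j k l * exchange_scalar F \<Omega> i (j + k) l = exchange_scalar F \<Omega> i j (k + l) * (exchange_scalar F \<Omega> i k l * F j k (i + l))"
    by (rule scaleC_cancel)
  then show ?thesis by (simp add: mult_ac)
qed

lemma braiding_symmetric:
  assumes n: "n \<in> choices I" and a: "associated M n F \<Omega>"
  shows "\<Omega> i j * \<Omega> j i = 1"
proof -
  have nij: "n i j \<in> I i j" and nji: "n j i \<in> I j i" using choices_in[OF n] by simp_all
  have ji: "j + i = i + j" by (rule add.commute)
  have skew: "skew (mL (M (i + j))) (n i j) \<in> I j i" by (rule skew_in_I[OF nij choices_nz[OF n]])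
  have "n i j = \<Omega> i j *\<^sub>C skew (mL (M (i + j))) (\<Omega> j i *\<^sub>C skew (mL (M (i + j))) (n i j))"
    using associated_braiding[OF a, of i j] associated_braiding[OF a, of j i] ji by simp
  also have "skew (mL (M (i + j))) (\<Omega> j i *\<^sub>C skew (mL (M (i + j))) (n i j)) = \<Omega> j i *\<^sub>C n i j"
    using skew_linear[OF skew] skew_involution[OF nij] by (simp add: ji)
  finally have eq: "n i j = \<Omega> i j *\<^sub>C \<Omega> j i *\<^sub>C n i j" .
  have "1 *\<^sub>C n i j = (\<Omega> i j * \<Omega> j i) *\<^sub>C n i j" using eq unfolding scaleC_scaleC scaleC_one .
  then have "1 = \<Omega> i j * \<Omega> j i" using choices_nz[OF n] by (rule scaleC_cancel)
  then show ?thesis by simp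
qed

text \<open>As \<open>n 0 i\<close> is the module action, the axioms of an intertwining operator for
  \<open>n j k\<close> already say that the three compositions with \<open>u\<close> in
  \<open>V\<close> expand one fraction. Comparison on vectors with nonzero product gives both
  scalars.\<close>

lemma unit_constraints:
  assumes n: "n \<in> choices I" and a: "associated M n F \<Omega>" and norm: "\<And>i. n 0 i = mact (M i)"
  shows "F 0 j k = 1" "exchange_scalar F \<Omega> 0 j k = 1"
proof -
  obtain u v x where uvx: "u \<in> S 0" "v \<in> S j" "x \<in> S k" and nz: "iterated (n (0 + j) k) (n 0 j) u v x \<noteq> 0"
    using iterated_nonzero[OF n] by metis
  have "\<exists>\<phi>\<in>locser2_on (S (j + k)). expand_zw \<phi> = nested (n 0 (j + k)) (n j k) u v x
        \<and> expand_w_zw \<phi> = iterated (n (0 + j) k) (n 0 j) u v x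
        \<and> expand_wz \<phi> = (\<lambda>b c. nested (n j (0 + k)) (n 0 k) v u x c b)"
    using I_intertwiner[OF choices_in[OF n], of j k] uvx S_0 by (simp add: intertwiners_def norm)
  then obtain \<phi> where \<phi>: "\<phi> \<in> locser2_on (S (j + k))" "expand_zw \<phi> = nested (n 0 (j + k)) (n j k) u v x"
        "expand_w_zw \<phi> = iterated (n (0 + j) k) (n 0 j) u v x" by (elim bexE conjE) (rule that)
  have "F 0 j k *\<^sub>C iterated (n (0 + j) k) (n 0 j) u v x = 1 *\<^sub>C iterated (n (0 + j) k) (n 0 j) u v x"
    using assoc_rel_fun[OF associated_rel[OF a uvx], of "S (j + k)"] assoc_relI[OF \<phi>] by simp
  then show "F 0 j k = 1" using nz by (rule scaleC_cancel)
next
  obtain v u x where uvx: "v \<in> S j" "u \<in> S 0" "x \<in> S k" and nz: "nested (n j (0 + k)) (n 0 k) v u x \<noteq> 0"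
    using nested_nonzero[OF n] by metis
  let ?N = "\<lambda>b c. nested (n j (0 + k)) (n 0 k) v u x c b"
  have "\<exists>\<phi>\<in>locser2_on (S (j + k)). expand_zw \<phi> = nested (n 0 (j + k)) (n j k) u v x
        \<and> expand_w_zw \<phi> = iterated (n (0 + j) k) (n 0 j) u v x
        \<and> expand_wz \<phi> = (\<lambda>b c. nested (n j (0 + k)) (n 0 k) v u x c b)"
    using I_intertwiner[OF choices_in[OF n], of j k] uvx S_0 by (simp add: intertwiners_def norm)
  then obtain \<phi> where \<phi>: "\<phi> \<in> locser2_on (S (j + k))" "expand_zw \<phi> = nested (n 0 (j + k)) (n j k) u v x"
        "expand_wz \<phi> = ?N" by (elim bexE conjE) (rule that)
  have "exchange_scalar F \<Omega> 0 j k *\<^sub>C ?N = 1 *\<^sub>C ?N"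
    using exch_rel_fun[OF exchange[OF n a uvx(2,1,3)], of "S (j + k)"] exch_relI[OF \<phi>] by simp
  moreover have "?N \<noteq> 0" using nz by (auto simp: fun_eq_iff)
  ultimately show "exchange_scalar F \<Omega> 0 j k = 1" by (rule scaleC_cancel)
qed

lemma normalized_cocycle:
  assumes n: "n \<in> choices I" and norm: "normalized_choice M n" and a: "associated M n F \<Omega>"
  shows "normalized_cocycle F \<Omega>"
proof -
  have n0: "n 0 i = mact (M i)" and ni: "n i 0 = skew (mL (M i)) (n 0 i)" for i
    using norm by (simp_all add: normalized_choice_def)
  note nz = associated_nz[OF a] and sym = braiding_symmetric[OF n a] and pent = pentagon[OF n a]
  have F0: "F 0 j k = 1" and \<tau>0: "exchange_scalar F \<Omega> 0 j k = 1" for j k using unit_constraints[OF n a n0] by simp_all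
  have \<Omega>i0: "\<Omega> i 0 = 1" for i
  proof -
    have "\<Omega> i 0 *\<^sub>C n i 0 = 1 *\<^sub>C n i 0" using associated_braiding[OF a, of i 0] ni[of i] by (simp add: scaleC_one)
    then show ?thesis using choices_nz[OF n] by (rule scaleC_cancel)
  qed
  then have \<Omega>0: "\<Omega> 0 i = 1" for i using sym[of i 0] by simp
  have Fi0: "F i 0 k = 1" for i k using \<tau>0[of i k] nz(1)[of i 0 k] by (simp add: exchange_scalar_def F0 \<Omega>0)
  \<comment> \<open>With two trailing zeros the pentagon reads \<open>x^2 = x\<close> for
    \<open>x = F i j 0\<close>.\<close>
  have F3: "F i j 0 = 1" for i j using pent[of i j 0 0] nz(1) by (simp add: Fi0)
  have "\<Omega> i (j + k) * F j i k = F j k i * F i j k * \<Omega> i j * \<Omega> i k" for i j k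
    using fusion[OF n a, of j k 0 i] nz(1)[of j i k] by (simp add: exchange_scalar_def F3 field_simps)
  then show ?thesis by unfold_locales (simp_all add: nz sym pent F0 Fi0 F3)
qed

section \<open>Rescaling a choice of operators\<close>

lemma choices_rescale:
  assumes n: "n \<in> choices I" and l: "\<And>i j. l i j \<noteq> 0"
  shows "rescale l n \<in> choices I"
  using choices_in[OF n] choices_nz[OF n] l I_one_dim
  by (simp add: choices_def families_def rescale_def one_dimensional_def complex_vector.subspace_scale)

lemma choices_transitive:
  assumes "n \<in> choices I" "n' \<in> choices I"
  shows "\<exists>l. (\<forall>i j. l i j \<noteq> 0) \<and> n' = rescale l n"
proof -
  have "\<forall>i j. \<exists>c. c \<noteq> 0 \<and> n' i j = c *\<^sub>C n i j"
    using one_dimensional_scalar[OF I_one_dim] choices_in choices_nz assms by metis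
  then obtain l where l: "\<forall>i j. l i j \<noteq> 0 \<and> n' i j = l i j *\<^sub>C n i j" by metis
  then have "n' = rescale l n" by (simp add: rescale_def fun_eq_iff)
  moreover have "\<forall>i j. l i j \<noteq> 0" using l by simp
  ultimately show ?thesis by (intro exI conjI)
qed

text \<open>Each composition is linear in the inner and in the outer operator, so it scales by two
  values of \<open>l\<close>; the quotient of the two resulting products is the
  differential.\<close>

lemma associated_rescale:
  assumes n: "n \<in> choices I" and a: "associated M n F \<Omega>" and l: "\<And>i j. l i j \<noteq> 0"
  shows "associated M (rescale l n) (\<lambda>i j k. l j k * l i (j + k) / (l (i + j) k * l i j) * F i j k)
    (\<lambda>i j. l i j / l j i * \<Omega> i j)"
  unfolding associated_def
proof (intro conjI allI ballI)
  fix i j k u v x assume uvx: "u \<in> S i" "v \<in> S j" "x \<in> S k"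
  note S = subspace_locser2_on[OF S_subspace, of "i + j + k"]
  have "\<exists>\<phi>\<in>locser2_on (S (i + j + k)). \<exists>\<psi>\<in>locser2_on (S (i + j + k)).
      expand_zw \<phi> = nested (n i (j + k)) (n j k) u v x
      \<and> expand_w_zw \<psi> = iterated (n (i + j) k) (n i j) u v x \<and> \<phi> = F i j k *\<^sub>C \<psi>"
    by (rule conjunct2[OF spec[OF spec[OF spec[OF conjunct1[OF a[unfolded associated_def]]]]],
          THEN bspec, OF uvx(1), THEN bspec, OF uvx(2), THEN bspec, OF uvx(3)])
  then obtain \<phi> \<psi> where \<phi>: "\<phi> \<in> locser2_on (S (i + j + k))" "\<psi> \<in> locser2_on (S (i + j + k))"
    "expand_zw \<phi> = nested (n i (j + k)) (n j k) u v x"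
    "expand_w_zw \<psi> = iterated (n (i + j) k) (n i j) u v x" "\<phi> = F i j k *\<^sub>C \<psi>" by metis
  have "nested (rescale l n i (j + k)) (rescale l n j k) u v x = (l j k * l i (j + k)) *\<^sub>C nested (n i (j + k)) (n j k) u v x"
    using lin_map_scale[OF choice_maps(2)[OF n uvx(1)] choice_maps(1)[OF n uvx(2,3)]]
    by (intro ext) (simp add: nested_def rescale_def scaleC_apply scaleC_scaleC mult.commute)
  moreover have "iterated (rescale l n (i + j) k) (rescale l n i j) u v x
      = (l (i + j) k * l i j) *\<^sub>C iterated (n (i + j) k) (n i j) u v x"
    using lin_map_scale[OF choice_maps(3)[OF n uvx(3)] choice_maps(1)[OF n uvx(1,2)]]
    by (intro ext) (simp add: iterated_def rescale_def scaleC_apply scaleC_scaleC)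
  ultimately show "\<exists>\<phi>\<in>locser2_on (S (i + j + k)). \<exists>\<psi>\<in>locser2_on (S (i + j + k)).
      expand_zw \<phi> = nested (rescale l n i (j + k)) (rescale l n j k) u v x
      \<and> expand_w_zw \<psi> = iterated (rescale l n (i + j) k) (rescale l n i j) u v x
      \<and> \<phi> = (l j k * l i (j + k) / (l (i + j) k * l i j) * F i j k) *\<^sub>C \<psi>"
    using complex_vector.subspace_scale[OF S \<phi>(1)] complex_vector.subspace_scale[OF S \<phi>(2)] l
    by (rule_tac bexI[where x = "(l j k * l i (j + k)) *\<^sub>C \<phi>"], rule_tac bexI[where x = "(l (i + j) k * l i j) *\<^sub>C \<psi>"])
      (simp_all only: expand_scale \<phi>(3,4), simp_all add: \<phi>(5) scaleC_scaleC)
next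
  fix i j
  have "skew (mL (M (i + j))) (l j i *\<^sub>C n j i) = l j i *\<^sub>C skew (mL (M (i + j))) (n j i)"
    using skew_linear[OF choices_in[OF n], of j i] by (simp add: add.commute)
  then show "rescale l n i j = (l i j / l j i * \<Omega> i j) *\<^sub>C skew (mL (M (i + j))) (rescale l n j i)"
    using associated_braiding[OF a, of i j] l by (simp add: rescale_def scaleC_scaleC)
qed (simp_all add: l associated_nz[OF a])

lemma associated_pair_rescale:
  assumes n: "n \<in> choices I" and l: "\<And>i j. l i j \<noteq> 0"
  shows "associated_pair M (rescale l n) = translate l (associated_pair M n)"
proof -
  obtain F \<Omega> where a: "associated M n F \<Omega>" using associated_exists[OF n] by metis
  then have "associated_pair M n = (F, \<Omega>)" using associated_pair_eq[OF n] by simp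
  moreover have "associated_pair M (rescale l n) = (\<lambda>i j k. l j k * l i (j + k) / (l (i + j) k * l i j) * F i j k,
    \<lambda>i j. l i j / l j i * \<Omega> i j)"
    using associated_pair_eq[OF choices_rescale[OF n l]] associated_rescale[OF n a l] by simp
  ultimately show ?thesis by (simp add: translate_def ab_diff_def Z3ab_def)
qed

end

subsection \<open>Group actions of cochains\<close>

lemma C2ab_carrier: "l \<in> carrier C2ab \<longleftrightarrow> (\<forall>i j. l i j \<noteq> 0)"
  by (simp add: C2ab_def)

lemma comm_group_C2ab: "comm_group (C2ab :: ('a::ab_group_add \<Rightarrow> 'a \<Rightarrow> complex) monoid)"
proof (rule comm_groupI)
  fix l :: "'a \<Rightarrow> 'a \<Rightarrow> complex" assume "l \<in> carrier C2ab"
  then show "\<exists>y\<in>carrier C2ab. y \<otimes>\<^bsub>C2ab\<^esub> l = \<one>\<^bsub>C2ab\<^esub>"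
    by (intro bexI[of _ "\<lambda>i j. 1 / l i j"]) (simp_all add: C2ab_def)
qed (auto simp: C2ab_def fun_eq_iff)

lemma abelian_3cocycleD:
  assumes "abelian_3cocycle p"
  shows "fst p i j k \<noteq> 0" "snd p i j \<noteq> 0"
    "fst p i j k * fst p i (j + k) l * fst p j k l = fst p (i + j) k l * fst p i j (k + l)"
    "inverse (fst p i j k) * snd p i (j + k) * inverse (fst p j k i) = snd p i j * inverse (fst p j i k) * snd p i k"
    "fst p i j k * snd p (i + j) k * fst p k i j = snd p j k * fst p i k j * snd p i k"
  using assms by (simp_all add: abelian_3cocycle_def split_beta)

lemma abelian_3cocycleI:
  assumes "\<And>i j k. fst p i j k \<noteq> 0" "\<And>i j. snd p i j \<noteq> 0"
    "\<And>i j k l. fst p i j k * fst p i (j + k) l * fst p j k l = fst p (i + j) k l * fst p i j (k + l)"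
    "\<And>i j k. inverse (fst p i j k) * snd p i (j + k) * inverse (fst p j k i) = snd p i j * inverse (fst p j i k) * snd p i k"
    "\<And>i j k. fst p i j k * snd p (i + j) k * fst p k i j = snd p j k * fst p i k j * snd p i k"
  shows "abelian_3cocycle p"
  using assms by (simp add: abelian_3cocycle_def split_beta)

lemma comm_group_Z3ab: "comm_group (Z3ab :: 'a::ab_group_add ab3cochain monoid)"
proof (rule comm_groupI)
  fix p q :: "'a ab3cochain" assume p: "p \<in> carrier Z3ab" and q: "q \<in> carrier Z3ab"
  then have p': "abelian_3cocycle p" and q': "abelian_3cocycle q" by (simp_all add: Z3ab_def)
  note P = abelian_3cocycleD[OF p'] and Q = abelian_3cocycleD[OF q']
  have "abelian_3cocycle (p \<otimes>\<^bsub>Z3ab\<^esub> q)"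
  proof (rule abelian_3cocycleI)
    fix i j k l
    show "fst (p \<otimes>\<^bsub>Z3ab\<^esub> q) i j k * fst (p \<otimes>\<^bsub>Z3ab\<^esub> q) i (j + k) l * fst (p \<otimes>\<^bsub>Z3ab\<^esub> q) j k l
      = fst (p \<otimes>\<^bsub>Z3ab\<^esub> q) (i + j) k l * fst (p \<otimes>\<^bsub>Z3ab\<^esub> q) i j (k + l)"
      using arg_cong2[where f = "(*)", OF P(3)[of i j k l] Q(3)[of i j k l]] by (simp add: Z3ab_def mult_ac)
    show "inverse (fst (p \<otimes>\<^bsub>Z3ab\<^esub> q) i j k) * snd (p \<otimes>\<^bsub>Z3ab\<^esub> q) i (j + k) * inverse (fst (p \<otimes>\<^bsub>Z3ab\<^esub> q) j k i)
      = snd (p \<otimes>\<^bsub>Z3ab\<^esub> q) i j * inverse (fst (p \<otimes>\<^bsub>Z3ab\<^esub> q) j i k) * snd (p \<otimes>\<^bsub>Z3ab\<^esub> q) i k"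
      using arg_cong2[where f = "(*)", OF P(4)[of i j k] Q(4)[of i j k]] by (simp add: Z3ab_def mult_ac)
    show "fst (p \<otimes>\<^bsub>Z3ab\<^esub> q) i j k * snd (p \<otimes>\<^bsub>Z3ab\<^esub> q) (i + j) k * fst (p \<otimes>\<^bsub>Z3ab\<^esub> q) k i j
      = snd (p \<otimes>\<^bsub>Z3ab\<^esub> q) j k * fst (p \<otimes>\<^bsub>Z3ab\<^esub> q) i k j * snd (p \<otimes>\<^bsub>Z3ab\<^esub> q) i k"
      using arg_cong2[where f = "(*)", OF P(5)[of i j k] Q(5)[of i j k]] by (simp add: Z3ab_def mult_ac)
  qed (simp_all add: Z3ab_def P Q)
  then show "p \<otimes>\<^bsub>Z3ab\<^esub> q \<in> carrier Z3ab" by (simp add: Z3ab_def)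
next
  fix p :: "'a ab3cochain" assume "p \<in> carrier Z3ab"
  then have "abelian_3cocycle p" by (simp add: Z3ab_def)
  note P = abelian_3cocycleD[OF this]
  let ?q = "(\<lambda>i j k. inverse (fst p i j k), \<lambda>i j. inverse (snd p i j))"
  have "abelian_3cocycle ?q"
  proof (rule abelian_3cocycleI)
    fix i j k l
    show "fst ?q i j k * fst ?q i (j + k) l * fst ?q j k l = fst ?q (i + j) k l * fst ?q i j (k + l)"
      using arg_cong[where f = inverse, OF P(3)[of i j k l]] by (simp add: mult_ac)
    show "inverse (fst ?q i j k) * snd ?q i (j + k) * inverse (fst ?q j k i) = snd ?q i j * inverse (fst ?q j i k) * snd ?q i k"
      using arg_cong[where f = inverse, OF P(4)[of i j k]] by (simp add: mult_ac)
    show "fst ?q i j k * snd ?q (i + j) k * fst ?q k i j = snd ?q j k * fst ?q i k j * snd ?q i k"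
      using arg_cong[where f = inverse, OF P(5)[of i j k]] by (simp add: mult_ac)
  qed (simp_all add: P)
  then show "\<exists>y\<in>carrier Z3ab. y \<otimes>\<^bsub>Z3ab\<^esub> p = \<one>\<^bsub>Z3ab\<^esub>"
    by (intro bexI[of _ ?q]) (simp_all add: Z3ab_def P)
qed (auto simp: Z3ab_def fun_eq_iff abelian_3cocycle_def)

lemma ab_diff_hom: "ab_diff \<in> hom (C2ab :: ('a::ab_group_add \<Rightarrow> 'a \<Rightarrow> complex) monoid) Z3ab"
proof (rule homI)
  fix l :: "'a \<Rightarrow> 'a \<Rightarrow> complex" assume "l \<in> carrier C2ab"
  then have l: "l i j \<noteq> 0" for i j by (simp add: C2ab_carrier)
  have "abelian_3cocycle (ab_diff l)"
    by (rule abelian_3cocycleI) (simp_all add: ab_diff_def l divide_simps add_ac)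
  then show "ab_diff l \<in> carrier Z3ab" by (simp add: Z3ab_def)
next
  fix l l' :: "'a \<Rightarrow> 'a \<Rightarrow> complex"
  show "ab_diff (l \<otimes>\<^bsub>C2ab\<^esub> l') = ab_diff l \<otimes>\<^bsub>Z3ab\<^esub> ab_diff l'"
    by (simp add: ab_diff_def Z3ab_def C2ab_def fun_eq_iff mult_ac)
qed

text \<open>Elements of \<open>BijGroup\<close> are extensional bijections, hence the restriction;
  the inverse group element supplies bijectivity.\<close>

lemma group_actionI:
  fixes G (structure)
  assumes G: "group G" and E: "\<And>g x. g \<in> carrier G \<Longrightarrow> x \<in> E \<Longrightarrow> a g x \<in> E"
    and one: "\<And>x. x \<in> E \<Longrightarrow> a \<one>\<^bsub>G\<^esub> x = x"
    and mult: "\<And>g h x. g \<in> carrier G \<Longrightarrow> h \<in> carrier G \<Longrightarrow> x \<in> E \<Longrightarrow> a (g \<otimes>\<^bsub>G\<^esub> h) x = a g (a h x)"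
  shows "group_action G E (\<lambda>g. restrict (a g) E)"
proof -
  interpret group G by (rule G)
  have inv: "a (inv g) (a g x) = x" "a g (a (inv g) x) = x" if "g \<in> carrier G" "x \<in> E" for g x
    using that mult[of "inv g" g x] mult[of g "inv g" x] one by simp_all
  have bij: "restrict (a g) E \<in> Bij E" if g: "g \<in> carrier G" for g
  proof -
    have "bij_betw (a g) E E"
      by (rule bij_betw_byWitness[of _ "a (inv g)"]) (auto simp: inv g E)
    then show ?thesis by (simp add: Bij_def)
  qed
  have "(\<lambda>g. restrict (a g) E) \<in> hom G (BijGroup E)"
  proof (rule homI)
    fix g h assume gh: "g \<in> carrier G" "h \<in> carrier G"
    show "restrict (a (g \<otimes> h)) E = restrict (a g) E \<otimes>\<^bsub>BijGroup E\<^esub> restrict (a h) E"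
      using gh bij by (auto simp: BijGroup_def compose_def restrict_def fun_eq_iff mult E)
  qed (simp add: BijGroup_def bij)
  then show ?thesis
    unfolding group_action_def group_hom_def group_hom_axioms_def using G group_BijGroup by blast
qed

context
begin

interpretation C2: comm_group C2ab by (rule comm_group_C2ab)
interpretation Z3: comm_group Z3ab by (rule comm_group_Z3ab)
interpretation d: group_hom C2ab Z3ab ab_diff
  unfolding group_hom_def group_hom_axioms_def using C2.is_group Z3.is_group ab_diff_hom by blast

lemma translate_one: "p \<in> carrier Z3ab \<Longrightarrow> translate \<one>\<^bsub>C2ab\<^esub> p = p"
  by (simp add: translate_def)

lemma translate_mult:
  "l \<in> carrier C2ab \<Longrightarrow> l' \<in> carrier C2ab \<Longrightarrow> p \<in> carrier Z3ab \<Longrightarrow>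
    translate (l \<otimes>\<^bsub>C2ab\<^esub> l') p = translate l (translate l' p)"
  by (simp add: translate_def Z3.m_assoc)

lemma translate_closed: "l \<in> carrier C2ab \<Longrightarrow> p \<in> carrier Z3ab \<Longrightarrow> translate l p \<in> carrier Z3ab"
  by (simp add: translate_def)

lemma translate_action: "group_action C2ab (carrier Z3ab) (\<lambda>l. restrict (translate l) (carrier Z3ab))"
  by (rule group_actionI[OF C2.is_group]) (simp_all add: translate_one translate_mult translate_closed)

text \<open>A coset of coboundaries is an orbit of translation, which makes transitivity on a class
  formal.\<close>

lemma cohomology_class_eq: "cohomology_class p = (\<lambda>l. translate l p) ` carrier C2ab"
  by (auto simp: cohomology_class_def B3ab_def r_coset_def translate_def)

lemma translate_transitive:
  assumes "X \<in> carrier H3ab"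
  shows "transitive_action C2ab X (\<lambda>l. restrict (translate l) X)"
proof -
  obtain p where p: "p \<in> carrier Z3ab" and X: "X = (\<lambda>l. translate l p) ` carrier C2ab"
    using assms unfolding cohomology_class_eq[symmetric]
    by (auto simp: H3ab_def FactGroup_def RCOSETS_def cohomology_class_def)
  have in_Z: "x \<in> carrier Z3ab" if "x \<in> X" for x 
    using that unfolding X by (rule imageE) (simp only: translate_closed p)
  have closed: "translate l x \<in> X" if l: "l \<in> carrier C2ab" and x: "x \<in> X" for l x
  proof -
    obtain l' where l': "l' \<in> carrier C2ab" "x = translate l' p" using x unfolding X by (rule imageE)
    then have "translate l x = translate (l \<otimes>\<^bsub>C2ab\<^esub> l') p" using translate_mult[OF l l'(1) p] by simp
    then show ?thesis using l l'(1) unfolding X by (intro image_eqI[where x = "l \<otimes>\<^bsub>C2ab\<^esub> l'"] C2.m_closed)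
  qed
  have "group_action C2ab X (\<lambda>l. restrict (translate l) X)"
    by (rule group_actionI[OF C2.is_group]) (simp_all add: closed translate_one translate_mult in_Z)
  moreover have "\<exists>l\<in>carrier C2ab. restrict (translate l) X x = y" if x: "x \<in> X" and y: "y \<in> X" for x y
  proof -
    obtain l where l: "l \<in> carrier C2ab" "x = translate l p" using x unfolding X by (rule imageE)
    obtain l' where l': "l' \<in> carrier C2ab" "y = translate l' p" using y unfolding X by (rule imageE)
    have "translate (l' \<otimes>\<^bsub>C2ab\<^esub> inv\<^bsub>C2ab\<^esub> l) x = translate (l' \<otimes>\<^bsub>C2ab\<^esub> inv\<^bsub>C2ab\<^esub> l \<otimes>\<^bsub>C2ab\<^esub> l) p"
      using l l' p by (simp add: translate_mult)
    also have "\<dots> = y" using l l' by (simp add: C2.m_assoc)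
    finally show ?thesis using l l' x by (intro bexI[of _ "l' \<otimes>\<^bsub>C2ab\<^esub> inv\<^bsub>C2ab\<^esub> l"]) simp_all
  qed
  ultimately show ?thesis
    unfolding transitive_action_def transitive_action_axioms_def by blast
qed

lemma translate_stabilizer:
  assumes "p \<in> carrier Z3ab"
  shows "stabilizer C2ab translate p = Z2ab"
proof -
  have "translate l p = p \<longleftrightarrow> ab_diff l = \<one>\<^bsub>Z3ab\<^esub>" if "l \<in> carrier C2ab" for l
    using that assms Z3.r_cancel_one[of p "ab_diff l"] by (simp add: translate_def)
  then show ?thesis by (auto simp: stabilizer_def Z2ab_def)
qed

lemma cohomology_class_translate:
  assumes "l \<in> carrier C2ab" "p \<in> carrier Z3ab"
  shows "cohomology_class (translate l p) = cohomology_class p"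
proof -
  have "(\<lambda>l'. translate l' (translate l p)) ` carrier C2ab = (\<lambda>l'. translate l' p) ` carrier C2ab"
  proof (intro equalityI subsetI)
    fix q assume "q \<in> (\<lambda>l'. translate l' (translate l p)) ` carrier C2ab"
    then show "q \<in> (\<lambda>l'. translate l' p) ` carrier C2ab" using assms by (auto simp flip: translate_mult)
  next
    fix q assume "q \<in> (\<lambda>l'. translate l' p) ` carrier C2ab"
    then obtain l' where l': "l' \<in> carrier C2ab" "q = translate l' p" by blast
    then have "q = translate (l' \<otimes>\<^bsub>C2ab\<^esub> inv\<^bsub>C2ab\<^esub> l) (translate l p)"
      using assms by (simp add: C2.m_assoc flip: translate_mult)
    then show "q \<in> (\<lambda>l'. translate l' (translate l p)) ` carrier C2ab" using l' assms by blast
  qed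
  then show ?thesis by (simp add: cohomology_class_eq)
qed

lemma rescale_action:
  assumes "\<And>i j. complex_vector.subspace (I i j)"
  shows "group_action C2ab (families I) (\<lambda>l. restrict (rescale l) (families I))"
  by (rule group_actionI[OF C2.is_group])
    (auto simp: families_def rescale_def C2ab_def scaleC_one scaleC_scaleC complex_vector.subspace_scale[OF assms])

end

subsection \<open>Direct sums\<close>

lemma lookup_scale: "Poly_Mapping.lookup (c *\<^sub>C f) i = c *\<^sub>C Poly_Mapping.lookup f i"
  by (simp add: scaleC_poly_mapping.rep_eq)

lemma single_scale: "c *\<^sub>C Poly_Mapping.single i a = Poly_Mapping.single i (c *\<^sub>C a)"
  by (rule poly_mapping_eqI) (simp add: lookup_scale lookup_single when_def)

lemma lookup_dsum_op:
  assumes "\<And>i. h i 0 = 0"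
  shows "Poly_Mapping.lookup (dsum_op h f) i = h i (Poly_Mapping.lookup f i)"
proof -
  have "Poly_Mapping.lookup (dsum_op h f) i = (\<Sum>j\<in>Poly_Mapping.keys f. h j (Poly_Mapping.lookup f j) when j = i)"
    by (simp add: dsum_op_def lookup_sum lookup_single)
  also have "\<dots> = h i (Poly_Mapping.lookup f i)"
    using assms by (simp add: when_def sum.delta not_in_keys_iff_lookup_eq_zero)
  finally show ?thesis .
qed

lemma dsum_op_single: "(\<And>i. h i 0 = 0) \<Longrightarrow> dsum_op h (Poly_Mapping.single i a) = Poly_Mapping.single i (h i a)"
  by (rule poly_mapping_eqI) (simp add: lookup_dsum_op lookup_single when_def)

lemma sum_single_lookup: "(\<Sum>i\<in>Poly_Mapping.keys f. Poly_Mapping.single i (Poly_Mapping.lookup f i)) = f"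
  for f :: "'i \<Rightarrow>\<^sub>0 'b::complex_vector"
  using lookup_dsum_op[of "\<lambda>i x. x" f] by (intro poly_mapping_eqI) (simp add: dsum_op_def)

lemma exch_rel_zero: "complex_vector.subspace S \<Longrightarrow> exch_rel S 0 0"
  by (rule exch_relI[of 0]) (simp_all add: expand_zero complex_vector.subspace_0[OF subspace_locser2_on])

context commutativity
begin

abbreviation D :: "('a \<Rightarrow>\<^sub>0 'v) set" where "D \<equiv> dsum_space M"

lemma D_subspace: "complex_vector.subspace D"
  using complex_vector.subspace_0[OF S_subspace] complex_vector.subspace_add[OF S_subspace]
    complex_vector.subspace_scale[OF S_subspace]
  by (intro complex_vector.subspaceI) (simp_all add: dsum_space_def lookup_add lookup_scale)

lemma single_in_D: "a \<in> S i \<Longrightarrow> Poly_Mapping.single i a \<in> D"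
  using complex_vector.subspace_0[OF S_subspace] by (simp add: dsum_space_def lookup_single when_def)

lemma lookup_in_S: "f \<in> D \<Longrightarrow> Poly_Mapping.lookup f i \<in> S i"
  by (simp add: dsum_space_def)

lemma dsum_induct [consumes 1, case_names zero single add]:
  assumes f: "f \<in> D" and 0: "P 0" and single: "\<And>i a. a \<in> S i \<Longrightarrow> P (Poly_Mapping.single i a)"
    and add: "\<And>f g. f \<in> D \<Longrightarrow> g \<in> D \<Longrightarrow> P f \<Longrightarrow> P g \<Longrightarrow> P (f + g)"
  shows "P f"
proof -
  let ?g = "\<lambda>A. \<Sum>i\<in>A. Poly_Mapping.single i (Poly_Mapping.lookup f i)"
  have "?g A \<in> D \<and> P (?g A)" if "finite A" for A
    using that
  proof (induction A rule: finite_induct)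
    case empty
    then show ?case using 0 complex_vector.subspace_0[OF D_subspace] by simp
  next
    case (insert i A)
    then show ?case
      using single_in_D[OF lookup_in_S[OF f]] single[OF lookup_in_S[OF f]] add complex_vector.subspace_add[OF D_subspace]
      by simp
  qed
  then have "P (?g (Poly_Mapping.keys f))" by simp
  then show ?thesis by (simp only: sum_single_lookup)
qed

lemma dsum_op_lin:
  assumes "\<And>i. lin_map (S i) (S i) (h i)"
  shows "lin_map D D (dsum_op h)"
proof -
  have h0: "h i 0 = 0" for i by (rule lin_map_zero[OF assms S_subspace])
  show ?thesis
  proof (rule lin_mapI)
    fix f assume f: "f \<in> D"
    then show "dsum_op h f \<in> D"
      using lin_map_in[OF assms] by (simp add: dsum_space_def lookup_dsum_op h0)
    show "dsum_op h (c *\<^sub>C f) = c *\<^sub>C dsum_op h f" for c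
      using f by (intro poly_mapping_eqI) (simp add: lookup_dsum_op h0 lookup_scale lin_map_scale[OF assms] lookup_in_S)
    fix g assume "g \<in> D"
    with f show "dsum_op h (f + g) = dsum_op h f + dsum_op h g"
      by (intro poly_mapping_eqI) (simp add: lookup_dsum_op h0 lookup_add lin_map_add[OF assms] lookup_in_S)
  qed
qed

lemma lookup_lin: "lin_map D (S i) (\<lambda>f. Poly_Mapping.lookup f i)"
  by (simp add: lin_map_def lookup_in_S lookup_add lookup_scale)

lemma single_lin: "lin_map (S i) D (Poly_Mapping.single i)"
  by (simp add: lin_map_def single_in_D single_add single_scale)

lemma choice_zero:
  assumes "n \<in> choices I"
  shows "b \<in> S j \<Longrightarrow> n i j 0 b r = 0" "a \<in> S i \<Longrightarrow> n i j a 0 r = 0"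
  using lin_map_zero[OF choice_maps(3)[OF assms] S_subspace] lin_map_zero[OF choice_maps(2)[OF assms] S_subspace]
  by simp_all

text \<open>The supports of \<open>f\<close>, \<open>g\<close> and \<open>f + g\<close> differ;
  summing over a common finite superset makes bilinearity a termwise statement.\<close>

lemma dsum_mul_sum:
  assumes n: "n \<in> choices I" and f: "f \<in> D" and g: "g \<in> D"
    and A: "finite A" "Poly_Mapping.keys f \<subseteq> A" and B: "finite B" "Poly_Mapping.keys g \<subseteq> B"
  shows "dsum_mul M n f g r
    = (\<Sum>i\<in>A. \<Sum>j\<in>B. Poly_Mapping.single (i + j) (n i j (Poly_Mapping.lookup f i) (Poly_Mapping.lookup g j) r))"
proof -
  let ?t = "\<lambda>i j. Poly_Mapping.single (i + j) (n i j (Poly_Mapping.lookup f i) (Poly_Mapping.lookup g j) r)"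
  have "(\<Sum>i\<in>A. \<Sum>j\<in>B. ?t i j) = (\<Sum>i\<in>A. \<Sum>j\<in>Poly_Mapping.keys g. ?t i j)"
    using B by (intro sum.cong refl sum.mono_neutral_right)
      (simp_all add: not_in_keys_iff_lookup_eq_zero choice_zero[OF n] lookup_in_S[OF f])
  also have "\<dots> = (\<Sum>i\<in>Poly_Mapping.keys f. \<Sum>j\<in>Poly_Mapping.keys g. ?t i j)"
    using A by (intro sum.mono_neutral_right)
      (simp_all add: not_in_keys_iff_lookup_eq_zero choice_zero[OF n] lookup_in_S[OF g])
  finally show ?thesis using f g by (simp add: dsum_mul_def)
qed

lemma dsum_mul_add:
  assumes n: "n \<in> choices I" and fgh: "f \<in> D" "g \<in> D" "h \<in> D"
  shows "dsum_mul M n (f + g) h r = dsum_mul M n f h r + dsum_mul M n g h r"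
    and "dsum_mul M n h (f + g) r = dsum_mul M n h f r + dsum_mul M n h g r"
proof -
  let ?A = "Poly_Mapping.keys f \<union> Poly_Mapping.keys g" and ?B = "Poly_Mapping.keys h"
  have k: "Poly_Mapping.keys (f + g) \<subseteq> ?A" by (rule keys_add)
  have fg: "f + g \<in> D" by (rule complex_vector.subspace_add[OF D_subspace fgh(1,2)])
  note lk = lookup_in_S[OF fgh(1)] lookup_in_S[OF fgh(2)] lookup_in_S[OF fgh(3)]
  show "dsum_mul M n (f + g) h r = dsum_mul M n f h r + dsum_mul M n g h r"
    using dsum_mul_sum[OF n fg fgh(3), of ?A ?B r] dsum_mul_sum[OF n fgh(1,3), of ?A ?B r]
      dsum_mul_sum[OF n fgh(2,3), of ?A ?B r] k
    by (simp add: lookup_add lin_map_add[OF choice_maps(3)[OF n]] lk single_add sum.distrib)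
  show "dsum_mul M n h (f + g) r = dsum_mul M n h f r + dsum_mul M n h g r"
    using dsum_mul_sum[OF n fgh(3) fg, of ?B ?A r] dsum_mul_sum[OF n fgh(3,1), of ?B ?A r]
      dsum_mul_sum[OF n fgh(3,2), of ?B ?A r] k
    by (simp add: lookup_add lin_map_add[OF choice_maps(2)[OF n]] lk single_add sum.distrib)
qed

lemma scale_sum_single: "c *\<^sub>C (\<Sum>i\<in>A. \<Sum>j\<in>B. Poly_Mapping.single (p i j) (q i j))
    = (\<Sum>i\<in>A. \<Sum>j\<in>B. Poly_Mapping.single (p i j) (c *\<^sub>C q i j))"
  by (simp add: complex_vector.scale_sum_right single_scale)

lemma dsum_mul_scale:
  assumes n: "n \<in> choices I" and fh: "f \<in> D" "h \<in> D"
  shows "dsum_mul M n (c *\<^sub>C f) h r = c *\<^sub>C dsum_mul M n f h r"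
    and "dsum_mul M n h (c *\<^sub>C f) r = c *\<^sub>C dsum_mul M n h f r"
proof -
  let ?A = "Poly_Mapping.keys f" and ?B = "Poly_Mapping.keys h"
  have k: "Poly_Mapping.keys (c *\<^sub>C f) \<subseteq> ?A"
    by (auto simp: in_keys_iff lookup_scale)
  have cf: "c *\<^sub>C f \<in> D" by (rule complex_vector.subspace_scale[OF D_subspace fh(1)])
  note lk = lookup_in_S[OF fh(1)] lookup_in_S[OF fh(2)]
  show "dsum_mul M n (c *\<^sub>C f) h r = c *\<^sub>C dsum_mul M n f h r"
    using dsum_mul_sum[OF n cf fh(2), of ?A ?B r] dsum_mul_sum[OF n fh, of ?A ?B r] k
    by (simp add: lookup_scale lin_map_scale[OF choice_maps(3)[OF n]] lk scale_sum_single)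
  show "dsum_mul M n h (c *\<^sub>C f) r = c *\<^sub>C dsum_mul M n h f r"
    using dsum_mul_sum[OF n fh(2) cf, of ?B ?A r] dsum_mul_sum[OF n fh(2,1), of ?B ?A r] k
    by (simp add: lookup_scale lin_map_scale[OF choice_maps(2)[OF n]] lk scale_sum_single)
qed

lemma dsum_mul_single:
  assumes n: "n \<in> choices I" and "a \<in> S i" "b \<in> S j"
  shows "dsum_mul M n (Poly_Mapping.single i a) (Poly_Mapping.single j b) r = Poly_Mapping.single (i + j) (n i j a b r)"
  using dsum_mul_sum[OF n single_in_D[OF assms(2)] single_in_D[OF assms(3)], of "{i}" "{j}" r] by simp

lemma dsum_mul_bilin:
  assumes n: "n \<in> choices I"
  shows "dsum_mul M n \<in> bilin_maps D D (laurent D)"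
proof -
  have lau: "dsum_mul M n f g \<in> laurent D" if f: "f \<in> D" and g: "g \<in> D" for f g
  proof -
    have "\<forall>i j. \<exists>N. \<forall>r<N. n i j (Poly_Mapping.lookup f i) (Poly_Mapping.lookup g j) r = 0"
      using I_laurent[OF choices_in[OF n]] by (simp add: laurent_def)
    then obtain N where N: "\<forall>i j. \<forall>r<N i j. n i j (Poly_Mapping.lookup f i) (Poly_Mapping.lookup g j) r = 0" by metis
    let ?K = "Poly_Mapping.keys f \<times> Poly_Mapping.keys g"
    \<comment> \<open>Only finitely many pairs of components contribute, so their lower bounds have
      a minimum; the extra \<open>0\<close> covers the case of no pair.\<close>
    let ?m = "Min (insert 0 ((\<lambda>(i, j). N i j) ` ?K))"
    have "dsum_mul M n f g r = 0" if r: "r < ?m" for r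
    proof -
      have "n i j (Poly_Mapping.lookup f i) (Poly_Mapping.lookup g j) r = 0"
        if "i \<in> Poly_Mapping.keys f" "j \<in> Poly_Mapping.keys g" for i j
      proof -
        have "N i j \<in> insert 0 ((\<lambda>(i, j). N i j) ` ?K)" using that by force
        then have "r < N i j" using r by (meson Min_le finite_SigmaI finite_imageI finite_insert finite_keys less_le_trans)
        then show ?thesis using N by simp
      qed
      then show ?thesis using f g by (simp add: dsum_mul_def)
    qed
    moreover have "dsum_mul M n f g r \<in> D" for r
      using f g by (simp add: dsum_mul_def)
        (intro complex_vector.subspace_sum[OF D_subspace] single_in_D choice_maps(1)[OF n] lookup_in_S; assumption)
    ultimately show ?thesis unfolding laurent_def by blast
  qed
  have "dsum_mul M n f g = 0" if "f \<notin> D \<or> g \<notin> D" for f g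
    using that by (auto simp: dsum_mul_def fun_eq_iff)
  then show ?thesis
    by (simp add: bilin_maps_def lin_map_def lau fun_eq_iff scaleC_apply dsum_mul_add[OF n] dsum_mul_scale[OF n])
qed

lemma dsum_mul_in: "n \<in> choices I \<Longrightarrow> f \<in> D \<Longrightarrow> g \<in> D \<Longrightarrow> dsum_mul M n f g r \<in> D"
  by (rule bilin_maps_facts(2)[OF dsum_mul_bilin])

lemma dsum_additive_eq:
  assumes f: "f \<in> D" and "\<And>f g. f \<in> D \<Longrightarrow> g \<in> D \<Longrightarrow> G (f + g) = G f + G g"
    and "\<And>f g. f \<in> D \<Longrightarrow> g \<in> D \<Longrightarrow> H (f + g) = H f + H g"
    and "\<And>i a. a \<in> S i \<Longrightarrow> G (Poly_Mapping.single i a) = H (Poly_Mapping.single i a)"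
  shows "G f = (H f :: 'x::ab_group_add)"
  using f
proof (induction rule: dsum_induct)
  case zero
  have "G (0 + 0) = G 0 + G 0" "H (0 + 0) = H 0 + H 0"
    using assms(2,3) complex_vector.subspace_0[OF D_subspace] by blast+
  then show ?case by simp
qed (simp_all add: assms)

lemma dsum_biadditive_eq:
  assumes f: "f \<in> D" and g: "g \<in> D"
    and "\<And>f g h. f \<in> D \<Longrightarrow> g \<in> D \<Longrightarrow> h \<in> D \<Longrightarrow> G (f + g) h = G f h + G g h"
    and "\<And>f g h. f \<in> D \<Longrightarrow> g \<in> D \<Longrightarrow> h \<in> D \<Longrightarrow> H (f + g) h = H f h + H g h"
    and "\<And>f g h. f \<in> D \<Longrightarrow> g \<in> D \<Longrightarrow> h \<in> D \<Longrightarrow> G h (f + g) = G h f + G h g"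
    and "\<And>f g h. f \<in> D \<Longrightarrow> g \<in> D \<Longrightarrow> h \<in> D \<Longrightarrow> H h (f + g) = H h f + H h g"
    and "\<And>i j a b. a \<in> S i \<Longrightarrow> b \<in> S j \<Longrightarrow> G (Poly_Mapping.single i a) (Poly_Mapping.single j b)
      = H (Poly_Mapping.single i a) (Poly_Mapping.single j b)"
  shows "G f g = (H f g :: 'x::ab_group_add)"
proof (rule dsum_additive_eq[OF f, of "\<lambda>f. G f g" "\<lambda>f. H f g"])
  fix i a assume a: "a \<in> S i"
  show "G (Poly_Mapping.single i a) g = H (Poly_Mapping.single i a) g"
    by (rule dsum_additive_eq[OF g, of "G (Poly_Mapping.single i a)" "H (Poly_Mapping.single i a)"])
      (simp_all add: assms(5-7) a single_in_D)
qed (simp_all add: assms(3,4) g)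

lemma vac_S: "vac V \<in> S 0"
  using V S_0 by (simp add: T_vertex_algebra_def vertex_algebra_def)

lemma dsum_nested_single:
  assumes n: "n \<in> choices I" and "u \<in> S i" "v \<in> S j" "x \<in> S k"
  shows "nested (dsum_mul M n) (dsum_mul M n) (Poly_Mapping.single i u) (Poly_Mapping.single j v) (Poly_Mapping.single k x)
    = (\<lambda>b c. Poly_Mapping.single (i + j + k) (nested (n i (j + k)) (n j k) u v x b c))"
  by (intro ext) (simp add: nested_def dsum_mul_single[OF n] assms choice_maps(1)[OF n] add.assoc)

text \<open>Locality is additive in each vector, so homogeneous vectors suffice; for them the
  exchange scalar is the only obstruction.\<close>

lemma dsum_locality:
  assumes n: "n \<in> choices I" and a: "associated M n F \<Omega>" and \<tau>: "\<And>i j k. exchange_scalar F \<Omega> i j k = 1"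
    and "u \<in> D" "v \<in> D" "x \<in> D"
  shows "exch_rel D (nested (dsum_mul M n) (dsum_mul M n) u v x)
    (\<lambda>b c. nested (dsum_mul M n) (dsum_mul M n) v u x c b)" (is "exch_rel D (?N u v x) (?N' u v x)")
proof -
  note mem = dsum_mul_in[OF n]
  have mul_zero: "dsum_mul M n 0 f r = 0" "dsum_mul M n f 0 r = 0" if "f \<in> D" for f r
    using dsum_mul_scale[OF n that that, of 0 r] by simp_all
  show ?thesis using assms(4)
  proof (induction rule: dsum_induct)
    case zero
    have "?N 0 v x = 0" "?N' 0 v x = 0"
      by (intro ext; simp add: nested_def mul_zero mem assms(5,6))+
    then show ?case using exch_rel_zero[OF D_subspace] by (simp only:)
  next
    case (add f g)
    have "?N (f + g) v x = ?N f v x + ?N g v x" "?N' (f + g) v x = ?N' f v x + ?N' g v x"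
      by (intro ext; simp add: nested_def dsum_mul_add[OF n] mem add.hyps assms(5,6))+
    then show ?case using exch_rel_add[OF D_subspace add.IH] by (simp only:)
  next
    case (single i a)
    note a = single and sa = single_in_D[OF single]
    show ?case using assms(5)
    proof (induction rule: dsum_induct)
      case zero
      have "?N (Poly_Mapping.single i a) 0 x = 0" "?N' (Poly_Mapping.single i a) 0 x = 0"
        by (intro ext; simp add: nested_def mul_zero mem sa assms(6))+
      then show ?case using exch_rel_zero[OF D_subspace] by (simp only:)
    next
      case (add f g)
      have "?N (Poly_Mapping.single i a) (f + g) x = ?N (Poly_Mapping.single i a) f x + ?N (Poly_Mapping.single i a) g x"
        "?N' (Poly_Mapping.single i a) (f + g) x = ?N' (Poly_Mapping.single i a) f x + ?N' (Poly_Mapping.single i a) g x"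
        by (intro ext; simp add: nested_def dsum_mul_add[OF n] mem add.hyps sa assms(6))+
      then show ?case using exch_rel_add[OF D_subspace add.IH] by (simp only:)
    next
      case (single j b)
      note b = single and sb = single_in_D[OF single]
      show ?case using assms(6)
      proof (induction rule: dsum_induct)
        case zero
        have "?N (Poly_Mapping.single i a) (Poly_Mapping.single j b) 0 = 0"
          "?N' (Poly_Mapping.single i a) (Poly_Mapping.single j b) 0 = 0"
          by (intro ext; simp add: nested_def mul_zero mem sa sb)+
        then show ?case using exch_rel_zero[OF D_subspace] by (simp only:)
      next
        case (add f g)
        have "?N (Poly_Mapping.single i a) (Poly_Mapping.single j b) (f + g)
            = ?N (Poly_Mapping.single i a) (Poly_Mapping.single j b) f + ?N (Poly_Mapping.single i a) (Poly_Mapping.single j b) g"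
          "?N' (Poly_Mapping.single i a) (Poly_Mapping.single j b) (f + g)
            = ?N' (Poly_Mapping.single i a) (Poly_Mapping.single j b) f + ?N' (Poly_Mapping.single i a) (Poly_Mapping.single j b) g"
          by (intro ext; simp add: nested_def dsum_mul_add[OF n] mem add.hyps sa sb)+
        then show ?case using exch_rel_add[OF D_subspace add.IH] by (simp only:)
      next
        case (single k c)
        have "exch_rel (S (i + j + k)) (nested (n i (j + k)) (n j k) a b c) (\<lambda>p q. nested (n j (i + k)) (n i k) b a c q p)"
          using exchange[OF n \<open>associated M n F \<Omega>\<close> a b single] by (simp add: \<tau> scaleC_one)
        then show ?case
          using exch_rel_map[OF single_lin S_subspace] by (simp add: dsum_nested_single[OF n] a b single add_ac)
      qed
    qed
  qed
qed

end

section \<open>Operators \<open>L(k)\<close> and the graded algebra on the direct sum\<close>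

lemma single_sum: "Poly_Mapping.single i (\<Sum>a\<in>A. f a) = (\<Sum>a\<in>A. Poly_Mapping.single i (f a))"
  by (induction A rule: infinite_finite_induct) (simp_all add: single_add)

lemma L_index_diff: "k \<in> L_index K \<Longrightarrow> - 1 \<le> k \<Longrightarrow> j \<le> nat (k + 1) \<Longrightarrow> k - int j \<in> L_index K"
  by (cases K) (auto simp: le_nat_iff)

context commutativity
begin

abbreviation LD :: "int \<Rightarrow> ('a \<Rightarrow>\<^sub>0 'v) \<Rightarrow> 'a \<Rightarrow>\<^sub>0 'v" where "LD k \<equiv> dsum_op (\<lambda>i. mL (M i) k)"

lemma LD_lin: "k \<in> L_index (kind_of T) \<Longrightarrow> lin_map D D (LD k)"
  by (rule dsum_op_lin) (rule L_lin)

lemma L_zero: "k \<in> L_index (kind_of T) \<Longrightarrow> mL (M i) k 0 = 0"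
  by (rule lin_map_zero[OF L_lin S_subspace])

lemma LD_single: "k \<in> L_index (kind_of T) \<Longrightarrow> LD k (Poly_Mapping.single i a) = Poly_Mapping.single i (mL (M i) k a)"
  by (simp add: dsum_op_single L_zero)

lemma dsum_L_covariant:
  assumes n: "n \<in> choices I" and k: "k \<in> L_index (kind_of T)" "- 1 \<le> k"
  shows "L_covariant k LD LD LD D D (dsum_mul M n)"
  unfolding L_covariant_def
proof (intro ballI allI)
  fix f g r assume f: "f \<in> D" and g: "g \<in> D"
  let ?B = "dsum_mul M n" and ?c = "\<lambda>j. of_nat (nat (k + 1) choose j) :: complex"
  let ?J = "{..nat (k + 1)}"
  note add = dsum_mul_add[OF n] and mem = dsum_mul_in[OF n]
  note L_in = lin_map_in[OF LD_lin] and L_add = lin_map_add[OF LD_lin]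
  \<comment> \<open>Covariance involves all lower indices down to \<open>-1\<close>, and the index
    set of each kind is closed under this.\<close>
  have idx: "k - int j \<in> L_index (kind_of T)" if "j \<in> ?J" for j
    using L_index_diff[OF k, of j] that by simp
  have sum: "(\<Sum>j\<in>?J. ?c j *\<^sub>C ?B (LD (k - int j) (f + g)) h (r - int j))
      = (\<Sum>j\<in>?J. ?c j *\<^sub>C ?B (LD (k - int j) f) h (r - int j)) + (\<Sum>j\<in>?J. ?c j *\<^sub>C ?B (LD (k - int j) g) h (r - int j))"
    "(\<Sum>j\<in>?J. ?c j *\<^sub>C ?B (LD (k - int j) h) (f + g) (r - int j))
      = (\<Sum>j\<in>?J. ?c j *\<^sub>C ?B (LD (k - int j) h) f (r - int j)) + (\<Sum>j\<in>?J. ?c j *\<^sub>C ?B (LD (k - int j) h) g (r - int j))"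
    if "f \<in> D" "g \<in> D" "h \<in> D" for f g h
    unfolding sum.distrib[symmetric] scaleC_add_right[symmetric]
    by (intro sum.cong refl arg_cong[where f = "scaleC _"]; simp add: L_add L_in add idx that)+
  show "LD k (?B f g r) - ?B f (LD k g) r = (\<Sum>j\<in>?J. ?c j *\<^sub>C ?B (LD (k - int j) f) g (r - int j))"
  proof (rule dsum_biadditive_eq[OF f g, of "\<lambda>f g. LD k (?B f g r) - ?B f (LD k g) r"
        "\<lambda>f g. \<Sum>j\<in>?J. ?c j *\<^sub>C ?B (LD (k - int j) f) g (r - int j)"])
    fix i j a b assume ab: "a \<in> S i" "b \<in> S j"
    have L_S: "mL (M i) k a \<in> S i" if "k \<in> L_index (kind_of T)" "a \<in> S i" for k i a
      using lin_map_in[OF L_lin] that by blast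
    have "L_covariant k (mL (M i)) (mL (M j)) (mL (M (i + j))) (S i) (S j) (n i j)"
      using I_intertwiner[OF choices_in[OF n], of i j] k by (simp add: intertwiners_def)
    then have cov: "mL (M (i + j)) k (n i j a b r) - n i j a (mL (M j) k b) r
        = (\<Sum>t\<in>?J. ?c t *\<^sub>C n i j (mL (M i) (k - int t) a) b (r - int t))"
      using ab unfolding L_covariant_def by blast
    have "LD k (?B (Poly_Mapping.single i a) (Poly_Mapping.single j b) r)
        - ?B (Poly_Mapping.single i a) (LD k (Poly_Mapping.single j b)) r
        = Poly_Mapping.single (i + j) (mL (M (i + j)) k (n i j a b r) - n i j a (mL (M j) k b) r)"
      by (simp add: dsum_mul_single[OF n] ab LD_single k L_S single_diff)
    also have "\<dots> = (\<Sum>t\<in>?J. ?c t *\<^sub>C ?B (LD (k - int t) (Poly_Mapping.single i a)) (Poly_Mapping.single j b) (r - int t))"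
      unfolding cov single_sum by (intro sum.cong refl)
        (simp add: single_scale LD_single idx dsum_mul_single[OF n] L_S ab)
    finally show "LD k (?B (Poly_Mapping.single i a) (Poly_Mapping.single j b) r)
        - ?B (Poly_Mapping.single i a) (LD k (Poly_Mapping.single j b)) r
        = (\<Sum>t\<in>?J. ?c t *\<^sub>C ?B (LD (k - int t) (Poly_Mapping.single i a)) (Poly_Mapping.single j b) (r - int t))" .
  qed (simp_all add: sum add mem L_add L_in k)
qed

lemma mact_unit: "x \<in> S i \<Longrightarrow> mact (M i) (vac V) x r = (if r = 0 then x else 0)"
  using M[of i] by (simp add: T_module_def)

text \<open>For \<open>r \<le> 0\<close> the terms with a positive power of \<open>L(-1)\<close>
  involve negative exponents in the action of the vacuum, which vanish; only the term without
  \<open>L(-1)\<close> is left.\<close>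

lemma skew_mact_unit:
  assumes "x \<in> S i" "r \<le> 0"
  shows "skew (mL (M i)) (mact (M i)) x (vac V) r = (if r = 0 then x else 0)"
  using skew_sum[where S = "S i" and L = "mL (M i)" and I = "mact (M i)" and u = "vac V" and v = x and N = 0 and n = r and K = 0]
    assms by (simp add: L1_lin S_subspace mact_unit scaleC_one)

lemma choice_derivative:
  assumes "n \<in> choices I" "a \<in> S i" "b \<in> S j"
  shows "ddz (n i j a b) r = mL (M (i + j)) (- 1) (n i j a b r) - n i j a (mL (M j) (- 1) b) r"
proof -
  have "\<forall>u\<in>S i. \<forall>v\<in>S j. \<forall>r. ddz (n i j u v) r = n i j (mL (M i) (- 1) u) v r
      \<and> ddz (n i j u v) r = mL (M (i + j)) (- 1) (n i j u v r) - n i j u (mL (M j) (- 1) v) r"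
    using I_intertwiner[OF choices_in[OF assms(1)], of i j] unfolding intertwiners_def mem_Collect_eq by (elim conjE)
  note this[THEN bspec, OF assms(2), THEN bspec, OF assms(3), THEN spec, of r]
  then show ?thesis by (rule conjunct2)
qed

lemma dsum_vertex_algebra:
  assumes n: "n \<in> choices I" and norm: "normalized_choice M n"
    and a: "associated M n F \<Omega>" and \<tau>: "\<And>i j k. exchange_scalar F \<Omega> i j k = 1"
  shows "vertex_algebra (dsum_valg V M n)"
proof -
  let ?B = "dsum_mul M n" and ?vac = "Poly_Mapping.single 0 (vac V)"
  have n0: "n 0 i = mact (M i)" and ni: "n i 0 = skew (mL (M i)) (mact (M i))" for i
    using norm by (simp_all add: normalized_choice_def)
  note add = dsum_mul_add[OF n] and mem = dsum_mul_in[OF n] and vac = single_in_D[OF vac_S]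
  have unit: "?B ?vac v r = (if r = 0 then v else 0)" if "v \<in> D" for v r
    by (rule dsum_additive_eq[OF that, of "\<lambda>v. ?B ?vac v r" "\<lambda>v. if r = 0 then v else 0"])
      (simp_all add: add vac dsum_mul_single[OF n vac_S] n0 mact_unit)
  have creation: "?B v ?vac r = (if r = 0 then v else 0)" if "v \<in> D" "r \<le> 0" for v r
    by (rule dsum_additive_eq[OF that(1), of "\<lambda>v. ?B v ?vac r" "\<lambda>v. if r = 0 then v else 0"])
      (simp_all add: add vac dsum_mul_single[OF n _ vac_S] ni skew_mact_unit that(2))
  have deriv: "LD (- 1) (?B f g r) - ?B f (LD (- 1) g) r = ddz (?B f g) r" if f: "f \<in> D" and g: "g \<in> D" for f g r
  proof -
    note LD = lin_map_in[OF LD_lin[OF minus_one_L_index]] lin_map_add[OF LD_lin[OF minus_one_L_index]]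
    show ?thesis
    proof (rule dsum_biadditive_eq[OF f g, of "\<lambda>f g. LD (- 1) (?B f g r) - ?B f (LD (- 1) g) r" "\<lambda>f g. ddz (?B f g) r"])
      fix i j a b assume ab: "a \<in> S i" "b \<in> S j"
      have "ddz (n i j a b) r = mL (M (i + j)) (- 1) (n i j a b r) - n i j a (mL (M j) (- 1) b) r"
        by (rule choice_derivative[OF n ab])
      moreover have "mL (M j) (- 1) b \<in> S j" by (rule lin_map_in[OF L1_lin ab(2)])
      ultimately show "LD (- 1) (?B (Poly_Mapping.single i a) (Poly_Mapping.single j b) r)
          - ?B (Poly_Mapping.single i a) (LD (- 1) (Poly_Mapping.single j b)) r
          = ddz (?B (Poly_Mapping.single i a) (Poly_Mapping.single j b)) r"
        by (simp add: dsum_mul_single[OF n] ab LD_single[OF minus_one_L_index] ddz_def single_scale flip: single_diff)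
    qed (simp_all add: add mem LD ddz_def scaleC_add_right)
  qed
  have "\<exists>\<phi>\<in>locser2_on D. expand_zw \<phi> = nested ?B ?B u v x \<and> expand_wz \<phi> = (\<lambda>b c. nested ?B ?B v u x c b)"
    if "u \<in> D" "v \<in> D" "x \<in> D" for u v x
    using dsum_locality[OF n a \<tau> that] unfolding exch_rel_def .
  then show ?thesis
    unfolding vertex_algebra_def
    by (simp add: dsum_valg_def D_subspace vac LD_lin[OF minus_one_L_index] dsum_mul_bilin[OF n] unit creation deriv)
qed

lemma component_subspace: "complex_vector.subspace (component M i)"
proof (rule complex_vector.subspaceI)
  show "0 \<in> component M i" using complex_vector.subspace_0[OF S_subspace, of i]
    by (auto simp: component_def intro!: image_eqI[of _ _ 0])
next
  fix x y assume "x \<in> component M i" "y \<in> component M i"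
  then show "x + y \<in> component M i"
    by (auto simp: component_def complex_vector.subspace_add[OF S_subspace] simp flip: single_add)
next
  fix c x assume "x \<in> component M i"
  then show "c *\<^sub>C x \<in> component M i"
    by (auto simp: component_def single_scale complex_vector.subspace_scale[OF S_subspace])
qed

lemma component_decomposition:
  assumes x: "x \<in> D"
  shows "\<exists>!f. (\<forall>i. Poly_Mapping.lookup f i \<in> component M i) \<and> x = (\<Sum>i\<in>Poly_Mapping.keys f. Poly_Mapping.lookup f i)"
proof -
  define f where "f = (\<Sum>i\<in>Poly_Mapping.keys x. Poly_Mapping.single i (Poly_Mapping.single i (Poly_Mapping.lookup x i)))"
  have f: "Poly_Mapping.lookup f i = Poly_Mapping.single i (Poly_Mapping.lookup x i)" for i
    unfolding f_def by (simp add: lookup_sum lookup_single when_def sum.delta not_in_keys_iff_lookup_eq_zero)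
  have sum: "Poly_Mapping.lookup (\<Sum>i\<in>Poly_Mapping.keys g. Poly_Mapping.lookup g i) j = Poly_Mapping.lookup (Poly_Mapping.lookup g j) j"
    if g: "\<forall>i. Poly_Mapping.lookup g i \<in> component M i" for g j
  proof -
    have "Poly_Mapping.lookup (Poly_Mapping.lookup g i) j = (if i = j then Poly_Mapping.lookup (Poly_Mapping.lookup g j) j else 0)" for i
      using g[rule_format, of i] by (auto simp: component_def lookup_single when_def)
    then have "Poly_Mapping.lookup (\<Sum>i\<in>Poly_Mapping.keys g. Poly_Mapping.lookup g i) j
        = (\<Sum>i\<in>Poly_Mapping.keys g. if i = j then Poly_Mapping.lookup (Poly_Mapping.lookup g j) j else 0)"
      unfolding lookup_sum by (intro sum.cong refl)
    also have "\<dots> = Poly_Mapping.lookup (Poly_Mapping.lookup g j) j"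
      by (simp add: not_in_keys_iff_lookup_eq_zero)
    finally show ?thesis .
  qed
  have fc: "\<forall>i. Poly_Mapping.lookup f i \<in> component M i" using lookup_in_S[OF x] by (simp add: f component_def)
  show ?thesis
  proof (rule ex1I[of _ f], intro conjI fc)
    show "x = (\<Sum>i\<in>Poly_Mapping.keys f. Poly_Mapping.lookup f i)"
      by (rule poly_mapping_eqI, subst sum[OF fc], simp add: f)
    fix g assume g: "(\<forall>i. Poly_Mapping.lookup g i \<in> component M i) \<and> x = (\<Sum>i\<in>Poly_Mapping.keys g. Poly_Mapping.lookup g i)"
    show "g = f"
    proof (rule poly_mapping_eqI)
      fix i
      have "Poly_Mapping.lookup g i \<in> component M i" using g by simp
      then obtain c where c: "Poly_Mapping.lookup g i = Poly_Mapping.single i c" unfolding component_def by (rule imageE)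
      have "Poly_Mapping.lookup x i = Poly_Mapping.lookup (Poly_Mapping.lookup g i) i"
        using arg_cong[OF conjunct2[OF g], of "\<lambda>x. Poly_Mapping.lookup x i"] sum[OF conjunct1[OF g], of i] by (rule trans)
      then show "Poly_Mapping.lookup g i = Poly_Mapping.lookup f i" by (simp add: c f)
    qed
  qed
qed

lemma dsum_graded:
  assumes n: "n \<in> choices I" and norm: "normalized_choice M n"
    and a: "associated M n F \<Omega>" and \<tau>: "\<And>i j k. exchange_scalar F \<Omega> i j k = 1" and comp: "T_compatible T V M"
  shows "graded_T_vertex_algebra T (dsum_valg V M n) (component M)"
proof -
  let ?W = "dsum_valg V M n" and ?B = "dsum_mul M n" and ?K = "kind_of T" and ?\<rho> = "\<lambda>g. dsum_op (\<lambda>i. mgrp (M i) g)"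
  have W: "vspace ?W = D" "vac ?W = Poly_Mapping.single 0 (vac V)" "vmul ?W = ?B" "vL ?W = LD"
    "vomega ?W = Poly_Mapping.single 0 (vomega V)" "vcharge ?W = vcharge V" "vgrp ?W = ?\<rho>"
    by (simp_all add: dsum_valg_def)
  have dm: "mspace (dsum_module V M) = D" "mL (dsum_module V M) = LD" "mgrp (dsum_module V M) = ?\<rho>"
    by (simp_all add: dsum_module_def)
  have comp': "T_module T V (dsum_module V M)" using comp by (simp add: T_compatible_def)
  have n0: "n 0 i = mact (M i)" for i using norm by (simp add: normalized_choice_def)
  note add = dsum_mul_add[OF n] and mem = dsum_mul_in[OF n]
  have M0': "mL (M 0) = vL V" "mgrp (M 0) = vgrp V" by (simp_all add: M0 adjoint_module_def)
  \<comment> \<open>Compatibility is used here: a lower bound on the spectrum and finite-dimensional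
    eigenspaces do not pass from the summands to an infinite direct sum.\<close>
  have Lstr: "L_structure ?K (vcharge V) D LD"
    using comp' by (simp add: T_module_def dm)
  have cov: "action_covariant ?K LD LD D D ?B"
  proof -
    have "0 \<in> L_index ?K" if "?K \<noteq> Unrestricted" using that by (cases ?K) simp_all
    moreover have "- 1 \<le> i" if "?K = Moebius \<or> ?K = Quasi_conformal" "i \<in> L_index ?K" for i using that by auto
    ultimately show ?thesis unfolding action_covariant_def using dsum_L_covariant[OF n] by simp
  qed
  have conf: "Poly_Mapping.single 0 (vomega V) \<in> eigenspace D (LD 0) 2
      \<and> (\<forall>v\<in>D. \<forall>r. ?B (Poly_Mapping.single 0 (vomega V)) v (- r - 2) = LD r v)" if hc: "has_conformal_vector ?K"
  proof -
    have K: "L_index ?K = UNIV" using hc by (auto simp: has_conformal_vector_def)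
    have \<omega>: "vomega V \<in> S 0" "vL V 0 (vomega V) = 2 *\<^sub>C vomega V"
      using V hc by (simp_all add: T_vertex_algebra_def eigenspace_def S_0)
    have "?B (Poly_Mapping.single 0 (vomega V)) v (- r - 2) = LD r v" if "v \<in> D" for v r
    proof (rule dsum_additive_eq[OF that, of "\<lambda>v. ?B (Poly_Mapping.single 0 (vomega V)) v (- r - 2)" "LD r"])
      fix i x assume "x \<in> S i"
      moreover from this have "mact (M i) (vomega V) x (- r - 2) = mL (M i) r x"
        using M[of i] hc by (simp add: T_module_def)
      ultimately show "?B (Poly_Mapping.single 0 (vomega V)) (Poly_Mapping.single i x) (- r - 2) = LD r (Poly_Mapping.single i x)"
        using dsum_mul_single[OF n \<omega>(1)] by (simp add: n0 LD_single K)
    qed (use K in \<open>simp_all add: add \<omega> single_in_D lin_map_add[OF LD_lin]\<close>)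
    moreover have "LD 0 (Poly_Mapping.single 0 (vomega V)) = 2 *\<^sub>C Poly_Mapping.single 0 (vomega V)"
      using LD_single[of 0 0 "vomega V"] K by (simp add: M0' \<omega> single_scale)
    ultimately show ?thesis by (simp add: eigenspace_def single_in_D \<omega>)
  qed
  have \<rho>: "group_rep G (S i) (mgrp (M i))" "mgrp (M i) g 0 = 0" if "T = Equivariant K G" "g \<in> carrier G" for K G g i
  proof -
    show gr: "group_rep G (S i) (mgrp (M i))" using M[of i] that by (simp add: T_module_def)
    then have "lin_map (S i) (S i) (mgrp (M i) g)" using that by (simp add: group_rep_def)
    then show "mgrp (M i) g 0 = 0" by (rule lin_map_zero[OF _ S_subspace])
  qed
  have \<rho>_in: "mgrp (M i) g a \<in> S i" and \<rho>_lin: "lin_map D D (?\<rho> g)"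
    if "T = Equivariant K G" "g \<in> carrier G" "a \<in> S i" for K G g i a
  proof -
    have l: "lin_map (S i) (S i) (mgrp (M i) g)" for i using \<rho>(1)[OF that(1,2)] that(2) by (simp add: group_rep_def)
    show "mgrp (M i) g a \<in> S i" by (rule lin_map_in[OF l that(3)])
    show "lin_map D D (?\<rho> g)" by (rule dsum_op_lin[OF l])
  qed
  have grp: "group_rep G D ?\<rho> \<and> commutes_with_L G K D LD ?\<rho>
      \<and> (\<forall>g\<in>carrier G. ?\<rho> g (Poly_Mapping.single 0 (vac V)) = Poly_Mapping.single 0 (vac V)
          \<and> (has_conformal_vector K \<longrightarrow> ?\<rho> g (Poly_Mapping.single 0 (vomega V)) = Poly_Mapping.single 0 (vomega V)))
      \<and> equivariant_op G D D ?\<rho> ?\<rho> ?\<rho> ?B" if T: "T = Equivariant K G" for K G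
  proof -
    have 1: "group_rep G D ?\<rho> \<and> commutes_with_L G K D LD ?\<rho>" using comp' by (simp add: T_module_def dm T)
    have 2: "?\<rho> g (Poly_Mapping.single 0 (vac V)) = Poly_Mapping.single 0 (vac V)
          \<and> (has_conformal_vector K \<longrightarrow> ?\<rho> g (Poly_Mapping.single 0 (vomega V)) = Poly_Mapping.single 0 (vomega V))"
      if g: "g \<in> carrier G" for g
      using V g by (simp add: dsum_op_single \<rho>(2)[OF T g] M0' T_vertex_algebra_def T)
    have 3: "?B (?\<rho> g u) (?\<rho> g v) r = ?\<rho> g (?B u v r)" if g: "g \<in> carrier G" and u: "u \<in> D" and v: "v \<in> D" for g u v r
    proof -
      have lin: "lin_map D D (?\<rho> g)" by (rule \<rho>_lin[OF T g vac_S])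
      have eq: "n i j (mgrp (M i) g a) (mgrp (M j) g b) r = mgrp (M (i + j)) g (n i j a b r)" if "a \<in> S i" "b \<in> S j" for i j a b
        using I_intertwiner[OF choices_in[OF n], of i j] that g by (simp add: intertwiners_def T equivariant_op_def)
      show ?thesis
        by (rule dsum_biadditive_eq[OF u v, of "\<lambda>u v. ?B (?\<rho> g u) (?\<rho> g v) r" "\<lambda>u v. ?\<rho> g (?B u v r)"])
          (simp_all add: lin_map_add[OF lin] lin_map_in[OF lin] add mem dsum_op_single \<rho>(2)[OF T g]
            dsum_mul_single[OF n] \<rho>_in[OF T g] eq)
    qed
    show ?thesis using 1 2 3 unfolding equivariant_op_def by simp
  qed
  have TV: "T_vertex_algebra T ?W"
    unfolding T_vertex_algebra_def W
    using dsum_vertex_algebra[OF n norm a \<tau>] Lstr cov conf grp by (cases T) simp_all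
  have "component M i \<subseteq> D" for i using single_in_D by (auto simp: component_def)
  moreover have "Poly_Mapping.single 0 (vac V) \<in> component M 0" using vac_S by (simp add: component_def)
  moreover have "?B u v r \<in> component M (i + j)" if "u \<in> component M i" "v \<in> component M j" for u v r i j
    using that choice_maps(1)[OF n] by (auto simp: component_def dsum_mul_single[OF n])
  moreover have "LD k ` component M i \<subseteq> component M i" if "k \<in> L_index ?K" for k i
    using that lin_map_in[OF L_lin[OF that]] by (auto simp: component_def LD_single)
  moreover have "Poly_Mapping.single 0 (vomega V) \<in> component M 0" if "has_conformal_vector ?K"
    using V that by (simp add: T_vertex_algebra_def eigenspace_def S_0[symmetric] component_def)
  moreover have "?\<rho> g ` component M i \<subseteq> component M i" if "T = Equivariant K G" "g \<in> carrier G" for K G g i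
    using \<rho>_in[OF that] by (auto simp: component_def dsum_op_single \<rho>(2)[OF that])
  ultimately show ?thesis
    unfolding graded_T_vertex_algebra_def W
    using TV component_subspace component_decomposition by (cases T) simp_all
qed

text \<open>For homogeneous vectors with nonzero product, locality and \<open>exchange\<close> give
  the same series in the other order, with scalars \<open>1\<close> and the exchange scalar;
  projection to degree \<open>i + j + k\<close> brings locality back from the direct sum.\<close>

lemma locality_trivial:
  assumes n: "n \<in> choices I" and a: "associated M n F \<Omega>"
    and W: "vertex_algebra W" "vspace W = D" "vmul W = dsum_mul M n"
  shows "exchange_scalar F \<Omega> i j k = 1"
proof -
  obtain v u x where uvx: "v \<in> S j" "u \<in> S i" "x \<in> S k" and nz: "nested (n j (i + k)) (n i k) v u x \<noteq> 0"
    using nested_nonzero[OF n] by metis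
  let ?s = Poly_Mapping.single and ?B = "dsum_mul M n" and ?N = "\<lambda>b c. nested (n j (i + k)) (n i k) v u x c b"
  have "\<exists>\<phi>\<in>locser2_on D. expand_zw \<phi> = nested ?B ?B (?s i u) (?s j v) (?s k x)
      \<and> expand_wz \<phi> = (\<lambda>b c. nested ?B ?B (?s j v) (?s i u) (?s k x) c b)"
    using W(1) single_in_D[OF uvx(1)] single_in_D[OF uvx(2)] single_in_D[OF uvx(3)]
    unfolding vertex_algebra_def W(2,3) by simp
  then have "exch_rel D (nested ?B ?B (?s i u) (?s j v) (?s k x)) (\<lambda>b c. nested ?B ?B (?s j v) (?s i u) (?s k x) c b)"
    unfolding exch_rel_def .
  from exch_rel_map[OF lookup_lin D_subspace this, of "i + j + k"]
  have "exch_rel (S (i + j + k)) (nested (n i (j + k)) (n j k) u v x) ?N"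
    by (simp add: dsum_nested_single[OF n] uvx lookup_single add.commute[of j i])
  then have "exchange_scalar F \<Omega> i j k *\<^sub>C ?N = 1 *\<^sub>C ?N"
    using exch_rel_fun[OF exchange[OF n a uvx(2,1,3)]] by (simp add: scaleC_one)
  moreover have "?N \<noteq> 0" using nz by (auto simp: fun_eq_iff)
  ultimately show ?thesis by (rule scaleC_cancel)
qed

subsection \<open>Graded structures\<close>

lemma graded_structureD:
  assumes "graded_structure T M n W"
  shows "vspace W = D" "vmul W = dsum_mul M n" "vertex_algebra W" "T_vertex_algebra T W" "vac W \<in> component M 0"
    and "k \<in> L_index (kind_of T) \<Longrightarrow> f \<in> D \<Longrightarrow> vL W k f = LD k f"
    and "T = Equivariant K G \<Longrightarrow> g \<in> carrier G \<Longrightarrow> f \<in> D \<Longrightarrow> vgrp W g f = dsum_op (\<lambda>i. mgrp (M i) g) f"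
    and "has_conformal_vector (kind_of T) \<Longrightarrow> vomega W \<in> D"
    and "has_conformal_vector (kind_of T) \<Longrightarrow> f \<in> D \<Longrightarrow> dsum_mul M n (vomega W) f (- r - 2) = LD r f"
proof -
  show 1: "vspace W = D" "vmul W = dsum_mul M n" and T: "T_vertex_algebra T W" and "vac W \<in> component M 0"
    using assms by (simp_all add: graded_structure_def graded_T_vertex_algebra_def)
  then show "vertex_algebra W" by (simp add: T_vertex_algebra_def)
  show L: "vL W k f = LD k f" if "k \<in> L_index (kind_of T)" "f \<in> D" for k f
    using assms that by (simp add: graded_structure_def)
  show "vgrp W g f = dsum_op (\<lambda>i. mgrp (M i) g) f" if "T = Equivariant K G" "g \<in> carrier G" "f \<in> D"
    using assms that by (simp add: graded_structure_def)
  assume hc: "has_conformal_vector (kind_of T)"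
  then have K: "L_index (kind_of T) = UNIV" by (auto simp: has_conformal_vector_def)
  show "vomega W \<in> D" using T hc by (simp add: T_vertex_algebra_def eigenspace_def 1)
  show "dsum_mul M n (vomega W) f (- r - 2) = LD r f" if "f \<in> D"
    using T hc that L[of r f] K by (simp add: T_vertex_algebra_def 1)
qed

lemma vac_laws:
  assumes "vertex_algebra W" "vspace W = D" "vmul W = dsum_mul M n" "f \<in> D"
  shows "vac W \<in> D" "dsum_mul M n (vac W) f r = (if r = 0 then f else 0)" "dsum_mul M n f (vac W) 0 = f"
  using assms by (simp_all add: vertex_algebra_def)

text \<open>A zero module would leave no nonzero operator in \<open>I i 0\<close>. The vector is
  needed to read scalars off the unit laws.\<close>

lemma S_nonzero: "\<exists>x\<in>S i. x \<noteq> 0"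
proof (rule ccontr)
  assume "\<not> (\<exists>x\<in>S i. x \<noteq> 0)"
  then have 0: "x = 0" if "x \<in> S i" for x using that by blast
  obtain p where p: "p \<in> I i 0" "p \<noteq> 0"
  proof -
    obtain B where B: "B \<subseteq> I i 0" "complex_vector.independent B" "card B = complex_vector.dim (I i 0)"
      using complex_vector.basis_exists by metis
    then obtain b where "B = {b}"
      using I_one_dim[of i 0] by (auto simp: one_dimensional_def card_1_singleton_iff)
    then have "b \<in> I i 0" "b \<noteq> 0" using B complex_vector.dependent_zero[of B] by auto
    then show ?thesis by (rule that)
  qed
  have "p u v = 0" for u v
  proof (cases "u \<in> S i \<and> v \<in> S 0")
    case True
    then show ?thesis using 0 bilin_maps_facts(2)[OF I_bilin[OF p(1)], of u v] by (intro ext) simp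
  qed (use bilin_maps_facts(5)[OF I_bilin[OF p(1)], of u v] in blast)
  then show False using p(2) by (simp add: fun_eq_iff)
qed

text \<open>The unit of a graded structure need not be that of \<open>V\<close>, but it differs from it by a scalar \<open>c\<close>,
  and the unit axioms force the structure maps at index \<open>0\<close> to be \<open>c\<close> times the normalized ones.\<close>

lemma unit_rescaling:
  assumes n: "n \<in> choices I" and W: "vertex_algebra W" "vspace W = D" "vmul W = dsum_mul M n" "vac W \<in> component M 0"
  obtains c where "c \<noteq> 0" "normalized_choice M (rescale (\<lambda>i j. 1 / c) n)"
proof -
  obtain v0 where v0: "vac W = Poly_Mapping.single 0 v0" "v0 \<in> S 0" using W(4) by (auto simp: component_def)
  have sp: "I 0 i = complex_vector.span {mact (M i)}" "I i 0 = complex_vector.span {skew (mL (M i)) (mact (M i))}" for i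
    using assoc_datum unfolding associativity_datum_def by (elim conjE, simp)+
  have "\<exists>c. n 0 i = c *\<^sub>C mact (M i)" for i
    using choices_in[OF n, of 0 i] by (auto simp: sp complex_vector.span_singleton)
  then obtain c where c: "n 0 i = c i *\<^sub>C mact (M i)" for i by metis
  have "\<exists>d. n i 0 = d *\<^sub>C skew (mL (M i)) (mact (M i))" for i
    using choices_in[OF n, of i 0] by (auto simp: sp complex_vector.span_singleton)
  then obtain d where d: "n i 0 = d i *\<^sub>C skew (mL (M i)) (mact (M i))" for i by metis
  have c_nz: "c i \<noteq> 0" for i using choices_nz[OF n, of 0 i] c[of i] by auto
  have left: "c i *\<^sub>C mact (M i) v0 x 0 = x" if "x \<in> S i" for i x
  proof -
    have "Poly_Mapping.single i (n 0 i v0 x 0) = Poly_Mapping.single i x"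
      using vac_laws(2)[OF W(1-3) single_in_D[OF that], of 0] dsum_mul_single[OF n v0(2) that, of 0] by (simp add: v0(1))
    then have "n 0 i v0 x 0 = x" by (metis lookup_single_eq)
    then show ?thesis by (simp add: c scaleC_apply)
  qed
  have right: "d i *\<^sub>C skew (mL (M i)) (mact (M i)) x v0 0 = x" if "x \<in> S i" for i x
  proof -
    have "Poly_Mapping.single i (n i 0 x v0 0) = Poly_Mapping.single i x"
      using vac_laws(3)[OF W(1-3) single_in_D[OF that]] dsum_mul_single[OF n that v0(2), of 0] by (simp add: v0(1))
    then have "n i 0 x v0 0 = x" by (metis lookup_single_eq)
    then show ?thesis by (simp add: d scaleC_apply)
  qed
  \<comment> \<open>The creation property of \<open>V\<close> gives this value, and the left unit
    law at \<open>vac V\<close> then exhibits the new unit as a multiple of the old one.\<close>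
  have "mact (M 0) v0 (vac V) 0 = v0"
    using V v0(2) by (simp add: M0 adjoint_module_def T_vertex_algebra_def vertex_algebra_def)
  then have cv0: "c 0 *\<^sub>C v0 = vac V" using left[OF vac_S] by simp
  have v0': "v0 = (1 / c 0) *\<^sub>C vac V" using c_nz[of 0] by (simp add: cv0[symmetric] scaleC_scaleC scaleC_one)
  \<comment> \<open>The left unit law and the action of \<open>vac V\<close> evaluate the same
    product with a nonzero \<open>x\<close> in two ways.\<close>
  have ci: "c i = c 0" for i
  proof -
    obtain x where x: "x \<in> S i" "x \<noteq> 0" using S_nonzero by blast
    have "n 0 i v0 x 0 = (1 / c 0) *\<^sub>C n 0 i (vac V) x 0"
      unfolding v0' by (rule lin_map_scale[OF choice_maps(3)[OF n x(1)] vac_S])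
    then have "c i *\<^sub>C mact (M i) v0 x 0 = (1 / c 0 * c i) *\<^sub>C x"
      by (simp add: c scaleC_apply mact_unit x(1) scaleC_scaleC)
    then have "1 *\<^sub>C x = (1 / c 0 * c i) *\<^sub>C x" unfolding left[OF x(1)] scaleC_one .
    then have "1 = 1 / c 0 * c i" using x(2) by (rule scaleC_cancel)
    then show ?thesis using c_nz[of 0] by (simp add: field_simps)
  qed
  have di: "d i = c 0" for i
  proof -
    obtain x where x: "x \<in> S i" "x \<noteq> 0" using S_nonzero by blast
    have "n i 0 x v0 0 = (1 / c 0) *\<^sub>C n i 0 x (vac V) 0"
      unfolding v0' by (rule lin_map_scale[OF choice_maps(2)[OF n x(1)] vac_S])
    then have "d i *\<^sub>C skew (mL (M i)) (mact (M i)) x v0 0 = (1 / c 0 * d i) *\<^sub>C x"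
      by (simp add: d scaleC_apply skew_mact_unit x(1) scaleC_scaleC)
    then have "1 *\<^sub>C x = (1 / c 0 * d i) *\<^sub>C x" unfolding right[OF x(1)] scaleC_one .
    then have "1 = 1 / c 0 * d i" using x(2) by (rule scaleC_cancel)
    then show ?thesis using c_nz[of 0] by (simp add: field_simps)
  qed
  have "(1 / c 0) *\<^sub>C n 0 i = mact (M i)" "(1 / c 0) *\<^sub>C n i 0 = skew (mL (M i)) (mact (M i))" for i
    unfolding c[of i] d[of i] ci[of i] di[of i] scaleC_scaleC using c_nz[of 0] by (simp_all add: scaleC_one)
  then have "normalized_choice M (rescale (\<lambda>i j. 1 / c 0) n)"
    unfolding normalized_choice_def rescale_def by blast
  then show ?thesis by (rule that[OF c_nz[of 0]])
qed

text \<open>The operators need not be normalized, but they become so after multiplication by one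
  common constant, which leaves \<open>(F, \<Omega>)\<close> unchanged. Locality then trivializes
  the pair.\<close>

lemma graded_structure_trivial:
  assumes n: "n \<in> choices I" and g: "graded_structure T M n W"
  shows "associated M n (\<lambda>i j k. 1) (\<lambda>i j. 1)"
proof -
  obtain F \<Omega> where a: "associated M n F \<Omega>" using associated_exists[OF n] by metis
  note W = graded_structureD(3,1,2,5)[OF g]
  obtain c where c: "c \<noteq> 0" and norm: "normalized_choice M (rescale (\<lambda>i j. 1 / c) n)" by (rule unit_rescaling[OF n W])
  have "associated M (rescale (\<lambda>i j. 1 / c) n) F \<Omega>"
    using associated_rescale[OF n a, of "\<lambda>i j. 1 / c"] c by simp
  then interpret C: normalized_cocycle F \<Omega>
    using c by (intro normalized_cocycle[OF choices_rescale[OF n] norm]) simp_all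
  have "F i j k * \<Omega> i j = F j i k" for i j k
    using locality_trivial[OF n a W(1-3), of i j k] associated_nz(1)[OF a, of j i k] by (simp add: exchange_scalar_def)
  from C.trivial_exchange[OF this] have "F = (\<lambda>i j k. 1)" "\<Omega> = (\<lambda>i j. 1)" by (simp_all add: fun_eq_iff)
  then show ?thesis using a by simp
qed

lemma graded_structure_iso:
  assumes n: "n \<in> choices I" and n': "n' \<in> choices I"
    and g: "graded_structure T M n W" and g': "graded_structure T M n' W'"
  shows "graded_isomorphic T W (component M) W' (component M)"
proof -
  obtain l where l: "\<forall>i j. l i j \<noteq> 0" and n'_eq: "n' = rescale l n" using choices_transitive[OF n n'] by metis
  have a: "associated M n (\<lambda>i j k. 1) (\<lambda>i j. 1)" by (rule graded_structure_trivial[OF n g])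
  have "associated M n' (\<lambda>i j k. l j k * l i (j + k) / (l (i + j) k * l i j) * 1) (\<lambda>i j. l i j / l j i * 1)"
    unfolding n'_eq by (rule associated_rescale[OF n a]) (simp add: l)
  note eqs = associated_unique[OF n' this graded_structure_trivial[OF n' g']]
  have coc: "l j k * l i (j + k) = l (i + j) k * l i j" for i j k
    using fun_cong[OF fun_cong[OF fun_cong[OF eqs(1)]], of j k i] l by simp
  have sym: "l i j = l j i" for i j
    using fun_cong[OF fun_cong[OF eqs(2)], of i j] l by simp
  \<comment> \<open>The units of \<open>W\<close> and \<open>W'\<close> may be different multiples
    of that of \<open>V\<close>, so \<open>l\<close> is normalized only up to its value at
    \<open>(0, 0)\<close>, which is divided out.\<close>
  define e where "e = l 0 0"
  have e: "e \<noteq> 0" "l 0 s = e" for s using l coc[of 0 s 0] coc[of 0 0 s] by (simp_all add: e_def)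
  have "\<exists>\<mu>. (\<forall>s\<in>UNIV. \<mu> s \<noteq> 0) \<and> (\<forall>s\<in>UNIV. \<forall>t\<in>UNIV. l s t / e * \<mu> (s + t) = \<mu> s * \<mu> t)"
  proof (rule symmetric_cocycle_coboundary)
    fix s t r show "l s t / e * (l (s + t) r / e) = l t r / e * (l s (t + r) / e)"
      using coc[of t r s] by (simp add: mult.commute)
  qed (simp_all add: l e, rule sym)
  then obtain \<mu> where \<mu>: "\<And>s. \<mu> s \<noteq> 0" "\<And>s t. l s t / e * \<mu> (s + t) = \<mu> s * \<mu> t" by auto
  \<comment> \<open>Component \<open>i\<close> will be scaled by \<open>h i\<close>. As
    \<open>n'\<close> is \<open>l\<close> times \<open>n\<close>, multiplicativity requires
    \<open>h (i + j) = h i * h j * l i j\<close>; the \<open>e\<close> in the denominator absorbs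
    the constant in \<open>l\<close>.\<close>
  define h where "h i = 1 / (e * \<mu> i)" for i
  have h_nz: "h i \<noteq> 0" for i by (simp add: h_def e \<mu>)
  have h_mult: "h (i + j) = h i * h j * l i j" for i j
  proof -
    have "l i j = e * \<mu> i * \<mu> j / \<mu> (i + j)" using \<mu>(2)[of i j] \<mu>(1)[of "i + j"] e(1) by (simp add: field_simps)
    then show ?thesis using \<mu>(1) e(1) by (simp add: h_def field_simps)
  qed
  define \<phi> where "\<phi> = dsum_op (\<lambda>i. (*\<^sub>C) (h i) :: 'v \<Rightarrow> 'v)"
  have lk: "Poly_Mapping.lookup (\<phi> f) i = h i *\<^sub>C Poly_Mapping.lookup f i" for f i
    by (simp add: \<phi>_def lookup_dsum_op)
  have \<phi>_single: "\<phi> (Poly_Mapping.single i a) = Poly_Mapping.single i (h i *\<^sub>C a)" for i a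
    by (simp add: \<phi>_def dsum_op_single)
  have lin: "lin_map D D \<phi>"
    unfolding \<phi>_def by (rule dsum_op_lin)
      (simp add: lin_map_def complex_vector.subspace_scale[OF S_subspace] scaleC_add_right scaleC_scaleC mult.commute)
  define \<psi> where "\<psi> = dsum_op (\<lambda>i. (*\<^sub>C) (1 / h i) :: 'v \<Rightarrow> 'v)"
  have lk': "Poly_Mapping.lookup (\<psi> f) i = (1 / h i) *\<^sub>C Poly_Mapping.lookup f i" for f i
    by (simp add: \<psi>_def lookup_dsum_op)
  have inv: "\<psi> (\<phi> f) = f" "\<phi> (\<psi> f) = f" for f
    by (rule poly_mapping_eqI, simp add: lk lk' scaleC_scaleC h_nz scaleC_one)+
  have \<psi>_in: "\<psi> f \<in> D" if "f \<in> D" for f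
    using that by (simp add: dsum_space_def lk' complex_vector.subspace_scale[OF S_subspace])
  note \<phi>_in = lin_map_in[OF lin] and \<phi>_add = lin_map_add[OF lin]
  have bij: "bij_betw \<phi> D D"
    by (rule bij_betw_byWitness[of _ \<psi>]) (auto simp: inv \<phi>_in \<psi>_in)
  have comp: "\<phi> ` component M i = component M i" for i
  proof (intro equalityI subsetI)
    fix f assume "f \<in> \<phi> ` component M i"
    then show "f \<in> component M i"
      by (auto simp: component_def \<phi>_single complex_vector.subspace_scale[OF S_subspace])
  next
    fix f assume "f \<in> component M i"
    then obtain a where "f = Poly_Mapping.single i a" "a \<in> S i" by (auto simp: component_def)
    then have "f = \<phi> (Poly_Mapping.single i ((1 / h i) *\<^sub>C a))" "(1 / h i) *\<^sub>C a \<in> S i"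
      using h_nz[of i] by (simp_all add: \<phi>_single scaleC_scaleC scaleC_one complex_vector.subspace_scale[OF S_subspace])
    then show "f \<in> \<phi> ` component M i" by (auto simp: component_def)
  qed
  have mult: "\<phi> (dsum_mul M n u v r) = dsum_mul M n' (\<phi> u) (\<phi> v) r" if "u \<in> D" "v \<in> D" for u v r
  proof (rule dsum_biadditive_eq[OF that, of "\<lambda>u v. \<phi> (dsum_mul M n u v r)" "\<lambda>u v. dsum_mul M n' (\<phi> u) (\<phi> v) r"])
    fix i j a b assume ab: "a \<in> S i" "b \<in> S j"
    have hab: "h i *\<^sub>C a \<in> S i" "h j *\<^sub>C b \<in> S j" using ab by (simp_all add: complex_vector.subspace_scale[OF S_subspace])
    have "n' i j (h i *\<^sub>C a) (h j *\<^sub>C b) r = (h i * h j * l i j) *\<^sub>C n i j a b r"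
      using lin_map_scale[OF choice_maps(3)[OF n hab(2)] ab(1)] lin_map_scale[OF choice_maps(2)[OF n ab(1)] ab(2)]
      by (simp add: n'_eq rescale_def scaleC_apply scaleC_scaleC mult_ac)
    then show "\<phi> (dsum_mul M n (Poly_Mapping.single i a) (Poly_Mapping.single j b) r)
        = dsum_mul M n' (\<phi> (Poly_Mapping.single i a)) (\<phi> (Poly_Mapping.single j b)) r"
      by (simp add: dsum_mul_single[OF n] dsum_mul_single[OF n'] ab hab \<phi>_single h_mult)
  qed (simp_all add: dsum_mul_add[OF n] dsum_mul_add[OF n'] dsum_mul_in[OF n] \<phi>_in \<phi>_add)
  have op: "\<phi> (dsum_op q f) = dsum_op q (\<phi> f)" if "f \<in> D" "\<And>i. lin_map (S i) (S i) (q i)" for q f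
  proof -
    have "q i 0 = 0" for i by (rule lin_map_zero[OF that(2) S_subspace])
    then show ?thesis
      by (intro poly_mapping_eqI) (simp add: lk lookup_dsum_op lin_map_scale[OF that(2) lookup_in_S[OF that(1)]])
  qed
  note gD = graded_structureD[OF g] and gD' = graded_structureD[OF g']
  note vac = vac_laws[OF gD(3,1,2)] and vac' = vac_laws[OF gD'(3,1,2)]
  have zero_D: "0 \<in> D" by (rule complex_vector.subspace_0[OF D_subspace])
  have vacD: "vac W \<in> D" "vac W' \<in> D" using vac(1)[OF zero_D] vac'(1)[OF zero_D] by simp_all
  \<comment> \<open>A two-sided unit is unique: the product of \<open>vac W\<close> with the
    preimage of \<open>vac W'\<close> is evaluated by the left unit law in \<open>W\<close> and,
    after applying \<open>\<phi>\<close>, by the right unit law in \<open>W'\<close>.\<close>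
  have "\<phi> (vac W) = vac W'"
  proof -
    have "\<phi> (dsum_mul M n (vac W) (\<psi> (vac W')) 0) = dsum_mul M n' (\<phi> (vac W)) (vac W') 0"
      using mult[OF vacD(1) \<psi>_in[OF vacD(2)], of 0] by (simp add: inv)
    then show ?thesis using vac(2)[OF \<psi>_in[OF vacD(2)], of 0] vac'(3)[OF \<phi>_in[OF vacD(1)]] by (simp add: inv)
  qed
  \<comment> \<open>The conformal vector is \<open>L(-2)\<close> applied to the unit, because the
    exponent \<open>- r - 2\<close> is \<open>0\<close> for \<open>r = - 2\<close>.\<close>
  moreover have "\<phi> (vomega W) = vomega W'" if hc: "has_conformal_vector (kind_of T)"
  proof -
    have K: "L_index (kind_of T) = UNIV" using hc by (auto simp: has_conformal_vector_def)
    have \<omega>: "vomega W \<in> D" "vomega W' \<in> D" using gD(8)[OF hc] gD'(8)[OF hc] by simp_all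
    have "dsum_mul M n' (\<phi> (vomega W)) (vac W') 0 = \<phi> (dsum_mul M n (vomega W) (\<psi> (vac W')) 0)"
      using mult[OF \<omega>(1) \<psi>_in[OF vacD(2)], of 0] by (simp add: inv)
    also have "\<dots> = \<phi> (LD (- 2) (\<psi> (vac W')))" using gD(9)[OF hc \<psi>_in[OF vacD(2)], of "- 2"] by simp
    also have "\<dots> = LD (- 2) (vac W')" using op[OF \<psi>_in[OF vacD(2)] L_lin[of "- 2"]] K by (simp add: inv)
    also have "\<dots> = dsum_mul M n' (vomega W') (vac W') 0" using gD'(9)[OF hc vacD(2), of "- 2"] by simp
    finally show ?thesis using vac'(3)[OF \<phi>_in[OF \<omega>(1)]] vac'(3)[OF \<omega>(2)] by simp
  qed
  moreover have "\<phi> (vL W k x) = vL W' k (\<phi> x)" if "k \<in> L_index (kind_of T)" "x \<in> D" for k x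
    using op[OF that(2) L_lin[OF that(1)]] gD(6)[OF that] gD'(6)[OF that(1) \<phi>_in[OF that(2)]] by simp
  moreover have "\<phi> (vgrp W \<gamma> x) = vgrp W' \<gamma> (\<phi> x)" if "T = Equivariant K G" "\<gamma> \<in> carrier G" "x \<in> D" for K G \<gamma> x
  proof -
    have "lin_map (S i) (S i) (mgrp (M i) \<gamma>)" for i
      using M[of i] that by (simp add: T_module_def group_rep_def)
    from op[OF that(3) this] show ?thesis
      using gD(7)[OF that] gD'(7)[OF that(1,2) \<phi>_in[OF that(3)]] by simp
  qed
  ultimately show ?thesis
    unfolding graded_isomorphic_def gD(1,2) gD'(1,2)
    by (intro exI[of _ \<phi>] conjI) (use lin bij comp mult in \<open>cases T; simp\<close>)+
qed

end

theorem theorem2p2p13: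
  fixes T :: "'g setting"
    and V :: "('v::complex_vector, 'g) valg"
    and M :: "'a::ab_group_add \<Rightarrow> ('v, 'v, 'g) vmodule"
    and I :: "'a \<Rightarrow> 'a \<Rightarrow> ('v \<Rightarrow> 'v \<Rightarrow> int \<Rightarrow> 'v) set"
    and m :: "'a \<Rightarrow> 'a \<Rightarrow> 'v \<Rightarrow> 'v \<Rightarrow> int \<Rightarrow> 'v"
    and F :: "'a \<Rightarrow> 'a \<Rightarrow> 'a \<Rightarrow> complex"
    and \<Omega> :: "'a \<Rightarrow> 'a \<Rightarrow> complex"
  assumes "T_vertex_algebra T V"
    and "\<And>i. T_module T V (M i)"
    and "M 0 = adjoint_module V"
    and "commutativity_datum T V M I"
    and "m \<in> choices I" and "normalized_choice M m"
    and "associated_pair M m = (F, \<Omega>)"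
  shows
    "(group_action C2ab (families I) (\<lambda>l. restrict (rescale l) (families I))
      \<and> group_action C2ab (carrier Z3ab)
          (\<lambda>l::'a \<Rightarrow> 'a \<Rightarrow> complex. restrict (translate l) (carrier Z3ab))
      \<and> (F, \<Omega>) \<in> carrier Z3ab
      \<and> (\<forall>n\<in>choices I. associated_pair M n \<in> carrier Z3ab
          \<and> (\<forall>l\<in>carrier C2ab. rescale l n \<in> choices I
              \<and> associated_pair M (rescale l n) = translate l (associated_pair M n)))
      \<and> (\<forall>X::'a ab3cochain set\<in>carrier H3ab.
          transitive_action C2ab X (\<lambda>l. restrict (translate l) X))
      \<and> (\<forall>p::'a ab3cochain\<in>carrier Z3ab. stabilizer C2ab translate p = Z2ab))
    \<and> ((\<forall>i. \<Omega> i i \<in> {1, - 1}) \<and> quadratic_form (\<lambda>i. \<Omega> i i)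
      \<and> (\<forall>l\<in>carrier C2ab. \<forall>i. snd (associated_pair M (rescale l m)) i i = \<Omega> i i)
      \<and> (\<forall>n\<in>choices I. cohomology_class (associated_pair M n) = cohomology_class (F, \<Omega>)))
    \<and> (T_compatible T V M \<longrightarrow>
        ((\<forall>i. \<Omega> i i = 1) \<longleftrightarrow>
          (\<exists>l\<in>carrier C2ab. normalized_cochain l
            \<and> graded_T_vertex_algebra T (dsum_valg V M (rescale l m)) (component M))))
    \<and> (\<forall>n\<in>choices I. \<forall>n'\<in>choices I. \<forall>W W'.
        graded_structure T M n W \<and> graded_structure T M n' W' \<longrightarrow>
          graded_isomorphic T W (component M) W' (component M))"
proof -
  interpret commutativity T V M I by unfold_locales (rule assms)+
  note m = assms(5) and norm = assms(6)
  have a: "associated M m F \<Omega>" by (rule iffD1[OF associated_pair_eq[OF m] assms(7)])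
  interpret C: normalized_cocycle F \<Omega> by (rule normalized_cocycle[OF m norm a])
  have Z: "(F, \<Omega>) \<in> carrier Z3ab" using C.abelian_3cocycle by (simp add: Z3ab_def)
  have resc: "rescale l n \<in> choices I" "associated_pair M (rescale l n) = translate l (associated_pair M n)"
    if "n \<in> choices I" "l \<in> carrier C2ab" for n l
    using that choices_rescale[OF that(1)] associated_pair_rescale[OF that(1)] by (simp_all add: C2ab_carrier)
  \<comment> \<open>Any two choices differ by a 2-cochain, so statements about all choices reduce to
    the normalized one.\<close>
  have from_m: "\<exists>l\<in>carrier C2ab. associated_pair M n = translate l (F, \<Omega>)" if n: "n \<in> choices I" for n
  proof -
    obtain l where "\<forall>i j. l i j \<noteq> 0" "n = rescale l m" using choices_transitive[OF m n] by metis
    then show ?thesis using resc(2)[OF m, of l] assms(7) by (intro bexI[of _ l]) (simp_all add: C2ab_carrier)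
  qed
  have part1: "associated_pair M n \<in> carrier Z3ab" if "n \<in> choices I" for n
    using from_m[OF that] translate_closed[OF _ Z] by metis
  have class_eq: "cohomology_class (associated_pair M n) = cohomology_class (F, \<Omega>)" if "n \<in> choices I" for n
    using from_m[OF that] cohomology_class_translate[OF _ Z] by metis
  \<comment> \<open>The braiding part of a coboundary is \<open>1\<close> on the diagonal.\<close>
  have diag: "snd (associated_pair M (rescale l m)) i i = \<Omega> i i" if "l \<in> carrier C2ab" for l i
    using resc(2)[OF m that] that assms(7) by (simp add: translate_def ab_diff_def Z3ab_def C2ab_carrier)
  have "(\<forall>i. \<Omega> i i = 1) \<longleftrightarrow> (\<exists>l\<in>carrier C2ab. normalized_cochain l
      \<and> graded_T_vertex_algebra T (dsum_valg V M (rescale l m)) (component M))" if comp: "T_compatible T V M"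
  proof
    assume "\<forall>i. \<Omega> i i = 1"
    then interpret S: strict_cocycle F \<Omega> by unfold_locales simp
    obtain l where l: "\<forall>i j. l i j \<noteq> 0" "\<forall>i. l 0 i = 1 \<and> l i 0 = 1"
      "\<forall>i j k. l j k * l i (j + k) * F i j k = l (i + j) k * l i j" "\<forall>i j. l i j * \<Omega> i j = l j i"
      using S.coboundary by metis
    have "associated M (rescale l m) (\<lambda>i j k. l j k * l i (j + k) / (l (i + j) k * l i j) * F i j k) (\<lambda>i j. l i j / l j i * \<Omega> i j)"
      by (rule associated_rescale[OF m a]) (simp add: l)
    then have 1: "associated M (rescale l m) (\<lambda>i j k. 1) (\<lambda>i j. 1)" using l by simp
    have "normalized_choice M (rescale l m)"
      using norm l(2) by (simp add: normalized_choice_def rescale_def scaleC_one)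
    then have "graded_T_vertex_algebra T (dsum_valg V M (rescale l m)) (component M)"
      using l(1) by (intro dsum_graded[OF choices_rescale[OF m] _ 1 _ comp]) (simp_all add: exchange_scalar_def)
    then show "\<exists>l\<in>carrier C2ab. normalized_cochain l
      \<and> graded_T_vertex_algebra T (dsum_valg V M (rescale l m)) (component M)"
      using l(1,2) by (intro bexI[of _ l]) (simp_all add: C2ab_carrier normalized_cochain_def)
  next
    assume "\<exists>l\<in>carrier C2ab. normalized_cochain l
      \<and> graded_T_vertex_algebra T (dsum_valg V M (rescale l m)) (component M)"
    then obtain l where l: "\<forall>i j. l i j \<noteq> 0" "\<forall>i. l 0 i = 1 \<and> l i 0 = 1"
      and g: "graded_T_vertex_algebra T (dsum_valg V M (rescale l m)) (component M)"
      by (auto simp: C2ab_carrier normalized_cochain_def)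
    have n: "rescale l m \<in> choices I" using choices_rescale[OF m] l(1) by simp
    obtain F' \<Omega>' where a': "associated M (rescale l m) F' \<Omega>'" using associated_exists[OF n] by metis
    \<comment> \<open>As \<open>l\<close> is normalized, the rescaled choice falls under the same
      cocycle lemma; trivial exchange scalars then make its braiding \<open>1\<close>, and the
      diagonal is unaffected by the rescaling.\<close>
    have "normalized_choice M (rescale l m)"
      using norm l(2) by (simp add: normalized_choice_def rescale_def scaleC_one)
    then interpret N: normalized_cocycle F' \<Omega>' by (rule normalized_cocycle[OF n _ a'])
    let ?W = "dsum_valg V M (rescale l m)"
    have "vertex_algebra ?W" using g by (simp add: graded_T_vertex_algebra_def T_vertex_algebra_def)
    then have "exchange_scalar F' \<Omega>' i j k = 1" for i j k
      by (rule locality_trivial[OF n a']) (simp_all add: dsum_valg_def)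
    then have "F' i j k * \<Omega>' i j = F' j i k" for i j k using N.F_nz[of j i k] by (simp add: exchange_scalar_def)
    from N.trivial_exchange(2)[OF this] have "\<Omega>' i i = 1" for i by simp
    moreover have "associated_pair M (rescale l m) = (F', \<Omega>')" using associated_pair_eq[OF n] a' by metis
    ultimately show "\<forall>i. \<Omega> i i = 1" using diag[of l] l(1) by (simp add: C2ab_carrier)
  qed
  then show ?thesis
    using rescale_action[of I] Z part1 resc C.trace_sign C.quadratic_form_trace diag class_eq graded_structure_iso I_one_dim
    by (simp add: one_dimensional_def translate_action translate_transitive translate_stabilizer)
qed

end
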